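(* Up to isomorphism, there are exactly $35$ non-trivially Hoffman colorable exceptional graphs in $\mathcal S_8$ that are irregular. Of these, exactly four are maximal with respect to chromatic components, namely $M_5$, $M_{22}$, $M_{23}$ and $M_{25}$, and each of the $35$ graphs is a chromatic component of at least one of $M_5,M_{22},M_{23},M_{25}$.
   Context: Graphs are finite and simple; $\lambda_{\max},\lambda_{\min}$ are the largest/smallest adjacency eigenvalues. A graph $G$ with an edge is Hoffman colorable if $\chi(G)=1-\lambda_{\max}(G)/\lambda_{\min}(G)$, non-trivially so if moreover not bipartite and not complete multipartite $K_{m,\dots,m}$ with equal parts. For $m\ge2$, $H$ is an $m$-chromatic component of $G$ if for some optimal coloring $V_1\sqcup\dots\sqcup V_{\chi(G)}$, $H\cong G[V_1\cup\dots\cup V_m]$; chromatic component = $m$-chromatic component for some $2\le m\le \chi(G)$; maximal with respect to chromatic components means not isomorphic to a chromatic component of a non-isomorphic graph in the class considered. Seidel switching of $G$ w.r.t. $X\subseteq V(G)$ gives $G_X$, where $u,v$ are adjacent iff either adjacent in $G$ with both or neither in $X$, or non-adjacent in $G$ with exactly one in $X$. $\mathcal S_8$ is the class of graphs isomorphic to $L(H)_X$ for some graph $H$ on $8$ vertices and some $X\subseteq E(H)$. Exceptional graphs: connected graphs admitting an injective map $f$ into the $E_8$ root system (vectors of $\mathbb Z^8$ with two coordinates $\pm 2$ and the rest $0$, or all coordinates $\pm1$ with an even number of $-1$'s) with $\langle f(u),f(v)\rangle=4$ for adjacent and $0$ for distinct non-adjacent vertices, which are not generalized line graphs ($L(G;a_1,\dots,a_n)$: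 line graph $L(G)$ together with cocktail party graphs $CP(a_i)$, each vertex of the $i$-th one joined to all edges of $G$ at the $i$-th vertex). With $a_{ij}=2e_i+2e_j$ and $b_{ij}=\mathbf 1-2e_i-2e_j$ in $\mathbb R^8$, for sets $A,B$ of pairs $ij$ let $\Gamma(A,B)$ be the graph with vertex set $\{a_{ij}:ij\in A\}\cup\{b_{ij}:ij\in B\}$, two vectors adjacent iff their inner product is $4$. Then $M_5=\Gamma(\{35,36,37,38,45,46,47,48,56,57,68,78\},\{12,34,58,67\})$; $M_{22}=\Gamma(\{34,35,36,37,45,46,48,57,58,67,68,78\},\{12,13,14,15,26,27,28,38,47,56\})$; $M_{23}=\Gamma(\{35,36,37,38,45,46,47,48,57,58,67,68\},\{12,13,14,15,26,27,28,34,56,78\})$; $M_{25}=\Gamma(\{18,27,34,35,36,37,38,45,46,47,48,56,57,58,67,68\},\{12,13,14,15,16,17,23,24,25,26,28,78\})$. *)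

theory Defs
  imports
    "HOL-Library.Disjoint_Sets"
    "Jordan_Normal_Form.Char_Poly"
    "Graph_Theory.Digraph_Isomorphism"
begin

text \<open>
  A finite simple graph is a \<open>pair_graph\<close>: a finite, loop-free, symmetric digraph given by
  vertices \<open>pverts G\<close> and arcs \<open>parcs G\<close>. Each undirected edge \<open>uv\<close> is the pair of arcs
  \<open>(u, v)\<close>, \<open>(v, u)\<close>.
\<close>

abbreviation isomorphic :: "'a pair_pre_digraph \<Rightarrow> 'b pair_pre_digraph \<Rightarrow> bool"
  (infix \<open>\<simeq>\<close> 50) where
  "G \<simeq> H \<equiv> digraph_iso (with_proj G) (with_proj H)"

definition edges :: "'a pair_pre_digraph \<Rightarrow> 'a set set" where
  "edges G = {{u, v} | u v. (u, v) \<in> parcs G}"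

definition irregular :: "'a pair_pre_digraph \<Rightarrow> bool" where
  "irregular G \<longleftrightarrow>
     \<not> (\<exists>d. \<forall>v \<in> pverts G. card {u. (u, v) \<in> parcs G} = d)"

definition bipartite :: "'a pair_pre_digraph \<Rightarrow> bool" where
  "bipartite G \<longleftrightarrow> (\<exists>U. \<forall>(u, v) \<in> parcs G. u \<in> U \<longleftrightarrow> v \<notin> U)"

definition equal_complete_multipartite :: "'a pair_pre_digraph \<Rightarrow> bool" where
  "equal_complete_multipartite G \<longleftrightarrow>
     (\<exists>P m. partition_on (pverts G) P \<and> (\<forall>p \<in> P. card p = m) \<and>
        (\<forall>u \<in> pverts G. \<forall>v \<in> pverts G.
           (u, v) \<in> parcs G \<longleftrightarrow> \<not> (\<exists>p \<in> P. u \<in> p \<and> v \<in> p)))"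


subsection \<open>Eigenvalues and Hoffman colorings\<close>

definition adj_mat :: "'a pair_pre_digraph \<Rightarrow> 'a list \<Rightarrow> real mat" where
  "adj_mat G vs = mat (length vs) (length vs)
     (\<lambda>(i, j). if (vs ! i, vs ! j) \<in> parcs G then 1 else 0)"

text \<open>
  The eigenvalues do not depend on the enumeration \<open>vs\<close> of the vertices. All of them are real,
  as the adjacency matrix is symmetric.
\<close>

definition adj_eigenvalues :: "'a pair_pre_digraph \<Rightarrow> real set" where
  "adj_eigenvalues G =
     {k. \<exists>vs. distinct vs \<and> set vs = pverts G \<and> eigenvalue (adj_mat G vs) k}"

definition lambda_max :: "'a pair_pre_digraph \<Rightarrow> real" where
  "lambda_max G = Max (adj_eigenvalues G)"

definition lambda_min :: "'a pair_pre_digraph \<Rightarrow> real" where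
  "lambda_min G = Min (adj_eigenvalues G)"

definition proper_coloring :: "'a pair_pre_digraph \<Rightarrow> nat \<Rightarrow> ('a \<Rightarrow> nat) \<Rightarrow> bool" where
  "proper_coloring G k c \<longleftrightarrow>
     (\<forall>v \<in> pverts G. c v < k) \<and> (\<forall>(u, v) \<in> parcs G. c u \<noteq> c v)"

definition chromatic_number :: "'a pair_pre_digraph \<Rightarrow> nat" where
  "chromatic_number G = (LEAST k. \<exists>c. proper_coloring G k c)"

definition hoffman_colorable :: "'a pair_pre_digraph \<Rightarrow> bool" where
  "hoffman_colorable G \<longleftrightarrow>
     parcs G \<noteq> {} \<and> real (chromatic_number G) = 1 - lambda_max G / lambda_min G"

definition nontrivially_hoffman_colorable :: "'a pair_pre_digraph \<Rightarrow> bool" where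
  "nontrivially_hoffman_colorable G \<longleftrightarrow>
     hoffman_colorable G \<and> \<not> bipartite G \<and> \<not> equal_complete_multipartite G"

text \<open>
  The color classes \<open>V\<^sub>1, \<dots>, V\<^sub>\<chi>\<close> are the fibres of \<open>c\<close> over \<open>0, \<dots>, \<chi> - 1\<close>, all nonempty because
  \<open>\<chi>\<close> is least. As \<open>c\<close> ranges over all optimal colorings, so does the choice of the \<open>m\<close> classes.
\<close>

definition m_chromatic_component ::
    "nat \<Rightarrow> 'a pair_pre_digraph \<Rightarrow> 'b pair_pre_digraph \<Rightarrow> bool" where
  "m_chromatic_component m H G \<longleftrightarrow>
     (\<exists>c. proper_coloring G (chromatic_number G) c \<and>
        digraph_iso (with_proj H) (with_proj G \<restriction> {v \<in> pverts G. c v < m}))"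

definition chromatic_component :: "'a pair_pre_digraph \<Rightarrow> 'b pair_pre_digraph \<Rightarrow> bool" where
  "chromatic_component H G \<longleftrightarrow>
     (\<exists>m. 2 \<le> m \<and> m \<le> chromatic_number G \<and> m_chromatic_component m H G)"

definition maximal_chromatic :: "'a pair_pre_digraph set \<Rightarrow> 'a pair_pre_digraph \<Rightarrow> bool" where
  "maximal_chromatic \<C> G \<longleftrightarrow>
     G \<in> \<C> \<and> \<not> (\<exists>G' \<in> \<C>. \<not> G \<simeq> G' \<and> chromatic_component G G')"


subsection \<open>Line graphs and Seidel switching\<close>

definition line_graph :: "'a pair_pre_digraph \<Rightarrow> 'a set pair_pre_digraph" where
  "line_graph G = \<lparr> pverts = edges G,
     parcs = {(e, f). e \<in> edges G \<and> f \<in> edges G \<and> e \<noteq> f \<and> e \<inter> f \<noteq> {}} \<rparr>"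

definition seidel_switching :: "'a pair_pre_digraph \<Rightarrow> 'a set \<Rightarrow> 'a pair_pre_digraph" where
  "seidel_switching G X = \<lparr> pverts = pverts G,
     parcs = {(u, v). u \<in> pverts G \<and> v \<in> pverts G \<and>
       ((u, v) \<in> parcs G \<and> (u \<in> X \<longleftrightarrow> v \<in> X) \<or>
        (u, v) \<notin> parcs G \<and> (u \<in> X \<longleftrightarrow> v \<notin> X))} \<rparr>"

definition in_S8 :: "'a pair_pre_digraph \<Rightarrow> bool" where
  "in_S8 G \<longleftrightarrow>
     (\<exists>(H :: nat pair_pre_digraph) X. pair_graph H \<and> card (pverts H) = 8 \<and>
        X \<subseteq> edges H \<and> G \<simeq> seidel_switching (line_graph H) X)"

text \<open>
  In \<open>L(G; a)\<close> the vertices \<open>Inr (i, k, s)\<close> with \<open>k < a i\<close> form the cocktail party graph \<open>CP(a i)\<close>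
  on \<open>2 * a i\<close> vertices; \<open>Inr (i, k, True)\<close> and \<open>Inr (i, k, False)\<close> are its non-adjacent pairs.
\<close>

fun gen_line_adj :: "'a set + 'a \<times> nat \<times> bool \<Rightarrow> 'a set + 'a \<times> nat \<times> bool \<Rightarrow> bool" where
  "gen_line_adj (Inl e) (Inl f) \<longleftrightarrow> e \<noteq> f \<and> e \<inter> f \<noteq> {}"
| "gen_line_adj (Inl e) (Inr (i, _)) \<longleftrightarrow> i \<in> e"
| "gen_line_adj (Inr (i, _)) (Inl e) \<longleftrightarrow> i \<in> e"
| "gen_line_adj (Inr (i, k, _)) (Inr (j, l, _)) \<longleftrightarrow> i = j \<and> k \<noteq> l"

definition gen_line_graph ::
    "'a pair_pre_digraph \<Rightarrow> ('a \<Rightarrow> nat) \<Rightarrow> ('a set + 'a \<times> nat \<times> bool) pair_pre_digraph" where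
  "gen_line_graph G a =
     (let V = Inl ` edges G \<union> Inr ` {(i, k, s). i \<in> pverts G \<and> k < a i}
      in \<lparr> pverts = V, parcs = {(x, y). x \<in> V \<and> y \<in> V \<and> gen_line_adj x y} \<rparr>)"

definition generalized_line_graph :: "'a pair_pre_digraph \<Rightarrow> bool" where
  "generalized_line_graph G \<longleftrightarrow>
     (\<exists>(H :: nat pair_pre_digraph) a. pair_graph H \<and> G \<simeq> gen_line_graph H a)"


subsection \<open>Exceptional graphs\<close>

text \<open>The root system is scaled so that \<open>v \<bullet> v = 8\<close> for every root \<open>v\<close>.\<close>

definition E8_roots :: "int vec set" where
  "E8_roots =
     {v \<in> carrier_vec 8. \<exists>i < 8. \<exists>j < 8. i \<noteq> j \<and> v $ i \<in> {2, -2} \<and> v $ j \<in> {2, -2} \<and>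
        (\<forall>k < 8. k \<noteq> i \<longrightarrow> k \<noteq> j \<longrightarrow> v $ k = 0)} \<union>
     {v \<in> carrier_vec 8. (\<forall>i < 8. v $ i \<in> {1, -1}) \<and> even (card {i. i < 8 \<and> v $ i = -1})}"

definition exceptional :: "'a pair_pre_digraph \<Rightarrow> bool" where
  "exceptional G \<longleftrightarrow>
     Digraph_Component.connected (with_proj G) \<and>
     (\<exists>f. inj_on f (pverts G) \<and> f ` pverts G \<subseteq> E8_roots \<and>
        (\<forall>u \<in> pverts G. \<forall>v \<in> pverts G. u \<noteq> v \<longrightarrow>
           f u \<bullet> f v = (if (u, v) \<in> parcs G then 4 else 0))) \<and>
     \<not> generalized_line_graph G"

definition irregular_S8_graphs :: "'a pair_pre_digraph set" where
  "irregular_S8_graphs =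
     {G. pair_graph G \<and> nontrivially_hoffman_colorable G \<and> exceptional G \<and>
         in_S8 G \<and> irregular G}"

definition iso_rel :: "'a pair_pre_digraph set \<Rightarrow> 'a pair_pre_digraph rel" where
  "iso_rel \<C> = {(G, H). G \<in> \<C> \<and> H \<in> \<C> \<and> G \<simeq> H}"


subsection \<open>The maximal graphs\<close>

text \<open>Coordinates are numbered from \<open>1\<close> in the pairs \<open>ij\<close> but from \<open>0\<close> in vectors.\<close>

definition a_vec :: "nat \<times> nat \<Rightarrow> int vec" where
  "a_vec = (\<lambda>(i, j). 2 \<cdot>\<^sub>v unit_vec 8 (i - 1) + 2 \<cdot>\<^sub>v unit_vec 8 (j - 1))"

definition b_vec :: "nat \<times> nat \<Rightarrow> int vec" where
  "b_vec = (\<lambda>(i, j). vec 8 (\<lambda>_. 1) - 2 \<cdot>\<^sub>v unit_vec 8 (i - 1) - 2 \<cdot>\<^sub>v unit_vec 8 (j - 1))"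

definition Gamma_graph :: "(nat \<times> nat) set \<Rightarrow> (nat \<times> nat) set \<Rightarrow> int vec pair_pre_digraph" where
  "Gamma_graph A B =
     (let V = a_vec ` A \<union> b_vec ` B
      in \<lparr> pverts = V, parcs = {(u, v). u \<in> V \<and> v \<in> V \<and> u \<noteq> v \<and> u \<bullet> v = 4} \<rparr>)"

definition M5 :: "int vec pair_pre_digraph" where
  "M5 = Gamma_graph
     {(3,5), (3,6), (3,7), (3,8), (4,5), (4,6), (4,7), (4,8), (5,6), (5,7), (6,8),
      (7,8)}
     {(1,2), (3,4), (5,8), (6,7)}"

definition M22 :: "int vec pair_pre_digraph" where
  "M22 = Gamma_graph
     {(3,4), (3,5), (3,6), (3,7), (4,5), (4,6), (4,8), (5,7), (5,8), (6,7), (6,8),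
      (7,8)}
     {(1,2), (1,3), (1,4), (1,5), (2,6), (2,7), (2,8), (3,8), (4,7), (5,6)}"

definition M23 :: "int vec pair_pre_digraph" where
  "M23 = Gamma_graph
     {(3,5), (3,6), (3,7), (3,8), (4,5), (4,6), (4,7), (4,8), (5,7), (5,8), (6,7),
      (6,8)}
     {(1,2), (1,3), (1,4), (1,5), (2,6), (2,7), (2,8), (3,4), (5,6), (7,8)}"

definition M25 :: "int vec pair_pre_digraph" where
  "M25 = Gamma_graph
     {(1,8), (2,7), (3,4), (3,5), (3,6), (3,7), (3,8), (4,5), (4,6), (4,7), (4,8),
      (5,6), (5,7), (5,8), (6,7), (6,8)}
     {(1,2), (1,3), (1,4), (1,5), (1,6), (1,7), (2,3), (2,4), (2,5), (2,6), (2,8),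
      (7,8)}"

end

(*
  A graph of the class is represented by vectors of the form 2e_i + 2e_j or 1 - 2e_i - 2e_j with
  inner products 8, 4, 0. In a Hoffman coloring the parts of the Perron eigenvector x supported on
  the single color classes differ by vectors in the kernel of A - lambda_min. If lambda_min = -2, the
  sums of the vectors over the color classes, weighted by x, therefore coincide; this forces classes
  of three or four vertices, and irregularity leaves exactly one class {P0, P1, P2, P3} of size
  four, P0 being adjacent to everything outside. The case lambda_min > -2 leads to a generalized
  line graph. Reflections in the symmetry group of the 56 vectors move the class of size four to a
  standard position. The other color classes are then disjoint members of an explicit list of 32
  triples, and adding triples one at a time, up to automorphisms fixing the standard class, yields 35
  families with at least two triples. A weighted count of the triples inside a family separates
  them. Irregular chromatic components correspond to subfamilies, so the maximal graphs are the
  families to which no further triple can be added.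
*)

theory Submission
  imports Defs "HOL-Analysis.Analysis"
begin

text \<open>Seidel switching becomes linear algebra: an edge \<open>ij\<close> of \<open>H\<close>
  is sent to a_ij outside \<open>X\<close> and to b_ij inside, and adjacency is then inner product
  4. The all-one vector is itself a root and all 56 vectors have inner product 4 with it, so besides
  the Gram matrix \<open>4 * (A + 2 I)\<close> every vertex has a fixed coordinate sum. This is what
  bounds the classes: the sum of \<open>n\<close> mutually orthogonal vectors has squared distance
  \<open>32 - 8 * n\<close> from the constant vector 2. Conversely, the partition into
  \<open>P0\<close>, the set of \<open>P1\<close>, \<open>P2\<close>, \<open>P3\<close> and the
  triples is equitable, so any disjoint family of at least two triples yields explicit extremal
  eigenvectors, and Hoffman's bound determines the chromatic number. The obstacle in counting is
  that a union of triples may split into triples in several ways; hence symmetries are only asked to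
  match unions, and the separating invariant counts all triples inside the union. The finite
  searches are stored as tables of words in generators, so that only the tables have to be
  checked.\<close>

no_notation Inner_Product.real_inner_class.inner (infixl \<open>\<bullet>\<close> 70)
no_notation Finite_Cartesian_Product.vec_nth (infixl \<open>$\<close> 90)

subsection \<open>Quadratic forms on finite sets\<close>

definition bil :: "('a \<Rightarrow> 'a \<Rightarrow> real) \<Rightarrow> 'a set \<Rightarrow> ('a \<Rightarrow> real) \<Rightarrow> ('a \<Rightarrow> real) \<Rightarrow> real" where
  "bil b V y z = (\<Sum>v\<in>V. \<Sum>u\<in>V. b v u * y v * z u)"

lemma bil_add_left: "bil b V (\<lambda>v. y v + y' v) z = bil b V y z + bil b V y' z"
  by (simp add: bil_def algebra_simps sum.distrib)

lemma bil_add_right: "bil b V z (\<lambda>v. y v + y' v) = bil b V z y + bil b V z y'"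
  by (simp add: bil_def algebra_simps sum.distrib)

lemma bil_scale_left: "bil b V (\<lambda>v. c * y v) z = c * bil b V y z"
  by (simp add: bil_def algebra_simps sum_distrib_left)

lemma bil_scale_right: "bil b V z (\<lambda>v. c * y v) = c * bil b V z y"
  by (simp add: bil_def algebra_simps sum_distrib_left)

lemma bil_commute:
  assumes "\<And>v u. v \<in> V \<Longrightarrow> u \<in> V \<Longrightarrow> b v u = b u v"
  shows "bil b V y z = bil b V z y"
proof -
  have "bil b V y z = (\<Sum>u\<in>V. \<Sum>v\<in>V. b v u * y v * z u)"
    unfolding bil_def by (rule sum.swap)
  also have "\<dots> = bil b V z y"
    unfolding bil_def using assms by (intro sum.cong refl) (simp add: mult_ac)
  finally show ?thesis .
qed

lemma bil_eq_sum: "bil b V y z = (\<Sum>v\<in>V. y v * (\<Sum>u\<in>V. b v u * z u))"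
  by (simp add: bil_def sum_distrib_left mult_ac)

text \<open>Near 0 the linear term dominates, so a nonzero \<open>c\<close> would give a negative
  value at some small \<open>t\<close> of opposite sign.\<close>

lemma linear_coeff_zero:
  fixes c d :: real
  assumes "\<And>t. 0 \<le> 2 * t * c + t^2 * d"
  shows "c = 0"
proof (rule ccontr)
  assume c: "c \<noteq> 0"
  define e where "e = 1 + \<bar>d\<bar>"
  have e: "e > 0" "d \<le> e" by (auto simp: e_def)
  \<comment> \<open>At \<open>t = - c / e\<close> the quadratic term is at most half the absolute
    value of the linear one, because \<open>d \<le> e\<close>.\<close>
  have "0 \<le> 2 * (- c / e) * c + (- c / e)^2 * d" by (rule assms)
  also have "\<dots> = - 2 * c^2 / e + c^2 / e^2 * d" by (simp add: power2_eq_square)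
  also have "\<dots> \<le> - 2 * c^2 / e + c^2 / e^2 * e"
    using e by (intro add_left_mono mult_left_mono) auto
  also have "\<dots> = - (c^2 / e)" using e by (simp add: power2_eq_square field_simps)
  also have "\<dots> < 0" using c e by simp
  finally show False by simp
qed

text \<open>Perturbing \<open>x\<close> by a multiple of the indicator of \<open>v\<close> cannot
  make the form negative, so the first-order term, twice the sum in the conclusion, vanishes.
  Extremal vectors become eigenvectors in this way.\<close>

lemma psd_null_vector:
  assumes fin: "finite V" and sym: "\<And>v u. v \<in> V \<Longrightarrow> u \<in> V \<Longrightarrow> b v u = b u v"
    and psd: "\<And>z. 0 \<le> bil b V z z" and null: "bil b V x x = 0" and v: "v \<in> V"
  shows "(\<Sum>u\<in>V. b v u * x u) = 0"
proof -
  define e where "e = (\<lambda>w. if w = v then 1 else 0 :: real)"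
  have ev: "bil b V e z = (\<Sum>u\<in>V. b v u * z u)" for z
  proof -
    have "bil b V e z = (\<Sum>w\<in>V. if w = v then (\<Sum>u\<in>V. b w u * z u) else 0)"
      unfolding bil_eq_sum e_def by (intro sum.cong) auto
    then show ?thesis using fin v by simp
  qed
  have "0 \<le> 2 * t * bil b V e x + t^2 * bil b V e e" for t
  proof -
    have "bil b V (\<lambda>w. x w + t * e w) (\<lambda>w. x w + t * e w)
        = bil b V x x + t * bil b V e x + t * bil b V x e + t^2 * bil b V e e"
      by (simp add: bil_add_left bil_add_right bil_scale_left bil_scale_right power2_eq_square
          algebra_simps)
    then show ?thesis using psd[of "\<lambda>w. x w + t * e w"] null bil_commute[of V b e x, OF sym]
      by (simp add: algebra_simps)
  qed
  then show ?thesis using linear_coeff_zero ev by metis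
qed

lemma bil_delta: "finite V \<Longrightarrow> bil (\<lambda>v u. if v = u then c else 0) V y z = c * (\<Sum>v\<in>V. y v * z v)"
proof -
  assume fin: "finite V"
  have "bil (\<lambda>v u. if v = u then c else 0) V y z = (\<Sum>v\<in>V. y v * (\<Sum>u\<in>V. if v = u then c * z u else 0))"
    unfolding bil_eq_sum by (intro sum.cong refl arg_cong2[where f = "(*)"]) auto
  also have "\<dots> = c * (\<Sum>v\<in>V. y v * z v)"
    using fin by (simp add: sum_distrib_left mult_ac)
  finally show ?thesis .
qed

lemma bil_diff: "bil (\<lambda>v u. b v u - b' v u) V y z = bil b V y z - bil b' V y z"
  by (simp add: bil_def algebra_simps sum_subtractf)

lemma bil_cong:
  "(\<And>v. v \<in> V \<Longrightarrow> y v = y' v) \<Longrightarrow> (\<And>v. v \<in> V \<Longrightarrow> z v = z' v) \<Longrightarrow> bil b V y z = bil b V y' z'"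
  by (simp add: bil_def)

text \<open>The form attains its maximum \<open>l\<close> on the unit sphere by compactness;
  \<open>l\<close> times the identity minus \<open>b\<close> is then positive semidefinite with the
  maximizer as a null vector. Both extremal adjacency eigenvectors come from here.\<close>

lemma max_quadratic_form:
  assumes fin: "finite V" and ne: "V \<noteq> {}" and sym: "\<And>v u. v \<in> V \<Longrightarrow> u \<in> V \<Longrightarrow> b v u = b u v"
  shows "\<exists>x l. (\<exists>v\<in>V. x v \<noteq> 0) \<and> (\<forall>v\<in>V. (\<Sum>u\<in>V. b v u * x u) = l * x v) \<and>
    (\<forall>z. bil b V z z \<le> l * (\<Sum>v\<in>V. (z v)^2))"
proof -
  \<comment> \<open>The sphere lies in a cube of extensional functions, which is compact as a
    product of intervals.\<close>
  define S where "S = {x \<in> Pi\<^sub>E V (\<lambda>_. {-1..1::real}). (\<Sum>v\<in>V. (x v)^2) = 1}"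
  have "compactin (product_topology (\<lambda>_. euclideanreal) V) (Pi\<^sub>E V (\<lambda>_. {-1..1::real}))"
    by (subst compactin_PiE) auto
  moreover have closed: "closedin (product_topology (\<lambda>_. euclideanreal) V)
      {x \<in> topspace (product_topology (\<lambda>_. euclideanreal) V). (\<Sum>v\<in>V. (x v)^2) \<in> {1}}"
    by (rule closedin_continuous_map_preimage[where Y = euclideanreal])
      (auto intro!: continuous_intros continuous_map_sum continuous_map_real_pow
        continuous_map_product_projection simp: fin)
  ultimately have "compactin (product_topology (\<lambda>_. euclideanreal) V)
     (Pi\<^sub>E V (\<lambda>_. {-1..1::real}) \<inter> {x \<in> topspace (product_topology (\<lambda>_. euclideanreal) V). (\<Sum>v\<in>V. (x v)^2) \<in> {1}})"
    by (rule compact_Int_closedin)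
  also have "(Pi\<^sub>E V (\<lambda>_. {-1..1::real}) \<inter> {x \<in> topspace (product_topology (\<lambda>_. euclideanreal) V). (\<Sum>v\<in>V. (x v)^2) \<in> {1}}) = S"
    by (auto simp: S_def PiE_def)
  finally have cS: "compactin (product_topology (\<lambda>_. euclideanreal) V) S" .
  \<comment> \<open>\<open>restrict\<close> brings the normalized vector back to the extensional
    functions, the points of the product topology.\<close>
  have unit: "\<exists>c>0. restrict (\<lambda>v. c * z v) V \<in> S" if "\<exists>v\<in>V. z v \<noteq> 0" for z
  proof -
    define n where "n = (\<Sum>v\<in>V. (z v)^2)"
    have n: "n > 0" unfolding n_def using that fin
      by (metis (mono_tags, lifting) less_eq_real_def sum_nonneg sum_nonneg_eq_0_iff zero_le_power2 zero_eq_power2)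
    define c where "c = 1 / sqrt n"
    have le: "\<bar>c * z v\<bar> \<le> 1" if "v \<in> V" for v
    proof -
      have "(z v)^2 \<le> n" unfolding n_def using that fin by (intro member_le_sum) auto
      then have "\<bar>z v\<bar> \<le> sqrt n" using real_sqrt_le_iff[of "(z v)^2" n] by simp
      then show ?thesis using n by (simp add: c_def abs_mult field_simps)
    qed
    have "(\<Sum>v\<in>V. (c * z v)^2) = c^2 * n"
      unfolding n_def by (simp add: power_mult_distrib sum_distrib_left)
    also have "\<dots> = 1" using n by (simp add: c_def power_divide)
    finally have "restrict (\<lambda>v. c * z v) V \<in> S"
      using le by (force simp: S_def abs_le_iff)
    then show ?thesis using n by (intro exI[of _ c]) (auto simp: c_def)
  qed
  have cont: "continuous_map (product_topology (\<lambda>_. euclideanreal) V) euclideanreal (\<lambda>z. bil b V z z)"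
    unfolding bil_def using fin
    by (auto intro!: continuous_map_sum continuous_map_real_mult continuous_map_product_projection)
  have "compact ((\<lambda>z. bil b V z z) ` S)"
    using image_compactin[OF cS cont] by simp
  moreover have "(\<lambda>z. bil b V z z) ` S \<noteq> {}" using unit[of "\<lambda>_. 1"] ne by auto
  ultimately obtain x where x: "x \<in> S" "\<And>z. z \<in> S \<Longrightarrow> bil b V z z \<le> bil b V x x"
    using compact_attains_sup[of "(\<lambda>z. bil b V z z) ` S"] by auto
  define l where "l = bil b V x x"
  have le: "bil b V z z \<le> l * (\<Sum>v\<in>V. (z v)^2)" for z
  proof (cases "\<exists>v\<in>V. z v \<noteq> 0")
    case True
    then obtain c where c: "c > 0" "restrict (\<lambda>v. c * z v) V \<in> S" using unit by blast
    have "bil b V (restrict (\<lambda>v. c * z v) V) (restrict (\<lambda>v. c * z v) V) = c * (c * bil b V z z)"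
      by (subst bil_cong[where y' = "\<lambda>v. c * z v" and z' = "\<lambda>v. c * z v"])
         (auto simp: bil_scale_left bil_scale_right)
    then have "c * (c * bil b V z z) \<le> l" using x(2)[OF c(2)] by (simp add: l_def)
    moreover have "c * c * (\<Sum>v\<in>V. (z v)^2) = (\<Sum>v\<in>V. (c * z v)^2)"
      by (simp add: power_mult_distrib sum_distrib_left power2_eq_square[of c])
    moreover have "(\<Sum>v\<in>V. (c * z v)^2) = 1"
      using c(2) by (simp add: S_def)
    ultimately have "c * c * bil b V z z \<le> l * (c * c * (\<Sum>v\<in>V. (z v)^2))" by (simp add: mult_ac)
    then have "(c * c) * bil b V z z \<le> (c * c) * (l * (\<Sum>v\<in>V. (z v)^2))"
      by (simp add: mult_ac)
    then show ?thesis using c(1) by (simp add: mult_le_cancel_left_pos)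
  next
    case False
    then have "bil b V z z = 0" by (simp add: bil_def)
    moreover have "(\<Sum>v\<in>V. (z v)^2) = 0" using False by simp
    ultimately show ?thesis by simp
  qed
  \<comment> \<open>For this form the kernel equation of \<open>psd_null_vector\<close> is the
    eigenvalue equation of \<open>b\<close>.\<close>
  define b' where "b' v u = (if v = u then l else 0) - b v u" for v u
  have bil': "bil b' V z z = l * (\<Sum>v\<in>V. (z v)^2) - bil b V z z" for z
    unfolding b'_def bil_diff bil_delta[OF fin] by (simp add: power2_eq_square)
  have "(\<Sum>u\<in>V. b' v u * x u) = 0" if "v \<in> V" for v
  proof (rule psd_null_vector[OF fin _ _ _ that])
    show "bil b' V x x = 0" using x(1) by (simp add: bil' l_def S_def)
    show "0 \<le> bil b' V z z" for z using le by (simp add: bil')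
    show "b' v u = b' u v" if "v \<in> V" "u \<in> V" for v u using sym that by (auto simp: b'_def)
  qed
  moreover have "(\<Sum>u\<in>V. b' v u * x u) = l * x v - (\<Sum>u\<in>V. b v u * x u)" if "v \<in> V" for v
  proof -
    have "(\<Sum>u\<in>V. b' v u * x u) = (\<Sum>u\<in>V. (if v = u then l * x u else 0)) - (\<Sum>u\<in>V. b v u * x u)"
      by (simp add: b'_def left_diff_distrib sum_subtractf if_distrib[of "\<lambda>t. t * _"] cong: if_cong)
    then show ?thesis using fin that by simp
  qed
  moreover have "\<exists>v\<in>V. x v \<noteq> 0"
    using x(1) by (auto simp: S_def) (metis (mono_tags, lifting) sum.neutral zero_neq_one zero_eq_power2)
  ultimately show ?thesis using le by (intro exI[of _ x] exI[of _ l]) auto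
qed

subsection \<open>Adjacency eigenvalues\<close>

definition adj :: "'a pair_pre_digraph \<Rightarrow> 'a \<Rightarrow> 'a \<Rightarrow> real" where
  "adj G v u = (if (v, u) \<in> parcs G then 1 else 0)"

definition nbsum :: "'a pair_pre_digraph \<Rightarrow> ('a \<Rightarrow> real) \<Rightarrow> 'a \<Rightarrow> real" where
  "nbsum G x v = (\<Sum>u\<in>pverts G. adj G v u * x u)"

lemma pair_graph_finite: "pair_graph G \<Longrightarrow> finite (pverts G)"
proof -
  assume "pair_graph G"
  then interpret pair_graph G .
  show ?thesis by (rule pair_finite_verts)
qed

lemma pair_graph_sym: "pair_graph G \<Longrightarrow> (u, v) \<in> parcs G \<longleftrightarrow> (v, u) \<in> parcs G"
proof -
  assume "pair_graph G"
  then interpret pair_graph G .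
  show ?thesis using pair_sym_arcs unfolding symmetric_def sym_def with_proj_simps by blast
qed

lemma pair_graph_irrefl: "pair_graph G \<Longrightarrow> (v, v) \<notin> parcs G"
proof -
  assume "pair_graph G"
  then interpret pair_graph G .
  show ?thesis using pair_no_loops[of "(v, v)"] by auto
qed

lemma pair_graph_wf: "pair_graph G \<Longrightarrow> (u, v) \<in> parcs G \<Longrightarrow> u \<in> pverts G \<and> v \<in> pverts G"
proof -
  assume "pair_graph G" and uv: "(u, v) \<in> parcs G"
  then interpret pair_graph G by simp
  show ?thesis using in_arcsD1[OF uv] in_arcsD2[OF uv] by simp
qed

lemma pair_graphI:
  assumes "finite (pverts G)" "\<And>u v. (u, v) \<in> parcs G \<Longrightarrow> u \<in> pverts G \<and> v \<in> pverts G \<and> u \<noteq> v \<and> (v, u) \<in> parcs G"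
  shows "pair_graph G"
proof unfold_locales
  show "finite (parcs G)"
    by (rule finite_subset[of _ "pverts G \<times> pverts G"]) (use assms in auto)
  show "Digraph.symmetric (with_proj G)"
    unfolding symmetric_def using assms(2) by (auto intro!: symI)
qed (use assms in auto)

lemma adj_sym: "pair_graph G \<Longrightarrow> adj G u v = adj G v u"
  by (simp add: adj_def pair_graph_sym[of G u v])

lemma nbsum_eq: "finite (pverts G) \<Longrightarrow> nbsum G x v = (\<Sum>u | u \<in> pverts G \<and> (v, u) \<in> parcs G. x u)"
proof -
  assume fin: "finite (pverts G)"
  have "nbsum G x v = (\<Sum>u\<in>pverts G. if (v, u) \<in> parcs G then x u else 0)"
    unfolding nbsum_def adj_def by (intro sum.cong) auto
  also have "\<dots> = (\<Sum>u\<in>{u \<in> pverts G. (v, u) \<in> parcs G}. x u)"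
    using fin by (simp add: sum.inter_filter)
  finally show ?thesis by simp
qed

text \<open>Replaces vectors indexed by an enumeration by functions on the vertices; afterwards the
  spectrum is handled without matrices.\<close>

lemma eigenvalue_adj_mat:
  assumes vs: "distinct vs" "set vs = pverts G"
  shows "eigenvalue (adj_mat G vs) k \<longleftrightarrow>
    (\<exists>x. (\<exists>v\<in>pverts G. x v \<noteq> 0) \<and> (\<forall>v\<in>pverts G. nbsum G x v = k * x v))"
proof -
  let ?n = "length vs"
  have bij: "bij_betw ((!) vs) {0..<?n} (pverts G)"
    using bij_betw_nth[OF vs(1), of "{0..<?n}"] vs(2) by (simp add: lessThan_atLeast0)
  have sum_vs: "(\<Sum>u\<in>pverts G. f u) = (\<Sum>j = 0..<?n. f (vs ! j))" for f :: "_ \<Rightarrow> real"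
    using sum.reindex_bij_betw[OF bij, of f] by simp
  have mv: "(adj_mat G vs *\<^sub>v w) $ i = nbsum G x (vs ! i)"
    if "w \<in> carrier_vec ?n" "i < ?n" "\<And>j. j < ?n \<Longrightarrow> w $ j = x (vs ! j)" for w x i
    using that unfolding nbsum_def sum_vs adj_def
    by (auto simp: adj_mat_def scalar_prod_def row_def intro!: sum.cong)
  show ?thesis
  proof
    assume "eigenvalue (adj_mat G vs) k"
    then obtain w where w: "w \<in> carrier_vec ?n" "w \<noteq> 0\<^sub>v ?n" "adj_mat G vs *\<^sub>v w = k \<cdot>\<^sub>v w"
      by (auto simp: eigenvalue_def eigenvector_def adj_mat_def)
    define x where "x v = w $ (the_inv_into {0..<?n} ((!) vs) v)" for v
    have xw: "x (vs ! j) = w $ j" if "j < ?n" for j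
      using bij that by (simp add: x_def the_inv_into_f_f bij_betw_def)
    have "nbsum G x v = k * x v" if v: "v \<in> pverts G" for v
    proof -
      obtain i where i: "i < ?n" "v = vs ! i" using v vs(2) by (metis in_set_conv_nth)
      have "(adj_mat G vs *\<^sub>v w) $ i = nbsum G x (vs ! i)"
        using mv[OF w(1) i(1), of x] xw by metis
      then have "nbsum G x (vs ! i) = (k \<cdot>\<^sub>v w) $ i" unfolding w(3) by (rule sym)
      then show ?thesis using i w(1) xw by simp
    qed
    moreover have "\<exists>v\<in>pverts G. x v \<noteq> 0"
    proof (rule ccontr)
      assume "\<not> ?thesis"
      then have "w $ j = 0" if "j < ?n" for j using xw that vs(2) by (metis nth_mem)
      then have "w = 0\<^sub>v ?n" using w(1) by (intro eq_vecI) auto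
      then show False using w(2) by simp
    qed
    ultimately show "\<exists>x. (\<exists>v\<in>pverts G. x v \<noteq> 0) \<and> (\<forall>v\<in>pverts G. nbsum G x v = k * x v)" by blast
  next
    assume "\<exists>x. (\<exists>v\<in>pverts G. x v \<noteq> 0) \<and> (\<forall>v\<in>pverts G. nbsum G x v = k * x v)"
    then obtain x where x: "\<exists>v\<in>pverts G. x v \<noteq> 0" "\<And>v. v\<in>pverts G \<Longrightarrow> nbsum G x v = k * x v" by blast
    define w where "w = Matrix.vec ?n (\<lambda>i. x (vs ! i))"
    have w: "w \<in> carrier_vec ?n" "\<And>j. j < ?n \<Longrightarrow> w $ j = x (vs ! j)" by (auto simp: w_def)
    have "adj_mat G vs *\<^sub>v w = k \<cdot>\<^sub>v w"
    proof (rule eq_vecI)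
      fix i assume "i < dim_vec (k \<cdot>\<^sub>v w)"
      then have i: "i < ?n" by (simp add: w_def)
      show "(adj_mat G vs *\<^sub>v w) $ i = (k \<cdot>\<^sub>v w) $ i"
        using mv[OF w(1) i w(2)] x(2)[of "vs ! i"] i vs(2) w nth_mem[OF i] by (simp add: w_def)
    qed (simp add: w_def adj_mat_def)
    moreover have "w \<noteq> 0\<^sub>v ?n"
    proof
      assume "w = 0\<^sub>v ?n"
      then have "x (vs ! j) = 0" if "j < ?n" for j using w(2)[OF that] that by simp
      then show False using x(1) vs(2) by (metis in_set_conv_nth)
    qed
    ultimately show "eigenvalue (adj_mat G vs) k"
      using w(1) by (auto simp: eigenvalue_def eigenvector_def adj_mat_def)
  qed
qed

lemma adj_eigenvalues_iff:
  assumes "finite (pverts G)"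
  shows "k \<in> adj_eigenvalues G \<longleftrightarrow>
    (\<exists>x. (\<exists>v\<in>pverts G. x v \<noteq> 0) \<and> (\<forall>v\<in>pverts G. nbsum G x v = k * x v))"
  using finite_distinct_list[OF assms] eigenvalue_adj_mat[of _ G k] unfolding adj_eigenvalues_def by blast

text \<open>Eigenvalues are roots of the characteristic polynomial. Finiteness gives
  \<open>Max\<close> and \<open>Min\<close> in \<open>lambda_max\<close> and
  \<open>lambda_min\<close> their meaning.\<close>

lemma finite_adj_eigenvalues:
  assumes "finite (pverts G)"
  shows "finite (adj_eigenvalues G)"
proof -
  obtain vs where vs: "set vs = pverts G" "distinct vs" using finite_distinct_list[OF assms] by blast
  have A: "adj_mat G vs \<in> carrier_mat (length vs) (length vs)" by (simp add: adj_mat_def)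
  have "char_poly (adj_mat G vs) \<noteq> 0" using degree_monic_char_poly[OF A] by auto
  then have "finite {k. poly (char_poly (adj_mat G vs)) k = 0}" by (rule poly_roots_finite)
  moreover have "adj_eigenvalues G \<subseteq> {k. poly (char_poly (adj_mat G vs)) k = 0}"
    using eigenvalue_adj_mat[OF vs(2,1)] adj_eigenvalues_iff[OF assms] eigenvalue_root_char_poly[OF A]
    by auto
  ultimately show ?thesis by (rule finite_subset[rotated])
qed

definition sqn :: "'a pair_pre_digraph \<Rightarrow> ('a \<Rightarrow> real) \<Rightarrow> real" where
  "sqn G x = (\<Sum>v\<in>pverts G. (x v)^2)"

lemma bil_adj: "bil (adj G) (pverts G) y z = (\<Sum>v\<in>pverts G. y v * nbsum G z v)"
  by (simp add: bil_eq_sum nbsum_def)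

lemma bil_eigenfunction:
  "(\<And>v. v \<in> pverts G \<Longrightarrow> nbsum G x v = k * x v) \<Longrightarrow> bil (adj G) (pverts G) x x = k * sqn G x"
  by (simp add: bil_adj sqn_def power2_eq_square sum_distrib_left mult_ac)

lemma sqn_pos: "finite (pverts G) \<Longrightarrow> v \<in> pverts G \<Longrightarrow> x v \<noteq> 0 \<Longrightarrow> 0 < sqn G x"
  unfolding sqn_def by (rule sum_pos2[of _ v]) auto

lemma lambda_max_props:
  assumes G: "pair_graph G" and ne: "pverts G \<noteq> {}"
  shows lambda_max_bound: "bil (adj G) (pverts G) z z \<le> lambda_max G * sqn G z"
    and lambda_max_eigen: "\<exists>x. (\<exists>v\<in>pverts G. x v \<noteq> 0) \<and> (\<forall>v\<in>pverts G. nbsum G x v = lambda_max G * x v)"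
proof -
  note fin = pair_graph_finite[OF G]
  obtain x l where x: "\<exists>v\<in>pverts G. x v \<noteq> 0" "\<And>v. v\<in>pverts G \<Longrightarrow> nbsum G x v = l * x v"
    "\<And>z. bil (adj G) (pverts G) z z \<le> l * sqn G z"
    using max_quadratic_form[OF fin ne, of "adj G", OF adj_sym[OF G], folded sqn_def nbsum_def] by blast
  have "lambda_max G = l" unfolding lambda_max_def
  proof (rule Max_eqI[OF finite_adj_eigenvalues[OF fin]])
    show "l \<in> adj_eigenvalues G" using x adj_eigenvalues_iff[OF fin] by blast
    fix k assume "k \<in> adj_eigenvalues G"
    then obtain y where y: "\<exists>v\<in>pverts G. y v \<noteq> 0" "\<And>v. v\<in>pverts G \<Longrightarrow> nbsum G y v = k * y v"
      using adj_eigenvalues_iff[OF fin] by blast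
    have "k * sqn G y \<le> l * sqn G y" using x(3)[of y] bil_eigenfunction[OF y(2)] by simp
    then show "k \<le> l" using y(1) sqn_pos[OF fin, of _ y] by auto
  qed
  then show "bil (adj G) (pverts G) z z \<le> lambda_max G * sqn G z"
    "\<exists>x. (\<exists>v\<in>pverts G. x v \<noteq> 0) \<and> (\<forall>v\<in>pverts G. nbsum G x v = lambda_max G * x v)"
    using x by auto
qed

text \<open>The maximum principle applied to the negated adjacency form.\<close>

lemma lambda_min_props:
  assumes G: "pair_graph G" and ne: "pverts G \<noteq> {}"
  shows lambda_min_bound: "lambda_min G * sqn G z \<le> bil (adj G) (pverts G) z z"
    and lambda_min_eigen: "\<exists>x. (\<exists>v\<in>pverts G. x v \<noteq> 0) \<and> (\<forall>v\<in>pverts G. nbsum G x v = lambda_min G * x v)"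
proof -
  note fin = pair_graph_finite[OF G]
  have neg: "bil (\<lambda>v u. - adj G v u) (pverts G) z z = - bil (adj G) (pverts G) z z" for z
    by (simp add: bil_def sum_negf)
  have sy: "- adj G v u = - adj G u v" for v u
    using adj_sym[OF G, of v u] by simp
  obtain x l where xl: "(\<exists>v\<in>pverts G. x v \<noteq> 0) \<and> (\<forall>v\<in>pverts G. - nbsum G x v = l * x v) \<and>
    (\<forall>z. - bil (adj G) (pverts G) z z \<le> l * sqn G z)"
    using max_quadratic_form[of "pverts G" "\<lambda>v u. - adj G v u", OF fin ne sy, unfolded neg mult_minus_left sum_negf,
        folded sqn_def nbsum_def] by (elim exE) (rule that)
  then have x: "\<exists>v\<in>pverts G. x v \<noteq> 0" "\<And>v. v\<in>pverts G \<Longrightarrow> - nbsum G x v = l * x v"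
    "\<And>z. - bil (adj G) (pverts G) z z \<le> l * sqn G z" by blast+
  have x': "nbsum G x v = - l * x v" if "v \<in> pverts G" for v using x(2)[OF that] by simp
  have "lambda_min G = - l" unfolding lambda_min_def
  proof (rule Min_eqI[OF finite_adj_eigenvalues[OF fin]])
    show "- l \<in> adj_eigenvalues G" using x(1) x' adj_eigenvalues_iff[OF fin] by blast
    fix k assume "k \<in> adj_eigenvalues G"
    then obtain y where y: "\<exists>v\<in>pverts G. y v \<noteq> 0" "\<And>v. v\<in>pverts G \<Longrightarrow> nbsum G y v = k * y v"
      using adj_eigenvalues_iff[OF fin] by blast
    have "- l * sqn G y \<le> k * sqn G y" using x(3)[of y] bil_eigenfunction[OF y(2)] by simp
    then show "- l \<le> k" using y(1) sqn_pos[OF fin, of _ y] by (metis mult_le_cancel_right_pos)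
  qed
  then show "lambda_min G * sqn G z \<le> bil (adj G) (pverts G) z z"
    "\<exists>x. (\<exists>v\<in>pverts G. x v \<noteq> 0) \<and> (\<forall>v\<in>pverts G. nbsum G x v = lambda_min G * x v)"
    using x(1) x' x(3)[of z] by auto
qed

text \<open>The absolute values of an eigenvector for \<open>lambda_max G\<close> are stretched by
  at least that factor. Pairing them with the positive vector \<open>x\<close> and moving the
  adjacency form to the other side gives \<open>lambda_max G \<le> l\<close>. An explicit positive
  eigenvector thus identifies the largest eigenvalue.\<close>

lemma lambda_max_eqI:
  assumes G: "pair_graph G" and ne: "pverts G \<noteq> {}"
    and pos: "\<And>v. v \<in> pverts G \<Longrightarrow> 0 < x v" and ev: "\<And>v. v \<in> pverts G \<Longrightarrow> nbsum G x v = l * x v"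
  shows "lambda_max G = l"
proof -
  note fin = pair_graph_finite[OF G]
  obtain y where y: "\<exists>v\<in>pverts G. y v \<noteq> 0" "\<And>v. v\<in>pverts G \<Longrightarrow> nbsum G y v = lambda_max G * y v"
    using lambda_max_eigen[OF G ne] by blast
  obtain v0 where v0: "v0 \<in> pverts G" using ne by blast
  have "l * sqn G x \<le> lambda_max G * sqn G x"
    using lambda_max_bound[OF G ne, of x] bil_eigenfunction[OF ev] by simp
  moreover have "0 < sqn G x" using sqn_pos[OF fin v0, of x] pos[OF v0] by auto
  ultimately have ge: "l \<le> lambda_max G" by simp
  have comm: "(\<Sum>v\<in>pverts G. x v * nbsum G z v) = (\<Sum>v\<in>pverts G. z v * nbsum G x v)" for z
    using bil_commute[of "pverts G" "adj G" x z] adj_sym[OF G] by (simp add: bil_adj)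
  have abs: "lambda_max G * \<bar>y v\<bar> \<le> nbsum G (\<lambda>u. \<bar>y u\<bar>) v" if "v \<in> pverts G" for v
  proof -
    have "lambda_max G * \<bar>y v\<bar> \<le> \<bar>lambda_max G * y v\<bar>" by (simp add: abs_mult mult_right_mono)
    also have "\<dots> = \<bar>nbsum G y v\<bar>" using y(2)[OF that] by simp
    also have "\<dots> \<le> (\<Sum>u\<in>pverts G. \<bar>adj G v u * y u\<bar>)" unfolding nbsum_def by (rule sum_abs)
    also have "\<dots> = nbsum G (\<lambda>u. \<bar>y u\<bar>) v" unfolding nbsum_def by (intro sum.cong) (auto simp: adj_def)
    finally show ?thesis .
  qed
  have "lambda_max G * (\<Sum>v\<in>pverts G. x v * \<bar>y v\<bar>) = (\<Sum>v\<in>pverts G. x v * (lambda_max G * \<bar>y v\<bar>))"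
    by (simp add: sum_distrib_left mult_ac)
  also have "\<dots> \<le> (\<Sum>v\<in>pverts G. x v * nbsum G (\<lambda>u. \<bar>y u\<bar>) v)"
    using abs pos by (intro sum_mono mult_left_mono) (auto intro: less_imp_le)
  also have "\<dots> = l * (\<Sum>v\<in>pverts G. x v * \<bar>y v\<bar>)"
    unfolding comm using ev by (simp add: sum_distrib_left mult_ac)
  finally have le: "lambda_max G * (\<Sum>v\<in>pverts G. x v * \<bar>y v\<bar>) \<le> l * (\<Sum>v\<in>pverts G. x v * \<bar>y v\<bar>)" .
  obtain v where v: "v \<in> pverts G" "y v \<noteq> 0" using y(1) by blast
  have "0 < (\<Sum>v\<in>pverts G. x v * \<bar>y v\<bar>)"
    using v pos by (intro sum_pos2[OF fin v(1)]) (auto simp: less_imp_le)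
  then show ?thesis using le ge by simp
qed

lemma lambda_min_eqI:
  assumes G: "pair_graph G" and ne: "pverts G \<noteq> {}"
    and ev: "\<And>v. v \<in> pverts G \<Longrightarrow> nbsum G x v = l * x v" and nz: "v0 \<in> pverts G" "x v0 \<noteq> 0"
    and psd: "\<And>z. l * sqn G z \<le> bil (adj G) (pverts G) z z"
  shows "lambda_min G = l"
proof -
  note fin = pair_graph_finite[OF G]
  obtain y where y: "\<exists>v\<in>pverts G. y v \<noteq> 0" "\<And>v. v\<in>pverts G \<Longrightarrow> nbsum G y v = lambda_min G * y v"
    using lambda_min_eigen[OF G ne] by blast
  have "lambda_min G * sqn G x \<le> l * sqn G x"
    using lambda_min_bound[OF G ne, of x] bil_eigenfunction[OF ev] by simp
  then have "lambda_min G \<le> l" using sqn_pos[where x = x, OF fin nz] by simp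
  moreover have "l * sqn G y \<le> lambda_min G * sqn G y" using psd[of y] bil_eigenfunction[OF y(2)] by simp
  then have "l \<le> lambda_min G" using y(1) sqn_pos[OF fin, of _ y] by auto
  ultimately show ?thesis by simp
qed

section \<open>Representations by root vectors and the Perron eigenvector\<close>

text \<open>Gaussian elimination, one coordinate per induction step; it bounds the number of
  vertices in \<open>card_le_8\<close>.\<close>

lemma nontrivial_dependency:
  fixes g :: "'a \<Rightarrow> nat \<Rightarrow> real"
  assumes "finite V" "n < card V"
  shows "\<exists>z. (\<exists>v\<in>V. z v \<noteq> 0) \<and> (\<forall>k<n. (\<Sum>v\<in>V. z v * g v k) = 0)"
  using assms
proof (induction n arbitrary: V g)
  case 0
  then have "V \<noteq> {}" by auto
  then show ?case by (intro exI[of _ "\<lambda>_. 1"]) auto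
next
  case (Suc n)
  show ?case
  proof (cases "\<forall>v\<in>V. g v n = 0")
    case True
    obtain z where z: "\<exists>v\<in>V. z v \<noteq> 0" "\<forall>k<n. (\<Sum>v\<in>V. z v * g v k) = 0"
      using Suc.IH[of V g] Suc.prems by auto
    have "(\<Sum>v\<in>V. z v * g v k) = 0" if "k < Suc n" for k
      using z(2) True that by (cases "k = n") auto
    then show ?thesis using z(1) by blast
  next
    case False
    then obtain v0 where v0: "v0 \<in> V" "g v0 n \<noteq> 0" by blast
    \<comment> \<open>The pivot \<open>v0\<close> clears coordinate \<open>n\<close>. Its
      coefficient \<open>t\<close> is chosen so that sums with \<open>g\<close> over
      \<open>V\<close> equal sums with \<open>g'\<close> over the rest.\<close>
    define g' where "g' v k = g v k - g v n / g v0 n * g v0 k" for v k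
    have lt: "n < card (V - {v0})" using Suc.prems v0 by simp
    obtain z where z: "\<exists>v\<in>V - {v0}. z v \<noteq> 0" "\<forall>k<n. (\<Sum>v\<in>V - {v0}. z v * g' v k) = 0"
      using Suc.IH[OF finite_Diff[OF Suc.prems(1)] lt, of g'] by blast
    define t where "t = - (\<Sum>v\<in>V - {v0}. z v * (g v n / g v0 n))"
    define y where "y = z(v0 := t)"
    have y: "(\<Sum>v\<in>V. y v * g v k) = (\<Sum>v\<in>V - {v0}. z v * g' v k)" for k
    proof -
      have "(\<Sum>v\<in>V. y v * g v k) = y v0 * g v0 k + (\<Sum>v\<in>V - {v0}. y v * g v k)"
        using v0 Suc.prems by (simp add: sum.remove)
      also have "(\<Sum>v\<in>V - {v0}. y v * g v k) = (\<Sum>v\<in>V - {v0}. z v * g v k)"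
        by (intro sum.cong) (auto simp: y_def)
      also have "y v0 * g v0 k = - (\<Sum>v\<in>V - {v0}. z v * (g v n / g v0 n * g v0 k))"
        by (simp add: y_def t_def sum_distrib_left sum_distrib_right mult_ac)
      finally show ?thesis by (simp add: g'_def right_diff_distrib sum_subtractf)
    qed
    have "(\<Sum>v\<in>V. y v * g v k) = 0" if "k < Suc n" for k
    proof (cases "k = n")
      case True
      then show ?thesis unfolding y using v0(2) by (simp add: g'_def)
    next
      case False
      then show ?thesis unfolding y using z(2) that by auto
    qed
    moreover have "\<exists>v\<in>V. y v \<noteq> 0" using z(1) by (auto simp: y_def)
    ultimately show ?thesis by blast
  qed
qed

definition ip :: "(nat \<Rightarrow> int) \<Rightarrow> (nat \<Rightarrow> int) \<Rightarrow> int" where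
  "ip p q = (\<Sum>k<8. p k * q k)"

lemma ip_commute: "ip p q = ip q p"
  by (simp add: ip_def mult.commute)

definition root_rep :: "'a pair_pre_digraph \<Rightarrow> ('a \<Rightarrow> nat \<Rightarrow> int) \<Rightarrow> bool" where
  "root_rep G g \<longleftrightarrow> (\<forall>u\<in>pverts G. \<forall>v\<in>pverts G.
     ip (g u) (g v) = (if u = v then 8 else if (u, v) \<in> parcs G then 4 else 0))"

text \<open>The Gram matrix of the vectors is \<open>4 * (A + 2 I)\<close>. Hence \<open>- 2\<close>
  bounds the spectrum from below, and kernel vectors of \<open>A + 2 I\<close> are exactly the
  linear dependencies of the vectors.\<close>

lemma root_rep_norm:
  assumes "root_rep G g" "pair_graph G"
  shows "(\<Sum>k<8. (\<Sum>u\<in>pverts G. z u * of_int (g u k))^2) = 4 * (bil (adj G) (pverts G) z z + 2 * sqn G z)"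
proof -
  let ?V = "pverts G"
  note fin = pair_graph_finite[OF assms(2)]
  have "(\<Sum>k<8. (\<Sum>u\<in>?V. z u * of_int (g u k))^2)
      = (\<Sum>k<8. \<Sum>u\<in>?V. \<Sum>v\<in>?V. z u * z v * of_int (g u k * g v k))"
    by (simp add: power2_eq_square sum_product mult_ac)
  also have "\<dots> = (\<Sum>u\<in>?V. \<Sum>v\<in>?V. \<Sum>k<8. z u * z v * of_int (g u k * g v k))"
    by (subst sum.swap) (intro sum.cong refl, rule sum.swap)
  also have "\<dots> = (\<Sum>u\<in>?V. \<Sum>v\<in>?V. z u * z v * of_int (ip (g u) (g v)))"
    by (simp add: ip_def sum_distrib_left)
  also have "\<dots> = (\<Sum>u\<in>?V. \<Sum>v\<in>?V. 4 * (adj G u v * z u * z v) + (if u = v then 8 * (z u)^2 else 0))"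
    using assms(1) pair_graph_irrefl[OF assms(2)] unfolding root_rep_def
    by (intro sum.cong refl) (auto simp: adj_def power2_eq_square)
  also have "\<dots> = 4 * bil (adj G) ?V z z + (\<Sum>u\<in>?V. 8 * (z u)^2)"
    using fin by (simp add: sum.distrib bil_def sum_distrib_left)
  finally show ?thesis by (simp add: sqn_def sum_distrib_left)
qed

lemma root_rep_psd:
  assumes "root_rep G g" "pair_graph G"
  shows "- 2 * sqn G z \<le> bil (adj G) (pverts G) z z"
proof -
  have "0 \<le> (\<Sum>k<8. (\<Sum>u\<in>pverts G. z u * of_int (g u k))^2)" by (simp add: sum_nonneg)
  then show ?thesis using root_rep_norm[OF assms, of z] by simp
qed

text \<open>Connectedness as an induction principle. The library notion refers to the symmetrized
  digraph, which here has the same arcs.\<close>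

lemma connected_closed:
  assumes con: "Digraph_Component.connected (with_proj G)" and G: "pair_graph G"
    and S: "v0 \<in> S" "v0 \<in> pverts G" and cl: "\<And>u w. u \<in> S \<Longrightarrow> (u, w) \<in> parcs G \<Longrightarrow> w \<in> S"
  shows "pverts G \<subseteq> S"
proof
  fix v assume v: "v \<in> pverts G"
  have "reachable (with_proj (mk_symmetric (with_proj G))) v0 v"
    using con S v unfolding connected_def strongly_connected_def by (auto simp: mk_symmetric_def)
  then have "(v0, v) \<in> rtrancl_on (pverts G) (parcs (mk_symmetric (with_proj G)))"
    by (simp add: reachable_def)
  moreover have "parcs (mk_symmetric (with_proj G)) = parcs G"
    unfolding parcs_mk_symmetric using pair_graph_sym[OF G] by auto
  ultimately have "(v0, v) \<in> rtrancl_on (pverts G) (parcs G)" by simp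
  moreover have "(a, b) \<in> rtrancl_on (pverts G) (parcs G) \<Longrightarrow> a \<in> S \<Longrightarrow> b \<in> S" for a b
    by (induction rule: rtrancl_on.induct) (use cl in auto)
  ultimately show "v \<in> S" using S by blast
qed

text \<open>Taking absolute values of a top eigenvector does not lower the quadratic form, so the
  result is again extremal and an eigenvector. A zero entry would force zeros at all neighbours and,
  by connectedness, everywhere.\<close>

lemma perron:
  assumes G: "pair_graph G" and con: "Digraph_Component.connected (with_proj G)"
  shows "\<exists>x. (\<forall>v\<in>pverts G. 0 < x v) \<and> (\<forall>v\<in>pverts G. nbsum G x v = lambda_max G * x v)"
proof -
  let ?V = "pverts G"
  note fin = pair_graph_finite[OF G]
  have ne: "?V \<noteq> {}" using con unfolding connected_def strongly_connected_def by auto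
  obtain y where y: "\<exists>v\<in>?V. y v \<noteq> 0" "\<And>v. v\<in>?V \<Longrightarrow> nbsum G y v = lambda_max G * y v"
    using lambda_max_eigen[OF G ne] by blast
  define x where "x v = \<bar>y v\<bar>" for v
  have sx: "sqn G x = sqn G y" by (simp add: sqn_def x_def)
  have "bil (adj G) ?V y y \<le> bil (adj G) ?V x x" unfolding bil_def
  proof (intro sum_mono)
    fix i j
    have "y i * y j \<le> \<bar>y i\<bar> * \<bar>y j\<bar>" by (metis abs_ge_self abs_mult)
    then show "adj G i j * y i * y j \<le> adj G i j * x i * x j" by (simp add: adj_def x_def)
  qed
  then have eq: "bil (adj G) ?V x x = lambda_max G * sqn G x"
    using lambda_max_bound[OF G ne, of x] bil_eigenfunction[OF y(2)] sx by auto
  define b where "b v u = (if v = u then lambda_max G else 0) - adj G v u" for v u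
  have bil: "bil b ?V z z = lambda_max G * sqn G z - bil (adj G) ?V z z" for z
    unfolding b_def bil_diff bil_delta[OF fin] by (simp add: power2_eq_square sqn_def)
  have ev: "nbsum G x v = lambda_max G * x v" if v: "v \<in> ?V" for v
  proof -
    have "(\<Sum>u\<in>?V. b v u * x u) = 0"
    proof (rule psd_null_vector[OF fin _ _ _ v])
      show "bil b ?V x x = 0" by (simp add: bil eq)
      show "0 \<le> bil b ?V z z" for z using lambda_max_bound[OF G ne, of z] by (simp add: bil)
      show "b v u = b u v" for v u using adj_sym[OF G, of u v] by (auto simp: b_def)
    qed
    moreover have "(\<Sum>u\<in>?V. b v u * x u) = (\<Sum>u\<in>?V. (if v = u then lambda_max G * x u else 0)) - nbsum G x v"
      by (simp add: b_def nbsum_def left_diff_distrib sum_subtractf if_distrib[of "\<lambda>t. t * _"] cong: if_cong)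
    ultimately show ?thesis using fin v by simp
  qed
  have "0 < x v" if v: "v \<in> ?V" for v
  proof (rule ccontr)
    assume "\<not> 0 < x v"
    then have x0: "x v = 0" by (simp add: x_def)
    have "?V \<subseteq> {u \<in> ?V. x u = 0}"
    proof (rule connected_closed[OF con G, of v])
      show "v \<in> {u \<in> ?V. x u = 0}" "v \<in> ?V" using v x0 by auto
      fix u w assume u: "u \<in> {u \<in> ?V. x u = 0}" and uw: "(u, w) \<in> parcs G"
      have w: "w \<in> ?V" using pair_graph_wf[OF G uw] by simp
      have "(\<Sum>u'\<in>?V. adj G u u' * x u') = 0" using ev[of u] u by (simp add: nbsum_def)
      then have "adj G u w * x w = 0"
        using w fin by (subst (asm) sum_nonneg_eq_0_iff) (auto simp: adj_def x_def)
      then show "w \<in> {u \<in> ?V. x u = 0}" using w uw by (simp add: adj_def)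
    qed
    then show False using y(1) by (auto simp: x_def)
  qed
  then show ?thesis using ev by blast
qed

text \<open>The test vectors of Hoffman's bound: \<open>z i\<close> is the eigenvector minus
  \<open>k\<close> times its part on class \<open>i\<close>. The form vanishes on each part because
  a color class is independent, and the squared norms of the parts add up to that of
  \<open>x\<close>, so the sum over the classes has a closed form.\<close>

lemma coloring_quadratic_sum:
  assumes G: "pair_graph G" and col: "proper_coloring G k c"
    and ev: "\<And>v. v \<in> pverts G \<Longrightarrow> nbsum G x v = l * x v"
  defines "z \<equiv> \<lambda>i v. x v - of_nat k * (if c v = i then x v else 0)"
  shows "(\<Sum>i<k. bil (adj G) (pverts G) (z i) (z i) + t * sqn G (z i))
    = of_nat k * (of_nat k * t - l - t) * sqn G x"
proof -
  let ?V = "pverts G" and ?K = "of_nat k :: real"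
  note fin = pair_graph_finite[OF G]
  define xi where "xi i v = (if c v = i then x v else 0)" for i v
  have ck: "c v < k" if "v \<in> ?V" for v using col that by (auto simp: proper_coloring_def)
  have cd: "c u \<noteq> c v" if "(u, v) \<in> parcs G" for u v using col that by (auto simp: proper_coloring_def)
  have z: "z i = (\<lambda>v. x v + (- ?K) * xi i v)" for i by (auto simp: z_def xi_def)
  have xx: "bil (adj G) ?V x x = l * sqn G x" by (rule bil_eigenfunction[OF ev])
  have xxi: "bil (adj G) ?V (xi i) x = l * sqn G (xi i)" for i
  proof -
    have "bil (adj G) ?V (xi i) x = (\<Sum>v\<in>?V. xi i v * (l * x v))"
      unfolding bil_adj using ev by (intro sum.cong) auto
    also have "\<dots> = (\<Sum>v\<in>?V. l * (xi i v)^2)"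
      by (intro sum.cong) (auto simp: xi_def power2_eq_square)
    finally show ?thesis by (simp add: sqn_def sum_distrib_left)
  qed
  have xix: "bil (adj G) ?V x (xi i) = l * sqn G (xi i)" for i
    using bil_commute[of ?V "adj G" x "xi i"] adj_sym[OF G] xxi by metis
  have xii: "bil (adj G) ?V (xi i) (xi i) = 0" for i
    unfolding bil_def by (intro sum.neutral ballI) (auto simp: xi_def adj_def dest: cd)
  have bz: "bil (adj G) ?V (z i) (z i) = l * sqn G x - 2 * ?K * l * sqn G (xi i)" for i
    unfolding z bil_add_left bil_add_right bil_scale_left bil_scale_right xx xxi xix xii
    by (simp add: algebra_simps)
  have sz: "sqn G (z i) = sqn G x + (?K^2 - 2 * ?K) * sqn G (xi i)" for i
  proof -
    have "sqn G (z i) = (\<Sum>v\<in>?V. (x v)^2 + (?K^2 - 2 * ?K) * (xi i v)^2)"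
      unfolding sqn_def z by (intro sum.cong) (auto simp: xi_def power2_eq_square algebra_simps)
    then show ?thesis by (simp add: sqn_def sum.distrib sum_distrib_left)
  qed
  have "(\<Sum>i<k. sqn G (xi i)) = (\<Sum>v\<in>?V. \<Sum>i<k. (xi i v)^2)"
    unfolding sqn_def by (rule sum.swap)
  also have "\<dots> = sqn G x"
    unfolding sqn_def xi_def using ck
    by (intro sum.cong refl) (auto simp: if_distrib[of "\<lambda>t. t^2"] cong: if_cong)
  finally have S: "(\<Sum>i<k. sqn G (xi i)) = sqn G x" .
  have "(\<Sum>i<k. bil (adj G) ?V (z i) (z i) + t * sqn G (z i))
     = (\<Sum>i<k. (l + t) * sqn G x) + (\<Sum>i<k. (t * (?K^2 - 2 * ?K) - 2 * ?K * l) * sqn G (xi i))"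
    unfolding bz sz sum.distrib[symmetric] by (intro sum.cong) (auto simp: algebra_simps)
  also have "\<dots> = ?K * (l + t) * sqn G x + (t * (?K^2 - 2 * ?K) - 2 * ?K * l) * sqn G x"
    unfolding sum_distrib_left[symmetric] S by simp
  also have "\<dots> = ?K * (?K * t - l - t) * sqn G x" by (simp add: power2_eq_square algebra_simps)
  finally show ?thesis .
qed

text \<open>All summands of \<open>coloring_quadratic_sum\<close> are nonnegative. With
  \<open>- t\<close> the smallest and \<open>l\<close> the largest eigenvalue this is Hoffman's
  lower bound on the number of colors.\<close>

lemma hoffman_bound:
  assumes G: "pair_graph G" and col: "proper_coloring G k c" and ne: "v0 \<in> pverts G" "x v0 \<noteq> 0"
    and ev: "\<And>v. v \<in> pverts G \<Longrightarrow> nbsum G x v = l * x v"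
    and psd: "\<And>z. - t * sqn G z \<le> bil (adj G) (pverts G) z z"
  shows "l + t \<le> of_nat k * t"
proof -
  have nonneg: "0 \<le> bil (adj G) (pverts G) z z + t * sqn G z" for z using psd[of z] by simp
  have "0 \<le> (\<Sum>i<k. bil (adj G) (pverts G) (\<lambda>v. x v - of_nat k * (if c v = i then x v else 0))
     (\<lambda>v. x v - of_nat k * (if c v = i then x v else 0))
     + t * sqn G (\<lambda>v. x v - of_nat k * (if c v = i then x v else 0)))"
    by (rule sum_nonneg) (rule nonneg)
  then have "0 \<le> of_nat k * (of_nat k * t - l - t) * sqn G x"
    using coloring_quadratic_sum[OF G col ev, of t] by simp
  moreover have "0 < sqn G x" using sqn_pos[where x = x, OF pair_graph_finite[OF G] ne] .
  moreover have "0 < k" using col ne(1) by (auto simp: proper_coloring_def)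
  ultimately show ?thesis by (simp add: zero_le_mult_iff)
qed

text \<open>Equality in the bound makes every test vector a null vector, hence a kernel vector, of
  the form of \<open>A + t I\<close>. Read at \<open>v\<close>, this says that the neighbours of
  \<open>v\<close> in each foreign class have total weight \<open>t * x v\<close>.\<close>

lemma hoffman_equality:
  assumes G: "pair_graph G" and col: "proper_coloring G k c" and v: "v \<in> pverts G" and i: "i < k"
    and ev: "\<And>v. v \<in> pverts G \<Longrightarrow> nbsum G x v = l * x v"
    and psd: "\<And>z. - t * sqn G z \<le> bil (adj G) (pverts G) z z"
    and eq: "l + t = of_nat k * t"
  shows "nbsum G (\<lambda>v. if c v = i then x v else 0) v = t * (if c v = i then 0 else x v)"
proof -
  let ?V = "pverts G"
  note fin = pair_graph_finite[OF G]
  define z where "z i v = x v - of_nat k * (if c v = i then x v else 0)" for i v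
  define b where "b v u = (if v = u then t else 0) - (- adj G v u)" for v u
  have bil: "bil b ?V y y = t * sqn G y + bil (adj G) ?V y y" for y
    unfolding b_def bil_diff bil_delta[OF fin] by (simp add: power2_eq_square sqn_def bil_def sum_negf)
  have psd': "0 \<le> bil b ?V y y" for y using psd[of y] by (simp add: bil)
  have "(\<Sum>i<k. bil b ?V (z i) (z i)) = of_nat k * (of_nat k * t - l - t) * sqn G x"
    using coloring_quadratic_sum[OF G col ev, of t] unfolding bil z_def by (simp add: add.commute)
  also have "\<dots> = 0" using eq by simp
  finally have null: "bil b ?V (z i) (z i) = 0"
    using i psd' by (subst (asm) sum_nonneg_eq_0_iff) auto
  have b_sum: "(\<Sum>u\<in>?V. b v u * y u) = t * y v + nbsum G y v" for y
  proof -
    have "(\<Sum>u\<in>?V. b v u * y u) = (\<Sum>u\<in>?V. (if v = u then t * y u else 0)) + nbsum G y v"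
      by (simp add: b_def nbsum_def distrib_right sum.distrib if_distrib[of "\<lambda>t. t * _"] cong: if_cong)
    then show ?thesis using fin v by simp
  qed
  have "(\<Sum>u\<in>?V. b v u * z i u) = 0"
    by (rule psd_null_vector[OF fin _ psd' null v]) (auto simp: b_def adj_sym[OF G])
  then have "t * z i v + nbsum G (z i) v = 0" unfolding b_sum .
  moreover have "nbsum G (z i) v = nbsum G x v - of_nat k * nbsum G (\<lambda>v. if c v = i then x v else 0) v"
    by (simp add: nbsum_def z_def right_diff_distrib sum_subtractf sum_distrib_left mult_ac)
  ultimately have "of_nat k * nbsum G (\<lambda>v. if c v = i then x v else 0) v = t * z i v + l * x v"
    using ev[OF v] by simp
  also have "\<dots> = (l + t) * x v - of_nat k * (t * (if c v = i then x v else 0))"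
    by (simp add: z_def algebra_simps)
  also have "\<dots> = of_nat k * (t * (if c v = i then 0 else x v))"
    by (simp add: eq algebra_simps)
  finally show ?thesis using i by simp
qed

section \<open>Hoffman colorings of graphs represented by roots\<close>

text \<open>Intended reading: \<open>x\<close> is the Perron eigenvector, \<open>l\<close> the
  largest and \<open>- t\<close> the smallest eigenvalue. The condition \<open>one\<close>
  prescribes the inner product with the all-one vector, and \<open>wt\<close> is what equality in
  Hoffman's bound provides.\<close>

locale hoffman_rep =
  fixes G :: "'a pair_pre_digraph" and k :: nat and c :: "'a \<Rightarrow> nat" and x :: "'a \<Rightarrow> real"
    and g :: "'a \<Rightarrow> nat \<Rightarrow> int" and t l :: real
  assumes G: "pair_graph G" and con: "Digraph_Component.connected (with_proj G)"
    and rep: "root_rep G g" and one: "\<And>v. v \<in> pverts G \<Longrightarrow> (\<Sum>j<8. g v j) = 4"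
    and pos: "\<And>v. v \<in> pverts G \<Longrightarrow> 0 < x v"
    and ev: "\<And>v. v \<in> pverts G \<Longrightarrow> nbsum G x v = l * x v"
    and col: "proper_coloring G k c" and sur: "\<And>i. i < k \<Longrightarrow> \<exists>v\<in>pverts G. c v = i"
    and k3: "3 \<le> k" and tpos: "0 < t"
    and wt: "\<And>v i. v \<in> pverts G \<Longrightarrow> i < k \<Longrightarrow>
      nbsum G (\<lambda>u. if c u = i then x u else 0) v = t * (if c v = i then 0 else x v)"
    and psd: "\<And>z. - t * sqn G z \<le> bil (adj G) (pverts G) z z"
    and irr: "irregular G"
begin

definition "cls i = {v \<in> pverts G. c v = i}"
definition "nbr v i = {u \<in> cls i. (v, u) \<in> parcs G}"
definition "nn v i = card (nbr v i)"
definition "S i = (\<Sum>u\<in>cls i. x u)"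
definition "sg A j = (\<Sum>u\<in>A. g u j)"

lemma fin: "finite (pverts G)" by (rule pair_graph_finite[OF G])
lemma fin_cls [simp]: "finite (cls i)" using fin by (simp add: cls_def)
lemma fin_nbr [simp]: "finite (nbr v i)" by (simp add: nbr_def)
lemma clsD: "v \<in> cls i \<Longrightarrow> v \<in> pverts G \<and> c v = i" by (simp add: cls_def)
lemma nn_le: "nn v i \<le> card (cls i)" unfolding nn_def nbr_def by (rule card_mono) auto
lemma cls_ne: "i < k \<Longrightarrow> cls i \<noteq> {}" using sur by (auto simp: cls_def)
lemma c_less: "v \<in> pverts G \<Longrightarrow> c v < k" using col by (auto simp: proper_coloring_def)
lemma c_adj: "(u, v) \<in> parcs G \<Longrightarrow> c u \<noteq> c v" using col by (auto simp: proper_coloring_def)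
lemma S_pos: "i < k \<Longrightarrow> 0 < S i"
  unfolding S_def using cls_ne[of i] pos by (intro sum_pos) (auto dest: clsD)

lemma wt': "v \<in> pverts G \<Longrightarrow> i < k \<Longrightarrow> c v \<noteq> i \<Longrightarrow> (\<Sum>u\<in>nbr v i. x u) = t * x v"
proof -
  assume a: "v \<in> pverts G" "i < k" "c v \<noteq> i"
  have "(\<Sum>u\<in>nbr v i. x u) = (\<Sum>u | u \<in> pverts G \<and> (v, u) \<in> parcs G. if c u = i then x u else 0)"
    using fin by (intro sum.mono_neutral_cong_left) (auto simp: nbr_def cls_def)
  also have "\<dots> = t * x v" using wt[OF a(1,2)] a(3) by (simp add: nbsum_eq[OF fin])
  finally show ?thesis .
qed

lemma psym: "(u, v) \<in> parcs G \<Longrightarrow> (v, u) \<in> parcs G" using pair_graph_sym[OF G] by blast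
lemma nbr_alt: "{u \<in> cls i. (u, v) \<in> parcs G} = nbr v i" by (auto simp: nbr_def intro: psym)

lemma nn_pos: "v \<in> pverts G \<Longrightarrow> i < k \<Longrightarrow> c v \<noteq> i \<Longrightarrow> 1 \<le> nn v i"
proof (rule ccontr)
  assume a: "v \<in> pverts G" "i < k" "c v \<noteq> i" and "\<not> 1 \<le> nn v i"
  then have "nn v i = 0" by linarith
  then have "nbr v i = {}" by (simp add: nn_def)
  then show False using wt'[OF a] pos[OF a(1)] tpos by simp
qed

lemma nbr_full: "nn v i = card (cls i) \<Longrightarrow> nbr v i = cls i"
  unfolding nn_def by (rule card_subset_eq) (auto simp: nbr_def)

text \<open>Sums \<open>x v\<close> over the edges from \<open>u\<close> in class \<open>i\<close>
  to \<open>v\<close> in class \<open>j\<close>, once grouped by \<open>u\<close> and once by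
  \<open>v\<close>.\<close>

lemma double_count:
  assumes "i < k" "j < k" "i \<noteq> j"
  shows "(\<Sum>v\<in>cls j. real (nn v i) * x v) = t * S i"
proof -
  have "t * S i = (\<Sum>u\<in>cls i. \<Sum>v\<in>{v \<in> cls j. (u, v) \<in> parcs G}. x v)"
    unfolding S_def sum_distrib_left using wt'[of _ j] assms
    by (intro sum.cong refl) (auto simp: nbr_def dest: clsD)
  also have "\<dots> = (\<Sum>v\<in>cls j. \<Sum>u\<in>{u \<in> cls i. (u, v) \<in> parcs G}. x v)"
    by (rule sum.swap_restrict) auto
  also have "\<dots> = (\<Sum>v\<in>cls j. real (nn v i) * x v)"
    unfolding nbr_alt by (simp add: nn_def)
  finally show ?thesis by simp
qed

lemma edge_count: "(\<Sum>v\<in>cls j. nn v i) = (\<Sum>u\<in>cls i. nn u j)"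
proof -
  have "(\<Sum>v\<in>cls j. nn v i) = (\<Sum>v\<in>cls j. \<Sum>u\<in>{u \<in> cls i. (v, u) \<in> parcs G}. 1)"
    by (simp add: nn_def nbr_def)
  also have "\<dots> = (\<Sum>u\<in>cls i. \<Sum>v\<in>{v \<in> cls j. (v, u) \<in> parcs G}. 1)"
    by (rule sum.swap_restrict) auto
  also have "\<dots> = (\<Sum>u\<in>cls i. nn u j)"
  proof (rule sum.cong[OF refl])
    fix u
    show "(\<Sum>v\<in>{v \<in> cls j. (v, u) \<in> parcs G}. 1) = nn u j" unfolding nbr_alt by (simp add: nn_def)
  qed
  finally show ?thesis .
qed

lemma degree: "card {u. (u, v) \<in> parcs G} = (\<Sum>i<k. nn v i)"
proof -
  have "{u. (u, v) \<in> parcs G} = (\<Union>i<k. nbr v i)"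
    using pair_graph_wf[OF G] c_less by (auto simp: nbr_def cls_def intro: psym)
  moreover have "card (\<Union>i<k. nbr v i) = (\<Sum>i<k. nn v i)"
    unfolding nn_def by (rule card_UN_disjoint) (auto simp: nbr_def cls_def fin)
  ultimately show ?thesis by simp
qed

text \<open>A constant eigenvector makes every degree equal to \<open>l\<close>.\<close>

lemma not_const: "\<not> (\<forall>v\<in>pverts G. x v = a)"
proof
  assume a: "\<forall>v\<in>pverts G. x v = a"
  obtain v0 where v0: "v0 \<in> pverts G" using sur k3 by force
  have apos: "a > 0" using pos[OF v0] a v0 by simp
  have "real (card {u. (u, v) \<in> parcs G}) = l" if v: "v \<in> pverts G" for v
  proof -
    have eq: "{u. (u, v) \<in> parcs G} = {u \<in> pverts G. (v, u) \<in> parcs G}"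
      using pair_graph_wf[OF G] by (auto intro: psym)
    have "nbsum G x v = (\<Sum>u | u \<in> pverts G \<and> (v, u) \<in> parcs G. a)"
      unfolding nbsum_eq[OF fin] using a by (intro sum.cong) auto
    then have "real (card {u. (u, v) \<in> parcs G}) * a = l * a" using ev[OF v] a v eq by auto
    then show ?thesis using apos by simp
  qed
  then have "\<forall>v\<in>pverts G. card {u. (u, v) \<in> parcs G} = nat \<lfloor>l\<rfloor>" by (metis floor_of_nat nat_int)
  then show False using irr unfolding irregular_def by blast
qed

lemma not_two_regular: "\<not> (\<forall>v\<in>pverts G. \<forall>i<k. i \<noteq> c v \<longrightarrow> nn v i = m)"
proof
  assume a: "\<forall>v\<in>pverts G. \<forall>i<k. i \<noteq> c v \<longrightarrow> nn v i = m"
  have "card {u. (u, v) \<in> parcs G} = m * (k - 1)" if v: "v \<in> pverts G" for v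
  proof -
    have "nbr v (c v) = {}" using c_adj by (force simp: nbr_def cls_def)
    then have "nn v (c v) = 0" by (simp add: nn_def)
    then have "(\<Sum>i<k. nn v i) = (\<Sum>i\<in>{..<k} - {c v}. nn v i)"
      using c_less[OF v] by (simp add: sum.remove[of "{..<k}" "c v"])
    also have "\<dots> = (\<Sum>i\<in>{..<k} - {c v}. m)" using a v by (intro sum.cong) auto
    finally show ?thesis using c_less[OF v] by (simp add: degree mult.commute)
  qed
  then show False using irr unfolding irregular_def by blast
qed

lemma ip_g: "u \<in> pverts G \<Longrightarrow> v \<in> pverts G \<Longrightarrow>
   ip (g u) (g v) = (if u = v then 8 else if (u, v) \<in> parcs G then 4 else 0)"
  using rep unfolding root_rep_def by blast

lemma ip_sg: "ip (sg A) q = (\<Sum>u\<in>A. ip (g u) q)"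
  unfolding ip_def sg_def sum_distrib_right by (rule sum.swap)

lemma ip_sg_cls: "v \<in> pverts G \<Longrightarrow> c v \<noteq> i \<Longrightarrow> ip (sg (cls i)) (g v) = 4 * int (nn v i)"
proof -
  assume v: "v \<in> pverts G" "c v \<noteq> i"
  have "ip (sg (cls i)) (g v) = (\<Sum>u\<in>cls i. if (v, u) \<in> parcs G then 4 else 0)"
    unfolding ip_sg
  proof (rule sum.cong[OF refl])
    fix u assume "u \<in> cls i"
    then show "ip (g u) (g v) = (if (v, u) \<in> parcs G then 4 else 0)"
      using ip_g[of u v] pair_graph_sym[OF G, of u v] v by (auto dest: clsD)
  qed
  also have "\<dots> = 4 * int (nn v i)" by (simp add: nn_def nbr_def sum.inter_filter[symmetric])
  finally show ?thesis .
qed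

lemma sg_norm: "ip (sg (cls i)) (sg (cls i)) = 8 * int (card (cls i))"
proof -
  have "ip (sg (cls i)) (g v) = 8" if v: "v \<in> cls i" for v
  proof -
    have "ip (sg (cls i)) (g v) = (\<Sum>u\<in>cls i. if u = v then 8 else 0)"
      unfolding ip_sg using v ip_g c_adj by (intro sum.cong) (auto dest!: clsD)
    then show ?thesis using v by simp
  qed
  then have "(\<Sum>u\<in>cls i. ip (g u) (sg (cls i))) = (\<Sum>u\<in>cls i. 8)"
    by (intro sum.cong) (auto simp: ip_commute[of "g _" "sg _"])
  then have "ip (sg (cls i)) (sg (cls i)) = (\<Sum>u\<in>cls i. 8)"
    using ip_sg[of "cls i" "sg (cls i)"] by simp
  then show ?thesis by simp
qed

lemma sg_one: "(\<Sum>j<8. sg (cls i) j) = 4 * int (card (cls i))"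
proof -
  have "(\<Sum>j<8. sg (cls i) j) = (\<Sum>u\<in>cls i. \<Sum>j<8. g u j)" unfolding sg_def by (rule sum.swap)
  also have "\<dots> = (\<Sum>u\<in>cls i. 4)" using one by (intro sum.cong) (auto dest: clsD)
  finally show ?thesis by simp
qed

text \<open>Squared distance of the class sum from the constant vector 2. It is nonnegative, so a
  class has at most four vertices; for four vertices it is zero, so the class sum is constantly 2,
  and then every outside vertex has two neighbours in the class.\<close>

lemma sg_two: "(\<Sum>j<8. (2 - sg (cls i) j)^2) = 32 - 8 * int (card (cls i))"
proof -
  have "(\<Sum>j<8. (2 - sg (cls i) j)^2) = (\<Sum>j<8::nat. 4) - 4 * (\<Sum>j<8. sg (cls i) j) + ip (sg (cls i)) (sg (cls i))"
    unfolding ip_def sum_distrib_left sum_subtractf[symmetric] sum.distrib[symmetric]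
    by (intro sum.cong refl) (simp add: power2_eq_square algebra_simps)
  then show ?thesis by (simp add: sg_norm sg_one)
qed

lemma card_cls_le: "card (cls i) \<le> 4"
proof -
  have "0 \<le> (\<Sum>j<8. (2 - sg (cls i) j)^2)" by (simp add: sum_nonneg)
  then show ?thesis unfolding sg_two by linarith
qed

lemma nn_four:
  assumes "card (cls i) = 4" "v \<in> pverts G" "c v \<noteq> i"
  shows "nn v i = 2"
proof -
  have "(\<Sum>j<8. (2 - sg (cls i) j)^2) = 0" using sg_two assms(1) by simp
  then have "sg (cls i) j = 2" if "j < 8" for j
    using that by (subst (asm) sum_nonneg_eq_0_iff) auto
  then have "ip (sg (cls i)) (g v) = (\<Sum>j<8. 2 * g v j)" by (simp add: ip_def)
  then have "ip (sg (cls i)) (g v) = 8" using one[OF assms(2)] by (simp add: sum_distrib_left[symmetric])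
  then show ?thesis using ip_sg_cls[OF assms(2,3)] by simp
qed

text \<open>For a common neighbour \<open>u\<close> of a class of three, the vector
  \<open>sg (cls i) - 1 - g u\<close> has norm zero, so \<open>g u\<close> is determined by the
  class.\<close>

lemma nn_three_unique:
  assumes i: "card (cls i) = 3" and v: "v \<in> pverts G" "c v \<noteq> i" "nn v i = 3"
    and w: "w \<in> pverts G" "c w \<noteq> i" "nn w i = 3"
  shows "v = w"
proof -
  have key: "g u j = sg (cls i) j - 1" if u: "u \<in> pverts G" "c u \<noteq> i" "nn u i = 3" and j: "j < 8" for u j
  proof -
    have "(\<Sum>j<8. (sg (cls i) j - 1 - g u j)^2) = ip (sg (cls i)) (sg (cls i)) + (\<Sum>j<8::nat. 1) + ip (g u) (g u)
       - 2 * (\<Sum>j<8. sg (cls i) j) - 2 * ip (sg (cls i)) (g u) + 2 * (\<Sum>j<8. g u j)"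
      unfolding ip_def sum_distrib_left sum_subtractf[symmetric] sum.distrib[symmetric]
      by (intro sum.cong refl) (simp add: power2_eq_square algebra_simps)
    also have "\<dots> = 0"
      using ip_sg_cls[OF u(1,2)] u(3) i one[OF u(1)] ip_g[OF u(1,1)] by (simp add: sg_norm sg_one)
    finally have "(sg (cls i) j - 1 - g u j)^2 = 0" using j by (subst (asm) sum_nonneg_eq_0_iff) auto
    then show ?thesis by simp
  qed
  have "ip (g v) (g w) = ip (g v) (g v)" unfolding ip_def by (intro sum.cong) (auto simp: key[OF v] key[OF w])
  then show ?thesis using ip_g[OF v(1) w(1)] ip_g[OF v(1,1)] by (auto split: if_splits)
qed

subsection \<open>Smallest eigenvalue $-2$\<close>

context
  assumes t2: "t = 2"
begin

text \<open>Every vector has coordinate sum 4, so adding up the coordinates of the coinciding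
  weighted vector sums leaves the class weights.\<close>

lemma S_eq: "i < k \<Longrightarrow> j < k \<Longrightarrow> S i = S j"
proof -
  assume ij: "i < k" "j < k"
  define z where "z v = (if c v = i then x v else 0) - (if c v = j then x v else 0)" for v
  have nz: "nbsum G z v = - 2 * z v" if v: "v \<in> pverts G" for v
  proof -
    have "nbsum G z v = nbsum G (\<lambda>u. if c u = i then x u else 0) v - nbsum G (\<lambda>u. if c u = j then x u else 0) v"
      by (simp add: nbsum_def z_def right_diff_distrib sum_subtractf)
    then show ?thesis using wt[OF v ij(1)] wt[OF v ij(2)] by (auto simp: z_def t2)
  qed
  have "bil (adj G) (pverts G) z z + 2 * sqn G z = 0"
    using bil_eigenfunction[OF nz] by simp
  then have "(\<Sum>j<8. (\<Sum>u\<in>pverts G. z u * of_int (g u j))^2) = 0"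
    using root_rep_norm[OF rep G, of z] by simp
  then have "(\<Sum>u\<in>pverts G. z u * of_int (g u j)) = 0" if "j < 8" for j
    using that by (subst (asm) sum_nonneg_eq_0_iff) auto
  then have "0 = (\<Sum>j<8. \<Sum>u\<in>pverts G. z u * of_int (g u j))" by simp
  also have "\<dots> = (\<Sum>u\<in>pverts G. \<Sum>j<8. z u * of_int (g u j))" by (rule sum.swap)
  also have "\<dots> = (\<Sum>u\<in>pverts G. z u * of_int (\<Sum>j<8. g u j))" by (simp add: sum_distrib_left)
  also have "\<dots> = (\<Sum>u\<in>pverts G. 4 * z u)" using one by (intro sum.cong) auto
  also have "\<dots> = 4 * ((\<Sum>u\<in>pverts G. if c u = i then x u else 0) - (\<Sum>u\<in>pverts G. if c u = j then x u else 0))"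
    by (simp add: z_def sum_distrib_left[symmetric] sum_subtractf)
  finally show ?thesis unfolding S_def cls_def using fin by (simp add: sum.inter_filter)
qed

lemma excess_zero:
  assumes "i < k" "j < k" "i \<noteq> j"
  shows "(\<Sum>v\<in>cls j. (real (nn v i) - 2) * x v) = 0"
proof -
  have "(\<Sum>v\<in>cls j. (real (nn v i) - 2) * x v) = t * S i - 2 * S j"
    using double_count[OF assms] by (simp add: left_diff_distrib sum_subtractf S_def sum_distrib_left)
  then show ?thesis using S_eq[OF assms(1,2)] t2 by simp
qed

text \<open>Deviations from 2 of a single sign whose positively weighted sum vanishes are all
  zero.\<close>

lemma nn_le_two:
  assumes ij: "i < k" "j < k" "i \<noteq> j" and le: "\<And>v. v \<in> cls j \<Longrightarrow> nn v i \<le> 2" and v: "v \<in> cls j"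
  shows "nn v i = 2"
proof -
  have "(\<Sum>v\<in>cls j. (2 - real (nn v i)) * x v) = 0"
    using excess_zero[OF ij] by (simp add: left_diff_distrib sum_subtractf)
  moreover have "0 \<le> (2 - real (nn w i)) * x w" if "w \<in> cls j" for w
    using le[OF that] pos[of w] clsD[OF that] by simp
  ultimately have "(2 - real (nn v i)) * x v = 0"
    using v by (subst (asm) sum_nonneg_eq_0_iff) auto
  then show ?thesis using pos[of v] v by (auto dest: clsD)
qed

lemma other_class: "i < k \<Longrightarrow> \<exists>j<k. j \<noteq> i"
  using k3 by (intro exI[of _ "if i = 0 then 1 else 0"]) auto

lemma third_class: "\<exists>m<k. m \<noteq> i \<and> m \<noteq> j"
proof -
  have "\<exists>m<3. m \<noteq> i \<and> m \<noteq> j" by presburger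
  then show ?thesis using k3 by (meson less_le_trans)
qed

text \<open>A class of at most two vertices would give every outside vertex exactly two neighbours
  in it, and hence the weight \<open>S i / 2\<close>. Equal class weights then make all classes
  pairs that are completely joined to each other, and the graph regular.\<close>

lemma card_cls_ge: "i < k \<Longrightarrow> 3 \<le> card (cls i)"
proof (rule ccontr)
  assume i: "i < k" and "\<not> 3 \<le> card (cls i)"
  then have le: "card (cls i) \<le> 2" by simp
  have two: "nn v i = 2" if "v \<in> pverts G" "c v \<noteq> i" for v
    by (rule nn_le_two[OF i c_less[OF that(1)]])
       (use that nn_le[of _ i] le in \<open>auto simp: cls_def intro: order_trans\<close>)
  have card_i: "card (cls i) = 2"
  proof -
    obtain j where j: "j < k" "j \<noteq> i" using other_class[OF i] by blast
    obtain v where "v \<in> cls j" using cls_ne[OF j(1)] by blast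
    then have "nn v i = 2" using two j by (auto dest: clsD)
    then show ?thesis using nn_le[of v i] le by simp
  qed
  have half: "x v = S i / 2" if v: "v \<in> pverts G" "c v \<noteq> i" for v
  proof -
    have "nbr v i = cls i" using nbr_full two[OF v] card_i by simp
    then show ?thesis using wt'[OF v(1) i v(2)] t2 by (simp add: S_def)
  qed
  have card_j: "card (cls j) = 2" if j: "j < k" for j
  proof (cases "j = i")
    case False
    have "S j = (\<Sum>u\<in>cls j. S i / 2)"
      unfolding S_def[of j] using half False by (intro sum.cong) (auto dest: clsD)
    then have "real (card (cls j)) * S i = 2 * S i" using S_eq[OF i j] by simp
    then show ?thesis using S_pos[OF i] by simp
  qed (use card_i in simp)
  have "nn v j = 2" if "v \<in> pverts G" "j < k" "j \<noteq> c v" for v j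
    by (rule nn_le_two[OF that(2) c_less[OF that(1)] that(3)])
       (use that nn_le[of _ j] card_j in \<open>auto simp: cls_def intro: order_trans\<close>)
  then show False using not_two_regular[of 2] by blast
qed

lemma card_cls: "i < k \<Longrightarrow> card (cls i) = 3 \<or> card (cls i) = 4"
  using card_cls_ge[of i] card_cls_le[of i] by linarith

lemma three_cases:
  assumes ij: "i < k" "j < k" "i \<noteq> j" and i3: "card (cls i) = 3"
  shows "(\<forall>v\<in>cls j. nn v i = 2) \<or>
    (\<exists>u\<in>cls j. nn u i = 3 \<and> x u = S i / 2 \<and> (\<forall>v\<in>cls j - {u}. nn v i = 1))"
proof (cases "\<exists>u\<in>cls j. nn u i = 3")
  case True
  then obtain u where u: "u \<in> cls j" "nn u i = 3" by blast
  have u': "u \<in> pverts G" "c u \<noteq> i" using u(1) ij by (auto dest: clsD)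
  have "nbr u i = cls i" using nbr_full u(2) i3 by simp
  then have xu: "x u = S i / 2" using wt'[OF u'(1) ij(1) u'(2)] t2 by (simp add: S_def)
  have "S j = x u + (\<Sum>v\<in>cls j - {u}. x v)" unfolding S_def using u(1) by (simp add: sum.remove)
  then have others: "(\<Sum>v\<in>cls j - {u}. x v) = x u" using xu S_eq[OF ij(1,2)] by simp
  have "(\<Sum>v\<in>cls j. (real (nn v i) - 2) * x v) = x u + (\<Sum>v\<in>cls j - {u}. (real (nn v i) - 2) * x v)"
    using u by (simp add: sum.remove)
  also have "\<dots> = (\<Sum>v\<in>cls j - {u}. (real (nn v i) - 1) * x v)"
    unfolding others[symmetric] sum.distrib[symmetric] by (intro sum.cong) (auto simp: algebra_simps)
  finally have z: "(\<Sum>v\<in>cls j - {u}. (real (nn v i) - 1) * x v) = 0" using excess_zero[OF ij] by simp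
  have "nn v i = 1" if v: "v \<in> cls j - {u}" for v
  proof -
    have ge: "1 \<le> nn w i" "0 < x w" if "w \<in> cls j" for w
      using nn_pos[of w i] ij pos that by (auto dest: clsD)
    have "(real (nn v i) - 1) * x v = 0"
      using z v ge by (subst (asm) sum_nonneg_eq_0_iff) (auto simp: less_imp_le intro!: mult_nonneg_nonneg)
    then show ?thesis using ge(2)[of v] v by auto
  qed
  then show ?thesis using u xu by blast
next
  case False
  have "nn v i \<le> 2" if v: "v \<in> cls j" for v
    using nn_le[of v i] i3 False v by (metis One_nat_def Suc_1 le_SucE numeral_3_eq_3)
  then show ?thesis using nn_le_two[OF ij] by blast
qed

text \<open>The even alternative of \<open>three_cases\<close> would count 8 edges from the side of
  \<open>j\<close> and 6 from the side of \<open>i\<close>.\<close>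

lemma three_four:
  assumes ij: "i < k" "j < k" "i \<noteq> j" and i3: "card (cls i) = 3" and j4: "card (cls j) = 4"
  shows "\<exists>u\<in>cls j. nn u i = 3 \<and> x u = S i / 2 \<and> (\<forall>v\<in>cls j - {u}. nn v i = 1)"
proof -
  have "\<not> (\<forall>v\<in>cls j. nn v i = 2)"
  proof
    assume "\<forall>v\<in>cls j. nn v i = 2"
    then have "(\<Sum>v\<in>cls j. nn v i) = 8" using j4 by simp
    moreover have "(\<Sum>u\<in>cls i. nn u j) = 6"
      using nn_four[OF j4] ij i3 by (subst sum.cong[OF refl, of _ _ "\<lambda>_. 2"]) (auto dest: clsD)
    ultimately show False using edge_count[of i j] by simp
  qed
  then show ?thesis using three_cases[OF ij i3] by blast
qed

text \<open>If all classes had three vertices, irregularity would give two unevenly joined classes,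
  each with a vertex of half the class weight. A third class turns out to be joined evenly to the
  first; it contains exactly one non-neighbour \<open>w\<close> of such a vertex \<open>r\<close>,
  and weight regularity at \<open>r\<close> and at \<open>w\<close> is contradictory.\<close>

lemma ex_four: "\<exists>q<k. card (cls q) = 4"
proof (rule ccontr)
  assume no: "\<not> ?thesis"
  then have c3: "card (cls i) = 3" if "i < k" for i using card_cls that by blast
  have "nn v i = 2" if v: "v \<in> pverts G" and i: "i < k" "i \<noteq> c v" for v i
  proof (rule ccontr)
    define j where "j = c v"
    have ij: "i < k" "j < k" "i \<noteq> j" using i c_less[OF v] by (auto simp: j_def)
    have vj: "v \<in> cls j" using v by (simp add: cls_def j_def)
    assume "nn v i \<noteq> 2"
    then obtain u where u: "u \<in> cls j" "nn u i = 3" "x u = S i / 2" "\<forall>v\<in>cls j - {u}. nn v i = 1"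
      using three_cases[OF ij c3[OF ij(1)]] vj by blast
    have "(\<Sum>v\<in>cls j. nn v i) = 3 + (\<Sum>v\<in>cls j - {u}. nn v i)" using u(1,2) by (simp add: sum.remove)
    also have "(\<Sum>v\<in>cls j - {u}. nn v i) = (\<Sum>v\<in>cls j - {u}. 1)" using u(4) by (intro sum.cong) auto
    also have "\<dots> = 2" using u(1) c3[OF ij(2)] by simp
    \<comment> \<open>An even joining would need six edges, so \<open>i\<close> is joined unevenly
      to \<open>j\<close> as well.\<close>
    finally have "(\<Sum>r\<in>cls i. nn r j) = 5" using edge_count[of i j] by simp
    moreover have "(\<Sum>r\<in>cls i. nn r j) = 6" if "\<forall>r\<in>cls i. nn r j = 2"
      using c3[OF ij(1)] that by simp
    ultimately have "\<not> (\<forall>r\<in>cls i. nn r j = 2)" by fastforce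
    then obtain r where r: "r \<in> cls i" "x r = S j / 2"
      using three_cases[OF ij(2,1) ij(3)[symmetric] c3[OF ij(2)]] by blast
    obtain m where m: "m < k" "m \<noteq> i" "m \<noteq> j" using third_class by blast
    \<comment> \<open>The only vertex that can be adjacent to all of class \<open>i\<close> is
      \<open>u\<close>, which lies in \<open>j\<close> and not in \<open>m\<close>.\<close>
    have nm: "nn w i = 2" if w: "w \<in> cls m" for w
    proof (rule ccontr)
      assume "nn w i \<noteq> 2"
      then obtain u' where u': "u' \<in> cls m" "nn u' i = 3"
        using three_cases[OF ij(1) m(1) m(2)[symmetric] c3[OF ij(1)]] w by blast
      have "u = u'" using u u' m ij by (intro nn_three_unique[OF c3[OF ij(1)]]) (auto dest: clsD)
      then show False using u(1) u'(1) m by (auto dest: clsD)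
    qed
    then have "(\<Sum>r\<in>cls i. nn r m) = 6" using edge_count[of m i] c3[OF m(1)] by simp
    moreover have "(\<Sum>r\<in>cls i. nn r m) = 5" if sp: "\<not> (\<forall>r\<in>cls i. nn r m = 2)"
    proof -
      obtain s where s: "s \<in> cls i" "nn s m = 3" "\<forall>v\<in>cls i - {s}. nn v m = 1"
        using three_cases[OF m(1) ij(1) m(2) c3[OF m(1)]] sp by blast
      have "(\<Sum>v\<in>cls i. nn v m) = 3 + (\<Sum>v\<in>cls i - {s}. nn v m)" using s(1,2) by (simp add: sum.remove)
      also have "(\<Sum>v\<in>cls i - {s}. nn v m) = (\<Sum>v\<in>cls i - {s}. 1)" using s(3) by (intro sum.cong) auto
      also have "\<dots> = 2" using s(1) c3[OF ij(1)] by simp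
      finally show ?thesis by simp
    qed
    ultimately have "\<forall>r\<in>cls i. nn r m = 2" by fastforce
    then have "nn r m = 2" using r(1) by blast
    then have "card (cls m - nbr r m) = 1"
      using c3[OF m(1)] by (subst card_Diff_subset) (auto simp: nn_def nbr_def)
    then obtain w where w: "cls m - nbr r m = {w}" by (auto simp: card_1_singleton_iff)
    then have wm: "w \<in> cls m" "w \<notin> nbr r m" by auto
    have nbr_eq: "nbr r m = cls m - {w}" using w by (auto simp: nbr_def)
    have rG: "r \<in> pverts G" "c r = i" and wG: "w \<in> pverts G" "c w = m" using r(1) wm(1) by (auto dest: clsD)
    \<comment> \<open>As \<open>x r\<close> is half of the common class weight, this equation gives
      \<open>x w = 0\<close>, while the next one makes \<open>x w\<close> a quarter of that
      weight.\<close>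
    have "2 * x r = S m - x w"
      using wt'[OF rG(1) m(1)] rG(2) m t2 wm(1) unfolding nbr_eq by (simp add: sum_diff1 S_def)
    moreover have "nbr w i = cls i - {r}"
    proof -
      have "r \<notin> nbr w i" using wm r(1) by (auto simp: nbr_def dest: psym)
      then have "nbr w i \<subseteq> cls i - {r}" by (auto simp: nbr_def)
      moreover have "card (nbr w i) = card (cls i - {r})"
        using nm[OF wm(1)] r(1) c3[OF ij(1)] by (simp add: nn_def)
      ultimately show ?thesis by (intro card_subset_eq) auto
    qed
    then have "2 * x w = S i - x r"
      using wt'[OF wG(1) ij(1)] wG(2) m t2 r(1) by (simp add: sum_diff1 S_def)
    ultimately show False using r(2) S_eq[OF ij(1,2)] S_eq[OF ij(1) m(1)] S_pos[OF ij(1)] by simp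
  qed
  then show False using not_two_regular[of 2] by blast
qed

text \<open>By \<open>nn_three_unique\<close> a triple has at most one common neighbour. Each class
  of four contains a common neighbour of each triple, so there cannot be two classes of four, and a
  vertex in another triple cannot be such a neighbour either.\<close>

lemma quad_trio_structure:
  "\<exists>q u0. q < k \<and> u0 \<in> cls q \<and> card (cls q) = 4 \<and>
    (\<forall>i<k. i \<noteq> q \<longrightarrow> card (cls i) = 3 \<and> nn u0 i = 3 \<and> (\<forall>v\<in>cls q - {u0}. nn v i = 1) \<and>
       (\<forall>r\<in>cls i. nn r q = 2) \<and> (\<forall>j<k. j \<noteq> q \<longrightarrow> j \<noteq> i \<longrightarrow> (\<forall>r\<in>cls i. nn r j = 2)))"
proof -
  obtain q where q: "q < k" "card (cls q) = 4" using ex_four by blast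
  obtain i0 where i0: "i0 < k" "card (cls i0) = 3"
  proof (rule ccontr)
    assume "\<not> thesis"
    then have "card (cls i) = 4" if "i < k" for i using card_cls that \<open>\<And>i. i < k \<Longrightarrow> card (cls i) = 3 \<Longrightarrow> thesis\<close> by blast
    then show False using nn_four not_two_regular[of 2] by metis
  qed
  have i0q: "i0 \<noteq> q" using q i0 by auto
  obtain u0 where u0: "u0 \<in> cls q" "nn u0 i0 = 3" "x u0 = S i0 / 2"
    using three_four[OF i0(1) q(1) i0q i0(2) q(2)] by blast
  have c3: "card (cls i) = 3" if i: "i < k" "i \<noteq> q" for i
  proof (rule ccontr)
    assume "card (cls i) \<noteq> 3"
    then have i4: "card (cls i) = 4" using card_cls i by blast
    then have ne: "i0 \<noteq> i" using i0 by auto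
    obtain u where u: "u \<in> cls i" "nn u i0 = 3" using three_four[OF i0(1) i(1) ne i0(2) i4] by blast
    have "u = u0" using u u0 ne i0q by (intro nn_three_unique[OF i0(2)]) (auto dest: clsD)
    then show False using u(1) u0(1) i by (auto dest: clsD)
  qed
  have sp: "nn u0 i = 3 \<and> (\<forall>v\<in>cls q - {u0}. nn v i = 1)" if i: "i < k" "i \<noteq> q" for i
  proof -
    obtain u where u: "u \<in> cls q" "nn u i = 3" "x u = S i / 2" "\<forall>v\<in>cls q - {u}. nn v i = 1"
      using three_four[OF i(1) q(1) i(2) c3[OF i] q(2)] by blast
    have "u = u0"
    proof (rule ccontr)
      assume ne: "u \<noteq> u0"
      obtain w where w: "w \<in> cls q - {u, u0}"
      proof -
        have "card (cls q - {u, u0}) = 2" using q(2) u(1) u0(1) ne by (simp add: card_Diff_subset)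
        then have "cls q - {u, u0} \<noteq> {}" by (intro notI) simp
        then show ?thesis using that by blast
      qed
      \<comment> \<open>Two vertices of half the class weight leave nothing for a third one, so all
        triples share the same common neighbour.\<close>
      have "x u + x u0 + x w = (\<Sum>v\<in>{u, u0, w}. x v)" using ne w by auto
      also have "\<dots> \<le> S q" unfolding S_def using u(1) u0(1) w pos
        by (intro sum_mono2) (auto simp: less_imp_le dest!: clsD)
      finally show False using u(3) u0(3) S_eq[OF i(1) q(1)] S_eq[OF i0(1) q(1)] pos[of w] w
        by (auto dest: clsD)
    qed
    then show ?thesis using u by blast
  qed
  have "nn r j = 2" if i: "i < k" "i \<noteq> q" and j: "j < k" "j \<noteq> q" "j \<noteq> i" and r: "r \<in> cls i" for i j r
  proof (rule ccontr)
    assume "nn r j \<noteq> 2"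
    then obtain u where u: "u \<in> cls i" "nn u j = 3"
      using three_cases[OF j(1) i(1) j(3) c3[OF j(1,2)]] r by blast
    have "u = u0" using u u0(1) sp[OF j(1,2)] i j by (intro nn_three_unique[OF c3[OF j(1,2)]]) (auto dest: clsD)
    then show False using u(1) u0(1) i by (auto dest: clsD)
  qed
  moreover have "nn r q = 2" if "i \<noteq> q" "r \<in> cls i" for i r
    using nn_four[OF q(2)] that by (auto dest: clsD)
  ultimately show ?thesis using q u0(1) c3 sp by blast
qed

end
end

section \<open>Isomorphisms and induced subgraphs\<close>

text \<open>\<open>digraph_iso\<close> involves maps of vertices, arcs, heads and tails. Since arcs
  are pairs of vertices, all of them can be read off from a vertex bijection.\<close>

lemma isomorphic_iff:
  assumes G: "pair_graph G" and H: "parcs H \<subseteq> pverts H \<times> pverts H"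
  shows "G \<simeq> H \<longleftrightarrow> (\<exists>f. bij_betw f (pverts G) (pverts H) \<and>
    (\<forall>u\<in>pverts G. \<forall>v\<in>pverts G. (u, v) \<in> parcs G \<longleftrightarrow> (f u, f v) \<in> parcs H))"
proof
  assume "G \<simeq> H"
  then obtain hom where hom: "pre_digraph.digraph_isomorphism (with_proj G) hom"
    and H_eq: "with_proj H = app_iso hom (with_proj G)" unfolding digraph_iso_def by blast
  have th: "iso_tail hom = fst" "iso_head hom = snd"
    using H_eq[THEN arg_cong[where f = tail]] H_eq[THEN arg_cong[where f = head]] by simp_all
  have VH: "pverts H = iso_verts hom ` pverts G" and AH: "parcs H = iso_arcs hom ` parcs G"
    using H_eq[THEN arg_cong[where f = verts]] H_eq[THEN arg_cong[where f = arcs]] by simp_all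
  have inj: "inj_on (iso_verts hom) (pverts G)" using hom by (simp add: pre_digraph.digraph_isomorphism_def)
  have arc: "iso_arcs hom a = (iso_verts hom (fst a), iso_verts hom (snd a))" if "a \<in> parcs G" for a
    using hom that by (simp add: pre_digraph.digraph_isomorphism_def th prod_eq_iff)
  have "(u, v) \<in> parcs G \<longleftrightarrow> (iso_verts hom u, iso_verts hom v) \<in> parcs H"
    if uv: "u \<in> pverts G" "v \<in> pverts G" for u v
  proof
    assume "(u, v) \<in> parcs G"
    then show "(iso_verts hom u, iso_verts hom v) \<in> parcs H"
      unfolding AH using arc[of "(u, v)"] by (metis fst_conv image_eqI snd_conv)
  next
    assume "(iso_verts hom u, iso_verts hom v) \<in> parcs H"
    then obtain a where a: "a \<in> parcs G" "iso_arcs hom a = (iso_verts hom u, iso_verts hom v)"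
      unfolding AH by auto
    have "fst a \<in> pverts G" "snd a \<in> pverts G" using pair_graph_wf[OF G, of "fst a" "snd a"] a(1) by auto
    then have "fst a = u" "snd a = v" using arc[OF a(1)] a(2) inj uv by (auto dest: inj_onD)
    then show "(u, v) \<in> parcs G" using a(1) by (metis prod.collapse)
  qed
  then show "\<exists>f. bij_betw f (pverts G) (pverts H) \<and>
    (\<forall>u\<in>pverts G. \<forall>v\<in>pverts G. (u, v) \<in> parcs G \<longleftrightarrow> (f u, f v) \<in> parcs H)"
    using inj VH by (intro exI[of _ "iso_verts hom"]) (auto simp: bij_betw_def)
next
  assume "\<exists>f. bij_betw f (pverts G) (pverts H) \<and>
    (\<forall>u\<in>pverts G. \<forall>v\<in>pverts G. (u, v) \<in> parcs G \<longleftrightarrow> (f u, f v) \<in> parcs H)"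
  then obtain f where f: "inj_on f (pverts G)" "pverts H = f ` pverts G"
    and arc: "\<And>u v. u\<in>pverts G \<Longrightarrow> v\<in>pverts G \<Longrightarrow> (u, v) \<in> parcs G \<longleftrightarrow> (f u, f v) \<in> parcs H"
    by (auto simp: bij_betw_def)
  define hom where "hom = \<lparr>iso_verts = f, iso_arcs = map_prod f f, iso_head = snd, iso_tail = fst\<rparr>"
  have wf: "fst a \<in> pverts G \<and> snd a \<in> pverts G" if "a \<in> parcs G" for a
    using pair_graph_wf[OF G, of "fst a" "snd a"] that by simp
  have "wf_digraph (with_proj G)"
    by unfold_locales (use wf in auto)
  moreover have "inj_on (map_prod f f) (parcs G)"
  proof (rule inj_onI)
    fix a b assume "a \<in> parcs G" "b \<in> parcs G" "map_prod f f a = map_prod f f b"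
    then show "a = b" using wf[of a] wf[of b] f(1)
      by (cases a; cases b) (auto dest: inj_onD)
  qed
  ultimately have "pre_digraph.digraph_isomorphism (with_proj G) hom"
    using f(1) by (simp add: pre_digraph.digraph_isomorphism_def hom_def)
  moreover have "parcs H = map_prod f f ` parcs G"
  proof
    show "parcs H \<subseteq> map_prod f f ` parcs G"
    proof
      fix b assume b: "b \<in> parcs H"
      then obtain u v where "u \<in> pverts G" "v \<in> pverts G" "b = (f u, f v)" using H f(2) by auto
      then show "b \<in> map_prod f f ` parcs G" using arc b by (intro image_eqI[of _ _ "(u, v)"]) auto
    qed
    show "map_prod f f ` parcs G \<subseteq> parcs H"
    proof
      fix b assume "b \<in> map_prod f f ` parcs G"
      then obtain u v where uv: "(u, v) \<in> parcs G" "b = (f u, f v)" by auto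
      then show "b \<in> parcs H" using arc[of u v] pair_graph_wf[OF G uv(1)] by simp
    qed
  qed
  then have "with_proj H = app_iso hom (with_proj G)"
    using f(2) by (simp add: app_iso_def hom_def with_proj_def)
  ultimately show "G \<simeq> H" unfolding digraph_iso_def by blast
qed

lemma isomorphicI:
  assumes "pair_graph G" "parcs H \<subseteq> pverts H \<times> pverts H" "bij_betw f (pverts G) (pverts H)"
    "\<And>u v. u \<in> pverts G \<Longrightarrow> v \<in> pverts G \<Longrightarrow> (u, v) \<in> parcs G \<longleftrightarrow> (f u, f v) \<in> parcs H"
  shows "G \<simeq> H"
  using assms isomorphic_iff by blast

lemma pair_graph_arcs: "pair_graph G \<Longrightarrow> parcs G \<subseteq> pverts G \<times> pverts G"
  by (auto dest: pair_graph_wf)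

lemma isomorphic_sym:
  assumes "pair_graph G" "pair_graph H" "G \<simeq> H" shows "H \<simeq> G"
proof -
  obtain f where f: "bij_betw f (pverts G) (pverts H)"
    "\<And>u v. u \<in> pverts G \<Longrightarrow> v \<in> pverts G \<Longrightarrow> (u, v) \<in> parcs G \<longleftrightarrow> (f u, f v) \<in> parcs H"
    using assms isomorphic_iff[OF assms(1) pair_graph_arcs[OF assms(2)]] by blast
  let ?h = "the_inv_into (pverts G) f"
  show ?thesis
  proof (rule isomorphicI[OF assms(2) pair_graph_arcs[OF assms(1)]])
    show "bij_betw ?h (pverts H) (pverts G)" using f(1) by (rule bij_betw_the_inv_into)
    fix u v assume uv: "u \<in> pverts H" "v \<in> pverts H"
    then have "?h u \<in> pverts G" "?h v \<in> pverts G" "f (?h u) = u" "f (?h v) = v"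
      using f(1) by (auto simp: bij_betw_def the_inv_into_into f_the_inv_into_f)
    then show "(u, v) \<in> parcs H \<longleftrightarrow> (?h u, ?h v) \<in> parcs G" using f(2)[of "?h u" "?h v"] by simp
  qed
qed

lemma isomorphic_trans:
  assumes G: "pair_graph G" and H: "pair_graph H" and K: "parcs K \<subseteq> pverts K \<times> pverts K"
    and "G \<simeq> H" "H \<simeq> K"
  shows "G \<simeq> K"
proof -
  obtain f where f: "bij_betw f (pverts G) (pverts H)"
    "\<And>u v. u \<in> pverts G \<Longrightarrow> v \<in> pverts G \<Longrightarrow> (u, v) \<in> parcs G \<longleftrightarrow> (f u, f v) \<in> parcs H"
    using assms isomorphic_iff[OF G pair_graph_arcs[OF H]] by blast
  obtain h where h: "bij_betw h (pverts H) (pverts K)"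
    "\<And>u v. u \<in> pverts H \<Longrightarrow> v \<in> pverts H \<Longrightarrow> (u, v) \<in> parcs H \<longleftrightarrow> (h u, h v) \<in> parcs K"
    using assms isomorphic_iff[OF H K] by blast
  show ?thesis
  proof (rule isomorphicI[OF G K bij_betw_trans[OF f(1) h(1)]])
    fix u v assume uv: "u \<in> pverts G" "v \<in> pverts G"
    then have "f u \<in> pverts H" "f v \<in> pverts H" using f(1) by (auto simp: bij_betw_def)
    then show "(u, v) \<in> parcs G \<longleftrightarrow> ((h \<circ> f) u, (h \<circ> f) v) \<in> parcs K" using f(2)[OF uv] h(2) by simp
  qed
qed

text \<open>\<open>induce_subgraph\<close> yields a general digraph; this is the same subgraph as a
  pair digraph, so that \<open>isomorphic_iff\<close> applies to it.\<close>

definition induced :: "'a pair_pre_digraph \<Rightarrow> 'a set \<Rightarrow> 'a pair_pre_digraph" where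
  "induced G S = \<lparr> pverts = S, parcs = {(u, v) \<in> parcs G. u \<in> S \<and> v \<in> S} \<rparr>"

lemma induced_restrict: "with_proj G \<restriction> S = with_proj (induced G S)"
  unfolding induce_subgraph_def with_proj_def induced_def by auto

lemma pair_graph_induced:
  "pair_graph G \<Longrightarrow> S \<subseteq> pverts G \<Longrightarrow> pair_graph (induced G S)"
  by (rule pair_graphI)
     (auto simp: induced_def finite_subset[OF _ pair_graph_finite] pair_graph_irrefl pair_graph_sym)

section \<open>Smallest eigenvalue above -2: classes of two vertices\<close>

text \<open>Intended for a class of two vertices with weights \<open>P\<close> and \<open>Q\<close>,
  and \<open>s = t^2\<close>: of another class, \<open>n1\<close> vertices see only the first,
  \<open>n2\<close> only the second and \<open>n3\<close> both. The two equations are linear in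
  \<open>P\<close> and \<open>Q\<close>, so their determinant vanishes.\<close>

lemma pair_count_product:
  fixes P Q s n1 n2 n3 :: real
  assumes "0 < P" "0 < Q" and p: "s * P = n1 * P + n3 * (P + Q)" and q: "s * Q = n2 * Q + n3 * (P + Q)"
  shows "(s - n1 - n3) * (s - n2 - n3) = n3^2" "(s - n1 - n3) * P = n3 * Q" "(s - n2 - n3) * Q = n3 * P"
proof -
  show 1: "(s - n1 - n3) * P = n3 * Q" and 2: "(s - n2 - n3) * Q = n3 * P"
    using p q by (simp_all add: algebra_simps)
  have "((s - n1 - n3) * P) * ((s - n2 - n3) * Q) = (n3 * Q) * (n3 * P)" unfolding 1 2 ..
  then have "((s - n1 - n3) * (s - n2 - n3)) * (P * Q) = n3^2 * (P * Q)"
    by (simp add: power2_eq_square mult_ac)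
  then show "(s - n1 - n3) * (s - n2 - n3) = n3^2" using assms(1,2) by simp
qed

lemma pair_count_gt:
  fixes P Q s n1 n2 n3 :: real
  assumes "0 < P" "0 < Q" "s * P = n1 * P + n3 * (P + Q)" "0 < n3"
  shows "n1 + n3 < s"
proof -
  have "(s - n1 - n3) * P = n3 * Q" using assms(3) by (simp add: algebra_simps)
  then have "0 < (s - n1 - n3) * P" using assms by simp
  then show ?thesis using assms(1) by (simp add: zero_less_mult_iff)
qed

text \<open>Only one vertex that sees both and one that sees a single vertex survive; there
  \<open>s\<close> is the square of the golden ratio.\<close>

lemma pair_counts_2:
  fixes P Q s :: real and n1 n2 n3 :: nat
  assumes PQ: "0 < P" "0 < Q" and s: "s < 4" "s \<noteq> 1"
    and p: "s * P = n1 * P + n3 * (P + Q)" and q: "s * Q = n2 * Q + n3 * (P + Q)"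
    and n: "n1 + n2 + n3 = 2"
  shows "2 < s \<and> s^2 - 3 * s + 1 = 0 \<and> (Q = (s - 2) * P \<or> P = (s - 2) * Q)"
proof -
  note pr = pair_count_product[OF PQ p q]
  consider "n3 = 0" | "n1 = 1" "n2 = 0" "n3 = 1" | "n1 = 0" "n2 = 1" "n3 = 1" | "n1 = 0" "n2 = 0" "n3 = 2"
  proof -
    have "n3 = 0 \<or> n3 = 1 \<or> n3 = 2" "n1 = 0 \<or> n1 = 1 \<or> n1 = 2" using n by linarith+
    then show ?thesis using n that by (elim disjE) simp_all
  qed
  then show ?thesis
  proof cases
    case 1
    then have "s = n1" "s = n2" using p q PQ by auto
    then show ?thesis using n 1 s by simp
  next
    case 2
    then show ?thesis using pr pair_count_gt[OF PQ p] by (simp add: power2_eq_square algebra_simps)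
  next
    case 3
    have "s * Q = n2 * Q + n3 * (Q + P)" using q by (simp add: add.commute)
    then show ?thesis using pr 3 pair_count_gt[OF PQ(2,1), of s n2 n3] by (simp add: power2_eq_square algebra_simps)
  next
    case 4
    then have "2 < s" using pair_count_gt[OF PQ p] by simp
    moreover have "s * (s - 4) = 0" using pr(1) 4 by (simp add: power2_eq_square algebra_simps)
    ultimately show ?thesis using s by simp
  qed
qed

text \<open>The survivors are \<open>s = 3\<close> with equal weights and
  \<open>s = 2 + sqrt 2\<close>. They are excluded in \<open>no_three\<close> and
  \<open>no_silver\<close> with the help of a third class.\<close>

lemma pair_counts_3:
  fixes P Q s :: real and n1 n2 n3 :: nat
  assumes PQ: "0 < P" "0 < Q" and s: "s < 4"
    and p: "s * P = n1 * P + n3 * (P + Q)" and q: "s * Q = n2 * Q + n3 * (P + Q)"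
    and n: "n1 + n2 + n3 = 3"
  shows "(s = 3 \<and> P = Q) \<or> (3 < s \<and> s^2 - 4 * s + 2 = 0 \<and>
    ((0 < n1 \<and> n2 = 0 \<and> Q = (s - 3) * P) \<or> (0 < n2 \<and> n1 = 0 \<and> P = (s - 3) * Q)))"
proof -
  note pr = pair_count_product[OF PQ p q]
  have q': "s * Q = n2 * Q + n3 * (Q + P)" using q by (simp add: add.commute)
  consider "n3 = 0" | "n1 = 1" "n2 = 1" "n3 = 1" | "n1 = 2" "n2 = 0" "n3 = 1" | "n1 = 0" "n2 = 2" "n3 = 1"
    | "n1 = 1" "n2 = 0" "n3 = 2" | "n1 = 0" "n2 = 1" "n3 = 2" | "n1 = 0" "n2 = 0" "n3 = 3"
  proof -
    have "n3 = 0 \<or> n3 = 1 \<or> n3 = 2 \<or> n3 = 3" "n1 = 0 \<or> n1 = 1 \<or> n1 = 2 \<or> n1 = 3" using n by linarith+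
    then show ?thesis using n that by (elim disjE) simp_all
  qed
  then show ?thesis
  proof cases
    case 1
    then have "s = n1" "s = n2" using p q PQ by auto
    then have "n1 = n2" by simp
    then show ?thesis using n 1 by presburger
  next
    case 2
    have "2 < s" using pair_count_gt[OF PQ p] 2 by simp
    moreover have "(s - 3) * (s - 1) = 0" using pr(1) 2 by (simp add: power2_eq_square algebra_simps)
    ultimately show ?thesis using pr(2) 2 by simp
  next
    case 3
    then show ?thesis using pr pair_count_gt[OF PQ p] by (simp add: power2_eq_square algebra_simps)
  next
    case 4
    then show ?thesis using pr pair_count_gt[OF PQ(2,1) q'] by (simp add: power2_eq_square algebra_simps)
  next
    case 5
    have "3 < s" using pair_count_gt[OF PQ p] 5 by simp
    then have "(s - 3) * (s - 2) < 1 * 2" using s by (intro mult_strict_mono) auto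
    then show ?thesis using pr(1) 5 by simp
  next
    case 6
    have "3 < s" using pair_count_gt[OF PQ(2,1) q'] 6 by simp
    then have "(s - 2) * (s - 3) < 2 * 1" using s by (intro mult_strict_mono) auto
    then show ?thesis using pr(1) 6 by simp
  next
    case 7
    have "3 < s" using pair_count_gt[OF PQ p] 7 by simp
    then have "(s - 3) * (s - 3) < 1 * 1" using s by (intro mult_strict_mono) auto
    then show ?thesis using pr(1) 7 by simp
  qed
qed

text \<open>The prescribed ratio \<open>Q / P = s - 2\<close> turns the first equation into
  \<open>s - n1 - n3 = n3 * (s - 2)\<close>, and \<open>s\<close> lies strictly between 5/2 and 3;
  this leaves only \<open>n3 = 1\<close>.\<close>

lemma pair_counts_golden:
  fixes P Q s :: real and n1 n2 n3 :: nat
  assumes PQ: "0 < P" "0 < Q" and s: "2 < s" "s^2 - 3 * s + 1 = 0" and Q: "Q = (s - 2) * P"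
    and p: "s * P = n1 * P + n3 * (P + Q)" and q: "s * Q = n2 * Q + n3 * (P + Q)"
    and n: "n1 + n2 + n3 \<le> 4"
  shows "n1 = 1 \<and> n2 = 0 \<and> n3 = 1"
proof -
  have s3: "5/2 < s" "s < 3"
  proof -
    have e: "s * (3 - s) = 1" using s(2) by (simp add: power2_eq_square algebra_simps)
    show "s < 3"
    proof (rule ccontr)
      assume "\<not> s < 3"
      then have "s * (3 - s) \<le> 0" using s(1) by (intro mult_nonneg_nonpos) auto
      then show False using e by simp
    qed
    show "5/2 < s"
    proof (rule ccontr)
      assume "\<not> 5/2 < s"
      then have "s * (1/2) \<le> s * (3 - s)" using s(1) by (intro mult_left_mono) auto
      then show False using e s(1) by simp
    qed
  qed
  have "(s - n1 - n3) * P = (n3 * (s - 2)) * P" using pair_count_product(2)[OF PQ p q] Q by simp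
  then have e: "s - n1 - n3 = n3 * (s - 2)" using PQ by simp
  have "n3 = 1"
  proof -
    consider "n3 = 0" | "n3 = 1" | "n3 = 2" | "n3 = 3" | "n3 = 4" using n by linarith
    then show ?thesis
    proof cases
      case 1
      then have "s = n1" using e by simp
      then have "2 < n1" "n1 < 3" using s3 by auto
      then show ?thesis by simp
    next
      case 3 then show ?thesis using e s3 by simp
    next
      case 4 then show ?thesis using e s3 by simp
    next
      case 5 then show ?thesis using e s3 by simp
    qed simp
  qed
  then have n1: "n1 = 1" using e by simp
  have "s * Q = n2 * Q + P + Q" using q \<open>n3 = 1\<close> by simp
  then have "(s * (s - 2) - n2 * (s - 2) - 1 - (s - 2)) * P = 0" unfolding Q by (simp add: algebra_simps)
  then have "s * (s - 2) - n2 * (s - 2) - 1 - (s - 2) = 0" using PQ by simp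
  then have "n2 * (s - 2) = s^2 - 3 * s + 1" by (simp add: power2_eq_square algebra_simps)
  then have "n2 = 0" using s by simp
  then show ?thesis using n1 \<open>n3 = 1\<close> by simp
qed

context hoffman_rep
begin

context
  assumes t2: "t < 2" and ngl: "\<not> generalized_line_graph G"
begin

text \<open>With a smallest eigenvalue above -2 the Gram matrix is positive definite, so the vectors
  are linearly independent in dimension 8.\<close>

lemma card_le_8: "card (pverts G) \<le> 8"
proof (rule ccontr)
  assume "\<not> ?thesis"
  then obtain z where z: "\<exists>v\<in>pverts G. z v \<noteq> 0" "\<forall>j<8. (\<Sum>v\<in>pverts G. z v * of_int (g v j)) = (0::real)"
    using nontrivial_dependency[OF fin, of 8 "\<lambda>v j. of_int (g v j)"] by auto
  have "bil (adj G) (pverts G) z z + 2 * sqn G z = 0" using root_rep_norm[OF rep G, of z] z(2) by simp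
  moreover have "0 < sqn G z" using z(1) sqn_pos[OF fin] by blast
  then have "t * sqn G z < 2 * sqn G z" using t2 by simp
  ultimately show False using psd[of z] by simp
qed

lemma card_three_classes:
  assumes "i \<noteq> j" "i \<noteq> m" "j \<noteq> m"
  shows "card (cls i) + card (cls j) + card (cls m) \<le> 8"
proof -
  have "card (cls i \<union> cls j \<union> cls m) = card (cls i) + card (cls j) + card (cls m)"
    using assms by (subst card_Un_disjoint; (subst card_Un_disjoint)?) (auto simp: cls_def fin)
  moreover have "card (cls i \<union> cls j \<union> cls m) \<le> card (pverts G)"
    by (rule card_mono[OF fin]) (auto simp: cls_def)
  ultimately show ?thesis using card_le_8 by simp
qed

text \<open>For \<open>t = 1\<close> no neighbour of a vertex outweighs it, so weights are constant
  along edges and by connectedness everywhere.\<close>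

lemma t_not_one: "t \<noteq> 1"
proof
  assume t1: "t = 1"
  have le: "x u \<le> x v" if uv: "(v, u) \<in> parcs G" for u v
  proof -
    have V: "v \<in> pverts G" "u \<in> pverts G" using pair_graph_wf[OF G uv] by auto
    have "x u \<le> (\<Sum>w\<in>nbr v (c u). x w)"
      using uv V pos by (intro member_le_sum) (auto simp: nbr_def cls_def less_imp_le fin)
    then show ?thesis using wt'[OF V(1) c_less[OF V(2)] c_adj[OF uv]] t1 by simp
  qed
  obtain v0 where v0: "v0 \<in> pverts G" using sur k3 by force
  have "pverts G \<subseteq> {v \<in> pverts G. x v = x v0}"
  proof (rule connected_closed[OF con G, of v0])
    fix u w assume u: "u \<in> {v \<in> pverts G. x v = x v0}" and uw: "(u, w) \<in> parcs G"
    show "w \<in> {v \<in> pverts G. x v = x v0}"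
      using le[OF uw] le[OF psym[OF uw]] u pair_graph_wf[OF G uw] by auto
  qed (use v0 in auto)
  then show False using not_const[of "x v0"] by blast
qed

lemma ex_two_other: "\<exists>j m. j < k \<and> m < k \<and> j \<noteq> i \<and> m \<noteq> i \<and> j \<noteq> m"
proof -
  consider "i = 0" | "i = 1" | "1 < i" by linarith
  then show ?thesis
  proof cases
    case 1 then show ?thesis using k3 by (intro exI[of _ 1] exI[of _ 2]) auto
  next
    case 2 then show ?thesis using k3 by (intro exI[of _ 0] exI[of _ 2]) auto
  next
    case 3 then show ?thesis using k3 by (intro exI[of _ 0] exI[of _ 1]) auto
  qed
qed

text \<open>Next to a class \<open>{p}\<close> every other weight is \<open>x p / t\<close>. Weight
  regularity between two further classes then makes \<open>t\<close> a natural number below 2, that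
  is 1.\<close>

lemma card_cls_ge2: assumes i: "i < k" shows "2 \<le> card (cls i)"
proof (rule ccontr)
  assume "\<not> ?thesis"
  moreover have "card (cls i) \<noteq> 0" using cls_ne[OF i] by simp
  ultimately have "card (cls i) = 1" by linarith
  then obtain p where p: "cls i = {p}" by (auto simp: card_1_singleton_iff)
  have xp: "x p = t * x v" if v: "v \<in> pverts G" "c v \<noteq> i" for v
  proof -
    have "nbr v i \<noteq> {}" using nn_pos[OF v(1) i v(2)] by (auto simp: nn_def)
    then have "nbr v i = {p}" using p by (auto simp: nbr_def)
    then show ?thesis using wt'[OF v(1) i v(2)] by simp
  qed
  obtain j m where jm: "j < k" "m < k" "j \<noteq> i" "m \<noteq> i" "j \<noteq> m" using ex_two_other by blast
  obtain v where v: "v \<in> cls j" using cls_ne[OF jm(1)] by blast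
  have v': "v \<in> pverts G" "c v = j" using v by (auto dest: clsD)
  have eq: "(\<Sum>w\<in>nbr v m. x w) = (\<Sum>w\<in>nbr v m. x v)"
  proof (rule sum.cong[OF refl])
    fix w assume "w \<in> nbr v m"
    then have "x p = t * x w" using xp jm by (auto simp: nbr_def cls_def)
    then show "x w = x v" using xp[of v] v' jm tpos by auto
  qed
  have "(\<Sum>w\<in>nbr v m. x w) = t * x v" by (rule wt'[OF v'(1) jm(2)]) (use v' jm in simp)
  moreover have "(\<Sum>w\<in>nbr v m. x v) = real (nn v m) * x v" by (simp add: nn_def)
  ultimately have "real (nn v m) * x v = t * x v" using eq by linarith
  then have tn: "t = real (nn v m)" using pos[OF v'(1)] by auto
  then have "nn v m = 1" using t2 tpos by simp
  then show False using tn t_not_one by simp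
qed

text \<open>Multiplying weight regularity at \<open>p\<close> by \<open>t\<close> expresses the
  weights of its neighbours by those of \<open>p\<close> and \<open>q\<close>; this produces the
  equations used in \<open>pair_count_product\<close>.\<close>

lemma pair_types:
  assumes i: "i < k" and j: "j < k" "i \<noteq> j" and pq: "cls i = {p, q}" "p \<noteq> q"
  defines "A1 \<equiv> {v \<in> cls j. (v, p) \<in> parcs G \<and> (v, q) \<notin> parcs G}"
    and "A2 \<equiv> {v \<in> cls j. (v, p) \<notin> parcs G \<and> (v, q) \<in> parcs G}"
    and "A3 \<equiv> {v \<in> cls j. (v, p) \<in> parcs G \<and> (v, q) \<in> parcs G}"
  shows "cls j = A1 \<union> A2 \<union> A3" "card A1 + card A2 + card A3 = card (cls j)"
    "\<And>v. v \<in> A1 \<Longrightarrow> t * x v = x p" "\<And>v. v \<in> A2 \<Longrightarrow> t * x v = x q" "\<And>v. v \<in> A3 \<Longrightarrow> t * x v = x p + x q"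
    "t^2 * x p = real (card A1) * x p + real (card A3) * (x p + x q)"
    "t^2 * x q = real (card A2) * x q + real (card A3) * (x p + x q)"
proof -
  have w: "(\<Sum>u\<in>nbr v i. x u) = t * x v" "nbr v i \<noteq> {}" if v: "v \<in> cls j" for v
  proof -
    have v': "v \<in> pverts G" "c v \<noteq> i" using v j(2) by (auto dest: clsD)
    show "(\<Sum>u\<in>nbr v i. x u) = t * x v" by (rule wt'[OF v'(1) i v'(2)])
    show "nbr v i \<noteq> {}" using nn_pos[OF v'(1) i v'(2)] by (auto simp: nn_def)
  qed
  have fins: "finite A1" "finite A2" "finite A3" by (auto simp: A1_def A2_def A3_def)
  show un: "cls j = A1 \<union> A2 \<union> A3"
    using w(2) pq by (fastforce simp: A1_def A2_def A3_def nbr_def)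
  show "card A1 + card A2 + card A3 = card (cls j)"
    unfolding un using fins
    by (subst card_Un_disjoint; (subst card_Un_disjoint)?) (auto simp: A1_def A2_def A3_def)
  show a1: "t * x v = x p" if "v \<in> A1" for v
  proof -
    have "nbr v i = {p}" using that pq by (auto simp: A1_def nbr_def)
    then show ?thesis using w(1)[of v] that by (simp add: A1_def)
  qed
  show a2: "t * x v = x q" if "v \<in> A2" for v
  proof -
    have "nbr v i = {q}" using that pq by (auto simp: A2_def nbr_def)
    then show ?thesis using w(1)[of v] that by (simp add: A2_def)
  qed
  show a3: "t * x v = x p + x q" if "v \<in> A3" for v
  proof -
    have "nbr v i = {p, q}" using that pq by (auto simp: A3_def nbr_def)
    then show ?thesis using w(1)[of v] that pq by (simp add: A3_def)
  qed
  have p: "p \<in> pverts G" "c p = i" and q: "q \<in> pverts G" "c q = i" using pq by (auto simp: cls_def)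
  have nb: "nbr p j = A1 \<union> A3" "nbr q j = A2 \<union> A3" "A1 \<inter> A3 = {}" "A2 \<inter> A3 = {}"
    unfolding nbr_alt[symmetric] by (auto simp: A1_def A2_def A3_def nbr_def cls_def intro: psym)
  have "t^2 * x p = t * (\<Sum>u\<in>nbr p j. x u)" using wt'[OF p(1) j(1)] p(2) j(2) by (simp add: power2_eq_square)
  also have "\<dots> = (\<Sum>u\<in>A1. t * x u) + (\<Sum>u\<in>A3. t * x u)"
    unfolding nb using fins nb by (simp add: sum.union_disjoint sum_distrib_left distrib_left)
  also have "\<dots> = (\<Sum>u\<in>A1. x p) + (\<Sum>u\<in>A3. x p + x q)"
    using a1 a3 by (intro arg_cong2[where f = "(+)"] sum.cong) auto
  finally show "t^2 * x p = real (card A1) * x p + real (card A3) * (x p + x q)" by simp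
  have "t^2 * x q = t * (\<Sum>u\<in>nbr q j. x u)" using wt'[OF q(1) j(1)] q(2) j(2) by (simp add: power2_eq_square)
  also have "\<dots> = (\<Sum>u\<in>A2. t * x u) + (\<Sum>u\<in>A3. t * x u)"
    unfolding nb using fins nb by (simp add: sum.union_disjoint sum_distrib_left distrib_left)
  also have "\<dots> = (\<Sum>u\<in>A2. x q) + (\<Sum>u\<in>A3. x p + x q)"
    using a2 a3 by (intro arg_cong2[where f = "(+)"] sum.cong) auto
  finally show "t^2 * x q = real (card A2) * x q + real (card A3) * (x p + x q)" by simp
qed

lemma s_bounds: "t^2 < 4" "t^2 \<noteq> 1"
proof -
  have "t^2 < 2^2" using t2 tpos by (intro power_strict_mono) auto
  then show "t^2 < 4" by simp
  show "t^2 \<noteq> 1" using tpos t_not_one by (simp add: power2_eq_1_iff)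
qed

text \<open>In units of \<open>x p / t\<close>, the neighbours of \<open>v\<close> in class
  \<open>m\<close> weigh 1 or \<open>t^2 - 2\<close> each and \<open>t\<close> together. So
  \<open>t = a + b * (t^2 - 2)\<close> for natural numbers \<open>a\<close> and \<open>b\<close>,
  which is impossible between \<open>sqrt 3\<close> and 2.\<close>

lemma no_silver:
  assumes i: "i < k" and j: "j < k" "i \<noteq> j" and m: "m < k" "m \<noteq> i" "m \<noteq> j"
    and pq: "cls i = {p, q}" "p \<noteq> q"
    and s: "3 < t^2" and Q: "x q = (t^2 - 3) * x p"
    and A1: "v \<in> cls j" "(v, p) \<in> parcs G" "(v, q) \<notin> parcs G"
    and A2: "\<And>w. w \<in> cls m \<Longrightarrow> \<not> ((w, p) \<notin> parcs G \<and> (w, q) \<in> parcs G)"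
  shows False
proof -
  have P: "0 < x p" using pq pos[of p] by (auto simp: cls_def)
  have v: "v \<in> pverts G" "c v = j" using A1 by (auto dest: clsD)
  have tv: "t * x v = x p" using pair_types(3)[OF i j pq, of v] A1 by simp
  define B where "B = {w \<in> nbr v m. (w, q) \<in> parcs G}"
  define A where "A = {w \<in> nbr v m. (w, q) \<notin> parcs G}"
  have AB: "nbr v m = A \<union> B" "A \<inter> B = {}" "finite A" "finite B" by (auto simp: A_def B_def)
  have im: "i \<noteq> m" using m by simp
  have twA: "t * x w = x p" if "w \<in> A" for w
  proof -
    have wm: "w \<in> cls m" "(w, q) \<notin> parcs G" using that by (auto simp: A_def nbr_def)
    then have "(w, p) \<in> parcs G" using pair_types(1)[OF i m(1) im pq] by blast
    then show ?thesis using pair_types(3)[OF i m(1) im pq, of w] wm by simp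
  qed
  have twB: "t * x w = (t^2 - 2) * x p" if "w \<in> B" for w
  proof -
    have wm: "w \<in> cls m" "(w, q) \<in> parcs G" using that by (auto simp: B_def nbr_def)
    then have "(w, p) \<in> parcs G" using A2 by blast
    then have "t * x w = x p + x q" using pair_types(5)[OF i m(1) im pq, of w] wm by simp
    then show ?thesis by (simp add: Q algebra_simps)
  qed
  have "t * x p = t * (t * x v)" using tv by simp
  also have "t * x v = (\<Sum>w\<in>nbr v m. x w)" using wt'[OF v(1) m(1)] v(2) m(3) by simp
  also have "t * \<dots> = (\<Sum>w\<in>A. t * x w) + (\<Sum>w\<in>B. t * x w)"
    unfolding AB(1) using AB by (simp add: sum.union_disjoint sum_distrib_left distrib_left)
  also have "\<dots> = (\<Sum>w\<in>A. x p) + (\<Sum>w\<in>B. (t^2 - 2) * x p)"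
    using twA twB by (intro arg_cong2[where f = "(+)"] sum.cong) auto
  also have "\<dots> = (real (card A) + real (card B) * (t^2 - 2)) * x p" by (simp add: algebra_simps)
  finally have te: "t = real (card A) + real (card B) * (t^2 - 2)" using P by simp
  consider "card B = 0" | "card B = 1" "card A = 0" | "card B = 1" "1 \<le> card A" | "2 \<le> card B" by linarith
  then show False
  proof cases
    case 1
    then have "t = real (card A)" using te by simp
    then have "3 < (real (card A))^2" "card A < 2" using s t2 by auto
    then have "card A = 0 \<or> card A = 1" by linarith
    then show False using \<open>3 < (real (card A))^2\<close> by auto
  next
    case 2
    then have "t = t^2 - 2" using te by simp
    then have "(t - 2) * (t + 1) = 0" by (simp add: power2_eq_square algebra_simps)
    then show False using t2 tpos by simp
  next
    case 3
    then show False using te s t2 by simp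
  next
    case 4
    define T where "T = t^2"
    have "2 * (T - 2) \<le> real (card B) * (T - 2)" using s 4 by (intro mult_right_mono) (auto simp: T_def)
    moreover have "t = real (card A) + real (card B) * (T - 2)" "3 < T" using te s by (auto simp: T_def)
    moreover have "0 \<le> real (card A)" by simp
    ultimately show False using t2 by argo
  qed
qed

text \<open>In units of \<open>x p / t\<close> all weights outside the class are 1 or 2, so weight
  regularity between two further classes would make \<open>sqrt 3\<close> rational.\<close>

lemma no_three:
  assumes i: "i < k" and j: "j < k" "i \<noteq> j" and m: "m < k" "m \<noteq> i" "m \<noteq> j"
    and pq: "cls i = {p, q}" "p \<noteq> q" "x p = x q" and s: "t^2 = 3"
  shows False
proof -
  have P: "0 < x p" using pq pos[of p] by (auto simp: cls_def)
  have ty: "\<exists>a::nat. (a = (1::nat) \<or> a = 2) \<and> t * x w = real a * x p" if w: "w \<in> cls h" and h: "h < k" "i \<noteq> h" for w h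
  proof -
    note T = pair_types[OF i h pq(1,2)]
    have "t * x w = x p \<or> t * x w = x q \<or> t * x w = x p + x q" using w T(1) T(3,4,5)[of w] by blast
    then have "t * x w = real 1 * x p \<or> t * x w = real 2 * x p" using pq(3) by auto
    then show ?thesis
    proof
      assume "t * x w = real 1 * x p" then show ?thesis by (intro exI[of _ "1 :: nat"]) simp
    next
      assume "t * x w = real 2 * x p" then show ?thesis by (intro exI[of _ "2 :: nat"]) simp
    qed
  qed
  obtain v where v: "v \<in> cls j" using cls_ne[OF j(1)] by blast
  have v': "v \<in> pverts G" "c v = j" using v by (auto dest: clsD)
  obtain a where a: "a = 1 \<or> a = 2" "t * x v = real a * x p"
    using ty[OF v j] by (elim exE conjE) (rule that)
  define b where "b w = (SOME n::nat. t * x w = real n * x p)" for w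
  have b: "t * x w = real (b w) * x p" if w: "w \<in> nbr v m" for w
  proof -
    have wm: "w \<in> cls m" using w by (simp add: nbr_def)
    have "\<exists>n::nat. t * x w = real n * x p"
      using ty[OF wm m(1) m(2)[symmetric]] by blast
    then show ?thesis unfolding b_def by (rule someI_ex)
  qed
  define N where "N = (\<Sum>w\<in>nbr v m. b w)"
  have "(t * a) * x p = t * (t * x v)" using a by simp
  also have "t * x v = (\<Sum>w\<in>nbr v m. x w)" using wt'[OF v'(1) m(1)] v' m by simp
  also have "t * \<dots> = (\<Sum>w\<in>nbr v m. real (b w) * x p)"
    unfolding sum_distrib_left by (intro sum.cong refl) (rule b)
  also have "\<dots> = real N * x p" by (simp add: N_def sum_distrib_right)
  finally have "t * a = N" using P by simp
  then have "(t * real a)^2 = (real N)^2" by simp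
  then have "3 * (real a)^2 = (real N)^2" unfolding power_mult_distrib s .
  then have "real (3 * a^2) = real (N^2)" by simp
  then have "3 * a^2 = N^2" unfolding of_nat_eq_iff .
  then have "N^2 = 3 \<or> N^2 = 12" using a(1) by auto
  moreover have "N \<le> 1 \<or> N = 2 \<or> N = 3 \<or> 4 \<le> N" by linarith
  moreover have "4^2 \<le> N^2" if "4 \<le> N" using that by (rule power_mono) simp
  moreover have "N^2 \<le> 1^2" if "N \<le> 1" using that by (rule power_mono) simp
  ultimately show False by auto
qed

text \<open>Three classes of at least two vertices with at most eight vertices in total include a
  pair and another class of at most three, where the counting lemmas apply. If both other classes
  have three vertices, they are confronted with each other.\<close>

lemma golden_start:
  "\<exists>i p q. i < k \<and> cls i = {p, q} \<and> p \<noteq> q \<and> x q = (t^2 - 2) * x p \<and> 2 < t^2 \<and> t^4 - 3 * t^2 + 1 = 0"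
proof -
  have lt: "0 < k" "1 < k" "2 < k" using k3 by auto
  have c: "2 \<le> card (cls 0)" "2 \<le> card (cls 1)" "2 \<le> card (cls 2)"
    "card (cls 0) + card (cls 1) + card (cls 2) \<le> 8"
    using card_cls_ge2 card_three_classes[of 0 1 2] lt by auto
  obtain i j m where ijm: "i < k" "j < k" "m < k" "i \<noteq> j" "m \<noteq> i" "m \<noteq> j"
    and ci: "card (cls i) = 2" and cj: "card (cls j) \<le> 3"
  proof -
    consider "card (cls 0) = 2" "card (cls 1) \<le> 3" | "card (cls 0) = 2" "card (cls 2) \<le> 3"
      | "card (cls 1) = 2" "card (cls 0) \<le> 3" | "card (cls 1) = 2" "card (cls 2) \<le> 3"
      | "card (cls 2) = 2" "card (cls 0) \<le> 3" | "card (cls 2) = 2" "card (cls 1) \<le> 3"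
      using c by linarith
    then show ?thesis
    proof cases
      case 1 then show ?thesis using lt by (intro that[of 0 1 2]) auto
    next
      case 2 then show ?thesis using lt by (intro that[of 0 2 1]) auto
    next
      case 3 then show ?thesis using lt by (intro that[of 1 0 2]) auto
    next
      case 4 then show ?thesis using lt by (intro that[of 1 2 0]) auto
    next
      case 5 then show ?thesis using lt by (intro that[of 2 0 1]) auto
    next
      case 6 then show ?thesis using lt by (intro that[of 2 1 0]) auto
    qed
  qed
  obtain p q where pq: "cls i = {p, q}" "p \<noteq> q" using ci by (auto simp: card_2_iff)
  have PQ: "0 < x p" "0 < x q" using pq pos[of p] pos[of q] by (auto simp: cls_def)
  have im: "i \<noteq> m" using ijm by simp
  note Tj = pair_types[OF ijm(1,2,4) pq] and Tm = pair_types[OF ijm(1,3) im pq]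
  have cm: "2 \<le> card (cls m)" "card (cls j) + card (cls m) \<le> 6" "2 \<le> card (cls j)"
    using card_cls_ge2 ijm card_three_classes[of i j m] ci by auto
  have two: "\<exists>i p q. i < k \<and> cls i = {p, q} \<and> p \<noteq> q \<and> x q = (t^2 - 2) * x p \<and> 2 < t^2 \<and> t^4 - 3 * t^2 + 1 = 0"
    if T: "2 < t^2 \<and> (t^2)^2 - 3 * t^2 + 1 = 0 \<and> (x q = (t^2 - 2) * x p \<or> x p = (t^2 - 2) * x q)"
  proof -
    have T': "2 < t^2" "t^4 - 3 * t^2 + 1 = 0" using T by (auto simp: power_mult[symmetric])
    have "cls i = {q, p}" "q \<noteq> p" using pq by auto
    then show ?thesis using T T' pq ijm(1) by blast
  qed
  show ?thesis
  proof (cases "card (cls j) = 2")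
    case True
    show ?thesis by (rule two, rule pair_counts_2[OF PQ s_bounds Tj(6,7)]) (use Tj(2) True in simp)
  next
    case False
    then have j3: "card (cls j) = 3" using cj cm by linarith
    show ?thesis
    proof (cases "card (cls m) = 2")
      case True
      show ?thesis by (rule two, rule pair_counts_2[OF PQ s_bounds Tm(6,7)]) (use Tm(2) True in simp)
    next
      case False
      then have m3: "card (cls m) = 3" using cm j3 by linarith
      have Cj: "(t^2 = 3 \<and> x p = x q) \<or> (3 < t^2 \<and> (t^2)^2 - 4 * t^2 + 2 = 0 \<and>
        ((0 < card {v \<in> cls j. (v, p) \<in> parcs G \<and> (v, q) \<notin> parcs G} \<and>
          card {v \<in> cls j. (v, p) \<notin> parcs G \<and> (v, q) \<in> parcs G} = 0 \<and> x q = (t^2 - 3) * x p) \<or>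
         (0 < card {v \<in> cls j. (v, p) \<notin> parcs G \<and> (v, q) \<in> parcs G} \<and>
          card {v \<in> cls j. (v, p) \<in> parcs G \<and> (v, q) \<notin> parcs G} = 0 \<and> x p = (t^2 - 3) * x q)))"
        by (rule pair_counts_3[OF PQ s_bounds(1) Tj(6,7)]) (use Tj(2) j3 in simp)
      have Cm: "(t^2 = 3 \<and> x p = x q) \<or> (3 < t^2 \<and> (t^2)^2 - 4 * t^2 + 2 = 0 \<and>
        ((0 < card {v \<in> cls m. (v, p) \<in> parcs G \<and> (v, q) \<notin> parcs G} \<and>
          card {v \<in> cls m. (v, p) \<notin> parcs G \<and> (v, q) \<in> parcs G} = 0 \<and> x q = (t^2 - 3) * x p) \<or>
         (0 < card {v \<in> cls m. (v, p) \<notin> parcs G \<and> (v, q) \<in> parcs G} \<and>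
          card {v \<in> cls m. (v, p) \<in> parcs G \<and> (v, q) \<notin> parcs G} = 0 \<and> x p = (t^2 - 3) * x q)))"
        by (rule pair_counts_3[OF PQ s_bounds(1) Tm(6,7)]) (use Tm(2) m3 in simp)
      \<comment> \<open>The ratio \<open>t^2 - 3\<close> is below 1, so only one of
        \<open>p\<close>, \<open>q\<close> can be the lighter vertex; both other classes therefore
        have the same orientation.\<close>
      have excl: "\<not> (x q = (t^2 - 3) * x p \<and> x p = (t^2 - 3) * x q)" if "3 < t^2"
      proof
        assume a: "x q = (t^2 - 3) * x p \<and> x p = (t^2 - 3) * x q"
        have "(t^2 - 3) * x p < 1 * x p" "(t^2 - 3) * x q < 1 * x q"
          using s_bounds PQ by (intro mult_strict_right_mono; simp)+
        then have "x q < x p" "x p < x q" using a by linarith+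
        then show False by simp
      qed
      have ne3: "t^2 \<noteq> 3"
      proof
        assume t3: "t^2 = 3"
        then have "\<not> 3 < t^2" by simp
        then have "x p = x q" using Cj by blast
        then show False using no_three[OF ijm(1,2,4,3,5,6) pq] t3 by blast
      qed
      then have s3: "3 < t^2" using Cj by blast
      have "x q = (t^2 - 3) * x p \<or> x p = (t^2 - 3) * x q" using Cj ne3 by blast
      then have False
      proof
        assume Q: "x q = (t^2 - 3) * x p"
        then have Q': "x p \<noteq> (t^2 - 3) * x q" using excl[OF s3] by blast
        have "0 < card {v \<in> cls j. (v, p) \<in> parcs G \<and> (v, q) \<notin> parcs G}" using Cj ne3 Q' by blast
        then have "{v \<in> cls j. (v, p) \<in> parcs G \<and> (v, q) \<notin> parcs G} \<noteq> {}" by (metis card.empty less_irrefl)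
        then obtain v where v: "v \<in> cls j" "(v, p) \<in> parcs G" "(v, q) \<notin> parcs G" by blast
        have "card {v \<in> cls m. (v, p) \<notin> parcs G \<and> (v, q) \<in> parcs G} = 0" using Cm ne3 Q' by blast
        then have "{v \<in> cls m. (v, p) \<notin> parcs G \<and> (v, q) \<in> parcs G} = {}" by simp
        then show False
          by (intro no_silver[OF ijm(1,2,4,3,5,6) pq s3 Q v]) blast
      next
        assume Q: "x p = (t^2 - 3) * x q"
        then have Q': "x q \<noteq> (t^2 - 3) * x p" using excl[OF s3] by blast
        have "0 < card {v \<in> cls j. (v, p) \<notin> parcs G \<and> (v, q) \<in> parcs G}" using Cj ne3 Q' by blast
        then have "{v \<in> cls j. (v, p) \<notin> parcs G \<and> (v, q) \<in> parcs G} \<noteq> {}" by (metis card.empty less_irrefl)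
        then obtain v where v: "v \<in> cls j" "(v, q) \<in> parcs G" "(v, p) \<notin> parcs G" by blast
        have "card {v \<in> cls m. (v, p) \<in> parcs G \<and> (v, q) \<notin> parcs G} = 0" using Cm ne3 Q' by blast
        then have e: "{v \<in> cls m. (v, p) \<in> parcs G \<and> (v, q) \<notin> parcs G} = {}" by simp
        have pq': "cls i = {q, p}" "q \<noteq> p" using pq by auto
        show False
          by (rule no_silver[OF ijm(1,2,4,3,5,6) pq' s3 Q v]) (use e in blast)
      qed
      then show ?thesis ..
    qed
  qed
qed

text \<open>Propagates the golden weight ratio from one class to all others: a vertex seeing both
  \<open>p\<close> and \<open>q\<close> is the heavier one of its class, and its partner sees only
  \<open>p\<close>.\<close>

lemma golden_step:
  assumes i: "i < k" and pq: "cls i = {p, q}" "p \<noteq> q" "x q = (t^2 - 2) * x p"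
    and s: "2 < t^2" "t^4 - 3 * t^2 + 1 = 0" and j: "j < k" "i \<noteq> j"
  shows "\<exists>h l. cls j = {h, l} \<and> h \<noteq> l \<and> x l = (t^2 - 2) * x h \<and>
    (h, p) \<in> parcs G \<and> (h, q) \<in> parcs G \<and> (l, p) \<in> parcs G \<and> (l, q) \<notin> parcs G"
proof -
  have PQ: "0 < x p" "0 < x q" using pq pos[of p] pos[of q] by (auto simp: cls_def)
  note T = pair_types[OF i j pq(1,2)]
  define A1 where "A1 = {v \<in> cls j. (v, p) \<in> parcs G \<and> (v, q) \<notin> parcs G}"
  define A2 where "A2 = {v \<in> cls j. (v, p) \<notin> parcs G \<and> (v, q) \<in> parcs G}"
  define A3 where "A3 = {v \<in> cls j. (v, p) \<in> parcs G \<and> (v, q) \<in> parcs G}"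
  note T = T[folded A1_def A2_def A3_def]
  have s2: "(t^2)^2 - 3 * t^2 + 1 = 0" using s(2) by (simp add: power_mult[symmetric])
  have "card A1 = 1 \<and> card A2 = 0 \<and> card A3 = 1"
    by (rule pair_counts_golden[OF PQ s(1) s2 pq(3) T(6,7)]) (use T(2) card_cls_le[of j] in simp)
  moreover have "finite A2" by (simp add: A2_def)
  ultimately obtain l h where lh: "A1 = {l}" "A2 = {}" "A3 = {h}" by (auto simp: card_1_singleton_iff)
  have h: "h \<in> A3" and l: "l \<in> A1" using lh by auto
  have "t * x l = x p" "t * x h = x p + x q" using T(3)[OF l] T(5)[OF h] by auto
  \<comment> \<open>The first summand on the right vanishes by the equation for
    \<open>t^2\<close>.\<close>
  moreover have "(t^2 - 2) * (x p + x q) = ((t^2)^2 - 3 * t^2 + 1) * x p + x p"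
    unfolding pq(3) by (simp add: power2_eq_square algebra_simps)
  moreover have "t * ((t^2 - 2) * x h) = (t^2 - 2) * (t * x h)" by (simp add: mult_ac)
  ultimately have "t * x l = t * ((t^2 - 2) * x h)" unfolding s2 by simp
  then have "x l = (t^2 - 2) * x h" using tpos by simp
  moreover have "h \<noteq> l" using h l by (auto simp: A1_def A3_def)
  moreover have "(h, p) \<in> parcs G" "(h, q) \<in> parcs G" "(l, p) \<in> parcs G" "(l, q) \<notin> parcs G"
    using h l unfolding A1_def A3_def by blast+
  moreover have "cls j = {h, l}" unfolding T(1) lh by blast
  ultimately show ?thesis by (intro exI[of _ h] exI[of _ l] conjI)
qed

text \<open>As \<open>t^2 - 2 < 1\<close>, the weights tell which vertex of a class is
  \<open>H\<close> and which is \<open>L\<close>, so the labels obtained from different pairs of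
  classes agree.\<close>

lemma golden_shape:
  obtains H L where "\<And>j. j < k \<Longrightarrow> cls j = {H j, L j}" "\<And>j. j < k \<Longrightarrow> H j \<noteq> L j"
    "2 < t^2" "t^4 - 3 * t^2 + 1 = 0"
    "\<And>j m. j < k \<Longrightarrow> m < k \<Longrightarrow> j \<noteq> m \<Longrightarrow>
      (H j, H m) \<in> parcs G \<and> (H j, L m) \<in> parcs G \<and> (L j, L m) \<notin> parcs G"
proof -
  obtain i p q where i: "i < k" and pq: "cls i = {p, q}" "p \<noteq> q" "x q = (t^2 - 2) * x p"
    and s: "2 < t^2" "t^4 - 3 * t^2 + 1 = 0" using golden_start by blast
  have s3: "t^2 - 2 < 1"
  proof (rule ccontr)
    assume "\<not> ?thesis"
    then have "t^2 * (3 - t^2) \<le> 0" by (intro mult_nonneg_nonpos) auto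
    moreover have "t^2 * (3 - t^2) = 1" using s(2) by (simp add: algebra_simps power_add[symmetric])
    ultimately show False by simp
  qed
  have ex: "\<exists>hl. j < k \<longrightarrow> cls j = {fst hl, snd hl} \<and> fst hl \<noteq> snd hl \<and> x (snd hl) = (t^2 - 2) * x (fst hl)"
    for j
  proof -
    show "\<exists>hl. j < k \<longrightarrow> cls j = {fst hl, snd hl} \<and> fst hl \<noteq> snd hl \<and> x (snd hl) = (t^2 - 2) * x (fst hl)"
    proof (cases "j = i \<or> \<not> j < k")
      case True
      then show ?thesis using pq by (intro exI[of _ "(p, q)"]) auto
    next
      case False
      then obtain h l where "cls j = {h, l}" "h \<noteq> l" "x l = (t^2 - 2) * x h"
        using golden_step[OF i pq s, of j] by blast
      then show ?thesis by (intro exI[of _ "(h, l)"]) auto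
    qed
  qed
  define hl where "hl j = (SOME hl. j < k \<longrightarrow> cls j = {fst hl, snd hl} \<and> fst hl \<noteq> snd hl \<and>
    x (snd hl) = (t^2 - 2) * x (fst hl))" for j
  have hl': "j < k \<longrightarrow> cls j = {fst (hl j), snd (hl j)} \<and> fst (hl j) \<noteq> snd (hl j) \<and>
    x (snd (hl j)) = (t^2 - 2) * x (fst (hl j))" for j
    unfolding hl_def by (fact someI_ex[OF ex[of j]])
  then have hl: "\<And>j. j < k \<Longrightarrow> cls j = {fst (hl j), snd (hl j)}"
    "\<And>j. j < k \<Longrightarrow> fst (hl j) \<noteq> snd (hl j)" "\<And>j. j < k \<Longrightarrow> x (snd (hl j)) = (t^2 - 2) * x (fst (hl j))"
    by blast+
  define H where "H j = fst (hl j)" for j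
  define L where "L j = snd (hl j)" for j
  note hl = hl[folded H_def L_def]
  have adjs: "(H j, H m) \<in> parcs G \<and> (H j, L m) \<in> parcs G \<and> (L j, L m) \<notin> parcs G"
    if jm: "j < k" "m < k" "j \<noteq> m" for j m
  proof -
    obtain h l where h: "cls j = {h, l}" "h \<noteq> l" "x l = (t^2 - 2) * x h"
      "(h, H m) \<in> parcs G" "(h, L m) \<in> parcs G" "(l, H m) \<in> parcs G" "(l, L m) \<notin> parcs G"
      using golden_step[OF jm(2) hl(1,2,3)[OF jm(2)] s jm(1)] jm(3) by blast
    have V: "h \<in> pverts G" "H j \<in> pverts G"
      by (rule clsD[of h j, THEN conjunct1], simp add: h(1))
         (rule clsD[of "H j" j, THEN conjunct1], simp add: hl(1)[OF jm(1)])
    have lt: "x l < x h" "x (L j) < x (H j)"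
      using mult_strict_right_mono[OF s3 pos[OF V(1)]] mult_strict_right_mono[OF s3 pos[OF V(2)]]
        h(3) hl(3)[OF jm(1)] by linarith+
    have "{h, l} = {H j, L j}" using h(1) hl(1)[OF jm(1)] by simp
    then have "(h = H j \<and> l = L j) \<or> (h = L j \<and> l = H j)" by (simp only: doubleton_eq_iff)
    then have "h = H j \<and> l = L j"
    proof
      assume "h = L j \<and> l = H j"
      then show ?thesis using lt by simp
    qed
    then show ?thesis using h by simp
  qed
  show ?thesis by (rule that[of H L, OF hl(1) hl(2) s adjs])
qed

lemma t_eq_golden: "2 < t^2 \<Longrightarrow> t^4 - 3 * t^2 + 1 = 0 \<Longrightarrow> t^2 = t + 1"
proof -
  assume s: "2 < t^2" "t^4 - 3 * t^2 + 1 = 0"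
  have "(t^2 - t - 1) * (t^2 + t - 1) = t^4 - 3 * t^2 + 1" by (simp add: algebra_simps power2_eq_square power4_eq_xxxx)
  then have "(t^2 - t - 1) * (t^2 + t - 1) = 0" using s by simp
  moreover have "0 < t^2 + t - 1" using s tpos by linarith
  ultimately show ?thesis by simp
qed

lemma nbsum_classes: "nbsum G z v = (\<Sum>m<k. \<Sum>u\<in>nbr v m. z u)"
proof -
  have un: "{u \<in> pverts G. (v, u) \<in> parcs G} = (\<Union>m\<in>{..<k}. nbr v m)"
    unfolding nbr_def cls_def using c_less by blast
  have "(\<Sum>u\<in>(\<Union>m\<in>{..<k}. nbr v m). z u) = (\<Sum>m<k. \<Sum>u\<in>nbr v m. z u)"
    by (rule sum.UNION_disjoint) (simp, simp, auto simp: nbr_def cls_def)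
  then show ?thesis unfolding nbsum_eq[OF fin] un .
qed

lemma sum_classes: "(\<Sum>v\<in>pverts G. f v) = (\<Sum>j<k. \<Sum>v\<in>cls j. f v)" for f :: "'a \<Rightarrow> real"
proof -
  have "pverts G = (\<Union>j\<in>{..<k}. cls j)" unfolding cls_def using c_less by blast
  then have "(\<Sum>v\<in>pverts G. f v) = (\<Sum>v\<in>(\<Union>j<k. cls j). f v)" by simp
  also have "\<dots> = (\<Sum>j<k. \<Sum>v\<in>cls j. f v)"
    by (rule sum.UNION_disjoint) (simp, simp, auto simp: cls_def)
  finally show ?thesis .
qed

text \<open>The vector with value 1 on the heavy and \<open>- t\<close> on the light vertices
  violates the spectral bound \<open>psd\<close> as soon as there are four classes.\<close>

lemma golden_three: "k = 3"
proof (rule ccontr)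
  assume "k \<noteq> 3"
  then have k4: "4 \<le> k" using k3 by simp
  obtain H L where cl: "\<And>j. j < k \<Longrightarrow> cls j = {H j, L j}" "\<And>j. j < k \<Longrightarrow> H j \<noteq> L j"
    and s: "2 < t^2" "t^4 - 3 * t^2 + 1 = 0"
    and ad: "\<And>j m. j < k \<Longrightarrow> m < k \<Longrightarrow> j \<noteq> m \<Longrightarrow>
      (H j, H m) \<in> parcs G \<and> (H j, L m) \<in> parcs G \<and> (L j, L m) \<notin> parcs G"
    by (rule golden_shape) (rule that)
  define z where "z v = (if v = H (c v) then 1 else - t)" for v
  have cHL: "c (H j) = j" "c (L j) = j" if "j < k" for j using cl(1)[OF that] by (auto simp: cls_def)
  have zHL: "z (H j) = 1" "z (L j) = - t" if "j < k" for j
    using cHL[OF that] cl(2)[OF that] by (auto simp: z_def)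
  have nH: "(\<Sum>u\<in>nbr (H j) m. z u) = (if m = j then 0 else 1 - t)" if jm: "j < k" "m < k" for j m
  proof (cases "m = j")
    case True
    have "nbr (H j) j = {}" using cHL[OF jm(1)] by (auto simp: nbr_def cls_def dest: c_adj)
    then show ?thesis using True by simp
  next
    case False
    have "nbr (H j) m = {H m, L m}" using ad[OF jm] cl(1)[OF jm(2)] False by (auto simp: nbr_def)
    then show ?thesis using False zHL[OF jm(2)] cl(2)[OF jm(2)] by simp
  qed
  have nL: "(\<Sum>u\<in>nbr (L j) m. z u) = (if m = j then 0 else 1)" if jm: "j < k" "m < k" for j m
  proof (cases "m = j")
    case True
    have "nbr (L j) j = {}" using cHL[OF jm(1)] by (auto simp: nbr_def cls_def dest: c_adj)
    then show ?thesis using True by simp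
  next
    case False
    have "nbr (L j) m = {H m}" using ad[OF jm] ad[OF jm(2,1)] cl(1)[OF jm(2)] False
      by (auto simp: nbr_def intro: psym)
    then show ?thesis using False zHL[OF jm(2)] by simp
  qed
  have one_out: "(\<Sum>m<k. if m = j then 0 else b) = (real k - 1) * b" if "j < k" for j and b :: real
  proof -
    have "(\<Sum>m<k. if m = j then 0 else b) = (\<Sum>m<k. b - (if m = j then b else 0))" by (intro sum.cong) auto
    also have "\<dots> = real k * b - b" using that by (simp add: sum_subtractf)
    finally show ?thesis by (simp add: algebra_simps)
  qed
  have "bil (adj G) (pverts G) z z = (\<Sum>j<k. \<Sum>v\<in>cls j. z v * nbsum G z v)"
    unfolding bil_adj sum_classes ..
  also have "\<dots> = (\<Sum>j<k. (real k - 1) * (1 - 2 * t))"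
  proof (rule sum.cong[OF refl])
    fix j assume "j \<in> {..<k}"
    then have j: "j < k" by simp
    have nbH: "nbsum G z (H j) = (real k - 1) * (1 - t)"
      unfolding nbsum_classes one_out[OF j, of "1 - t", symmetric] using nH[OF j] by (intro sum.cong) auto
    have nbL: "nbsum G z (L j) = (real k - 1) * 1"
      unfolding nbsum_classes one_out[OF j, of 1, symmetric] using nL[OF j] by (intro sum.cong) auto
    show "(\<Sum>v\<in>cls j. z v * nbsum G z v) = (real k - 1) * (1 - 2 * t)"
      unfolding cl(1)[OF j] using cl(2)[OF j] by (simp add: zHL[OF j] nbH nbL algebra_simps)
  qed
  finally have b: "bil (adj G) (pverts G) z z = real k * ((real k - 1) * (1 - 2 * t))" by simp
  have "sqn G z = (\<Sum>j<k. \<Sum>v\<in>cls j. (z v)^2)" unfolding sqn_def sum_classes ..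
  also have "\<dots> = (\<Sum>j<k. 1 + t^2)"
  proof (rule sum.cong[OF refl])
    fix j assume "j \<in> {..<k}"
    then have j: "j < k" by simp
    show "(\<Sum>v\<in>cls j. (z v)^2) = 1 + t^2"
      unfolding cl(1)[OF j] using cl(2)[OF j] by (simp add: zHL[OF j])
  qed
  finally have q: "sqn G z = real k * (1 + t^2)" by simp
  \<comment> \<open>Uses \<open>t^3 = 2 * t + 1\<close>, a consequence of
    \<open>t^2 = t + 1\<close>.\<close>
  have te: "- t * (1 + t^2) = - (3 * t + 1)"
    using t_eq_golden[OF s] by (simp add: distrib_left power2_eq_square)
  have "real k * (- t * (1 + t^2)) \<le> real k * ((real k - 1) * (1 - 2 * t))"
    using psd[of z] unfolding b q by (metis mult.left_commute)
  then have "- t * (1 + t^2) \<le> (real k - 1) * (1 - 2 * t)" 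
    by (rule iffD1[OF mult_le_cancel_left_pos, rotated]) (use k3 in simp)
  \<comment> \<open>For \<open>k = 4\<close> the inequality amounts to \<open>t \<le> 4/3\<close>,
    which contradicts \<open>2 < t^2\<close>.\<close>
  moreover have t1: "4/3 < t"
  proof (rule ccontr)
    assume "\<not> ?thesis"
    then have "t * t \<le> 4/3 * (4/3)" using tpos by (intro mult_mono) auto
    then show False using s by (simp add: power2_eq_square)
  qed
  moreover have "(real k - 1) * (1 - 2 * t) \<le> 3 * (1 - 2 * t)"
    using k4 t1 by (intro mult_right_mono_neg) auto
  ultimately have "- (3 * t + 1) \<le> 3 * (1 - 2 * t)" unfolding te by (meson order_trans)
  then show False using t1 by simp
qed

text \<open>The last case is the line graph of a triangle with a pendant edge at each vertex.\<close>

lemma golden_contradiction: False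
proof -
  obtain H L where cl: "\<And>j. j < k \<Longrightarrow> cls j = {H j, L j}" "\<And>j. j < k \<Longrightarrow> H j \<noteq> L j"
    and s: "2 < t^2" "t^4 - 3 * t^2 + 1 = 0"
    and ad: "\<And>j m. j < k \<Longrightarrow> m < k \<Longrightarrow> j \<noteq> m \<Longrightarrow>
      (H j, H m) \<in> parcs G \<and> (H j, L m) \<in> parcs G \<and> (L j, L m) \<notin> parcs G"
    by (rule golden_shape) (rule that)
  have cHL: "c (H j) = j" "c (L j) = j" "H j \<in> pverts G" "L j \<in> pverts G" if "j < k" for j
    using cl(1)[OF that] by (auto simp: cls_def)
  have kk: "0 < k" "1 < k" "2 < k" using k3 by auto
  have V: "pverts G = {H 0, L 0, H 1, L 1, H 2, L 2}"
  proof -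
    have "pverts G = (\<Union>j<k. cls j)" using c_less by (auto simp: cls_def)
    also have "\<dots> = cls 0 \<union> cls 1 \<union> cls 2"
      unfolding golden_three by (auto simp: numeral_3_eq_3 numeral_2_eq_2 lessThan_Suc)
    finally show ?thesis using cl(1) kk by auto
  qed
  \<comment> \<open>The triangle 0, 1, 2 with pendant edges from \<open>j\<close> to
    \<open>j + 3\<close>. Below, \<open>H j\<close> becomes the side opposite to \<open>j\<close>
    and \<open>L j\<close> the pendant edge at \<open>j\<close>.\<close>
  define ES where "ES = {{1, 2}, {0, 3}, {0, 2}, {1, 4}, {0, 1}, {2, 5 :: nat}}"
  define N where "N = \<lparr>pverts = {0..<6}, parcs = {(a, b). a \<noteq> b \<and> {a, b} \<in> ES}\<rparr>"
  have N: "pair_graph N"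
    by (rule pair_graphI) (auto simp: N_def ES_def doubleton_eq_iff)
  have EN: "edges N = ES"
  proof
    show "edges N \<subseteq> ES" by (auto simp: edges_def N_def)
    show "ES \<subseteq> edges N"
    proof
      fix e assume "e \<in> ES"
      then obtain a b where "e = {a, b}" "a \<noteq> b" unfolding ES_def by fastforce
      then show "e \<in> edges N" using \<open>e \<in> ES\<close> by (auto simp: edges_def N_def)
    qed
  qed
  define hh where "hh j = (if j = 0 then {1, 2} else if j = 1 then {0, 2} else {0, 1 :: nat})" for j :: nat
  define f where "f v = (if v = H (c v) then hh (c v) else {c v, c v + 3})" for v
  have fH: "f (H j) = hh j" "f (L j) = {j, j + 3}" if "j < k" for j
    using cHL[OF that] cl(2)[OF that] by (auto simp: f_def)
  have fv: "f (H 0) = {1, 2}" "f (L 0) = {0, 3}" "f (H 1) = {0, 2}" "f (L 1) = {1, 4}"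
    "f (H 2) = {0, 1}" "f (L 2) = {2, 5}"
    using fH[OF kk(1)] fH[OF kk(2)] fH[OF kk(3)] by (auto simp: hh_def)
  have img: "f ` pverts G = ES" unfolding V ES_def image_insert image_empty fv ..
  have c6: "card ES = 6" by (simp add: ES_def doubleton_eq_iff)
  have "card (set [H 0, L 0, H 1, L 1, H 2, L 2]) \<le> 6" by (rule order_trans[OF card_length]) simp
  then have "card (pverts G) \<le> 6" unfolding V by simp
  \<comment> \<open>At most six vertices are mapped onto six edges, which makes \<open>f\<close>
    injective.\<close>
  then have "card (f ` pverts G) = card (pverts G)"
    using card_image_le[OF fin, of f] c6 unfolding img by linarith
  then have inj: "inj_on f (pverts G)" by (rule eq_card_imp_inj_on[OF fin])
  let ?K = "gen_line_graph N (\<lambda>_. 0)"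
  have emp: "Inr ` {(i, n, b). i \<in> pverts N \<and> n < (0::nat)} = ({} :: (nat set + nat \<times> nat \<times> bool) set)"
    by auto
  have K: "pverts ?K = Inl ` ES"
    unfolding gen_line_graph_def Let_def EN emp by simp
  have K_adj: "(Inl e, Inl e') \<in> parcs ?K \<longleftrightarrow> e \<in> ES \<and> e' \<in> ES \<and> e \<noteq> e' \<and> e \<inter> e' \<noteq> {}" for e e'
    unfolding gen_line_graph_def Let_def EN emp by (simp add: inj_image_mem_iff)
  have nadj: "(H 0, L 0) \<notin> parcs G" "(H 1, L 1) \<notin> parcs G" "(H 2, L 2) \<notin> parcs G"
    "(L 0, H 0) \<notin> parcs G" "(L 1, H 1) \<notin> parcs G" "(L 2, H 2) \<notin> parcs G"
    using cHL kk by (auto dest: c_adj)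
  note ads = ad[OF kk(1) kk(2)] ad[OF kk(2) kk(1)] ad[OF kk(1) kk(3)] ad[OF kk(3) kk(1)]
    ad[OF kk(2) kk(3)] ad[OF kk(3) kk(2)]
  have ads': "(L j, H m) \<in> parcs G" if "j < k" "m < k" "j \<noteq> m" for j m
    using ad[OF that(2,1)] that(3) by (auto intro: psym)
  have irrefl: "(v, v) \<notin> parcs G" for v by (rule pair_graph_irrefl[OF G])
  note tab = ads ads'[OF kk(1) kk(2)] ads'[OF kk(2) kk(1)] ads'[OF kk(1) kk(3)] ads'[OF kk(3) kk(1)]
      ads'[OF kk(2) kk(3)] ads'[OF kk(3) kk(2)] nadj irrefl
  have tab': "(H 0, H 1) \<in> parcs G" "(H 0, H 2) \<in> parcs G" "(H 1, H 2) \<in> parcs G"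
    "(H 1, H 0) \<in> parcs G" "(H 2, H 0) \<in> parcs G" "(H 2, H 1) \<in> parcs G"
    "(H 0, L 1) \<in> parcs G" "(H 0, L 2) \<in> parcs G" "(H 1, L 2) \<in> parcs G"
    "(H 1, L 0) \<in> parcs G" "(H 2, L 0) \<in> parcs G" "(H 2, L 1) \<in> parcs G"
    "(L 0, H 1) \<in> parcs G" "(L 0, H 2) \<in> parcs G" "(L 1, H 2) \<in> parcs G"
    "(L 1, H 0) \<in> parcs G" "(L 2, H 0) \<in> parcs G" "(L 2, H 1) \<in> parcs G"
    "(L 0, L 1) \<notin> parcs G" "(L 0, L 2) \<notin> parcs G" "(L 1, L 2) \<notin> parcs G"
    "(L 1, L 0) \<notin> parcs G" "(L 2, L 0) \<notin> parcs G" "(L 2, L 1) \<notin> parcs G"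
    using tab by (simp_all only: one_neq_zero zero_neq_one simp_thms numeral_eq_one_iff one_eq_numeral_iff
      zero_neq_numeral numeral_neq_zero num.simps)
  have adjf: "(u, v) \<in> parcs G \<longleftrightarrow> f u \<noteq> f v \<and> f u \<inter> f v \<noteq> {}"
    if uv: "u \<in> pverts G" "v \<in> pverts G" for u v
  proof -
    have "u \<in> set [H 0, L 0, H 1, L 1, H 2, L 2]" "v \<in> set [H 0, L 0, H 1, L 1, H 2, L 2]"
      using uv unfolding V by simp_all
    moreover have "\<forall>u\<in>set [H 0, L 0, H 1, L 1, H 2, L 2]. \<forall>v\<in>set [H 0, L 0, H 1, L 1, H 2, L 2].
        (u, v) \<in> parcs G \<longleftrightarrow> f u \<noteq> f v \<and> f u \<inter> f v \<noteq> {}"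
      unfolding list.set ball_simps fv
      by (intro conjI TrueI) (simp_all add: tab' nadj irrefl doubleton_eq_iff del: One_nat_def)
    ultimately show ?thesis by blast
  qed
  have "G \<simeq> ?K"
  proof (rule isomorphicI[OF G])
    show "parcs ?K \<subseteq> pverts ?K \<times> pverts ?K" unfolding gen_line_graph_def Let_def by auto
    show "bij_betw (\<lambda>v. Inl (f v)) (pverts G) (pverts ?K)"
      unfolding K img[symmetric] bij_betw_def using inj by (auto simp: inj_on_def)
    fix u v assume uv: "u \<in> pverts G" "v \<in> pverts G"
    then have "f u \<in> ES" "f v \<in> ES" using img by auto
    then show "(u, v) \<in> parcs G \<longleftrightarrow> (Inl (f u), Inl (f v)) \<in> parcs ?K"
      unfolding K_adj adjf[OF uv] by blast
  qed
  then show False using ngl N unfolding generalized_line_graph_def by blast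
qed

end
end

text \<open>The points \<open>P0\<close>, \<open>P1\<close>, \<open>P2\<close>, \<open>P3\<close> are the color class of size four in standard position, the
  others are those of the 56 vectors with inner product 4 with \<open>P0\<close> and with exactly one of \<open>P1\<close>, \<open>P2\<close>,
  \<open>P3\<close>, and 0 with the remaining two.\<close>

datatype pt =
    P0 | P1 | P2 | P3 | P4 | P5 | P6 | P7 | P8 | P9 | P10 | P11 | P12 | P13 | P14 | P15 | P16 |
    P17 | P18 | P19 | P20 | P21 | P22 | P23 | P24 | P25 | P26 | P27

definition all_pt :: "pt list" where
  "all_pt = [P0, P1, P2, P3, P4, P5, P6, P7, P8, P9, P10, P11, P12, P13, P14, P15, P16, P17, P18, P19,
    P20, P21, P22, P23, P24, P25, P26, P27]"

primrec vec_of :: "pt \<Rightarrow> int list" where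
    "vec_of P0 = [2, 2, 0, 0, 0, 0, 0, 0]" | "vec_of P1 = [1, - 1, 1, 1, 1, 1, 1, - 1]" |
    "vec_of P2 = [0, 0, 2, 0, 0, 0, 0, 2]" | "vec_of P3 = [- 1, 1, - 1, 1, 1, 1, 1, 1]" |
    "vec_of P4 = [2, 0, 0, 2, 0, 0, 0, 0]" | "vec_of P5 = [2, 0, 0, 0, 2, 0, 0, 0]" |
    "vec_of P6 = [2, 0, 0, 0, 0, 2, 0, 0]" | "vec_of P7 = [2, 0, 0, 0, 0, 0, 2, 0]" |
    "vec_of P8 = [1, 1, 1, 1, 1, 1, - 1, - 1]" | "vec_of P9 = [1, 1, 1, 1, 1, - 1, 1, - 1]" |
    "vec_of P10 = [1, 1, 1, 1, - 1, 1, 1, - 1]" | "vec_of P11 = [1, 1, 1, - 1, 1, 1, 1, - 1]" |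
    "vec_of P12 = [2, 0, 0, 0, 0, 0, 0, 2]" | "vec_of P13 = [1, 1, 1, 1, 1, - 1, - 1, 1]" |
    "vec_of P14 = [1, 1, 1, 1, - 1, 1, - 1, 1]" | "vec_of P15 = [1, 1, 1, - 1, 1, 1, - 1, 1]" |
    "vec_of P16 = [1, 1, 1, 1, - 1, - 1, 1, 1]" | "vec_of P17 = [1, 1, 1, - 1, 1, - 1, 1, 1]" |
    "vec_of P18 = [1, 1, 1, - 1, - 1, 1, 1, 1]" | "vec_of P19 = [0, 2, 2, 0, 0, 0, 0, 0]" |
    "vec_of P20 = [1, 1, - 1, 1, 1, 1, - 1, 1]" | "vec_of P21 = [1, 1, - 1, 1, 1, - 1, 1, 1]" |
    "vec_of P22 = [1, 1, - 1, 1, - 1, 1, 1, 1]" | "vec_of P23 = [1, 1, - 1, - 1, 1, 1, 1, 1]" |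
    "vec_of P24 = [0, 2, 0, 2, 0, 0, 0, 0]" | "vec_of P25 = [0, 2, 0, 0, 2, 0, 0, 0]" |
    "vec_of P26 = [0, 2, 0, 0, 0, 2, 0, 0]" | "vec_of P27 = [0, 2, 0, 0, 0, 0, 2, 0]"

text \<open>Adjacency is tabulated to keep the many finite checks cheap; \<open>ipl_vec_of\<close>
  certifies the table against the vectors.\<close>

primrec nb :: "pt \<Rightarrow> pt list" where
  "nb P0 = [P4, P5, P6, P7, P8, P9, P10, P11, P12, P13, P14, P15, P16, P17, P18, P19, P20, P21, P22, P23, P24, P25, P26, P27]"
| "nb P1 = [P4, P5, P6, P7, P8, P9, P10, P11]"
| "nb P2 = [P12, P13, P14, P15, P16, P17, P18, P19]"
| "nb P3 = [P20, P21, P22, P23, P24, P25, P26, P27]"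
| "nb P4 = [P0, P1, P5, P6, P7, P8, P9, P10, P12, P13, P14, P16, P20, P21, P22, P24]"
| "nb P5 = [P0, P1, P4, P6, P7, P8, P9, P11, P12, P13, P15, P17, P20, P21, P23, P25]"
| "nb P6 = [P0, P1, P4, P5, P7, P8, P10, P11, P12, P14, P15, P18, P20, P22, P23, P26]"
| "nb P7 = [P0, P1, P4, P5, P6, P9, P10, P11, P12, P16, P17, P18, P21, P22, P23, P27]"
| "nb P8 = [P0, P1, P4, P5, P6, P9, P10, P11, P13, P14, P15, P19, P20, P24, P25, P26]"
| "nb P9 = [P0, P1, P4, P5, P7, P8, P10, P11, P13, P16, P17, P19, P21, P24, P25, P27]"
| "nb P10 = [P0, P1, P4, P6, P7, P8, P9, P11, P14, P16, P18, P19, P22, P24, P26, P27]"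
| "nb P11 = [P0, P1, P5, P6, P7, P8, P9, P10, P15, P17, P18, P19, P23, P25, P26, P27]"
| "nb P12 = [P0, P2, P4, P5, P6, P7, P13, P14, P15, P16, P17, P18, P20, P21, P22, P23]"
| "nb P13 = [P0, P2, P4, P5, P8, P9, P12, P14, P15, P16, P17, P19, P20, P21, P24, P25]"
| "nb P14 = [P0, P2, P4, P6, P8, P10, P12, P13, P15, P16, P18, P19, P20, P22, P24, P26]"
| "nb P15 = [P0, P2, P5, P6, P8, P11, P12, P13, P14, P17, P18, P19, P20, P23, P25, P26]"
| "nb P16 = [P0, P2, P4, P7, P9, P10, P12, P13, P14, P17, P18, P19, P21, P22, P24, P27]"
| "nb P17 = [P0, P2, P5, P7, P9, P11, P12, P13, P15, P16, P18, P19, P21, P23, P25, P27]"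
| "nb P18 = [P0, P2, P6, P7, P10, P11, P12, P14, P15, P16, P17, P19, P22, P23, P26, P27]"
| "nb P19 = [P0, P2, P8, P9, P10, P11, P13, P14, P15, P16, P17, P18, P24, P25, P26, P27]"
| "nb P20 = [P0, P3, P4, P5, P6, P8, P12, P13, P14, P15, P21, P22, P23, P24, P25, P26]"
| "nb P21 = [P0, P3, P4, P5, P7, P9, P12, P13, P16, P17, P20, P22, P23, P24, P25, P27]"
| "nb P22 = [P0, P3, P4, P6, P7, P10, P12, P14, P16, P18, P20, P21, P23, P24, P26, P27]"
| "nb P23 = [P0, P3, P5, P6, P7, P11, P12, P15, P17, P18, P20, P21, P22, P25, P26, P27]"
| "nb P24 = [P0, P3, P4, P8, P9, P10, P13, P14, P16, P19, P20, P21, P22, P25, P26, P27]"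
| "nb P25 = [P0, P3, P5, P8, P9, P11, P13, P15, P17, P19, P20, P21, P23, P24, P26, P27]"
| "nb P26 = [P0, P3, P6, P8, P10, P11, P14, P15, P18, P19, P20, P22, P23, P24, P25, P27]"
| "nb P27 = [P0, P3, P7, P9, P10, P11, P16, P17, P18, P19, P21, P22, P23, P24, P25, P26]"

text \<open>The eight neighbours of each of \<open>P1\<close>, \<open>P2\<close>, \<open>P3\<close>
  induce a cocktail party graph; \<open>ap\<close> exchanges the nonadjacent pairs.\<close>

primrec ap :: "pt \<Rightarrow> pt" where
    "ap P0 = P0" | "ap P1 = P1" | "ap P2 = P2" | "ap P3 = P3" | "ap P4 = P11" | "ap P5 = P10" |
    "ap P6 = P9" | "ap P7 = P8" | "ap P8 = P7" | "ap P9 = P6" | "ap P10 = P5" | "ap P11 = P4" |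
    "ap P12 = P19" | "ap P13 = P18" | "ap P14 = P17" | "ap P15 = P16" | "ap P16 = P15" |
    "ap P17 = P14" | "ap P18 = P13" | "ap P19 = P12" | "ap P20 = P27" | "ap P21 = P26" |
    "ap P22 = P25" | "ap P23 = P24" | "ap P24 = P23" | "ap P25 = P22" | "ap P26 = P21" |
    "ap P27 = P20"

text \<open>Finite index types, here for the generators and below for the representatives, let one
  case distinction followed by simplification check a whole table.\<close>

datatype gi = G0 | G1 | G2 | G3 | G4 | G5 | G6 | G7

primrec g0 :: "pt \<Rightarrow> pt" where
    "g0 P0 = P0" | "g0 P1 = P3" | "g0 P2 = P2" | "g0 P3 = P1" | "g0 P4 = P20" | "g0 P5 = P21" |
    "g0 P6 = P25" | "g0 P7 = P24" | "g0 P8 = P23" | "g0 P9 = P22" | "g0 P10 = P26" |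
    "g0 P11 = P27" | "g0 P12 = P13" | "g0 P13 = P12" | "g0 P14 = P15" | "g0 P15 = P17" |
    "g0 P16 = P14" | "g0 P17 = P16" | "g0 P18 = P19" | "g0 P19 = P18" | "g0 P20 = P5" |
    "g0 P21 = P4" | "g0 P22 = P8" | "g0 P23 = P9" | "g0 P24 = P6" | "g0 P25 = P7" |
    "g0 P26 = P11" | "g0 P27 = P10"

primrec g1 :: "pt \<Rightarrow> pt" where
    "g1 P0 = P0" | "g1 P1 = P1" | "g1 P2 = P3" | "g1 P3 = P2" | "g1 P4 = P7" | "g1 P5 = P4" |
    "g1 P6 = P5" | "g1 P7 = P9" | "g1 P8 = P6" | "g1 P9 = P10" | "g1 P10 = P11" |
    "g1 P11 = P8" | "g1 P12 = P21" | "g1 P13 = P22" | "g1 P14 = P23" | "g1 P15 = P20" |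
    "g1 P16 = P27" | "g1 P17 = P24" | "g1 P18 = P25" | "g1 P19 = P26" | "g1 P20 = P12" |
    "g1 P21 = P16" | "g1 P22 = P17" | "g1 P23 = P13" | "g1 P24 = P18" | "g1 P25 = P14" |
    "g1 P26 = P15" | "g1 P27 = P19"

primrec g2 :: "pt \<Rightarrow> pt" where
    "g2 P0 = P0" | "g2 P1 = P2" | "g2 P2 = P3" | "g2 P3 = P1" | "g2 P4 = P15" | "g2 P5 = P17" |
    "g2 P6 = P12" | "g2 P7 = P18" | "g2 P8 = P13" | "g2 P9 = P19" | "g2 P10 = P14" |
    "g2 P11 = P16" | "g2 P12 = P23" | "g2 P13 = P25" | "g2 P14 = P20" | "g2 P15 = P21" |
    "g2 P16 = P26" | "g2 P17 = P27" | "g2 P18 = P22" | "g2 P19 = P24" | "g2 P20 = P5" |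
    "g2 P21 = P11" | "g2 P22 = P6" | "g2 P23 = P7" | "g2 P24 = P8" | "g2 P25 = P9" |
    "g2 P26 = P4" | "g2 P27 = P10"

primrec g3 :: "pt \<Rightarrow> pt" where
    "g3 P0 = P0" | "g3 P1 = P3" | "g3 P2 = P2" | "g3 P3 = P1" | "g3 P4 = P23" | "g3 P5 = P21" |
    "g3 P6 = P20" | "g3 P7 = P22" | "g3 P8 = P25" | "g3 P9 = P27" | "g3 P10 = P26" |
    "g3 P11 = P24" | "g3 P12 = P12" | "g3 P13 = P17" | "g3 P14 = P15" | "g3 P15 = P13" |
    "g3 P16 = P18" | "g3 P17 = P16" | "g3 P18 = P14" | "g3 P19 = P19" | "g3 P20 = P5" |
    "g3 P21 = P7" | "g3 P22 = P6" | "g3 P23 = P4" | "g3 P24 = P11" | "g3 P25 = P9" |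
    "g3 P26 = P8" | "g3 P27 = P10"

primrec g4 :: "pt \<Rightarrow> pt" where
    "g4 P0 = P0" | "g4 P1 = P1" | "g4 P2 = P3" | "g4 P3 = P2" | "g4 P4 = P4" | "g4 P5 = P7" |
    "g4 P6 = P9" | "g4 P7 = P5" | "g4 P8 = P10" | "g4 P9 = P6" | "g4 P10 = P8" |
    "g4 P11 = P11" | "g4 P12 = P21" | "g4 P13 = P22" | "g4 P14 = P24" | "g4 P15 = P27" |
    "g4 P16 = P20" | "g4 P17 = P23" | "g4 P18 = P25" | "g4 P19 = P26" | "g4 P20 = P16" |
    "g4 P21 = P12" | "g4 P22 = P13" | "g4 P23 = P17" | "g4 P24 = P14" | "g4 P25 = P18" |
    "g4 P26 = P19" | "g4 P27 = P15"

primrec g5 :: "pt \<Rightarrow> pt" where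
    "g5 P0 = P0" | "g5 P1 = P2" | "g5 P2 = P3" | "g5 P3 = P1" | "g5 P4 = P16" | "g5 P5 = P14" |
    "g5 P6 = P13" | "g5 P7 = P19" | "g5 P8 = P12" | "g5 P9 = P18" | "g5 P10 = P17" |
    "g5 P11 = P15" | "g5 P12 = P24" | "g5 P13 = P22" | "g5 P14 = P21" | "g5 P15 = P20" |
    "g5 P16 = P27" | "g5 P17 = P26" | "g5 P18 = P25" | "g5 P19 = P23" | "g5 P20 = P4" |
    "g5 P21 = P10" | "g5 P22 = P9" | "g5 P23 = P8" | "g5 P24 = P7" | "g5 P25 = P6" |
    "g5 P26 = P5" | "g5 P27 = P11"

primrec g6 :: "pt \<Rightarrow> pt" where
    "g6 P0 = P0" | "g6 P1 = P2" | "g6 P2 = P1" | "g6 P3 = P3" | "g6 P4 = P19" | "g6 P5 = P14" |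
    "g6 P6 = P18" | "g6 P7 = P16" | "g6 P8 = P15" | "g6 P9 = P13" | "g6 P10 = P17" |
    "g6 P11 = P12" | "g6 P12 = P10" | "g6 P13 = P8" | "g6 P14 = P11" | "g6 P15 = P6" |
    "g6 P16 = P9" | "g6 P17 = P4" | "g6 P18 = P7" | "g6 P19 = P5" | "g6 P20 = P26" |
    "g6 P21 = P24" | "g6 P22 = P27" | "g6 P23 = P22" | "g6 P24 = P25" | "g6 P25 = P20" |
    "g6 P26 = P23" | "g6 P27 = P21"

primrec g7 :: "pt \<Rightarrow> pt" where
    "g7 P0 = P0" | "g7 P1 = P1" | "g7 P2 = P3" | "g7 P3 = P2" | "g7 P4 = P9" | "g7 P5 = P7" |
    "g7 P6 = P5" | "g7 P7 = P4" | "g7 P8 = P11" | "g7 P9 = P10" | "g7 P10 = P8" |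
    "g7 P11 = P6" | "g7 P12 = P21" | "g7 P13 = P27" | "g7 P14 = P25" | "g7 P15 = P23" |
    "g7 P16 = P24" | "g7 P17 = P22" | "g7 P18 = P20" | "g7 P19 = P26" | "g7 P20 = P17" |
    "g7 P21 = P16" | "g7 P22 = P13" | "g7 P23 = P12" | "g7 P24 = P19" | "g7 P25 = P18" |
    "g7 P26 = P15" | "g7 P27 = P14"

primrec gen :: "gi \<Rightarrow> pt \<Rightarrow> pt" where
    "gen G0 = g0" | "gen G1 = g1" | "gen G2 = g2" | "gen G3 = g3" | "gen G4 = g4" |
    "gen G5 = g5" | "gen G6 = g6" | "gen G7 = g7"

definition tri_list :: "pt list list" where
  "tri_list = [
    [P4, P15, P27], [P4, P17, P26], [P4, P18, P25], [P4, P19, P23], [P5, P14, P27],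
    [P5, P16, P26], [P5, P18, P24], [P5, P19, P22], [P6, P13, P27], [P6, P16, P25],
    [P6, P17, P24], [P6, P19, P21], [P7, P13, P26], [P7, P14, P25], [P7, P15, P24],
    [P7, P19, P20], [P8, P12, P27], [P8, P16, P23], [P8, P17, P22], [P8, P18, P21],
    [P9, P12, P26], [P9, P14, P23], [P9, P15, P22], [P9, P18, P20], [P10, P12, P25],
    [P10, P13, P23], [P10, P15, P21], [P10, P17, P20], [P11, P12, P24], [P11, P13, P22],
    [P11, P14, P21], [P11, P16, P20]]"

datatype ri =
    R0 | R1 | R2 | R3 | R4 | R5 | R6 | R7 | R8 | R9 | R10 | R11 | R12 | R13 | R14 | R15 | R16 |
    R17 | R18 | R19 | R20 | R21 | R22 | R23 | R24 | R25 | R26 | R27 | R28 | R29 | R30 | R31 |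
    R32 | R33 | R34 | R35 | R36

text \<open>\<open>R0\<close> and \<open>R1\<close> only start the process of adding triples;
  \<open>R2\<close> to \<open>R36\<close> are the 35 families with at least two triples.\<close>

primrec dec :: "ri \<Rightarrow> pt list list" where
    "dec R0 = []"
  | "dec R1 = [[P4, P15, P27]]"
  | "dec R2 = [[P4, P15, P27], [P5, P16, P26]]"
  | "dec R3 = [[P4, P15, P27], [P5, P18, P24]]"
  | "dec R4 = [[P4, P15, P27], [P11, P16, P20]]"
  | "dec R5 = [[P4, P15, P27], [P5, P16, P26], [P6, P17, P24]]"
  | "dec R6 = [[P4, P15, P27], [P5, P16, P26], [P6, P19, P21]]"
  | "dec R7 = [[P4, P15, P27], [P5, P16, P26], [P10, P17, P20]]"
  | "dec R8 = [[P4, P15, P27], [P5, P18, P24], [P6, P19, P21]]"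
  | "dec R9 = [[P4, P15, P27], [P5, P18, P24], [P7, P14, P25]]"
  | "dec R10 = [[P4, P15, P27], [P5, P18, P24], [P10, P13, P23]]"
  | "dec R11 = [[P4, P15, P27], [P5, P16, P26], [P6, P17, P24], [P7, P14, P25]]"
  | "dec R12 = [[P4, P15, P27], [P5, P16, P26], [P6, P17, P24], [P7, P19, P20]]"
  | "dec R13 = [[P4, P15, P27], [P5, P16, P26], [P6, P17, P24], [P9, P14, P23]]"
  | "dec R14 = [[P4, P15, P27], [P5, P16, P26], [P6, P17, P24], [P9, P18, P20]]"
  | "dec R15 = [[P4, P15, P27], [P5, P16, P26], [P6, P17, P24], [P11, P14, P21]]"
  | "dec R16 = [[P4, P15, P27], [P5, P16, P26], [P6, P19, P21], [P9, P18, P20]]"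
  | "dec R17 = [[P4, P15, P27], [P5, P16, P26], [P6, P19, P21], [P10, P13, P23]]"
  | "dec R18 = [[P4, P15, P27], [P5, P16, P26], [P10, P17, P20], [P11, P14, P21]]"
  | "dec R19 = [[P4, P15, P27], [P5, P18, P24], [P6, P19, P21], [P7, P14, P25]]"
  | "dec R20 = [[P4, P15, P27], [P5, P18, P24], [P6, P19, P21], [P9, P12, P26]]"
  | "dec R21 = [[P4, P15, P27], [P5, P18, P24], [P10, P13, P23], [P11, P16, P20]]"
  | "dec R22 = [[P4, P15, P27], [P5, P16, P26], [P6, P17, P24], [P7, P14, P25], [P8, P18,
  P21]]"
  | "dec R23 = [[P4, P15, P27], [P5, P16, P26], [P6, P17, P24], [P7, P19, P20], [P8, P18,
  P21]]"
  | "dec R24 = [[P4, P15, P27], [P5, P16, P26], [P6, P17, P24], [P7, P19, P20], [P9, P14,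
  P23]]"
  | "dec R25 = [[P4, P15, P27], [P5, P16, P26], [P6, P17, P24], [P7, P19, P20], [P11, P13,
  P22]]"
  | "dec R26 = [[P4, P15, P27], [P5, P16, P26], [P6, P17, P24], [P7, P19, P20], [P11, P14,
  P21]]"
  | "dec R27 = [[P4, P15, P27], [P5, P16, P26], [P6, P17, P24], [P9, P18, P20], [P10, P13,
  P23]]"
  | "dec R28 = [[P4, P15, P27], [P5, P16, P26], [P6, P19, P21], [P9, P18, P20], [P10, P13,
  P23]]"
  | "dec R29 = [[P4, P15, P27], [P5, P18, P24], [P6, P19, P21], [P7, P14, P25], [P9, P12,
  P26]]"
  | "dec R30 = [[P4, P15, P27], [P5, P16, P26], [P6, P17, P24], [P7, P14, P25], [P8, P18, P21],
  [P10, P13, P23]]"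
  | "dec R31 = [[P4, P15, P27], [P5, P16, P26], [P6, P17, P24], [P7, P19, P20], [P8, P18, P21],
  [P9, P14, P23]]"
  | "dec R32 = [[P4, P15, P27], [P5, P16, P26], [P6, P17, P24], [P7, P19, P20], [P8, P18, P21],
  [P10, P12, P25]]"
  | "dec R33 = [[P4, P15, P27], [P5, P16, P26], [P6, P17, P24], [P9, P18, P20], [P10, P13,
  P23], [P11, P14, P21]]"
  | "dec R34 = [[P4, P15, P27], [P5, P16, P26], [P6, P19, P21], [P9, P18, P20], [P10, P13,
  P23], [P11, P12, P24]]"
  | "dec R35 = [[P4, P15, P27], [P5, P16, P26], [P6, P17, P24], [P7, P19, P20], [P8, P18, P21],
  [P9, P14, P23], [P10, P12, P25]]"
  | "dec R36 = [[P4, P15, P27], [P5, P16, P26], [P6, P17, P24], [P7, P19, P20], [P8, P18, P21],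
  [P9, P14, P23], [P10, P12, P25], [P11, P13, P22]]"

text \<open>The graph depends only on the union of the triples, and the same union can arise from
  different families.\<close>

definition rep :: "ri \<Rightarrow> pt list" where
  "rep r = concat (dec r)"

text \<open>To each triple disjoint from \<open>rep r\<close> belong a word in the generators \<open>gen\<close> and the
  representative to which this word moves \<open>rep r\<close> together with the triple.\<close>

primrec steps :: "ri \<Rightarrow> (pt list \<times> gi list \<times> ri) list" where
    "steps R0 = [([P4, P15, P27], [], R1), ([P4, P17, P26], [G2], R1), ([P4, P18, P25], [G3,
  G3], R1), ([P4, P19, P23], [G1, G7], R1), ([P5, P14, P27], [G5, G0], R1), ([P5, P16, P26],
  [G1], R1), ([P5, P18, P24], [G2, G6], R1), ([P5, P19, P22], [G4, G7], R1), ([P6, P13, P27],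
  [G2, G1, G0], R1), ([P6, P16, P25], [G0, G6, G5], R1), ([P6, P17, P24], [G3, G5], R1), ([P6,
  P19, P21], [G1, G1], R1), ([P7, P13, P26], [G7], R1), ([P7, P14, P25], [G1, G3], R1), ([P7,
  P15, P24], [G2, G7, G5], R1), ([P7, P19, P20], [G4, G1], R1), ([P8, P12, P27], [G7, G0], R1),
  ([P8, P16, P23], [G0, G3], R1), ([P8, P17, P22], [G6], R1), ([P8, P18, P21], [G7, G5], R1),
  ([P9, P12, P26], [G7, G0, G2], R1), ([P9, P14, P23], [G3], R1), ([P9, P15, P22], [G0, G6],
  R1), ([P9, P18, P20], [G6, G7], R1), ([P10, P12, P25], [G2, G3], R1), ([P10, P13, P23], [G6,
  G6], R1), ([P10, P15, P21], [G0, G2], R1), ([P10, P17, P20], [G0, G1], R1), ([P11, P12, P24],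
  [G4, G0], R1), ([P11, P13, P22], [G1, G6], R1), ([P11, P14, P21], [G0], R1), ([P11, P16,
  P20], [G5], R1)]"
  | "steps R1 = [([P5, P16, P26], [], R2), ([P5, P18, P24], [], R3), ([P5, P19, P22], [G1, G2],
  R3), ([P6, P16, P25], [G0, G6, G2], R2), ([P6, P17, P24], [G1, G7, G2], R3), ([P6, P19, P21],
  [G0, G6, G2], R3), ([P7, P13, P26], [G0, G7, G6], R3), ([P7, P14, P25], [G4], R3), ([P7, P19,
  P20], [G4], R2), ([P8, P16, P23], [G0, G3], R2), ([P8, P17, P22], [G5, G5], R3), ([P8, P18,
  P21], [G7, G3], R3), ([P9, P12, P26], [G0, G3, G1], R3), ([P9, P14, P23], [G2, G1, G5], R3),
  ([P9, P18, P20], [G6, G7], R2), ([P10, P12, P25], [G1, G0], R3), ([P10, P13, P23], [G6, G6],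
  R3), ([P10, P17, P20], [G5, G2], R2), ([P11, P12, P24], [G5, G5, G4], R2), ([P11, P13, P22],
  [G1, G6], R2), ([P11, P14, P21], [G0, G5, G2], R2), ([P11, P16, P20], [], R4)]"
  | "steps R2 = [([P6, P17, P24], [], R5), ([P6, P19, P21], [], R6), ([P7, P14, P25], [G0, G0],
  R5), ([P7, P19, P20], [G0, G0], R6), ([P8, P17, P22], [G2, G0, G5], R5), ([P8, P18, P21],
  [G1, G5, G4, G2], R6), ([P9, P14, P23], [G1, G6, G1], R5), ([P9, P18, P20], [G6, G3, G6],
  R6), ([P10, P12, P25], [G2, G0, G2], R6), ([P10, P13, P23], [G4, G6], R6), ([P10, P17, P20],
  [], R7), ([P11, P12, P24], [G6, G3, G4], R6), ([P11, P13, P22], [G1, G6], R6), ([P11, P14,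
  P21], [G0, G0], R7)]"
  | "steps R3 = [([P6, P16, P25], [G4, G6, G7], R5), ([P6, P19, P21], [], R8), ([P7, P13, P26],
  [G7, G4], R5), ([P7, P14, P25], [], R9), ([P7, P19, P20], [G4, G0, G0], R5), ([P8, P16, P23],
  [G1, G3, G3], R6), ([P8, P17, P22], [G5, G5], R8), ([P9, P12, P26], [G7, G4, G1], R8), ([P9,
  P14, P23], [G2, G6], R5), ([P10, P12, P25], [G7, G7, G5], R5), ([P10, P13, P23], [], R10),
  ([P10, P17, P20], [G5, G5], R6), ([P11, P13, P22], [G1, G6, G0, G0], R6), ([P11, P14, P21],
  [G3, G5, G6], R5), ([P11, P16, P20], [G7, G4, G1], R10)]"
  | "steps R4 = [([P5, P18, P24], [G7, G4, G1], R10), ([P5, P19, P22], [G1, G2], R10), ([P6,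
  P17, P24], [G4, G3], R10), ([P6, P19, P21], [G7, G1], R10), ([P7, P13, P26], [G5, G1, G2],
  R10), ([P7, P14, P25], [G6, G5], R10), ([P8, P17, P22], [G4, G6, G6], R10), ([P8, P18, P21],
  [G5, G1, G0], R10), ([P9, P12, P26], [G2, G4, G2], R10), ([P9, P14, P23], [G3], R10), ([P10,
  P12, P25], [G1, G0], R10), ([P10, P13, P23], [G6, G6], R10)]"
  | "steps R5 = [([P7, P14, P25], [], R11), ([P7, P19, P20], [], R12), ([P8, P18, P21], [G2,
  G6, G1, G7], R12), ([P9, P14, P23], [], R13), ([P9, P18, P20], [], R14), ([P10, P12, P25],
  [G6, G3, G4], R12), ([P10, P13, P23], [G6, G3, G4], R14), ([P11, P13, P22], [G1, G6, G0, G0],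
  R12), ([P11, P14, P21], [], R15)]"
  | "steps R6 = [([P7, P14, P25], [G0, G0], R12), ([P8, P17, P22], [G1], R12), ([P9, P14, P23],
  [G3, G6, G1], R14), ([P9, P18, P20], [], R16), ([P10, P12, P25], [G3, G4, G1], R15), ([P10,
  P13, P23], [], R17), ([P10, P17, P20], [G2, G5, G0], R15), ([P11, P12, P24], [G1, G0, G0],
  R16), ([P11, P13, P22], [G3, G3, G2], R14)]"
  | "steps R7 = [([P6, P19, P21], [G2, G5, G0], R15), ([P7, P14, P25], [G0, G0], R15), ([P8,
  P18, P21], [G5, G5], R15), ([P9, P14, P23], [G1, G6, G1], R15), ([P11, P12, P24], [G0, G2,
  G5], R15), ([P11, P13, P22], [G1, G1, G7, G2], R15), ([P11, P14, P21], [], R18)]"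
  | "steps R8 = [([P7, P13, P26], [G7, G4], R12), ([P7, P14, P25], [], R19), ([P8, P16, P23],
  [G0, G3, G4], R12), ([P8, P17, P22], [G6], R19), ([P9, P12, P26], [], R20), ([P9, P14, P23],
  [G4, G5, G7], R12), ([P10, P12, P25], [G7, G7, G5], R12), ([P10, P13, P23], [G5, G6, G2],
  R17), ([P10, P17, P20], [G5, G5, G1], R12), ([P11, P13, P22], [G1, G6, G4], R12), ([P11, P16,
  P20], [G3, G0], R20)]"
  | "steps R9 = [([P6, P19, P21], [], R19), ([P8, P16, P23], [G1, G3, G3], R17), ([P8, P17,
  P22], [G0, G0, G2, G6], R17), ([P9, P12, P26], [G4], R19), ([P10, P13, P23], [G3, G0, G2],
  R17), ([P10, P17, P20], [G6, G5], R17), ([P11, P13, P22], [G7, G3, G3], R17), ([P11, P16,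
  P20], [G0, G2, G0], R17)]"
  | "steps R10 = [([P6, P16, P25], [G4, G6, G7], R13), ([P6, P19, P21], [G5, G6, G2], R17),
  ([P7, P14, P25], [G3, G0, G2], R17), ([P7, P19, P20], [G6, G1], R13), ([P8, P17, P22], [G5,
  G5], R20), ([P9, P12, P26], [G0, G3, G1], R20), ([P11, P14, P21], [G3, G5, G6], R13), ([P11,
  P16, P20], [], R21)]"
  | "steps R11 = [([P8, P18, P21], [], R22), ([P9, P18, P20], [G0, G0], R22), ([P10, P13, P23],
  [G4, G2, G6], R22), ([P11, P13, P22], [G1, G2, G6], R22)]"
  | "steps R12 = [([P8, P18, P21], [], R23), ([P9, P14, P23], [], R24), ([P10, P12, P25], [G5,
  G4, G2], R23), ([P10, P13, P23], [G5, G4, G2], R22), ([P11, P13, P22], [], R25), ([P11, P14,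
  P21], [], R26)]"
  | "steps R13 = [([P7, P19, P20], [], R24), ([P8, P18, P21], [G0, G5, G0, G2], R24), ([P10,
  P12, P25], [G6, G3], R24), ([P11, P13, P22], [G1, G6, G1], R24)]"
  | "steps R14 = [([P7, P14, P25], [G0, G0], R22), ([P10, P12, P25], [G4, G7, G5], R22), ([P10,
  P13, P23], [], R27), ([P11, P13, P22], [G2, G1], R26), ([P11, P14, P21], [G2, G6, G2, G0],
  R27)]"
  | "steps R15 = [([P7, P19, P20], [], R26), ([P9, P18, P20], [G2, G6, G2, G0], R27), ([P10,
  P12, P25], [G0, G0, G5], R26), ([P10, P13, P23], [G0, G1, G5, G0], R27)]"
  | "steps R16 = [([P7, P14, P25], [G0, G0], R23), ([P8, P17, P22], [G6, G7, G4], R23), ([P10,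
  P12, P25], [G0, G3, G1], R27), ([P10, P13, P23], [], R28), ([P11, P12, P24], [G6, G0, G7],
  R28), ([P11, P13, P22], [G3, G7, G2], R27)]"
  | "steps R17 = [([P7, P14, P25], [G0, G0], R25), ([P8, P17, P22], [G1], R25), ([P9, P18,
  P20], [], R28), ([P11, P12, P24], [G7, G1], R28)]"
  | "steps R18 = []"
  | "steps R19 = [([P8, P16, P23], [G0, G3, G4], R25), ([P8, P17, P22], [G4, G2, G6], R25),
  ([P9, P12, P26], [], R29), ([P10, P13, P23], [G2, G6, G5], R25), ([P10, P17, P20], [G2, G5,
  G0], R25), ([P11, P13, P22], [G3, G3], R25), ([P11, P16, P20], [G3, G5, G6], R25)]"
  | "steps R20 = [([P7, P14, P25], [], R29), ([P8, P16, P23], [G0, G3], R24), ([P8, P17, P22],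
  [G2, G1, G7], R25), ([P10, P13, P23], [G5, G6, G2], R28), ([P10, P17, P20], [G5, G5, G1],
  R24), ([P11, P13, P22], [G1, G6], R24), ([P11, P16, P20], [G6, G0, G7], R28)]"
  | "steps R21 = [([P6, P19, P21], [G4, G2], R28), ([P7, P14, P25], [G0, G2, G0], R28), ([P8,
  P17, P22], [G5, G2], R28), ([P9, P12, P26], [G6, G3, G6], R28)]"
  | "steps R22 = [([P10, P13, P23], [], R30), ([P11, P13, P22], [G5, G7], R30)]"
  | "steps R23 = [([P9, P14, P23], [], R31), ([P10, P12, P25], [], R32), ([P10, P13, P23], [G0,
  G5], R30), ([P11, P13, P22], [G7, G2], R32)]"
  | "steps R24 = [([P8, P18, P21], [], R31), ([P10, P12, P25], [G4], R31), ([P11, P13, P22],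
  [G2], R32)]"
  | "steps R25 = [([P8, P18, P21], [G7, G2], R32), ([P9, P14, P23], [G2], R32), ([P10, P12,
  P25], [G5, G2], R32)]"
  | "steps R26 = [([P10, P12, P25], [G6, G5], R30), ([P10, P13, P23], [G6, G1], R30)]"
  | "steps R27 = [([P7, P14, P25], [G3, G3], R30), ([P11, P14, P21], [], R33)]"
  | "steps R28 = [([P7, P14, P25], [G2, G1, G5], R32), ([P8, P17, P22], [G0, G2, G2], R32),
  ([P11, P12, P24], [], R34)]"
  | "steps R29 = [([P8, P16, P23], [G0, G3, G2], R32), ([P8, P17, P22], [G5, G7], R32), ([P10,
  P13, P23], [G7, G4], R32), ([P10, P17, P20], [G2, G5, G5], R32), ([P11, P13, P22], [G0, G6],
  R32), ([P11, P16, P20], [G0, G0], R32)]"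
  | "steps R30 = []"
  | "steps R31 = [([P10, P12, P25], [], R35), ([P11, P13, P22], [G2, G6], R35)]"
  | "steps R32 = [([P9, P14, P23], [], R35), ([P11, P13, P22], [G6], R35)]"
  | "steps R33 = []"
  | "steps R34 = [([P7, P14, P25], [G7], R35), ([P8, P17, P22], [G0, G3], R35)]"
  | "steps R35 = [([P11, P13, P22], [], R36)]"
  | "steps R36 = []"

section \<open>Verification of the tables\<close>

lemma set_all_pt: "set all_pt = UNIV"
proof -
  have "x \<in> set all_pt" for x by (cases x) (simp_all add: all_pt_def)
  then show ?thesis by blast
qed

text \<open>Turns a statement about all points into an explicit conjunction that the simplifier can
  evaluate.\<close>

lemma all_pt_iff: "(\<forall>x. Q x) \<longleftrightarrow> list_all Q all_pt"
  using set_all_pt by (auto simp: list_all_iff)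

definition adjp :: "pt \<Rightarrow> pt \<Rightarrow> bool" where "adjp x y \<longleftrightarrow> y \<in> set (nb x)"

definition ipl :: "int list \<Rightarrow> int list \<Rightarrow> int" where
  "ipl p q = sum_list (map2 (*) p q)"

lemma ipl_simps [simp]: "ipl [] q = 0" "ipl (a # p) (b # q) = a * b + ipl p q"
  by (simp_all add: ipl_def)

lemma ipl_commute: "ipl p q = ipl q p"
  unfolding ipl_def by (induction p q rule: list_induct2') (simp_all add: mult.commute)

lemma ipl_vec_of: "ipl (vec_of x) (vec_of y) = (if x = y then 8 else if adjp x y then 4 else 0)"
proof -
  have "\<forall>x. \<forall>y. ipl (vec_of x) (vec_of y) = (if x = y then 8 else if adjp x y then 4 else 0)"
    unfolding all_pt_iff by (simp add: all_pt_def adjp_def)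
  then show ?thesis by blast
qed

lemma adjp_sym: "adjp x y \<longleftrightarrow> adjp y x"
proof -
  have e: "adjp x y \<longleftrightarrow> x \<noteq> y \<and> ipl (vec_of x) (vec_of y) = 4" for x y
  proof -
    have "\<not> adjp x x" by (cases x) (simp_all add: adjp_def)
    then show ?thesis using ipl_vec_of[of x y] by auto
  qed
  have "ipl (vec_of x) (vec_of y) = ipl (vec_of y) (vec_of x)" for x y
    by (rule ipl_commute)
  then show ?thesis using e by metis
qed

text \<open>Symmetries of the standard position: the vertex \<open>P0\<close> is distinguished in
  the class of four, whereas \<open>P1\<close>, \<open>P2\<close>, \<open>P3\<close> may be
  permuted.\<close>

definition aut :: "(pt \<Rightarrow> pt) \<Rightarrow> bool" where
  "aut s \<longleftrightarrow> inj s \<and> (\<forall>x y. adjp (s x) (s y) \<longleftrightarrow> adjp x y) \<and> s P0 = P0 \<and>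
     (\<forall>x\<in>{P1, P2, P3}. s x \<in> {P1, P2, P3})"

lemma inj_ptI: "distinct (map s all_pt) \<Longrightarrow> inj s"
  by (simp add: distinct_map set_all_pt)

lemma aut_gen: "aut (gen i)"
proof -
  have "distinct (map (gen i) all_pt)"
    by (cases i) (simp_all add: all_pt_def)
  moreover have "\<forall>x. \<forall>y. adjp (gen i x) (gen i y) \<longleftrightarrow> adjp x y"
    unfolding all_pt_iff by (cases i) (simp_all add: all_pt_def adjp_def)
  moreover have "gen i P0 = P0 \<and> (\<forall>x\<in>{P1, P2, P3}. gen i x \<in> {P1, P2, P3})"
    by (cases i) simp_all
  ultimately show ?thesis using inj_ptI by (auto simp: aut_def)
qed

lemma aut_id: "aut id"
  by (simp add: aut_def)

lemma aut_comp: "aut r \<Longrightarrow> aut s \<Longrightarrow> aut (r \<circ> s)"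
proof -
  assume r: "aut r" and s: "aut s"
  have "inj (r \<circ> s)" using r s by (simp add: aut_def inj_compose)
  moreover have "\<forall>x\<in>{P1, P2, P3}. (r \<circ> s) x \<in> {P1, P2, P3}"
  proof
    fix x assume "x \<in> {P1, P2, P3}"
    then have "s x \<in> {P1, P2, P3}" using s unfolding aut_def by blast
    then show "(r \<circ> s) x \<in> {P1, P2, P3}" using r unfolding aut_def o_apply by blast
  qed
  moreover have "\<forall>x y. adjp ((r \<circ> s) x) ((r \<circ> s) y) \<longleftrightarrow> adjp x y" "(r \<circ> s) P0 = P0"
    using r s by (simp_all add: aut_def)
  ultimately show ?thesis unfolding aut_def by blast
qed

primrec appw :: "gi list \<Rightarrow> pt \<Rightarrow> pt" where
  "appw [] x = x"
| "appw (g # w) x = appw w (gen g x)"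

lemma aut_appw: "aut (appw w)"
proof (induction w)
  case Nil
  have "appw [] = id" by auto
  then show ?case using aut_id by metis
next
  case (Cons g w)
  have eq: "appw (g # w) = appw w \<circ> gen g" by auto
  show ?case unfolding eq by (rule aut_comp[OF Cons aut_gen])
qed

text \<open>The triples described by adjacency alone, a form that symmetries and isomorphisms
  visibly preserve; \<open>tri_list\<close> enumerates them.\<close>

definition TRI :: "pt set set" where
  "TRI = {t. t \<subseteq> set (nb P0) \<and> card t = 3 \<and> (\<forall>x\<in>t. \<forall>y\<in>t. \<not> adjp x y) \<and>
     (\<forall>i\<in>{P1, P2, P3}. \<exists>x\<in>t. adjp i x)}"

text \<open>Goes through all choices of one neighbour each of \<open>P1\<close>, \<open>P2\<close>
  and \<open>P3\<close>.\<close>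

lemma tri_list_complete:
  "list_all (\<lambda>a. list_all (\<lambda>b. b \<in> set (nb a) \<or>
     list_all (\<lambda>c. c \<in> set (nb a) \<or> c \<in> set (nb b) \<or> [a, b, c] \<in> set tri_list) (nb P3)) (nb P2)) (nb P1)"
  by (simp add: tri_list_def)

lemma TRI_D:
  assumes "t \<in> TRI"
  shows "t \<subseteq> set (nb P0)" "card t = 3" "\<And>x y. x \<in> t \<Longrightarrow> y \<in> t \<Longrightarrow> \<not> adjp x y"
    "\<And>i. i \<in> {P1, P2, P3} \<Longrightarrow> \<exists>x\<in>t. adjp i x"
  using assms unfolding TRI_def mem_Collect_eq by blast+

text \<open>The neighbourhoods of \<open>P1\<close>, \<open>P2\<close>, \<open>P3\<close> are
  disjoint, so the three witnesses are distinct and exhaust the triple.\<close>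

lemma TRI_obtain:
  assumes "t \<in> TRI"
  obtains a b c where "t = {a, b, c}" "a \<in> set (nb P1)" "b \<in> set (nb P2)" "c \<in> set (nb P3)"
    "[a, b, c] \<in> set tri_list" "\<not> adjp a b" "\<not> adjp a c" "\<not> adjp b c"
proof -
  have t3: "card t = 3" and ind: "\<And>x y. x \<in> t \<Longrightarrow> y \<in> t \<Longrightarrow> \<not> adjp x y"
    and ex: "\<exists>x\<in>t. adjp P1 x" "\<exists>x\<in>t. adjp P2 x" "\<exists>x\<in>t. adjp P3 x"
    using assms by (simp_all add: TRI_def)
  obtain a b c where abc: "a \<in> t" "b \<in> t" "c \<in> t" "adjp P1 a" "adjp P2 b" "adjp P3 c"
    using ex by (elim bexE) (rule that)
  have ga: "a \<in> set (nb P1)" and gb: "b \<in> set (nb P2)" and gc: "c \<in> set (nb P3)"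
    using abc(4,5,6) unfolding adjp_def .
  have "set (nb P1) \<inter> set (nb P2) = {}" "set (nb P1) \<inter> set (nb P3) = {}" "set (nb P2) \<inter> set (nb P3) = {}"
    by simp_all
  then have ne: "a \<noteq> b" "a \<noteq> c" "b \<noteq> c" using ga gb gc by (metis IntI empty_iff)+
  have "finite t" using t3 by (metis card.infinite zero_neq_numeral)
  moreover have "{a, b, c} \<subseteq> t" using abc(1,2,3) by simp
  moreover have "card {a, b, c} = card t" using ne t3 by simp
  ultimately have t: "t = {a, b, c}" by (rule card_subset_eq[symmetric])
  have "b \<in> set (nb a) \<or> c \<in> set (nb a) \<or> c \<in> set (nb b) \<or> [a, b, c] \<in> set tri_list"
    using bspec[OF bspec[OF tri_list_complete[unfolded list_all_iff] ga] gb] gc by blast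
  then have "[a, b, c] \<in> set tri_list"
    using ind[OF abc(1,2)] ind[OF abc(1,3)] ind[OF abc(2,3)] unfolding adjp_def by blast
  then show thesis
    by (rule that[OF t ga gb gc _ ind[OF abc(1,2)] ind[OF abc(1,3)] ind[OF abc(2,3)]])
qed

lemma adjp_irrefl: "\<not> adjp x x"
  by (cases x) (simp_all add: adjp_def)

lemma TRI_intro:
  assumes abc: "a \<in> set (nb P1)" "b \<in> set (nb P2)" "c \<in> set (nb P3)"
    "\<not> adjp a b" "\<not> adjp a c" "\<not> adjp b c"
  shows "{a, b, c} \<in> TRI"
proof -
  have "set (nb P1) \<inter> set (nb P2) = {}" "set (nb P1) \<inter> set (nb P3) = {}" "set (nb P2) \<inter> set (nb P3) = {}"
    by simp_all
  then have ne: "a \<noteq> b" "a \<noteq> c" "b \<noteq> c" using abc(1,2,3) by (metis IntI empty_iff)+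
  have "set (nb P1) \<subseteq> set (nb P0)" "set (nb P2) \<subseteq> set (nb P0)" "set (nb P3) \<subseteq> set (nb P0)"
    by simp_all
  then have sub: "{a, b, c} \<subseteq> set (nb P0)" using abc(1,2,3) by (simp only: insert_subset) blast
  have c3: "card {a, b, c} = 3" using ne by simp
  have ind: "\<forall>x\<in>{a, b, c}. \<forall>y\<in>{a, b, c}. \<not> adjp x y"
    using abc(4,5,6) adjp_irrefl adjp_sym by blast
  have "\<forall>i\<in>{P1, P2, P3}. \<exists>x\<in>{a, b, c}. adjp i x"
    using abc(1,2,3) unfolding adjp_def by blast
  then show ?thesis using sub c3 ind unfolding TRI_def by blast
qed

definition tri_ok :: "pt list \<Rightarrow> bool" where
  "tri_ok t \<longleftrightarrow> (case t of [a, b, c] \<Rightarrow> a \<in> set (nb P1) \<and> b \<in> set (nb P2) \<and> c \<in> set (nb P3) \<and>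
     b \<notin> set (nb a) \<and> c \<notin> set (nb a) \<and> c \<notin> set (nb b) | _ \<Rightarrow> False)"

lemma tri_ok_TRI: "tri_ok t \<Longrightarrow> set t \<in> TRI"
proof -
  assume t: "tri_ok t"
  then obtain a b c where t_eq: "t = [a, b, c]" unfolding tri_ok_def by (simp split: list.split_asm)
  have "a \<in> set (nb P1) \<and> b \<in> set (nb P2) \<and> c \<in> set (nb P3) \<and>
     \<not> adjp a b \<and> \<not> adjp a c \<and> \<not> adjp b c"
    using t unfolding tri_ok_def t_eq adjp_def by (simp only: list.case simp_thms)
  then have "{a, b, c} \<in> TRI" by (elim conjE) (rule TRI_intro)
  then show ?thesis unfolding t_eq by (simp only: list.set)
qed

lemma dec_tri_ok: "list_all tri_ok (dec r)"
  by (cases r) (simp_all add: tri_ok_def)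

lemma TRI_aut: "aut s \<Longrightarrow> t \<in> TRI \<Longrightarrow> s ` t \<in> TRI"
proof -
  assume s: "aut s" and t: "t \<in> TRI"
  have inj: "inj s" and ad: "\<And>x y. adjp (s x) (s y) \<longleftrightarrow> adjp x y" and s0: "s P0 = P0"
    and q: "\<And>x. x \<in> {P1, P2, P3} \<Longrightarrow> s x \<in> {P1, P2, P3}"
    using s unfolding aut_def by blast+
  have "s ` {P1, P2, P3} = {P1, P2, P3}"
  proof (rule card_subset_eq)
    show "s ` {P1, P2, P3} \<subseteq> {P1, P2, P3}" using q by (rule image_subsetI)
    show "card (s ` {P1, P2, P3}) = card {P1, P2, P3}"
      by (rule card_image[OF inj_on_subset[OF inj subset_UNIV]])
  qed simp
  then have surj: "\<exists>j\<in>{P1, P2, P3}. s j = i" if "i \<in> {P1, P2, P3}" for i using that by (metis imageE)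
  have "\<exists>x\<in>s ` t. adjp i x" if i: "i \<in> {P1, P2, P3}" for i
  proof -
    obtain j where j: "j \<in> {P1, P2, P3}" "s j = i" using surj[OF i] by blast
    obtain x where x: "x \<in> t" "adjp j x" using TRI_D(4)[OF t j(1)] by blast
    have "adjp (s j) (s x)" using x(2) ad by simp
    then show ?thesis using x(1) j(2) by blast
  qed
  moreover have "s x \<in> set (nb P0)" if "x \<in> t" for x
  proof -
    have "adjp P0 x" using subsetD[OF TRI_D(1)[OF t] that] unfolding adjp_def .
    then have "adjp (s P0) (s x)" unfolding ad .
    then show ?thesis unfolding s0 adjp_def .
  qed
  then have "s ` t \<subseteq> set (nb P0)" by (rule image_subsetI)
  moreover have "card (s ` t) = 3"
    unfolding card_image[OF inj_on_subset[OF inj subset_UNIV]] by (rule TRI_D(2)[OF t])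
  moreover have "\<forall>x\<in>s ` t. \<forall>y\<in>s ` t. \<not> adjp x y" 
    unfolding ball_simps ad using TRI_D(3)[OF t] by blast
  ultimately show ?thesis unfolding TRI_def mem_Collect_eq by (intro conjI ballI) blast+
qed

text \<open>No disjoint triple is missing from \<open>steps\<close>. Together with
  \<open>steps_correct\<close> this certifies the table; there an inclusion of images is enough,
  because \<open>rep_step\<close> upgrades it to an equality by counting.\<close>

lemma steps_complete: "list_all (\<lambda>t. list_ex (\<lambda>x. x \<in> set (rep r)) t \<or> t \<in> set (map fst (steps r))) tri_list"
  by (cases r) (simp_all add: tri_list_def rep_def)

lemma steps_correct: "list_all (\<lambda>(t, w, j). length (rep j) = length (rep r) + 3 \<and>
    list_all (\<lambda>x. appw w x \<in> set (rep j)) (rep r @ t)) (steps r)"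
  by (cases r) (simp_all add: rep_def)

lemma distinct_rep: "distinct (rep r)"
  by (cases r) (simp_all add: rep_def)

lemma rep_step:
  assumes t: "t \<in> TRI" and dis: "t \<inter> set (rep r) = {}"
  shows "\<exists>s j. aut s \<and> s ` (set (rep r) \<union> t) = set (rep j) \<and> length (rep j) = length (rep r) + 3"
proof -
  obtain a b c where abc: "t = {a, b, c}" "[a, b, c] \<in> set tri_list" using t by (rule TRI_obtain)
  have "\<not> list_ex (\<lambda>x. x \<in> set (rep r)) [a, b, c]" using dis abc(1) by auto
  then have "[a, b, c] \<in> fst ` set (steps r)"
    using steps_complete[of r] abc(2) unfolding list_all_iff by auto
  then obtain w j where wj: "([a, b, c], w, j) \<in> set (steps r)" by force
  then have c: "length (rep j) = length (rep r) + 3" "\<And>x. x \<in> set (rep r @ [a, b, c]) \<Longrightarrow> appw w x \<in> set (rep j)"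
    using steps_correct[of r] unfolding list_all_iff by auto
  have sub: "appw w ` (set (rep r) \<union> t) \<subseteq> set (rep j)" using c(2) abc(1) by auto
  have inj: "inj (appw w)" using aut_appw by (simp add: aut_def)
  have t3: "card t = 3" using t by (simp add: TRI_def)
  have "card (appw w ` (set (rep r) \<union> t)) = card (set (rep r) \<union> t)"
    using inj by (simp add: card_image inj_on_subset)
  also have "\<dots> = length (rep r) + 3"
    using dis t3 distinct_card[OF distinct_rep[of r]]
    by (subst card_Un_disjoint) (auto simp: abc(1))
  also have "\<dots> = card (set (rep j))" using c(1) distinct_card[OF distinct_rep[of j]] by simp
  finally have "appw w ` (set (rep r) \<union> t) = set (rep j)" using sub by (intro card_subset_eq) auto
  then show ?thesis using aut_appw c(1) by blast
qed

section \<open>The 56 vectors and their reflections\<close>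

text \<open>The flag \<open>s\<close> selects b_ij rather than a_ij; coordinates are numbered from
  0.\<close>

definition vecl :: "bool \<Rightarrow> nat \<Rightarrow> nat \<Rightarrow> int list" where
  "vecl s i j = map (\<lambda>k. if k = i \<or> k = j then (if s then - 1 else 2) else (if s then 1 else 0)) [0..<8]"

definition P56 :: "int list list" where
  "P56 = concat (map (\<lambda>s. concat (map (\<lambda>i. map (vecl s i) [Suc i..<8]) [0..<8])) [False, True])"

text \<open>Simple roots of the system E7 that consists of the roots orthogonal to the all-one
  vector: a chain of six differences and one branch. Reflections in them preserve coordinate sums
  and permute the 56 vectors.\<close>

definition S7 :: "int list list" where
  "S7 = [[0, 2, - 2, 0, 0, 0, 0, 0],
    [0, 0, 2, - 2, 0, 0, 0, 0],
    [0, 0, 0, 2, - 2, 0, 0, 0],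
    [0, 0, 0, 0, 2, - 2, 0, 0],
    [0, 0, 0, 0, 0, 2, - 2, 0],
    [0, 0, 0, 0, 0, 0, 2, - 2],
    [1, - 1, - 1, - 1, - 1, 1, 1, 1]]"

text \<open>A linear functional that is positive on all of \<open>S7\<close>. Reflecting in
  \<open>s\<close> a vector with negative inner product with \<open>s\<close> therefore raises
  it.\<close>

definition height :: "int list \<Rightarrow> int" where
  "height p = ipl p [40, 13, 11, 9, 7, 5, 3, 1]"

text \<open>The usual reflection, as \<open>s\<close> has squared norm 8; the division is exact on
  \<open>P56\<close> by \<open>S7_P56\<close>.\<close>

definition refl :: "int list \<Rightarrow> int list \<Rightarrow> int list" where
  "refl s v = map2 (\<lambda>a b. a - (ipl v s div 4) * b) v s"

lemma ipl_map2:
  assumes "length u = length s" "length v = length s"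
  shows "ipl (map2 (\<lambda>a b. a - c * b) u s) (map2 (\<lambda>a b. a - d * b) v s)
    = ipl u v - d * ipl u s - c * ipl s v + c * d * ipl s s"
  using assms(1) assms(2)[symmetric]
  by (induction u s v rule: list_induct3) (auto simp: algebra_simps)

text \<open>Literal vectors, on which all later checks over \<open>P56\<close> are
  evaluated.\<close>

lemma P56_explicit: "P56 = [[2, 2, 0, 0, 0, 0, 0, 0],
    [2, 0, 2, 0, 0, 0, 0, 0],
    [2, 0, 0, 2, 0, 0, 0, 0],
    [2, 0, 0, 0, 2, 0, 0, 0],
    [2, 0, 0, 0, 0, 2, 0, 0],
    [2, 0, 0, 0, 0, 0, 2, 0],
    [2, 0, 0, 0, 0, 0, 0, 2],
    [0, 2, 2, 0, 0, 0, 0, 0],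
    [0, 2, 0, 2, 0, 0, 0, 0],
    [0, 2, 0, 0, 2, 0, 0, 0],
    [0, 2, 0, 0, 0, 2, 0, 0],
    [0, 2, 0, 0, 0, 0, 2, 0],
    [0, 2, 0, 0, 0, 0, 0, 2],
    [0, 0, 2, 2, 0, 0, 0, 0],
    [0, 0, 2, 0, 2, 0, 0, 0],
    [0, 0, 2, 0, 0, 2, 0, 0],
    [0, 0, 2, 0, 0, 0, 2, 0],
    [0, 0, 2, 0, 0, 0, 0, 2],
    [0, 0, 0, 2, 2, 0, 0, 0],
    [0, 0, 0, 2, 0, 2, 0, 0],
    [0, 0, 0, 2, 0, 0, 2, 0],
    [0, 0, 0, 2, 0, 0, 0, 2],
    [0, 0, 0, 0, 2, 2, 0, 0],
    [0, 0, 0, 0, 2, 0, 2, 0],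
    [0, 0, 0, 0, 2, 0, 0, 2],
    [0, 0, 0, 0, 0, 2, 2, 0],
    [0, 0, 0, 0, 0, 2, 0, 2],
    [0, 0, 0, 0, 0, 0, 2, 2],
    [- 1, - 1, 1, 1, 1, 1, 1, 1],
    [- 1, 1, - 1, 1, 1, 1, 1, 1],
    [- 1, 1, 1, - 1, 1, 1, 1, 1],
    [- 1, 1, 1, 1, - 1, 1, 1, 1],
    [- 1, 1, 1, 1, 1, - 1, 1, 1],
    [- 1, 1, 1, 1, 1, 1, - 1, 1],
    [- 1, 1, 1, 1, 1, 1, 1, - 1],
    [1, - 1, - 1, 1, 1, 1, 1, 1],
    [1, - 1, 1, - 1, 1, 1, 1, 1],
    [1, - 1, 1, 1, - 1, 1, 1, 1],
    [1, - 1, 1, 1, 1, - 1, 1, 1],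
    [1, - 1, 1, 1, 1, 1, - 1, 1],
    [1, - 1, 1, 1, 1, 1, 1, - 1],
    [1, 1, - 1, - 1, 1, 1, 1, 1],
    [1, 1, - 1, 1, - 1, 1, 1, 1],
    [1, 1, - 1, 1, 1, - 1, 1, 1],
    [1, 1, - 1, 1, 1, 1, - 1, 1],
    [1, 1, - 1, 1, 1, 1, 1, - 1],
    [1, 1, 1, - 1, - 1, 1, 1, 1],
    [1, 1, 1, - 1, 1, - 1, 1, 1],
    [1, 1, 1, - 1, 1, 1, - 1, 1],
    [1, 1, 1, - 1, 1, 1, 1, - 1],
    [1, 1, 1, 1, - 1, - 1, 1, 1],
    [1, 1, 1, 1, - 1, 1, - 1, 1],
    [1, 1, 1, 1, - 1, 1, 1, - 1],
    [1, 1, 1, 1, 1, - 1, - 1, 1],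
    [1, 1, 1, 1, 1, - 1, 1, - 1],
    [1, 1, 1, 1, 1, 1, - 1, - 1]]"
  by (simp add: P56_def vecl_def upt_rec numeral_eq_Suc)

lemma P56_basic: "list_all (\<lambda>p. length p = 8 \<and> sum_list p = 4 \<and> ipl p p = 8 \<and> height p \<le> 500) P56"
  unfolding P56_explicit by (simp add: height_def)

lemma P56_length: "p \<in> set P56 \<Longrightarrow> length p = 8"
  using P56_basic unfolding list_all_iff by blast

lemma S7_basic: "s \<in> set S7 \<Longrightarrow> length s = 8 \<and> ipl s s = 8"
  by (auto simp: S7_def)

text \<open>Membership with short-circuit evaluation, since the simplifier evaluates both sides of a
  disjunction but only the condition of an \<open>if\<close>.\<close>

fun eql :: "int list \<Rightarrow> int list \<Rightarrow> bool" where
  "eql (a # p) (b # q) = (if a = b then eql p q else False)"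
| "eql [] [] = True"
| "eql p q = False"

fun meml :: "int list \<Rightarrow> int list list \<Rightarrow> bool" where
  "meml p [] = False"
| "meml p (q # qs) = (if eql p q then True else meml p qs)"

lemma eql_iff: "eql p q \<longleftrightarrow> p = q"
  by (induction p q rule: eql.induct) auto

lemma meml_iff: "meml p qs \<longleftrightarrow> p \<in> set qs"
  by (induction p qs rule: meml.induct) (auto simp: eql_iff)

lemma S7_P56: "list_all (\<lambda>s. list_all (\<lambda>p. if ipl p s = 0 then True else
    4 dvd ipl p s \<and> meml (refl s p) P56) P56) S7"
  unfolding P56_explicit by (simp add: S7_def refl_def)

definition isoP :: "(int list \<Rightarrow> int list) \<Rightarrow> bool" where
  "isoP f \<longleftrightarrow> (\<forall>p\<in>set P56. f p \<in> set P56) \<and> (\<forall>p\<in>set P56. \<forall>q\<in>set P56. ipl (f p) (f q) = ipl p q)"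

lemma isoP_comp: "isoP f \<Longrightarrow> isoP h \<Longrightarrow> isoP (f \<circ> h)"
  by (simp add: isoP_def)

lemma refl_orth: "length p = length s \<Longrightarrow> ipl p s = 0 \<Longrightarrow> refl s p = p"
  unfolding refl_def by (simp add: map2_map_map[symmetric] map_fst_zip case_prod_unfold)

lemma isoP_refl: "s \<in> set S7 \<Longrightarrow> isoP (refl s)"
proof -
  assume s: "s \<in> set S7"
  have d: "4 dvd ipl p s" "refl s p \<in> set P56" if "p \<in> set P56" for p
  proof -
    have p: "length p = length s" using P56_length[OF that] S7_basic[OF s] by simp
    have "if ipl p s = 0 then True else 4 dvd ipl p s \<and> meml (refl s p) P56"
      using S7_P56 s that unfolding list_all_iff by blast
    then show "4 dvd ipl p s" "refl s p \<in> set P56"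
      using refl_orth[OF p] that unfolding meml_iff by (auto split: if_splits)
  qed
  have "ipl (refl s p) (refl s q) = ipl p q" if p: "p \<in> set P56" and q: "q \<in> set P56" for p q
  proof -
    have l: "length p = length s" "length q = length s" using P56_length p q S7_basic[OF s] by auto
    obtain a b where ab: "ipl p s = 4 * a" "ipl q s = 4 * b" using d(1)[OF p] d(1)[OF q] by (auto elim!: dvdE)
    show ?thesis unfolding refl_def ipl_map2[OF l] using ab S7_basic[OF s] ipl_commute[of s q]
      by (simp add: algebra_simps)
  qed
  then show ?thesis using d(2) by (simp add: isoP_def)
qed

text \<open>Height ascent: unless it is \<open>c\<close>, a vector orthogonal to \<open>fx\<close>
  can be raised by a reflection in some element of \<open>S7\<close> orthogonal to
  \<open>fx\<close>, and such a reflection fixes \<open>fx\<close> pointwise. The number 500 is just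
  an upper bound for heights, which makes the induction measure a natural number.\<close>

lemma descend:
  assumes fx: "set fx \<subseteq> set P56" and c: "c \<in> set P56"
    and step: "list_all (\<lambda>p. if list_all (\<lambda>x. ipl p x = 0) fx then
      if p = c then True else
      list_ex (\<lambda>s. if list_all (\<lambda>x. ipl x s = 0) fx then height p < height (refl s p) else False) S7 else True) P56"
    and p: "p \<in> set P56" "\<And>x. x \<in> set fx \<Longrightarrow> ipl p x = 0"
  shows "\<exists>f. isoP f \<and> f p = c \<and> (\<forall>x\<in>set fx. f x = x)"
  using p
proof (induction "nat (500 - height p)" arbitrary: p rule: less_induct)
  case less
  show ?case
  proof (cases "p = c")
    case True
    then show ?thesis by (intro exI[of _ id]) (simp add: isoP_def)
  next
    case False
    then obtain s where s: "s \<in> set S7" "\<And>x. x \<in> set fx \<Longrightarrow> ipl x s = 0" "height p < height (refl s p)"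
    proof -
      have "if list_all (\<lambda>x. ipl p x = 0) fx then if p = c then True else
        list_ex (\<lambda>s. if list_all (\<lambda>x. ipl x s = 0) fx then height p < height (refl s p) else False) S7 else True"
        using step less.prems(1) unfolding list_all_iff[of _ P56] by blast
      moreover have "list_all (\<lambda>x. ipl p x = 0) fx" using less.prems(2) by (simp add: list_all_iff)
      ultimately have "list_ex (\<lambda>s. if list_all (\<lambda>x. ipl x s = 0) fx then height p < height (refl s p) else False) S7"
        using False by (simp only: if_True if_False)
      then show ?thesis using that by (auto simp: list_ex_iff list_all_iff split: if_splits)
    qed
    have iso: "isoP (refl s)" by (rule isoP_refl[OF s(1)])
    have P: "refl s p \<in> set P56" using iso less.prems(1) by (simp add: isoP_def)
    have fixed: "refl s x = x" if "x \<in> set fx" for x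
      using refl_orth[of x s] s(2)[OF that] P56_length[of x] S7_basic[OF s(1)] fx that by auto
    have orth: "ipl (refl s p) x = 0" if x: "x \<in> set fx" for x
    proof -
      have "ipl (refl s p) (refl s x) = ipl p x" using iso less.prems(1) fx x unfolding isoP_def by blast
      then show ?thesis using fixed[OF x] less.prems(2)[OF x] by simp
    qed
    have "height (refl s p) \<le> 500" using P56_basic P unfolding list_all_iff by blast
    then have "nat (500 - height (refl s p)) < nat (500 - height p)" using s(3) by simp
    then obtain f where f: "isoP f" "f (refl s p) = c" "\<forall>x\<in>set fx. f x = x"
      using less.hyps[OF _ P orth] by blast
    show ?thesis using isoP_comp[OF f(1) iso] f(2,3) fixed by (intro exI[of _ "f \<circ> refl s"]) simp
  qed
qed

lemma descend_0: "list_all (\<lambda>p. if list_all (\<lambda>x. ipl p x = 0) [] then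
    if p = vec_of P0 then True else
    list_ex (\<lambda>s. if list_all (\<lambda>x. ipl x s = 0) [] then height p < height (refl s p) else False) S7 else True) P56"
  unfolding P56_explicit by (simp add: S7_def refl_def height_def)

lemma descend_1: "list_all (\<lambda>p. if list_all (\<lambda>x. ipl p x = 0) [vec_of P0] then
    if p = vec_of P1 then True else
    list_ex (\<lambda>s. if list_all (\<lambda>x. ipl x s = 0) [vec_of P0] then height p < height (refl s p) else False) S7 else True) P56"
  unfolding P56_explicit by (simp add: S7_def refl_def height_def)

lemma descend_2: "list_all (\<lambda>p. if list_all (\<lambda>x. ipl p x = 0) [vec_of P0, vec_of P1] then
    if p = vec_of P2 then True else
    list_ex (\<lambda>s. if list_all (\<lambda>x. ipl x s = 0) [vec_of P0, vec_of P1] then height p < height (refl s p) else False) S7 else True) P56"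
  unfolding P56_explicit by (simp add: S7_def refl_def height_def)

text \<open>Four mutually orthogonal vectors of this kind sum to the constant vector 2, so three of
  them determine the fourth.\<close>

lemma descend_3: "list_all (\<lambda>p. list_all (\<lambda>x. ipl p x = 0) [vec_of P0, vec_of P1, vec_of P2] \<longrightarrow> p = vec_of P3) P56"
  unfolding P56_explicit by simp

text \<open>Locates the vertices outside the class of four: they are adjacent to \<open>P0\<close>
  and to exactly one further member of that class.\<close>

lemma remaining: "list_all (\<lambda>p. ipl p (vec_of P0) = 4 \<and> list_all (\<lambda>x. ipl p (vec_of x) = 0 \<or> ipl p (vec_of x) = 4) [P1, P2, P3] \<and>
     length (filter (\<lambda>x. ipl p (vec_of x) = 4) [P1, P2, P3]) = 1 \<longrightarrow> list_ex (\<lambda>x. p = vec_of x) (nb P0)) P56"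
  unfolding P56_explicit by simp

lemma quad_P56: "vec_of P0 \<in> set P56" "vec_of P1 \<in> set P56" "vec_of P2 \<in> set P56" "vec_of P3 \<in> set P56"
  unfolding P56_explicit by simp_all

text \<open>The class is moved one vector at a time by isometries that fix the vectors already
  placed; the last vector then has no choice.\<close>

lemma quad_canonical:
  assumes q: "q0 \<in> set P56" "q1 \<in> set P56" "q2 \<in> set P56" "q3 \<in> set P56"
    and o: "ipl q1 q0 = 0" "ipl q2 q0 = 0" "ipl q3 q0 = 0" "ipl q2 q1 = 0" "ipl q3 q1 = 0" "ipl q3 q2 = 0"
  shows "\<exists>f. isoP f \<and> f q0 = vec_of P0 \<and> f q1 = vec_of P1 \<and> f q2 = vec_of P2 \<and> f q3 = vec_of P3"
proof -
  obtain f where f: "isoP f" "f q0 = vec_of P0"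
    using descend[OF _ quad_P56(1) descend_0 q(1)] by auto
  have i: "ipl (f p) (f p') = ipl p p'" "f p \<in> set P56" if "p \<in> set P56" "p' \<in> set P56" for p p'
    using f(1) that unfolding isoP_def by blast+
  have a: "f q1 \<in> set P56" "ipl (f q1) (vec_of P0) = 0" using i[OF q(2,1)] o f(2) by auto
  have sub1: "set [vec_of P0] \<subseteq> set P56" using quad_P56 by simp
  obtain h where h: "isoP h" "h (f q1) = vec_of P1" "h (vec_of P0) = vec_of P0"
    using descend[OF sub1 quad_P56(2) descend_1 a(1)] a(2) by auto
  have fh: "isoP (h \<circ> f)" by (rule isoP_comp[OF h(1) f(1)])
  have i2: "ipl (h (f p)) (h (f p')) = ipl p p'" "h (f p) \<in> set P56" if "p \<in> set P56" "p' \<in> set P56" for p p'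
    using fh that unfolding isoP_def o_apply by blast+
  have b: "h (f q2) \<in> set P56" "ipl (h (f q2)) (vec_of P0) = 0" "ipl (h (f q2)) (vec_of P1) = 0"
    using i2[OF q(3,1)] i2[OF q(3,2)] o f(2) h(2,3) by auto
  have sub2: "set [vec_of P0, vec_of P1] \<subseteq> set P56" using quad_P56 by simp
  obtain k where k: "isoP k" "k (h (f q2)) = vec_of P2" "k (vec_of P0) = vec_of P0" "k (vec_of P1) = vec_of P1"
    using descend[OF sub2 quad_P56(3) descend_2 b(1)] b(2,3) by auto
  have kk: "isoP (k \<circ> (h \<circ> f))" by (rule isoP_comp[OF k(1) fh])
  let ?m = "k \<circ> (h \<circ> f)"
  have m: "?m q0 = vec_of P0" "?m q1 = vec_of P1" "?m q2 = vec_of P2" using f h k by auto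
  have i3: "ipl (?m p) (?m p') = ipl p p'" "?m p \<in> set P56" if "p \<in> set P56" "p' \<in> set P56" for p p'
    using kk that unfolding isoP_def by blast+
  have "ipl (?m q3) (vec_of P0) = 0" "ipl (?m q3) (vec_of P1) = 0" "ipl (?m q3) (vec_of P2) = 0"
    using i3(1)[OF q(4,1)] i3(1)[OF q(4,2)] i3(1)[OF q(4,3)] o unfolding m by simp_all
  then have "?m q3 = vec_of P3" using descend_3 i3(2)[OF q(4,4)] unfolding list_all_iff list.set by blast
  then show ?thesis using kk m by blast
qed

subsection \<open>Representing graphs of the switching class\<close>

definition pair_vec :: "nat set \<Rightarrow> bool \<Rightarrow> int list" where
  "pair_vec e s = map (\<lambda>k. if k \<in> e then (if s then - 1 else 2) else (if s then 1 else 0)) [0..<8]"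

lemma pair_vec_P56:
  assumes "e \<subseteq> {0..<8}" "card e = 2"
  shows "pair_vec e s \<in> set P56"
proof -
  obtain i j where ij: "e = {i, j}" "i < j"
  proof -
    obtain a b where "e = {a, b}" "a \<noteq> b" using assms(2) by (auto simp: card_2_iff)
    then show thesis using that[of a b] that[of b a] by (cases "a < b") auto
  qed
  have "pair_vec e s = vecl s i j" unfolding pair_vec_def vecl_def ij(1) by simp
  moreover have "vecl s i j \<in> set P56"
  proof -
    have "vecl s i j \<in> set (map (vecl s i) [Suc i..<8])" using assms(1) ij by simp
    then have "vecl s i j \<in> set (concat (map (\<lambda>i. map (vecl s i) [Suc i..<8]) [0..<8]))"
      unfolding set_concat using assms(1) ij by (intro UN_I[of "map (vecl s i) [Suc i..<8]"]) auto
    then show ?thesis unfolding P56_def set_concat[of "map _ [False, True]"] by (cases s) simp_all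
  qed
  ultimately show ?thesis by simp
qed

lemma ipl_map_upt: "ipl (map a [0..<n]) (map b [0..<n]) = (\<Sum>k = 0..<n. a k * b k)"
  unfolding ipl_def by (simp add: zip_map_map zip_same_conv_map o_def interv_sum_list_conv_sum_set_nat)

text \<open>With \<open>s\<close> marking membership in the switching set, distinct edges on the
  same side get 4 when they meet, and edges on different sides get 4 when they are disjoint. This is
  adjacency in a switched line graph.\<close>

lemma ipl_pair_vec:
  assumes e: "e \<subseteq> {0..<8}" "card e = 2" and e': "e' \<subseteq> {0..<8}" "card e' = 2"
  shows "ipl (pair_vec e s) (pair_vec e' s') =
    (if s = s' then 4 * int (card (e \<inter> e')) else 4 - 4 * int (card (e \<inter> e')))"
proof -
  define x where "x f k = (if k \<in> f then 1 else 0 :: int)" for f :: "nat set" and k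
  have sx: "(\<Sum>k = 0..<8. x f k) = int (card f)" if "f \<subseteq> {0..<8}" for f
    using that by (simp add: x_def sum.If_cases Int_absorb1)
  have mx: "x e k * x e' k = x (e \<inter> e') k" for k by (simp add: x_def)
  \<comment> \<open>Writes \<open>pair_vec e s\<close> as the constant \<open>a s\<close> plus
    \<open>b s\<close> times the indicator of \<open>e\<close>, so that the product expands into
    cardinalities.\<close>
  define a where "a s = (if s then 1 else 0 :: int)" for s
  define b where "b s = (if s then - 2 else 2 :: int)" for s
  have "ipl (pair_vec e s) (pair_vec e' s') = (\<Sum>k = 0..<8. (a s + b s * x e k) * (a s' + b s' * x e' k))"
    unfolding pair_vec_def ipl_map_upt by (intro sum.cong) (auto simp: a_def b_def x_def)
  also have "\<dots> = (\<Sum>k = 0..<8::nat. a s * a s') + a s' * b s * (\<Sum>k = 0..<8. x e k)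
      + a s * b s' * (\<Sum>k = 0..<8. x e' k) + b s * b s' * (\<Sum>k = 0..<8. x (e \<inter> e') k)"
    unfolding mx[symmetric] sum_distrib_left sum.distrib[symmetric] by (intro sum.cong) (auto simp: algebra_simps)
  also have "\<dots> = 8 * (a s * a s') + 2 * (a s' * b s) + 2 * (a s * b s') + b s * b s' * int (card (e \<inter> e'))"
    using sx[of "e \<inter> e'"] sx[OF e(1)] sx[OF e'(1)] e e' by auto
  finally show ?thesis by (cases s; cases s') (simp_all add: a_def b_def)
qed

lemma card_Int_pairs:
  assumes "card e = 2" "card e' = 2"
  shows "card (e \<inter> e') = (if e = e' then 2 else if e \<inter> e' \<noteq> {} then 1 else 0)"
proof -
  have fin: "finite e" "finite e'" using assms by (metis card.infinite zero_neq_numeral)+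
  show ?thesis
  proof (cases "e = e'")
    case False
    have "card (e \<inter> e') \<noteq> 2"
    proof
      assume c2: "card (e \<inter> e') = 2"
      have "e \<inter> e' = e" by (rule card_subset_eq[OF fin(1)]) (use assms c2 in simp_all)
      moreover have "e \<inter> e' = e'" by (rule card_subset_eq[OF fin(2)]) (use assms c2 in simp_all)
      ultimately show False using False by blast
    qed
    moreover have "card (e \<inter> e') \<le> 2" using card_mono[OF fin(1), of "e \<inter> e'"] assms by auto
    moreover have "card (e \<inter> e') = 0 \<longleftrightarrow> e \<inter> e' = {}" using fin by simp
    ultimately show ?thesis using False by (auto simp: le_Suc_eq numeral_2_eq_2)
  qed (use assms in simp)
qed

lemma line_switch_arcs:
  "(e, e') \<in> parcs (seidel_switching (line_graph H) X) \<longleftrightarrow>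
    e \<in> edges H \<and> e' \<in> edges H \<and> e \<noteq> e' \<and> (e \<inter> e' \<noteq> {} \<longleftrightarrow> (e \<in> X \<longleftrightarrow> e' \<in> X))"
  by (auto simp: seidel_switching_def line_graph_def)

lemma edges_pair_graph:
  assumes "pair_graph H" "e \<in> edges H" shows "e \<subseteq> pverts H \<and> card e = 2"
proof -
  obtain u v where uv: "e = {u, v}" "(u, v) \<in> parcs H" using assms(2) by (auto simp: edges_def)
  have "u \<noteq> v" using uv(2) pair_graph_irrefl[OF assms(1)] by auto
  then show ?thesis using uv pair_graph_wf[OF assms(1) uv(2)] by auto
qed

text \<open>After numbering the eight vertices of \<open>H\<close> from 0, an edge \<open>ij\<close>
  is represented by a_ij outside \<open>X\<close> and by b_ij inside \<open>X\<close>.\<close>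

lemma in_S8_rep:
  assumes G: "pair_graph G" and S: "in_S8 G"
  shows "\<exists>g. \<forall>u\<in>pverts G. g u \<in> set P56 \<and>
    (\<forall>v\<in>pverts G. ipl (g u) (g v) = (if u = v then 8 else if (u, v) \<in> parcs G then 4 else 0))"
proof -
  obtain H :: "nat pair_pre_digraph" and X where H: "pair_graph H" "card (pverts H) = 8"
    and iso: "G \<simeq> seidel_switching (line_graph H) X"
    using S unfolding in_S8_def by blast
  let ?K = "seidel_switching (line_graph H) X"
  have VK: "pverts ?K = edges H" by (simp add: seidel_switching_def line_graph_def)
  have "parcs ?K \<subseteq> pverts ?K \<times> pverts ?K" unfolding VK using line_switch_arcs by auto
  then obtain f where f: "bij_betw f (pverts G) (edges H)"
    and arc: "\<And>u v. u \<in> pverts G \<Longrightarrow> v \<in> pverts G \<Longrightarrow> (u, v) \<in> parcs G \<longleftrightarrow> (f u, f v) \<in> parcs ?K"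
    using iso isomorphic_iff[OF G, of ?K] unfolding VK by blast
  obtain h where h: "bij_betw h (pverts H) {0..<8::nat}"
    using ex_bij_betw_finite_nat[OF pair_graph_finite[OF H(1)]] H(2) by auto
  have hinj: "inj_on h (pverts H)" using h by (simp add: bij_betw_def)
  define g where "g u = pair_vec (h ` f u) (f u \<in> X)" for u
  have fe: "f u \<in> edges H" if "u \<in> pverts G" for u using f that by (auto simp: bij_betw_def)
  have sub: "f u \<subseteq> pverts H" "card (f u) = 2" if "u \<in> pverts G" for u
    using edges_pair_graph[OF H(1) fe[OF that]] by auto
  have img: "h ` f u \<subseteq> {0..<8}" "card (h ` f u) = 2" if "u \<in> pverts G" for u
    using sub[OF that] h hinj by (auto simp: bij_betw_def card_image inj_on_subset)
  have "ipl (g u) (g v) = (if u = v then 8 else if (u, v) \<in> parcs G then 4 else 0)"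
    if uv: "u \<in> pverts G" "v \<in> pverts G" for u v
  proof -
    have "h ` f u \<inter> h ` f v = h ` (f u \<inter> f v)"
      using inj_on_image_Int[OF hinj sub(1)[OF uv(1)] sub(1)[OF uv(2)]] by simp
    then have "card (h ` f u \<inter> h ` f v) = card (f u \<inter> f v)"
      using card_image[OF inj_on_subset[OF hinj, of "f u \<inter> f v"]] sub(1)[OF uv(1)] by auto
    then have c: "card (h ` f u \<inter> h ` f v) = (if f u = f v then 2 else if f u \<inter> f v \<noteq> {} then 1 else 0)"
      using card_Int_pairs[OF sub(2)[OF uv(1)] sub(2)[OF uv(2)]] by simp
    have eq: "f u = f v \<longleftrightarrow> u = v" using f uv by (auto simp: bij_betw_def dest: inj_onD)
    show ?thesis
      unfolding g_def ipl_pair_vec[OF img[OF uv(1)] img[OF uv(2)]] c eq arc[OF uv] line_switch_arcs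
      using fe[OF uv(1)] fe[OF uv(2)] eq by auto
  qed
  moreover have "g u \<in> set P56" if "u \<in> pverts G" for u
    unfolding g_def by (rule pair_vec_P56[OF img[OF that]])
  ultimately show ?thesis by (intro exI[of _ g] ballI conjI)
qed

subsection \<open>The structure of the graphs under consideration\<close>

text \<open>An empty color could take over the vertices of the last color and thereby save one
  color.\<close>

lemma color_classes_nonempty:
  assumes G: "pair_graph G" and col: "proper_coloring G (chromatic_number G) c" and i: "i < chromatic_number G"
  shows "\<exists>v\<in>pverts G. c v = i"
proof (rule ccontr)
  assume no: "\<not> ?thesis"
  let ?k = "chromatic_number G"
  have c: "c v < ?k" if "v \<in> pverts G" for v using col that by (auto simp: proper_coloring_def)
  define c' where "c' v = (if c v = ?k - 1 then i else c v)" for v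
  have "proper_coloring G (?k - 1) c'"
    unfolding proper_coloring_def
  proof (intro conjI ballI; (clarify)?)
    fix v assume v: "v \<in> pverts G"
    then have "c v \<noteq> i" using no by blast
    then show "c' v < ?k - 1" using c[OF v] i by (auto simp: c'_def)
  next
    fix u v assume uv: "(u, v) \<in> parcs G" and eq: "c' u = c' v"
    then have V: "u \<in> pverts G" "v \<in> pverts G" using pair_graph_wf[OF G] by blast+
    have "c u \<noteq> c v" using col uv by (auto simp: proper_coloring_def)
    moreover have "c u \<noteq> i" "c v \<noteq> i" using no V by blast+
    ultimately show False using eq by (auto simp: c'_def split: if_splits)
  qed
  then have "?k \<le> ?k - 1" unfolding chromatic_number_def by (blast intro: Least_le)
  then show False using i by simp
qed


lemma chromatic_ge_3:
  assumes G: "pair_graph G" and col: "proper_coloring G k c" and nb: "\<not> bipartite G"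
  shows "3 \<le> k"
proof (rule ccontr)
  assume "\<not> 3 \<le> k"
  then have k: "k \<le> 2" by simp
  have "u \<in> {v. c v = 0} \<longleftrightarrow> v \<notin> {v. c v = 0}" if uv: "(u, v) \<in> parcs G" for u v
  proof -
    have V: "u \<in> pverts G" "v \<in> pverts G" using pair_graph_wf[OF G uv] by auto
    have "c u < k" "c v < k" using col V unfolding proper_coloring_def by blast+
    moreover have "c u \<noteq> c v" using col uv unfolding proper_coloring_def by blast
    ultimately show ?thesis using k by auto
  qed
  then show False using nb unfolding bipartite_def by blast
qed

text \<open>The difference of the indicators of two adjacent vertices has Rayleigh quotient
  -1.\<close>

lemma lambda_min_neg:
  assumes G: "pair_graph G" and uv: "(u, v) \<in> parcs G"
  shows "lambda_min G \<le> - 1"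
proof -
  have V: "u \<in> pverts G" "v \<in> pverts G" using pair_graph_wf[OF G uv] by auto
  have ne: "u \<noteq> v" using uv pair_graph_irrefl[OF G] by auto
  note fin = pair_graph_finite[OF G]
  define z where "z w = (if w = u then 1 else 0) - (if w = v then 1 else 0 :: real)" for w
  have zs: "(\<Sum>w\<in>pverts G. z w * y w) = y u - y v" for y
  proof -
    have "(\<Sum>w\<in>pverts G. z w * y w) = (\<Sum>w\<in>pverts G. (if w = u then y w else 0) - (if w = v then y w else 0))"
      by (intro sum.cong) (auto simp: z_def)
    then show ?thesis using fin V by (simp add: sum_subtractf)
  qed
  have nz: "nbsum G z w = adj G w u - adj G w v" for w
    using zs[of "adj G w"] unfolding nbsum_def by (simp add: mult.commute)
  have "bil (adj G) (pverts G) z z = - 2"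
    unfolding bil_adj zs nz using uv pair_graph_sym[OF G, of u v] pair_graph_irrefl[OF G] by (simp add: adj_def)
  moreover have "sqn G z = 2" using zs[of z] ne unfolding sqn_def power2_eq_square by (simp add: z_def)
  ultimately show ?thesis using lambda_min_bound[OF G, of z] V by auto
qed

lemma ip_nth: "length p = 8 \<Longrightarrow> length q = 8 \<Longrightarrow> ip (nth p) (nth q) = ipl p q"
proof -
  assume l: "length p = 8" "length q = 8"
  have e: "map (nth p) [0..<8] = p" "map (nth q) [0..<8] = q" using l map_nth[of p] map_nth[of q] by simp_all
  have "ip (nth p) (nth q) = ipl (map (nth p) [0..<8]) (map (nth q) [0..<8])"
    unfolding ipl_map_upt ip_def lessThan_atLeast0 by (rule refl)
  then show ?thesis unfolding e .
qed

lemma vec_of_eq_iff: "vec_of x = vec_of y \<longleftrightarrow> x = y"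
proof
  assume "vec_of x = vec_of y"
  then have "ipl (vec_of x) (vec_of y) = 8" using ipl_vec_of[of y y] by simp
  then show "x = y" using ipl_vec_of[of x y] by (auto split: if_splits)
qed simp

text \<open>Stated for an arbitrary optimal coloring, because chromatic components refer to all of
  them.\<close>

lemma class_embedding:
  assumes G: "pair_graph G" and nh: "nontrivially_hoffman_colorable G" and ex: "exceptional G"
    and S8: "in_S8 G" and irr: "irregular G"
    and col: "proper_coloring G (chromatic_number G) c"
  shows "3 \<le> chromatic_number G \<and> (\<exists>f. inj_on f (pverts G) \<and>
    (\<forall>u\<in>pverts G. \<forall>v\<in>pverts G. (u, v) \<in> parcs G \<longleftrightarrow> adjp (f u) (f v)) \<and>
    (\<exists>q<chromatic_number G. f ` {v \<in> pverts G. c v = q} = {P0, P1, P2, P3} \<and>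
       (\<forall>i<chromatic_number G. i \<noteq> q \<longrightarrow> f ` {v \<in> pverts G. c v = i} \<in> TRI)))"
proof -
  let ?V = "pverts G" and ?k = "chromatic_number G"
  have con: "Digraph_Component.connected (with_proj G)" and ngl: "\<not> generalized_line_graph G"
    using ex by (simp_all add: exceptional_def)
  have nb: "\<not> bipartite G" and arcs: "parcs G \<noteq> {}"
    and hof: "real ?k = 1 - lambda_max G / lambda_min G"
    using nh by (simp_all add: nontrivially_hoffman_colorable_def hoffman_colorable_def)
  have ne: "?V \<noteq> {}" using con unfolding connected_def strongly_connected_def by auto
  obtain u v where "(u, v) \<in> parcs G" using arcs by auto
  then have lneg: "lambda_min G \<le> - 1" by (rule lambda_min_neg[OF G])
  define t where "t = - lambda_min G"
  have tpos: "0 < t" using lneg by (simp add: t_def)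
  have eq: "lambda_max G + t = real ?k * t" unfolding hof using lneg by (simp add: t_def field_simps)
  obtain x where x: "\<And>v. v \<in> ?V \<Longrightarrow> 0 < x v" "\<And>v. v \<in> ?V \<Longrightarrow> nbsum G x v = lambda_max G * x v"
    using perron[OF G con] by blast
  have psd: "- t * sqn G z \<le> bil (adj G) ?V z z" for z
    using lambda_min_bound[OF G ne, of z] by (simp add: t_def)
  have k3: "3 \<le> ?k" by (rule chromatic_ge_3[OF G col nb])
  obtain g where g: "\<And>u. u \<in> ?V \<Longrightarrow> g u \<in> set P56"
    "\<And>u v. u \<in> ?V \<Longrightarrow> v \<in> ?V \<Longrightarrow> ipl (g u) (g v) = (if u = v then 8 else if (u, v) \<in> parcs G then 4 else 0)"
    using in_S8_rep[OF G S8] by blast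
  have len: "length (g u) = 8" "sum_list (g u) = 4" if "u \<in> ?V" for u
    using P56_basic g(1)[OF that] unfolding list_all_iff by blast+
  have rep: "root_rep G (\<lambda>u. nth (g u))"
    unfolding root_rep_def using g(2) ip_nth len(1) by simp
  have one: "(\<Sum>j<8. g u ! j) = 4" if "u \<in> ?V" for u
    using len[OF that] by (simp add: sum_list_sum_nth lessThan_atLeast0)
  have wt: "nbsum G (\<lambda>u. if c u = i then x u else 0) v = t * (if c v = i then 0 else x v)"
    if "v \<in> ?V" "i < ?k" for v i
    by (rule hoffman_equality[OF G col that x(2) psd eq])
  interpret hoffman_rep G ?k c x "\<lambda>u. nth (g u)" t "lambda_max G"
    by (rule hoffman_rep.intro)
      (fact G con rep one x(1) x(2) col color_classes_nonempty[OF G col] k3 tpos wt psd irr)+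
  have "t \<le> 2"
  proof -
    obtain y where y: "\<exists>v\<in>?V. y v \<noteq> 0" "\<And>v. v\<in>?V \<Longrightarrow> nbsum G y v = lambda_min G * y v"
      using lambda_min_eigen[OF G ne] by blast
    have "- 2 * sqn G y \<le> lambda_min G * sqn G y"
      using root_rep_psd[OF rep G, of y] bil_eigenfunction[OF y(2)] by simp
    moreover have "0 < sqn G y" using y(1) sqn_pos[OF pair_graph_finite[OF G]] by blast
    ultimately show ?thesis unfolding t_def using mult_right_le_imp_le[of "- 2" "sqn G y" "lambda_min G"] by simp
  qed
  moreover have "\<not> t < 2"
  proof
    assume "t < 2"
    then show False by (rule golden_contradiction) (rule ngl)
  qed
  ultimately have t2: "t = 2" by simp
  obtain q u0 where q: "q < ?k" and u0: "u0 \<in> cls q" and cq: "card (cls q) = 4"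
    and st0: "\<forall>i<?k. i \<noteq> q \<longrightarrow> card (cls i) = 3 \<and> nn u0 i = 3 \<and> (\<forall>v\<in>cls q - {u0}. nn v i = 1) \<and>
       (\<forall>r\<in>cls i. nn r q = 2) \<and> (\<forall>j<?k. j \<noteq> q \<longrightarrow> j \<noteq> i \<longrightarrow> (\<forall>r\<in>cls i. nn r j = 2))"
    using quad_trio_structure[OF t2] by (elim exE conjE) (rule that)
  have st: "card (cls i) = 3" "nn u0 i = 3" "\<And>v. v \<in> cls q - {u0} \<Longrightarrow> nn v i = 1" "\<And>r. r \<in> cls i \<Longrightarrow> nn r q = 2"
    if "i < ?k" "i \<noteq> q" for i
    using st0[rule_format, OF that] by simp_all
  have "card (cls q - {u0}) = 3" using cq u0 by simp
  then obtain v1 v2 v3 where v: "cls q - {u0} = {v1, v2, v3}" "v1 \<noteq> v2" "v1 \<noteq> v3" "v2 \<noteq> v3"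
    by (auto simp: card_3_iff)
  have clq: "cls q = {u0, v1, v2, v3}" using v(1) u0 by blast
  have dis: "u0 \<noteq> v1" "u0 \<noteq> v2" "u0 \<noteq> v3" using v(1) by blast+
  have qV: "u0 \<in> ?V" "v1 \<in> ?V" "v2 \<in> ?V" "v3 \<in> ?V" and qc: "c u0 = q" "c v1 = q" "c v2 = q" "c v3 = q"
    using clq by (auto simp: cls_def)
  have nadj: "(a, b) \<notin> parcs G" if "c a = c b" for a b using c_adj that by blast
  obtain h where h: "isoP h" "h (g u0) = vec_of P0" "h (g v1) = vec_of P1" "h (g v2) = vec_of P2" "h (g v3) = vec_of P3"
    using quad_canonical[OF g(1)[OF qV(1)] g(1)[OF qV(2)] g(1)[OF qV(3)] g(1)[OF qV(4)]]
      g(2) qV qc nadj v dis by auto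
  define p where "p w = h (g w)" for w
  have p56: "p w \<in> set P56" if "w \<in> ?V" for w using h(1) g(1)[OF that] by (simp add: isoP_def p_def)
  have pip: "ipl (p a) (p b) = (if a = b then 8 else if (a, b) \<in> parcs G then 4 else 0)"
    if "a \<in> ?V" "b \<in> ?V" for a b
    using h(1) g(1)[OF that(1)] g(1)[OF that(2)] g(2)[OF that] by (simp add: isoP_def p_def)
  have pq: "p u0 = vec_of P0" "p v1 = vec_of P1" "p v2 = vec_of P2" "p v3 = vec_of P3"
    using h by (simp_all add: p_def)
  have out: "\<exists>y\<in>set (nb P0). p r = vec_of y" if i: "i < ?k" "i \<noteq> q" and r: "r \<in> cls i" for i r
  proof -
    have rV: "r \<in> ?V" "c r = i" using r by (auto simp: cls_def)
    have rne: "r \<noteq> u0" "r \<noteq> v1" "r \<noteq> v2" "r \<noteq> v3" using rV qc i by auto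
    have "nbr u0 i = cls i" using nbr_full st(1,2)[OF i] by simp
    then have ru: "(r, u0) \<in> parcs G" using r by (auto simp: nbr_def intro: psym)
    have "nbr r q = insert u0 {w \<in> {v1, v2, v3}. (r, w) \<in> parcs G}"
      using ru unfolding nbr_def clq by auto
    moreover have "u0 \<notin> {w \<in> {v1, v2, v3}. (r, w) \<in> parcs G}" using dis by auto
    \<comment> \<open>The vertex \<open>r\<close> has two neighbours in the class of four, and
      \<open>u0\<close> is one of them.\<close>
    ultimately have "card {w \<in> {v1, v2, v3}. (r, w) \<in> parcs G} = 1"
      using st(4)[OF i r] by (simp add: nn_def)
    then obtain w where w: "{w \<in> {v1, v2, v3}. (r, w) \<in> parcs G} = {w}" by (auto simp: card_1_singleton_iff)
    have val: "ipl (p r) (vec_of P0) = 4" "ipl (p r) (vec_of P1) = (if (r, v1) \<in> parcs G then 4 else 0)"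
      "ipl (p r) (vec_of P2) = (if (r, v2) \<in> parcs G then 4 else 0)"
      "ipl (p r) (vec_of P3) = (if (r, v3) \<in> parcs G then 4 else 0)"
      unfolding pq[symmetric] using pip[OF rV(1) qV(1)] pip[OF rV(1) qV(2)] pip[OF rV(1) qV(3)] pip[OF rV(1) qV(4)]
        rne ru by simp_all
    have m: "(r, v1) \<in> parcs G \<longleftrightarrow> v1 = w" "(r, v2) \<in> parcs G \<longleftrightarrow> v2 = w" "(r, v3) \<in> parcs G \<longleftrightarrow> v3 = w"
      using w[unfolded set_eq_iff, rule_format, of v1] w[unfolded set_eq_iff, rule_format, of v2]
        w[unfolded set_eq_iff, rule_format, of v3] by simp_all
    have wv: "w = v1 \<or> w = v2 \<or> w = v3" using w[unfolded set_eq_iff, rule_format, of w] by simp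
    have w': "(w = v1 \<and> (r, v1) \<in> parcs G \<and> (r, v2) \<notin> parcs G \<and> (r, v3) \<notin> parcs G) \<or>
      (w = v2 \<and> (r, v1) \<notin> parcs G \<and> (r, v2) \<in> parcs G \<and> (r, v3) \<notin> parcs G) \<or>
      (w = v3 \<and> (r, v1) \<notin> parcs G \<and> (r, v2) \<notin> parcs G \<and> (r, v3) \<in> parcs G)"
      using wv v(2,3,4) unfolding m by (elim disjE) simp_all
    have "list_all (\<lambda>x. ipl (p r) (vec_of x) = 0 \<or> ipl (p r) (vec_of x) = 4) [P1, P2, P3]"
      by (simp add: val del: vec_of.simps)
    moreover have "length (filter (\<lambda>x. ipl (p r) (vec_of x) = 4) [P1, P2, P3]) = 1"
      using w' v(2,3,4) by (elim disjE conjE) (simp_all add: val del: vec_of.simps)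
    ultimately have "list_ex (\<lambda>x. p r = vec_of x) (nb P0)"
      using remaining p56[OF rV(1)] val(1) unfolding list_all_iff[of _ P56] by blast
    then show ?thesis unfolding list_ex_iff .
  qed
  have ex_pt: "\<exists>y. p w = vec_of y" if w: "w \<in> ?V" for w
  proof (cases "c w = q")
    case True
    then have "w \<in> {u0, v1, v2, v3}" using w clq by (auto simp: cls_def)
    then show ?thesis using pq by blast
  next
    case False
    moreover have "w \<in> cls (c w)" using w by (simp add: cls_def)
    ultimately show ?thesis using out[OF c_less[OF w], of w] by blast
  qed
  define f where "f w = (SOME y. p w = vec_of y)" for w
  have f: "p w = vec_of (f w)" if "w \<in> ?V" for w
    unfolding f_def by (rule someI_ex[OF ex_pt[OF that]])
  have adjf: "(a, b) \<in> parcs G \<longleftrightarrow> adjp (f a) (f b)" and feq: "f a = f b \<longleftrightarrow> a = b"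
    if ab: "a \<in> ?V" "b \<in> ?V" for a b
  proof -
    have e: "ipl (vec_of (f a)) (vec_of (f b)) = (if a = b then 8 else if (a, b) \<in> parcs G then 4 else 0)"
      using pip[OF ab] f[OF ab(1)] f[OF ab(2)] by simp
    show fe: "f a = f b \<longleftrightarrow> a = b" using e ipl_vec_of[of "f a" "f b"] by (auto split: if_splits)
    show "(a, b) \<in> parcs G \<longleftrightarrow> adjp (f a) (f b)"
    proof (cases "a = b")
      case True
      then show ?thesis using adjp_irrefl pair_graph_irrefl[OF G] by simp
    next
      case False
      then show ?thesis using e ipl_vec_of[of "f a" "f b"] fe by (auto split: if_splits)
    qed
  qed
  have fq: "f u0 = P0" "f v1 = P1" "f v2 = P2" "f v3 = P3"
    using f[OF qV(1)] f[OF qV(2)] f[OF qV(3)] f[OF qV(4)] unfolding pq vec_of_eq_iff by simp_all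
  have inj: "inj_on f ?V" using feq by (simp add: inj_on_def)
  have imq: "f ` cls q = {P0, P1, P2, P3}" unfolding clq using fq by simp
  have tri: "f ` cls i \<in> TRI" if i: "i < ?k" "i \<noteq> q" for i
    unfolding TRI_def mem_Collect_eq
  proof (intro conjI ballI)
    show "f ` cls i \<subseteq> set (nb P0)"
    proof
      fix y assume "y \<in> f ` cls i"
      then obtain r where r: "r \<in> cls i" "y = f r" by blast
      obtain z where z: "z \<in> set (nb P0)" "p r = vec_of z" using out[OF i r(1)] by blast
      have "f r = z" using f[of r] z(2) r(1) unfolding cls_def by (simp add: vec_of_eq_iff)
      then show "y \<in> set (nb P0)" using z(1) r(2) by simp
    qed
    have "inj_on f (cls i)" by (rule inj_on_subset[OF inj]) (auto simp: cls_def)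
    then show "card (f ` cls i) = 3" using st(1)[OF i] by (simp add: card_image)
  next
    fix a b assume "a \<in> f ` cls i" "b \<in> f ` cls i"
    then obtain a' b' where ab: "a' \<in> cls i" "b' \<in> cls i" "a = f a'" "b = f b'" by blast
    then have "(a', b') \<notin> parcs G" using nadj by (simp add: cls_def)
    then show "\<not> adjp a b" using adjf[of a' b'] ab by (simp add: cls_def)
  next
    fix y assume "y \<in> {P1, P2, P3}"
    then obtain w where w: "w \<in> {v1, v2, v3}" "f w = y" using fq by blast
    then have "nn w i = 1" using st(3)[OF i, of w] v(1) by blast
    then obtain r where "nbr w i = {r}" by (auto simp: nn_def card_1_singleton_iff)
    then have r: "r \<in> cls i" "(w, r) \<in> parcs G" by (auto simp: nbr_def)
    have "w \<in> ?V" using w(1) qV by blast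
    then have "adjp y (f r)" using adjf[of w r] r w(2) by (simp add: cls_def)
    then show "\<exists>x\<in>f ` cls i. adjp y x" using r(1) by blast
  qed
  show ?thesis
  proof (intro conjI exI[of _ f] exI[of _ q])
    show "3 \<le> ?k" by (rule k3)
    show "inj_on f ?V" by (rule inj)
    show "\<forall>u\<in>?V. \<forall>v\<in>?V. (u, v) \<in> parcs G \<longleftrightarrow> adjp (f u) (f v)" using adjf by blast
    show "q < ?k" by (rule q)
    show "f ` {v \<in> ?V. c v = q} = {P0, P1, P2, P3}" using imq unfolding cls_def .
    show "\<forall>i<?k. i \<noteq> q \<longrightarrow> f ` {v \<in> ?V. c v = i} \<in> TRI" using tri unfolding cls_def by blast
  qed
qed

subsection \<open>Auxiliary criteria\<close>

text \<open>In a generalized line graph a vertex is attached to at most two vertices of the root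
  graph, so two of three independent neighbours of \<open>u\<close> are attached at the same one.
  Being nonadjacent, these two have the same neighbours, but \<open>v1\<close> or \<open>v2\<close>
  separates them.\<close>

lemma not_generalized_line_graph:
  assumes G: "pair_graph G"
    and ur: "(u, r1) \<in> parcs G" "(u, r2) \<in> parcs G" "(u, r3) \<in> parcs G"
    and rr: "(r1, r2) \<notin> parcs G" "(r1, r3) \<notin> parcs G" "(r2, r3) \<notin> parcs G"
    and rv: "(r1, v1) \<in> parcs G" "(r2, v2) \<in> parcs G" "(r3, v3) \<in> parcs G"
    and nrv: "(r2, v1) \<notin> parcs G" "(r3, v1) \<notin> parcs G" "(r3, v2) \<notin> parcs G"
  shows "\<not> generalized_line_graph G"
proof
  assume "generalized_line_graph G"
  then obtain N :: "nat pair_pre_digraph" and a where N: "pair_graph N" and iso: "G \<simeq> gen_line_graph N a"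
    unfolding generalized_line_graph_def by blast
  let ?K = "gen_line_graph N a"
  have arcsK: "(x, y) \<in> parcs ?K \<longleftrightarrow> x \<in> pverts ?K \<and> y \<in> pverts ?K \<and> gen_line_adj x y" for x y
    unfolding gen_line_graph_def Let_def by simp
  have "parcs ?K \<subseteq> pverts ?K \<times> pverts ?K" using arcsK by auto
  then obtain f where f: "bij_betw f (pverts G) (pverts ?K)"
    and arc: "\<And>u v. u \<in> pverts G \<Longrightarrow> v \<in> pverts G \<Longrightarrow> (u, v) \<in> parcs G \<longleftrightarrow> (f u, f v) \<in> parcs ?K"
    using iso isomorphic_iff[OF G, of ?K] by blast
  have fV: "f v \<in> pverts ?K" if "v \<in> pverts G" for v using f that by (auto simp: bij_betw_def)
  have arc': "(u, v) \<in> parcs G \<longleftrightarrow> gen_line_adj (f u) (f v)" if "u \<in> pverts G" "v \<in> pverts G" for u v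
    using arc[OF that] arcsK fV that by blast
  have V: "u \<in> pverts G" "r1 \<in> pverts G" "r2 \<in> pverts G" "r3 \<in> pverts G" "v1 \<in> pverts G" "v2 \<in> pverts G" "v3 \<in> pverts G"
    using ur rv pair_graph_wf[OF G] by blast+
  \<comment> \<open>The attachment in the root graph: the ends of an edge, or the single vertex that
    carries a cocktail party graph.\<close>
  define sup :: "nat set + nat \<times> nat \<times> bool \<Rightarrow> nat set" where
    "sup x = (case x of Inl e \<Rightarrow> e | Inr y \<Rightarrow> {fst y})" for x
  have meet: "sup x \<inter> sup y \<noteq> {}" if "gen_line_adj x y" for x y
    using that by (induction x y rule: gen_line_adj.induct) (auto simp: sup_def)
  \<comment> \<open>Nonadjacent vertices with a common attachment are either equal or a nonadjacent
    pair of the same cocktail party graph.\<close>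
  have twins: "gen_line_adj x z \<longleftrightarrow> gen_line_adj y z"
    if "\<not> gen_line_adj x y" "i \<in> sup x" "i \<in> sup y" for x y z i
    using that
  proof (induction x y rule: gen_line_adj.induct)
    case (4 i' k s j l b)
    then have "i' = j" "k = l" by (auto simp: sup_def)
    then show ?case by (cases z) auto
  qed (auto simp: sup_def)
  have sup_e: "\<exists>a b. sup (f u) \<subseteq> {a, b}"
  proof (cases "f u")
    case (Inl e)
    then have "e \<in> edges N" using fV[OF V(1)] unfolding gen_line_graph_def Let_def by auto
    then have "card e = 2" using edges_pair_graph[OF N] by blast
    then obtain a b where "e = {a, b}" by (auto simp: card_2_iff)
    moreover have "sup (f u) = e" using Inl by (simp add: sup_def)
    ultimately show ?thesis by blast
  next
    case (Inr y)
    then show ?thesis by (auto simp: sup_def)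
  qed
  then obtain a b where ab: "sup (f u) \<subseteq> {a, b}" by blast
  obtain i1 where i1: "i1 \<in> sup (f u)" "i1 \<in> sup (f r1)" using meet ur(1) arc'[OF V(1,2)] by blast
  obtain i2 where i2: "i2 \<in> sup (f u)" "i2 \<in> sup (f r2)" using meet ur(2) arc'[OF V(1,3)] by blast
  obtain i3 where i3: "i3 \<in> sup (f u)" "i3 \<in> sup (f r3)" using meet ur(3) arc'[OF V(1,4)] by blast
  have "i1 \<in> {a, b}" "i2 \<in> {a, b}" "i3 \<in> {a, b}" using ab i1 i2 i3 by blast+
  then have "i1 = i2 \<or> i1 = i3 \<or> i2 = i3" by auto
  then show False
  proof (elim disjE)
    assume "i1 = i2"
    then show False using twins[of "f r1" "f r2" i1 "f v1"] i1 i2 rr(1) rv(1) nrv(1) arc' V by blast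
  next
    assume "i1 = i3"
    then show False using twins[of "f r1" "f r3" i1 "f v1"] i1 i3 rr(2) rv(1) nrv(2) arc' V by blast
  next
    assume "i2 = i3"
    then show False using twins[of "f r2" "f r3" i2 "f v2"] i2 i3 rr(3) rv(2) nrv(3) arc' V by blast
  qed
qed

lemma connectedI_center:
  assumes G: "pair_graph G" and u: "u \<in> pverts G"
    and near: "\<And>v. v \<in> pverts G \<Longrightarrow> v = u \<or> (v, u) \<in> parcs G \<or> (\<exists>r. (v, r) \<in> parcs G \<and> (r, u) \<in> parcs G)"
  shows "Digraph_Component.connected (with_proj G)"
proof -
  have eq: "parcs (mk_symmetric (with_proj G)) = parcs G"
    unfolding parcs_mk_symmetric using pair_graph_sym[OF G] by auto
  let ?R = "rtrancl_on (pverts G) (parcs G)"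
  have V: "x \<in> pverts G" "y \<in> pverts G" if "(x, y) \<in> parcs G" for x y using pair_graph_wf[OF G that] by auto
  have step: "(x, z) \<in> ?R" if "(x, y) \<in> ?R" "(y, z) \<in> parcs G" for x y z
    using that V by (meson rtrancl_on_into_rtrancl_on)
  have refl: "(x, x) \<in> ?R" if "x \<in> pverts G" for x using that by (rule rtrancl_on_refl)
  have to_u: "(v, u) \<in> ?R" if v: "v \<in> pverts G" for v
    using near[OF v] refl[OF v] step by blast
  have sym: "(y, x) \<in> parcs G" if "(x, y) \<in> parcs G" for x y using that pair_graph_sym[OF G] by blast
  have from_u: "(u, v) \<in> ?R" if v: "v \<in> pverts G" for v
    using near[OF v] refl[OF u] step sym by blast
  have "(v, w) \<in> ?R" if "v \<in> pverts G" "w \<in> pverts G" for v w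
    using to_u[OF that(1)] from_u[OF that(2)] by (rule rtrancl_on_trans)
  then show ?thesis
    unfolding connected_def strongly_connected_def reachable_def using u
    by (auto simp: eq)
qed

lemma vecl_E8:
  assumes "i < j" "j < 8"
  shows "vec_of_list (vecl s i j) \<in> E8_roots"
proof -
  have c: "vec_of_list (vecl s i j) \<in> carrier_vec 8"
    unfolding carrier_vec_def vecl_def mem_Collect_eq dim_vec_of_list length_map length_upt by simp
  have n: "vec_of_list (vecl s i j) $ k = (if k = i \<or> k = j then (if s then - 1 else 2) else (if s then 1 else 0))"
    if "k < 8" for k using that unfolding vec_of_list_index vecl_def by (subst nth_map_upt) simp_all
  show ?thesis
  proof (cases s)
    case True
    have "{k. k < 8 \<and> vec_of_list (vecl s i j) $ k = - 1} = {i, j}" using n True assms by (auto split: if_splits)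
    then have "even (card {k. k < 8 \<and> vec_of_list (vecl s i j) $ k = - 1})" using assms by simp
    then show ?thesis unfolding E8_roots_def using c n True by auto
  next
    case False
    have "\<exists>i'<8. \<exists>j'<8. i' \<noteq> j' \<and> vec_of_list (vecl s i j) $ i' \<in> {2, -2} \<and> vec_of_list (vecl s i j) $ j' \<in> {2, -2} \<and>
        (\<forall>k<8. k \<noteq> i' \<longrightarrow> k \<noteq> j' \<longrightarrow> vec_of_list (vecl s i j) $ k = 0)"
      using n False assms by (intro exI[of _ i] conjI exI[of _ j]) auto
    then show ?thesis unfolding E8_roots_def using c by blast
  qed
qed

lemma P56_cases:
  assumes "p \<in> set P56"
  obtains s i j where "i < j" "j < 8" "p = vecl s i j"
proof -
  have "\<exists>s\<in>set [False, True]. \<exists>i\<in>{0..<8}. \<exists>j\<in>{Suc i..<8}. p = vecl s i j"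
    using assms unfolding P56_def by (simp only: set_concat set_map set_upt UN_iff bex_simps image_iff)
  then obtain s i j where "i \<in> {0..<8}" "j \<in> {Suc i..<8}" "p = vecl s i j" by blast
  then show thesis by (intro that[of i j s]) simp_all
qed

lemma vec_of_P56: "vec_of x \<in> set P56"
proof -
  have "meml (vec_of x) P56" unfolding P56_explicit by (cases x) simp_all
  then show ?thesis unfolding meml_iff .
qed

lemma scalar_prod_ipl: "length p = length q \<Longrightarrow> vec_of_list p \<bullet> vec_of_list q = ipl p q"
  unfolding scalar_prod_def ipl_def
  by (simp add: sum_list_sum_nth vec_of_list_index)

section \<open>Graphs built from disjoint families of triples\<close>

instance pt :: finite
  by standard (metis set_all_pt List.finite_set)

definition quadp :: "pt set" where "quadp = {P0, P1, P2, P3}"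

definition Gam :: "pt set \<Rightarrow> pt pair_pre_digraph" where
  "Gam U = \<lparr> pverts = quadp \<union> U, parcs = {(x, y). x \<in> quadp \<union> U \<and> y \<in> quadp \<union> U \<and> adjp x y} \<rparr>"

lemma pair_graph_Gam: "pair_graph (Gam U)"
proof (rule pair_graphI)
  fix x y assume "(x, y) \<in> parcs (Gam U)"
  then have "x \<in> quadp \<union> U" "y \<in> quadp \<union> U" "adjp x y" by (simp_all add: Gam_def)
  moreover from this(3) have "adjp y x" by (simp only: adjp_sym[of y x])
  moreover have "x \<noteq> y" using \<open>adjp x y\<close> adjp_irrefl by blast
  ultimately show "x \<in> pverts (Gam U) \<and> y \<in> pverts (Gam U) \<and> x \<noteq> y \<and> (y, x) \<in> parcs (Gam U)"
    by (simp add: Gam_def)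
qed simp

definition fam :: "pt set set \<Rightarrow> bool" where
  "fam F \<longleftrightarrow> F \<subseteq> TRI \<and> disjoint F"

lemma fam_subset:
  assumes "fam F" "F' \<subseteq> F" shows "fam F'"
  unfolding fam_def
proof
  show "F' \<subseteq> TRI" using assms by (simp add: fam_def subset_trans)
  have "disjoint F" using assms(1) by (simp add: fam_def)
  then show "disjoint F'" using assms(2) by (rule pairwise_subset)
qed

lemma fam_disjoint: "fam F \<Longrightarrow> t \<in> F \<Longrightarrow> t' \<in> F \<Longrightarrow> x \<in> t \<Longrightarrow> x \<in> t' \<Longrightarrow> t = t'"
  unfolding fam_def disjoint_def by blast

lemma fam_TRI: "fam F \<Longrightarrow> t \<in> F \<Longrightarrow> t \<in> TRI"
  unfolding fam_def by blast

text \<open>The joining between two disjoint triples, read off point by point; it makes the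
  partition into triples equitable.\<close>

lemma tri_two: "list_all (\<lambda>t. list_all (\<lambda>x. if x \<in> set t then True else
    length (filter (\<lambda>y. y \<in> set (nb x)) t) = 2) (nb P0)) tri_list"
  by (simp add: tri_list_def)

lemma nb_quad: "list_all (\<lambda>x. x \<notin> quadp \<and> adjp x P0 \<and> length (filter (adjp x) [P1, P2, P3]) = 1) (nb P0)"
  by (simp add: quadp_def adjp_def)

lemma nbP0_not_quadp: "x \<in> set (nb P0) \<Longrightarrow> x \<notin> quadp"
  using nb_quad unfolding list_all_iff by blast

lemma quadp_indep: "x \<in> quadp \<Longrightarrow> y \<in> quadp \<Longrightarrow> \<not> adjp x y"
proof -
  have "list_all (\<lambda>x. list_all (\<lambda>y. \<not> adjp x y) [P0, P1, P2, P3]) [P0, P1, P2, P3]" by (simp add: adjp_def)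
  then show "x \<in> quadp \<Longrightarrow> y \<in> quadp \<Longrightarrow> \<not> adjp x y" unfolding list_all_iff quadp_def list.set by blast
qed

lemma distinct_tri_list: "list_all distinct tri_list"
  by (simp add: tri_list_def)

lemma TRI_nbrs_nb:
  assumes t: "t \<in> TRI" and x: "x \<in> set (nb P0)" "x \<notin> t"
  shows "card {y \<in> t. adjp x y} = 2"
proof -
  obtain a b c where abc: "t = {a, b, c}" "[a, b, c] \<in> set tri_list" using t by (rule TRI_obtain)
  have "length (filter (\<lambda>y. y \<in> set (nb x)) [a, b, c]) = 2"
  proof -
    have "if x \<in> set [a, b, c] then True else length (filter (\<lambda>y. y \<in> set (nb x)) [a, b, c]) = 2"
      by (rule bspec[OF bspec[OF tri_two[unfolded list_all_iff] abc(2)] x(1)])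
    moreover have "x \<notin> set [a, b, c]" using x(2) abc(1) by simp
    ultimately show ?thesis by (simp only: if_False)
  qed
  moreover have "distinct [a, b, c]" using distinct_tri_list abc(2) unfolding list_all_iff by blast
  then have "distinct (filter (\<lambda>y. y \<in> set (nb x)) [a, b, c])" by (rule distinct_filter)
  moreover have "set (filter (\<lambda>y. y \<in> set (nb x)) [a, b, c]) = {y \<in> t. adjp x y}"
    unfolding set_filter abc(1) adjp_def by simp
  ultimately show ?thesis by (metis distinct_card)
qed

lemma TRI_nbrs_P0: "t \<in> TRI \<Longrightarrow> {y \<in> t. adjp P0 y} = t"
  using TRI_D(1) unfolding adjp_def by blast

lemma TRI_nbrs_quad:
  assumes t: "t \<in> TRI" and i: "i \<in> {P1, P2, P3}"
  shows "card {y \<in> t. adjp i y} = 1"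
proof -
  obtain a b c where abc: "t = {a, b, c}" "a \<in> set (nb P1)" "b \<in> set (nb P2)" "c \<in> set (nb P3)"
    using t by (rule TRI_obtain)
  have d: "set (nb P1) \<inter> set (nb P2) = {}" "set (nb P1) \<inter> set (nb P3) = {}" "set (nb P2) \<inter> set (nb P3) = {}"
    by simp_all
  have "{y \<in> t. adjp P1 y} = {a}" "{y \<in> t. adjp P2 y} = {b}" "{y \<in> t. adjp P3 y} = {c}"
    unfolding abc(1) adjp_def using abc(2,3,4) d by blast+
  then show ?thesis using i by (elim insertE) simp_all
qed

lemma TRI_not_quadp: "t \<in> TRI \<Longrightarrow> x \<in> t \<Longrightarrow> x \<notin> quadp"
  using TRI_D(1) nbP0_not_quadp by blast

lemma sum_if_const: "finite A \<Longrightarrow> (\<Sum>y\<in>A. if Q y then (c::real) else 0) = real (card {y \<in> A. Q y}) * c"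
  by (simp add: sum.inter_filter[symmetric])

text \<open>The blocks \<open>{P0}\<close>, \<open>{P1, P2, P3}\<close> and the triples form an
  equitable partition, so neighbour sums of a block-constant function are again block-constant. The
  three formulas give all degrees and all eigenvectors needed below.\<close>

lemma fam_sum:
  fixes h :: "pt \<Rightarrow> real"
  assumes F: "fam F" and a: "h P0 = a" and b: "\<And>i. i \<in> {P1, P2, P3} \<Longrightarrow> h i = b"
    and e: "\<And>t y. t \<in> F \<Longrightarrow> y \<in> t \<Longrightarrow> h y = e t"
  defines "s x \<equiv> \<Sum>y\<in>quadp \<union> \<Union>F. if adjp x y then h y else 0"
  shows fam_sum_P0: "s P0 = 3 * sum e F"
    and fam_sum_quad: "i \<in> {P1, P2, P3} \<Longrightarrow> s i = sum e F"
    and fam_sum_tri: "t \<in> F \<Longrightarrow> x \<in> t \<Longrightarrow> s x = a + b + 2 * sum e (F - {t})"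
proof -
  have dis: "quadp \<inter> \<Union>F = {}" using TRI_not_quadp fam_TRI[OF F] by blast
  define q where "q x = (\<Sum>y\<in>quadp. if adjp x y then h y else 0)" for x
  have split: "s x = q x + (\<Sum>t\<in>F. real (card {y \<in> t. adjp x y}) * e t)" for x
  proof -
    have "s x = q x + (\<Sum>y\<in>\<Union>F. if adjp x y then h y else 0)"
      unfolding s_def q_def by (rule sum.union_disjoint) (use dis in simp_all)
    also have "(\<Sum>y\<in>\<Union>F. if adjp x y then h y else 0) = (\<Sum>t\<in>F. \<Sum>y\<in>t. if adjp x y then h y else 0)"
      by (subst sum.Union_disjoint) (use fam_disjoint[OF F] in \<open>auto\<close>)
    also have "\<dots> = (\<Sum>t\<in>F. \<Sum>y\<in>t. if adjp x y then e t else 0)"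
      by (intro sum.cong) (simp_all add: e)
    finally show ?thesis by (simp add: sum_if_const)
  qed
  have q0: "q x = 0" if "x \<in> quadp" for x
    unfolding q_def by (rule sum.neutral) (use quadp_indep that in auto)
  have qP: "q P0 = 0" by (rule q0) (simp add: quadp_def)
  show "s P0 = 3 * sum e F"
    unfolding split qP sum_distrib_left using TRI_nbrs_P0 TRI_D(2) fam_TRI[OF F] by (simp cong: sum.cong)
  show "s i = sum e F" if i: "i \<in> {P1, P2, P3}"
  proof -
    have "q i = 0" by (rule q0) (use i in \<open>auto simp: quadp_def\<close>)
    then show ?thesis unfolding split using TRI_nbrs_quad[OF _ i] fam_TRI[OF F] by (simp cong: sum.cong)
  qed
  show "s x = a + b + 2 * sum e (F - {t})" if t: "t \<in> F" and x: "x \<in> t"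
  proof -
    have xn: "x \<in> set (nb P0)" using TRI_D(1)[OF fam_TRI[OF F t]] x by blast
    have ax: "adjp x P0" and l1: "length (filter (adjp x) [P1, P2, P3]) = 1"
      using nb_quad xn unfolding list_all_iff by blast+
    have "q x = a + (b * length (filter (adjp x) [P1, P2, P3]))"
      unfolding q_def quadp_def using ax a b by simp
    then have qx: "q x = a + b" unfolding l1 by simp
    have "(\<Sum>t'\<in>F. real (card {y \<in> t'. adjp x y}) * e t')
        = real (card {y \<in> t. adjp x y}) * e t + (\<Sum>t'\<in>F - {t}. real (card {y \<in> t'. adjp x y}) * e t')"
      by (rule sum.remove) (use t in simp_all)
    also have "{y \<in> t. adjp x y} = {}" using TRI_D(3)[OF fam_TRI[OF F t] x] by blast
    also have "(\<Sum>t'\<in>F - {t}. real (card {y \<in> t'. adjp x y}) * e t') = (\<Sum>t'\<in>F - {t}. 2 * e t')"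
    proof (rule sum.cong[OF refl])
      fix t' assume t': "t' \<in> F - {t}"
      then have "x \<notin> t'" using fam_disjoint[OF F t _ x] by blast
      then have "card {y \<in> t'. adjp x y} = 2" using TRI_nbrs_nb[OF fam_TRI[OF F] xn] t' by blast
      then show "real (card {y \<in> t'. adjp x y}) * e t' = 2 * e t'" by simp
    qed
    finally show ?thesis unfolding split qx by (simp add: sum_distrib_left)
  qed
qed

text \<open>A graph on an arbitrary vertex type together with an identification \<open>f\<close>
  with the standard graph of the family \<open>F\<close>.\<close>

locale tri_model =
  fixes G :: "'a pair_pre_digraph" and f :: "'a \<Rightarrow> pt" and F :: "pt set set"
  assumes G: "pair_graph G" and bij: "bij_betw f (pverts G) (quadp \<union> \<Union>F)"
    and arc: "\<And>u v. u \<in> pverts G \<Longrightarrow> v \<in> pverts G \<Longrightarrow> (u, v) \<in> parcs G \<longleftrightarrow> adjp (f u) (f v)"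
    and fam: "fam F"
begin

lemma fV: "v \<in> pverts G \<Longrightarrow> f v \<in> quadp \<union> \<Union>F"
  using bij by (auto simp: bij_betw_def)

lemma inj: "inj_on f (pverts G)"
  using bij by (simp add: bij_betw_def)

lemma vertex: "x \<in> quadp \<union> \<Union>F \<Longrightarrow> \<exists>v\<in>pverts G. f v = x"
  using bij_betw_imp_surj_on[OF bij] by (metis imageE)

lemma nbsum_model:
  assumes "v \<in> pverts G"
  shows "nbsum G (h \<circ> f) v = (\<Sum>y\<in>quadp \<union> \<Union>F. if adjp (f v) y then h y else 0)"
proof -
  have "nbsum G (h \<circ> f) v = (\<Sum>u\<in>pverts G. if adjp (f v) (f u) then h (f u) else 0)"
    unfolding nbsum_def adj_def using arc[OF assms] by (intro sum.cong) auto
  also have "\<dots> = (\<Sum>y\<in>quadp \<union> \<Union>F. if adjp (f v) y then h y else 0)"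
    by (rule sum.reindex_bij_betw[OF bij])
  finally show ?thesis .
qed

lemma point_cases:
  assumes "v \<in> pverts G"
  obtains "f v = P0" | "f v \<in> {P1, P2, P3}" | t where "t \<in> F" "f v \<in> t"
  using fV[OF assms] unfolding quadp_def by blast

text \<open>Block-constant functions; the description operator finds the triple of \<open>y\<close>,
  which is unique because the family is disjoint.\<close>

definition blk :: "real \<Rightarrow> real \<Rightarrow> (pt set \<Rightarrow> real) \<Rightarrow> pt \<Rightarrow> real" where
  "blk a b e y = (if y = P0 then a else if y \<in> quadp then b else e (THE t. t \<in> F \<and> y \<in> t))"

lemma blk_tri: "t \<in> F \<Longrightarrow> y \<in> t \<Longrightarrow> blk a b e y = e t"
proof -
  assume t: "t \<in> F" "y \<in> t"
  have "(THE t. t \<in> F \<and> y \<in> t) = t" by (rule the_equality) (use t fam_disjoint[OF fam] in blast)+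
  moreover have "y \<notin> quadp" by (rule TRI_not_quadp[OF fam_TRI[OF fam t(1)] t(2)])
  moreover have "P0 \<in> quadp" by (simp add: quadp_def)
  ultimately show ?thesis unfolding blk_def by metis
qed

lemma blk_P0: "blk a b e P0 = a"
  by (simp add: blk_def)

lemma blk_quad: "i \<in> {P1, P2, P3} \<Longrightarrow> blk a b e i = b"
  by (auto simp: blk_def quadp_def)

lemmas blk_sums = fam_sum[where h = "blk a b e" and a = a and b = b and e = e,
  OF fam blk_P0 blk_quad blk_tri] for a b e

lemma nbsum_P0: "v \<in> pverts G \<Longrightarrow> f v = P0 \<Longrightarrow> nbsum G (blk a b e \<circ> f) v = 3 * sum e F"
  by (simp only: nbsum_model blk_sums(1))

lemma nbsum_quad: "v \<in> pverts G \<Longrightarrow> f v \<in> {P1, P2, P3} \<Longrightarrow> nbsum G (blk a b e \<circ> f) v = sum e F"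
  by (simp only: nbsum_model blk_sums(2))

lemma nbsum_tri: "v \<in> pverts G \<Longrightarrow> t \<in> F \<Longrightarrow> f v \<in> t \<Longrightarrow>
    nbsum G (blk a b e \<circ> f) v = a + b + 2 * sum e (F - {t})"
  by (simp only: nbsum_model) (rule blk_sums(3))

lemma degree_eq: "real (card {u. (u, v) \<in> parcs G}) = nbsum G (blk 1 1 (\<lambda>_. 1) \<circ> f) v" if v: "v \<in> pverts G"
proof -
  have one: "blk 1 1 (\<lambda>_. 1) y = 1" for y by (simp add: blk_def)
  have "{u. (u, v) \<in> parcs G} = {u. u \<in> pverts G \<and> (v, u) \<in> parcs G}"
    using pair_graph_wf[OF G] pair_graph_sym[OF G] by blast
  then show ?thesis by (simp add: nbsum_eq[OF pair_graph_finite[OF G]] one)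
qed

lemma degree_P0: "v \<in> pverts G \<Longrightarrow> f v = P0 \<Longrightarrow> card {u. (u, v) \<in> parcs G} = 3 * card F"
  using degree_eq[of v] nbsum_P0[of v] by (simp flip: of_nat_eq_iff[where 'a = real])

lemma degree_quad:
  assumes "v \<in> pverts G" "f v \<in> {P1, P2, P3}"
  shows "card {u. (u, v) \<in> parcs G} = card F"
proof -
  have "real (card {u. (u, v) \<in> parcs G}) = real (card F)"
    unfolding degree_eq[OF assms(1)] nbsum_quad[OF assms] by simp
  then show ?thesis by (simp only: of_nat_eq_iff)
qed

lemma degree_tri: "v \<in> pverts G \<Longrightarrow> t \<in> F \<Longrightarrow> f v \<in> t \<Longrightarrow> card {u. (u, v) \<in> parcs G} = 2 * card F"
proof -
  assume v: "v \<in> pverts G" "t \<in> F" "f v \<in> t"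
  have "0 < card F" using v(2) by (auto simp: card_gt_0_iff)
  then have "real (card (F - {t})) = real (card F) - 1" using v(2) by simp
  then have "real (card {u. (u, v) \<in> parcs G}) = real (2 * card F)"
    unfolding degree_eq[OF v(1)] nbsum_tri[OF v] by simp
  then show ?thesis by (simp only: of_nat_eq_iff)
qed

lemma nonempty: "pverts G \<noteq> {}"
  using vertex[of P0] by (auto simp: quadp_def)

text \<open>The values 3, 1 and 2 on the three kinds of blocks solve the quotient system with
  eigenvalue \<open>2 * card F\<close>.\<close>

lemma lambda_max_model:
  assumes k: "1 \<le> card F"
  shows "lambda_max G = 2 * card F"
    and "\<And>v. v \<in> pverts G \<Longrightarrow> nbsum G (blk 3 1 (\<lambda>_. 2) \<circ> f) v = 2 * card F * (blk 3 1 (\<lambda>_. 2) \<circ> f) v"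
proof -
  show ev: "nbsum G (blk 3 1 (\<lambda>_. 2) \<circ> f) v = 2 * card F * (blk 3 1 (\<lambda>_. 2) \<circ> f) v" if v: "v \<in> pverts G" for v
    using v
  proof (cases rule: point_cases)
    case 1
    then show ?thesis using nbsum_P0[OF v] by (simp add: blk_P0)
  next
    case 2
    then show ?thesis using nbsum_quad[OF v 2] by (simp add: blk_quad)
  next
    case (3 t)
    have "real (card (F - {t})) = real (card F) - 1" using 3(1) k by simp
    then show ?thesis using nbsum_tri[OF v 3] by (simp add: blk_tri[OF 3] algebra_simps)
  qed
  show "lambda_max G = 2 * card F"
    by (rule lambda_max_eqI[OF G nonempty _ ev]) (auto simp: blk_def)
qed

lemma model_psd: "- 2 * sqn G z \<le> bil (adj G) (pverts G) z z"
proof (rule root_rep_psd[OF _ G])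
  have len: "length (vec_of x) = 8" for x using P56_length[OF vec_of_P56] .
  show "root_rep G (\<lambda>v. nth (vec_of (f v)))"
    unfolding root_rep_def ip_nth[OF len len] ipl_vec_of using arc inj by (auto simp: inj_on_def)
qed

lemma lambda_min_model:
  assumes k: "1 \<le> card F"
  shows "lambda_min G = - 2"
proof -
  obtain t0 where t0: "t0 \<in> F" using k by fastforce
  \<comment> \<open>With the values 3 and 1 this is the eigenvector of
    \<open>lambda_max_model\<close> on the class of four minus its part on the triple
    \<open>t0\<close>. Such differences of color class parts are eigenvectors for the smallest
    eigenvalue in a Hoffman coloring.\<close>
  let ?e = "\<lambda>t. if t = t0 then - 2 else 0 :: real"
  have ev: "nbsum G (blk 3 1 ?e \<circ> f) v = - 2 * (blk 3 1 ?e \<circ> f) v" if v: "v \<in> pverts G" for v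
    using v
  proof (cases rule: point_cases)
    case 1
    then show ?thesis using nbsum_P0[OF v] t0 by (simp add: blk_P0)
  next
    case 2
    then show ?thesis using nbsum_quad[OF v 2] t0 by (simp add: blk_quad)
  next
    case (3 t)
    have "sum ?e (F - {t}) = (if t = t0 then 0 else - 2)" using t0 by (simp add: sum.delta)
    then show ?thesis using nbsum_tri[OF v 3] by (simp add: blk_tri[OF 3])
  qed
  obtain v0 where v0: "v0 \<in> pverts G" "f v0 = P0" using vertex[of P0] by (auto simp: quadp_def)
  show ?thesis
  proof (rule lambda_min_eqI[OF G nonempty ev v0(1)])
    show "(blk 3 1 ?e \<circ> f) v0 \<noteq> 0" using v0(2) by (simp add: blk_P0)
    show "- 2 * sqn G z \<le> bil (adj G) (pverts G) z z" for z by (rule model_psd)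
  qed
qed

text \<open>The class of four receives color 0, so it belongs to every nonempty initial segment of
  colors; the triples are numbered by \<open>n\<close>.\<close>

definition tri_color :: "(pt set \<Rightarrow> nat) \<Rightarrow> 'a \<Rightarrow> nat" where
  "tri_color n v = (if f v \<in> quadp then 0 else n (THE t. t \<in> F \<and> f v \<in> t))"

lemma tri_color_quad: "f v \<in> quadp \<Longrightarrow> tri_color n v = 0"
  by (simp add: tri_color_def)

lemma tri_color_tri: "t \<in> F \<Longrightarrow> f v \<in> t \<Longrightarrow> tri_color n v = n t"
proof -
  assume t: "t \<in> F" "f v \<in> t"
  have "(THE t. t \<in> F \<and> f v \<in> t) = t" by (rule the_equality) (use t fam_disjoint[OF fam] in blast)+
  moreover have "f v \<notin> quadp" by (rule TRI_not_quadp[OF fam_TRI[OF fam t(1)] t(2)])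
  ultimately show ?thesis unfolding tri_color_def by simp
qed

lemma tri_color_proper:
  assumes n: "inj_on n F" "n ` F \<subseteq> {1..card F}"
  shows "proper_coloring G (card F + 1) (tri_color n)"
proof -
  have n0: "0 < n t \<and> n t < card F + 1" if "t \<in> F" for t using n(2) that by fastforce
  have less: "tri_color n v < card F + 1" if v: "v \<in> pverts G" for v
    using fV[OF v] n0 by (auto simp: tri_color_quad tri_color_tri)
  have ne: "tri_color n u \<noteq> tri_color n v" if uv: "(u, v) \<in> parcs G" for u v
  proof
    assume eq: "tri_color n u = tri_color n v"
    have V: "u \<in> pverts G" "v \<in> pverts G" using pair_graph_wf[OF G uv] by blast+
    have a: "adjp (f u) (f v)" using uv arc[OF V] by blast
    consider "f u \<in> quadp" "f v \<in> quadp" | t where "f u \<in> quadp" "t \<in> F" "f v \<in> t"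
      | t where "f v \<in> quadp" "t \<in> F" "f u \<in> t" | t t' where "t \<in> F" "f u \<in> t" "t' \<in> F" "f v \<in> t'"
      using fV[OF V(1)] fV[OF V(2)] by blast
    then show False
    proof cases
      case 1
      then show ?thesis using quadp_indep a by blast
    next
      case 2
      then show ?thesis using n0[of t] eq by (simp add: tri_color_quad tri_color_tri)
    next
      case 3
      then show ?thesis using n0[of t] eq by (simp add: tri_color_quad tri_color_tri)
    next
      case 4
      then have "n t = n t'" using eq by (simp add: tri_color_tri)
      then have "t = t'" using n(1) 4 by (auto dest: inj_onD)
      then show ?thesis using TRI_D(3)[OF fam_TRI[OF fam 4(1)]] 4 a by blast
    qed
  qed
  show ?thesis unfolding proper_coloring_def using less ne by blast
qed

text \<open>The coloring by the class of four and the triples meets Hoffman's bound for the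
  eigenvalues \<open>2 * card F\<close> and -2.\<close>

lemma chromatic_model:
  assumes k: "1 \<le> card F"
  shows "chromatic_number G = card F + 1"
proof -
  obtain n where n: "bij_betw n F {0..<card F}" using ex_bij_betw_finite_nat[of F] by auto
  have "n t < card F" if "t \<in> F" for t using bij_betwE[OF n] that by auto
  \<comment> \<open>The shift by one keeps color 0 for the class of four.\<close>
  then have "(Suc \<circ> n) ` F \<subseteq> {1..card F}" by (intro image_subsetI) (simp add: Suc_le_eq)
  moreover have "inj_on (Suc \<circ> n) F" using n by (auto simp: bij_betw_def inj_on_def)
  ultimately have col: "proper_coloring G (card F + 1) (tri_color (Suc \<circ> n))" by (intro tri_color_proper)
  have "card F + 1 \<le> j" if c: "proper_coloring G j c" for j c
  proof -
    obtain v0 where v0: "v0 \<in> pverts G" "f v0 = P0" using vertex[of P0] by (auto simp: quadp_def)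
    have nz: "(blk 3 1 (\<lambda>_. 2) \<circ> f) v0 \<noteq> 0" using v0(2) by (simp add: blk_P0)
    have "2 * card F + 2 \<le> real j * 2"
      using hoffman_bound[OF G c v0(1) nz lambda_max_model(2)[OF k], of 2] model_psd by simp
    then show ?thesis by simp
  qed
  then show ?thesis unfolding chromatic_number_def using col by (intro Least_equality) blast+
qed

end

lemma pair_form: "\<exists>e s. e \<subseteq> {0..<8} \<and> card e = 2 \<and> vec_of x = pair_vec e s"
proof -
  obtain s i j where ij: "i < j" "j < 8" "vec_of x = vecl s i j" using vec_of_P56[of x] by (rule P56_cases)
  have "vecl s i j = pair_vec {i, j} s" by (simp add: vecl_def pair_vec_def)
  then show ?thesis using ij by (intro exI[of _ "{i, j}"] exI[of _ s]) auto
qed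

context tri_model
begin

text \<open>Reads the vectors backwards: their pairs are the edges of \<open>H\<close>, and those of
  type b_ij form \<open>X\<close>. Different points have different pairs, because a_ij and b_ij have
  inner product -4, which does not occur among the 28 points.\<close>

lemma model_in_S8: "in_S8 G"
proof -
  have "\<forall>x. \<exists>p. fst p \<subseteq> {0..<8} \<and> card (fst p) = 2 \<and> vec_of x = pair_vec (fst p) (snd p)"
    using pair_form by simp
  then obtain p where p: "\<And>x. fst (p x) \<subseteq> {0..<8}" "\<And>x. card (fst (p x)) = 2"
    "\<And>x. vec_of x = pair_vec (fst (p x)) (snd (p x))" by (metis (no_types, lifting))
  define e where "e x = fst (p x)" for x :: pt
  define s where "s x = snd (p x)" for x :: pt
  have e: "e x \<subseteq> {0..<8}" "card (e x) = 2" for x using p by (simp_all add: e_def)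
  have es: "ipl (vec_of x) (vec_of y) = (if s x = s y then 4 * int (card (e x \<inter> e y)) else 4 - 4 * int (card (e x \<inter> e y)))" for x y
    using p(3) ipl_pair_vec[OF e e] by (simp add: e_def s_def)
  have ci: "card (e x \<inter> e y) = (if e x = e y then 2 else if e x \<inter> e y \<noteq> {} then 1 else 0)" for x y
    by (rule card_Int_pairs[OF e(2) e(2)])
  have inj_e: "x = y" if "e x = e y" for x y
  proof -
    have "ipl (vec_of x) (vec_of y) = 8 \<or> ipl (vec_of x) (vec_of y) = - 4"
      unfolding es ci using that by auto
    then show ?thesis unfolding ipl_vec_of by (auto split: if_splits)
  qed
  have adj_e: "adjp x y \<longleftrightarrow> e x \<noteq> e y \<and> (e x \<inter> e y \<noteq> {} \<longleftrightarrow> (s x \<longleftrightarrow> s y))" for x y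
  proof (cases "x = y")
    case False
    then have "e x \<noteq> e y" using inj_e by blast
    then show ?thesis using ipl_vec_of[of x y] False unfolding es ci by (auto split: if_splits)
  qed (simp add: adjp_irrefl)
  let ?Q = "quadp \<union> \<Union>F"
  define H :: "nat pair_pre_digraph" where
    "H = \<lparr> pverts = {0..<8}, parcs = {(a, b). a \<noteq> b \<and> {a, b} \<in> e ` ?Q} \<rparr>"
  define X where "X = e ` {x \<in> ?Q. s x}"
  have H: "pair_graph H"
  proof (rule pair_graphI)
    fix a b assume "(a, b) \<in> parcs H"
    then have ab: "a \<noteq> b" "{a, b} \<in> e ` ?Q" by (simp_all add: H_def)
    then have "{a, b} \<subseteq> {0..<8}" using e(1) by (metis imageE)
    then show "a \<in> pverts H \<and> b \<in> pverts H \<and> a \<noteq> b \<and> (b, a) \<in> parcs H"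
      using ab by (simp add: H_def insert_commute)
  qed (simp add: H_def)
  have edges_H: "edges H = e ` ?Q"
  proof (rule Set.set_eqI)
    fix d show "d \<in> edges H \<longleftrightarrow> d \<in> e ` ?Q"
    proof
      assume "d \<in> edges H"
      then show "d \<in> e ` ?Q" unfolding edges_def H_def by auto
    next
      assume d: "d \<in> e ` ?Q"
      then have "card d = 2" using e(2) by blast
      then obtain a b where "d = {a, b}" "a \<noteq> b" by (auto simp: card_2_iff)
      then show "d \<in> edges H" using d unfolding edges_def H_def by auto
    qed
  qed
  have X_mem: "e x \<in> X \<longleftrightarrow> s x" if "x \<in> ?Q" for x
    unfolding X_def using that inj_e by blast
  have iso: "G \<simeq> seidel_switching (line_graph H) X"
  proof (rule isomorphicI[OF G, where f = "e \<circ> f"])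
    show "parcs (seidel_switching (line_graph H) X) \<subseteq> pverts (seidel_switching (line_graph H) X) \<times> pverts (seidel_switching (line_graph H) X)"
      by (auto simp: seidel_switching_def)
    have "pverts (seidel_switching (line_graph H) X) = e ` ?Q"
      by (simp add: seidel_switching_def line_graph_def edges_H)
    moreover have "bij_betw e ?Q (e ` ?Q)" unfolding bij_betw_def inj_on_def using inj_e by blast
    ultimately show "bij_betw (e \<circ> f) (pverts G) (pverts (seidel_switching (line_graph H) X))"
      using bij_betw_trans[OF bij] by metis
    fix u v assume uv: "u \<in> pverts G" "v \<in> pverts G"
    show "(u, v) \<in> parcs G \<longleftrightarrow> ((e \<circ> f) u, (e \<circ> f) v) \<in> parcs (seidel_switching (line_graph H) X)"
      unfolding line_switch_arcs edges_H o_def arc[OF uv] adj_e X_mem[OF fV[OF uv(1)]] X_mem[OF fV[OF uv(2)]]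
      using fV[OF uv(1)] fV[OF uv(2)] by blast
  qed
  have "X \<subseteq> edges H" unfolding edges_H X_def by blast
  moreover have "card (pverts H) = 8" by (simp add: H_def)
  ultimately show ?thesis unfolding in_S8_def using H iso by blast
qed

text \<open>The vertex \<open>P0\<close>, one triple and the points \<open>P1\<close>,
  \<open>P2\<close>, \<open>P3\<close> form the configuration of
  \<open>not_generalized_line_graph\<close>.\<close>

lemma model_exceptional:
  assumes k: "1 \<le> card F"
  shows "exceptional G"
proof -
  obtain u where u: "u \<in> pverts G" "f u = P0" using vertex[of P0] by (auto simp: quadp_def)
  obtain v1 where v1: "v1 \<in> pverts G" "f v1 = P1" using vertex[of P1] by (auto simp: quadp_def)
  obtain v2 where v2: "v2 \<in> pverts G" "f v2 = P2" using vertex[of P2] by (auto simp: quadp_def)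
  obtain v3 where v3: "v3 \<in> pverts G" "f v3 = P3" using vertex[of P3] by (auto simp: quadp_def)
  obtain t where t: "t \<in> F" using k by fastforce
  obtain a b c where abc: "t = {a, b, c}" "a \<in> set (nb P1)" "b \<in> set (nb P2)" "c \<in> set (nb P3)"
    "\<not> adjp a b" "\<not> adjp a c" "\<not> adjp b c" using fam_TRI[OF fam t] by (rule TRI_obtain)
  have tU: "a \<in> quadp \<union> \<Union>F" "b \<in> quadp \<union> \<Union>F" "c \<in> quadp \<union> \<Union>F" using t abc(1) by blast+
  obtain r1 where r1: "r1 \<in> pverts G" "f r1 = a" using vertex[OF tU(1)] by blast
  obtain r2 where r2: "r2 \<in> pverts G" "f r2 = b" using vertex[OF tU(2)] by blast
  obtain r3 where r3: "r3 \<in> pverts G" "f r3 = c" using vertex[OF tU(3)] by blast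
  have t0: "adjp P0 a" "adjp P0 b" "adjp P0 c"
    using TRI_D(1)[OF fam_TRI[OF fam t]] unfolding abc(1) adjp_def by blast+
  have d: "set (nb P1) \<inter> set (nb P2) = {}" "set (nb P1) \<inter> set (nb P3) = {}" "set (nb P2) \<inter> set (nb P3) = {}"
    by simp_all
  have pa: "adjp P1 a" "adjp P2 b" "adjp P3 c" "\<not> adjp P1 b" "\<not> adjp P1 c" "\<not> adjp P2 c"
    using abc(2,3,4) d unfolding adjp_def by blast+
  have sy: "adjp x y \<Longrightarrow> adjp y x" for x y by (simp only: adjp_sym[of y x])
  have "\<not> generalized_line_graph G"
  proof (rule not_generalized_line_graph[OF G, of u r1 r2 r3 v1 v2 v3])
    show "(u, r1) \<in> parcs G" "(u, r2) \<in> parcs G" "(u, r3) \<in> parcs G"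
      using arc[OF u(1)] u(2) r1 r2 r3 t0 by simp_all
    show "(r1, r2) \<notin> parcs G" "(r1, r3) \<notin> parcs G" "(r2, r3) \<notin> parcs G"
      using arc r1 r2 r3 abc by simp_all
    show "(r1, v1) \<in> parcs G" "(r2, v2) \<in> parcs G" "(r3, v3) \<in> parcs G"
      using arc r1 r2 r3 v1 v2 v3 sy[OF pa(1)] sy[OF pa(2)] sy[OF pa(3)] by simp_all
    show "(r2, v1) \<notin> parcs G" "(r3, v1) \<notin> parcs G" "(r3, v2) \<notin> parcs G"
      using arc r1 r2 r3 v1 v2 v3 sy[of b P1] sy[of c P1] sy[of c P2] pa by auto
  qed
  moreover have "Digraph_Component.connected (with_proj G)"
  proof (rule connectedI_center[OF G u(1)])
    fix v assume v: "v \<in> pverts G"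
    from v show "v = u \<or> (v, u) \<in> parcs G \<or> (\<exists>r. (v, r) \<in> parcs G \<and> (r, u) \<in> parcs G)"
    proof (cases rule: point_cases)
      case 1
      then show ?thesis using inj_onD[OF inj, of v u] v u by simp
    next
      case 2
      then have "adjp (f v) a \<or> adjp (f v) b \<or> adjp (f v) c" using pa(1,2,3) by auto
      then show ?thesis
        using arc[OF v] arc[OF _ u(1)] r1 r2 r3 u(2) sy[OF t0(1)] sy[OF t0(2)] sy[OF t0(3)] by metis
    next
      case (3 t')
      then have "adjp P0 (f v)" using TRI_D(1)[OF fam_TRI[OF fam 3(1)]] unfolding adjp_def by blast
      then show ?thesis using arc[OF v u(1)] u(2) sy by simp
    qed
  qed
  moreover have "inj_on (\<lambda>v. vec_of_list (vec_of (f v))) (pverts G)"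
  proof (rule inj_onI)
    fix v w assume vw: "v \<in> pverts G" "w \<in> pverts G" and eq: "vec_of_list (vec_of (f v)) = vec_of_list (vec_of (f w))"
    have "vec_of (f v) = vec_of (f w)" using arg_cong[OF eq, of list_of_vec] by (simp only: list_vec)
    then show "v = w" using inj vw unfolding vec_of_eq_iff by (auto dest: inj_onD)
  qed
  moreover have "vec_of_list (vec_of x) \<in> E8_roots" for x
  proof -
    obtain s i j where ij: "i < j" "j < 8" "vec_of x = vecl s i j" using vec_of_P56[of x] by (rule P56_cases)
    show ?thesis unfolding ij(3) by (rule vecl_E8[OF ij(1,2)])
  qed
  moreover have "vec_of_list (vec_of (f v)) \<bullet> vec_of_list (vec_of (f w)) = (if (v, w) \<in> parcs G then 4 else 0)"
    if "v \<in> pverts G" "w \<in> pverts G" "v \<noteq> w" for v w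
  proof -
    have "f v \<noteq> f w" using inj that by (auto dest: inj_onD)
    have len: "length (vec_of (f v)) = length (vec_of (f w))" using P56_length[OF vec_of_P56] by simp
    show ?thesis unfolding scalar_prod_ipl[OF len] ipl_vec_of using arc[OF that(1,2)] \<open>f v \<noteq> f w\<close> by simp
  qed
  ultimately show ?thesis
    unfolding exceptional_def by (intro conjI exI[of _ "\<lambda>v. vec_of_list (vec_of (f v))"] ballI impI) auto
qed

lemma model_irregular:
  assumes k: "1 \<le> card F"
  shows "irregular G"
proof -
  obtain u where u: "u \<in> pverts G" "f u = P0" using vertex[of P0] by (auto simp: quadp_def)
  obtain v where v: "v \<in> pverts G" "f v = P1" using vertex[of P1] by (auto simp: quadp_def)
  have "card {w. (w, u) \<in> parcs G} = 3 * card F" "card {w. (w, v) \<in> parcs G} = card F"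
    using degree_P0[OF u] degree_quad[OF v(1)] v(2) by simp_all
  then have "card {w. (w, u) \<in> parcs G} \<noteq> card {w. (w, v) \<in> parcs G}" using k by linarith
  then show ?thesis unfolding irregular_def using u(1) v(1) by metis
qed

text \<open>In a complete multipartite graph nonadjacency is transitive. Here \<open>P1\<close> is
  nonadjacent to \<open>P0\<close> and to a neighbour \<open>b\<close> of \<open>P2\<close> in a
  triple, but \<open>P0\<close> and \<open>b\<close> are adjacent.\<close>

lemma model_not_multipartite:
  assumes k: "1 \<le> card F"
  shows "\<not> equal_complete_multipartite G"
proof
  assume "equal_complete_multipartite G"
  then obtain P m where part: "partition_on (pverts G) P"
    and "\<forall>p\<in>P. card p = (m :: nat)"
    and adj: "\<forall>u\<in>pverts G. \<forall>v\<in>pverts G. (u, v) \<in> parcs G \<longleftrightarrow> \<not> (\<exists>p \<in> P. u \<in> p \<and> v \<in> p)"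
    unfolding equal_complete_multipartite_def by (elim exE conjE) (rule that)
  note P = part adj[rule_format]
  have tr: "(a, c) \<notin> parcs G" if V: "a \<in> pverts G" "b \<in> pverts G" "c \<in> pverts G"
    and n: "(a, b) \<notin> parcs G" "(b, c) \<notin> parcs G" for a b c
  proof -
    obtain p where p: "p \<in> P" "a \<in> p" "b \<in> p" using P(2)[OF V(1,2)] n(1) by blast
    obtain q where q: "q \<in> P" "b \<in> q" "c \<in> q" using P(2)[OF V(2,3)] n(2) by blast
    have "p = q" using P(1) p q unfolding partition_on_def disjoint_def by blast
    then show ?thesis using P(2)[OF V(1,3)] p q by blast
  qed
  obtain t where t: "t \<in> F" using k by fastforce
  obtain a b c where abc: "t = {a, b, c}" "a \<in> set (nb P1)" "b \<in> set (nb P2)"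
    using fam_TRI[OF fam t] by (rule TRI_obtain)
  have "set (nb P1) \<inter> set (nb P2) = {}" by simp
  then have nb1: "\<not> adjp P1 b" using abc(3) unfolding adjp_def by blast
  have b0: "adjp P0 b" using TRI_D(1)[OF fam_TRI[OF fam t]] unfolding abc(1) adjp_def by blast
  obtain u where u: "u \<in> pverts G" "f u = P0" using vertex[of P0] by (auto simp: quadp_def)
  obtain v where v: "v \<in> pverts G" "f v = P1" using vertex[of P1] by (auto simp: quadp_def)
  obtain r where r: "r \<in> pverts G" "f r = b" using vertex[of b] t abc(1) by blast
  have "(u, v) \<notin> parcs G" using arc[OF u(1) v(1)] u v by (simp add: adjp_def)
  moreover have "(v, r) \<notin> parcs G" using arc[OF v(1) r(1)] v r nb1 by simp
  ultimately have "(u, r) \<notin> parcs G" by (rule tr[OF u(1) v(1) r(1)])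
  then show False using arc[OF u(1) r(1)] u r b0 by simp
qed

lemma model_in_class:
  assumes k: "2 \<le> card F"
  shows "G \<in> irregular_S8_graphs"
proof -
  have k1: "1 \<le> card F" using k by simp
  obtain n where n: "bij_betw n F {0..<card F}" using ex_bij_betw_finite_nat[of F] by auto
  have nb: "\<not> bipartite G"
  proof
    assume "bipartite G"
    then obtain U where U: "\<And>u v. (u, v) \<in> parcs G \<Longrightarrow> u \<in> U \<longleftrightarrow> v \<notin> U" unfolding bipartite_def by blast
    have "proper_coloring G 2 (\<lambda>v. if v \<in> U then 0 else 1)"
      unfolding proper_coloring_def using U by auto
    then have "chromatic_number G \<le> 2" unfolding chromatic_number_def by (intro Least_le) blast
    then show False using chromatic_model[OF k1] k by simp
  qed
  obtain u where u: "u \<in> pverts G" "f u = P0" using vertex[of P0] by (auto simp: quadp_def)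
  have "card {w. (w, u) \<in> parcs G} \<noteq> 0" using degree_P0[OF u] k by linarith
  then have "parcs G \<noteq> {}" by auto
  moreover have "real (chromatic_number G) = 1 - lambda_max G / lambda_min G"
    unfolding chromatic_model[OF k1] lambda_max_model(1)[OF k1] lambda_min_model[OF k1] by simp
  ultimately have "nontrivially_hoffman_colorable G"
    unfolding nontrivially_hoffman_colorable_def hoffman_colorable_def
    using nb model_not_multipartite[OF k1] by blast
  then show ?thesis
    unfolding irregular_S8_graphs_def using G model_in_S8 model_exceptional[OF k1] model_irregular[OF k1] by simp
qed

end

section \<open>The class described by families of triples\<close>

lemma optimal_coloring_exists:
  assumes G: "pair_graph G"
  shows "\<exists>c. proper_coloring G (chromatic_number G) c"
proof -
  obtain n where n: "bij_betw n (pverts G) {0..<card (pverts G)}"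
    using ex_bij_betw_finite_nat[OF pair_graph_finite[OF G]] by blast
  have "proper_coloring G (card (pverts G)) n"
    unfolding proper_coloring_def
  proof (intro conjI ballI; (clarify)?)
    fix v assume "v \<in> pverts G"
    then show "n v < card (pverts G)" using n by (auto simp: bij_betw_def)
  next
    fix u v assume uv: "(u, v) \<in> parcs G" "n u = n v"
    then have "u = v" using n pair_graph_wf[OF G uv(1)] by (auto simp: bij_betw_def dest: inj_onD)
    then show False using uv(1) pair_graph_irrefl[OF G] by simp
  qed
  then have "\<exists>k. \<exists>c. proper_coloring G k c" by blast
  then show ?thesis unfolding chromatic_number_def by (rule LeastI_ex)
qed

text \<open>Keeps the connection with the given coloring: \<open>q\<close> is the color of the class
  of four, and every other color class becomes a triple of the family. Chromatic components are
  analysed through this.\<close>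

lemma class_model:
  assumes G: "G \<in> irregular_S8_graphs" and c: "proper_coloring G (chromatic_number G) c"
  shows "\<exists>f F q. tri_model G f F \<and> 2 \<le> card F \<and> chromatic_number G = card F + 1 \<and> q < chromatic_number G \<and>
    f ` {v \<in> pverts G. c v = q} = quadp \<and>
    (\<forall>i<chromatic_number G. i \<noteq> q \<longrightarrow> f ` {v \<in> pverts G. c v = i} \<in> F)"
proof -
  let ?k = "chromatic_number G" and ?cl = "\<lambda>i. {v \<in> pverts G. c v = i}"
  have g: "pair_graph G" using G by (simp add: irregular_S8_graphs_def)
  have em: "3 \<le> ?k \<and> (\<exists>f. inj_on f (pverts G) \<and>
    (\<forall>u\<in>pverts G. \<forall>v\<in>pverts G. (u, v) \<in> parcs G \<longleftrightarrow> adjp (f u) (f v)) \<and>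
    (\<exists>q<?k. f ` ?cl q = quadp \<and> (\<forall>i<?k. i \<noteq> q \<longrightarrow> f ` ?cl i \<in> TRI)))"
    using G c unfolding irregular_S8_graphs_def quadp_def by (intro class_embedding) simp_all
  then obtain f q where k3: "3 \<le> ?k" and inj: "inj_on f (pverts G)"
    and arc: "\<forall>u\<in>pverts G. \<forall>v\<in>pverts G. (u, v) \<in> parcs G \<longleftrightarrow> adjp (f u) (f v)"
    and q: "q < ?k" "f ` ?cl q = quadp" and tri: "\<forall>i<?k. i \<noteq> q \<longrightarrow> f ` ?cl i \<in> TRI"
    by (elim conjE exE) (rule that)
  let ?I = "{..<?k} - {q}"
  define F where "F = (\<lambda>i. f ` ?cl i) ` ?I"
  have disj: "f ` ?cl i \<inter> f ` ?cl j = {}" if "i \<noteq> j" for i j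
    using that inj_on_image_Int[OF inj, of "?cl i" "?cl j"] by auto
  have ne: "f ` ?cl i \<noteq> {}" if "i \<in> ?I" for i
  proof
    assume e: "f ` ?cl i = {}"
    have "f ` ?cl i \<in> TRI" using tri that by blast
    then have "card (f ` ?cl i) = 3" by (rule TRI_D(2))
    then show False unfolding e by simp
  qed
  have inj_cl: "inj_on (\<lambda>i. f ` ?cl i) ?I"
  proof (rule inj_onI, rule ccontr)
    fix i j assume ij: "i \<in> ?I" "f ` ?cl i = f ` ?cl j" "i \<noteq> j"
    have "f ` ?cl i \<inter> f ` ?cl j = {}" by (rule disj[OF ij(3)])
    then have "f ` ?cl i = {}" using ij(2) by simp
    then show False using ne[OF ij(1)] by simp
  qed
  then have cF: "card F = ?k - 1" unfolding F_def by (simp add: card_image q(1))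
  have fam: "fam F"
    unfolding fam_def
  proof
    show "F \<subseteq> TRI" unfolding F_def using tri by blast
    show "disjoint F" unfolding F_def disjoint_def using disj by blast
  qed
  have less: "c v < ?k" if "v \<in> pverts G" for v using c that unfolding proper_coloring_def by blast
  have "pverts G = ?cl q \<union> (\<Union>i\<in>?I. ?cl i)" using less by blast
  then have "f ` pverts G = f ` (?cl q \<union> (\<Union>i\<in>?I. ?cl i))" by simp
  also have "\<dots> = quadp \<union> \<Union>F" unfolding image_Un image_UN q(2) F_def by simp
  finally have bij: "bij_betw f (pverts G) (quadp \<union> \<Union>F)" using inj by (simp add: bij_betw_def)
  have "tri_model G f F" by (rule tri_model.intro[OF g bij _ fam]) (use arc in blast)
  moreover have "2 \<le> card F" "?k = card F + 1" using cF k3 by simp_all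
  moreover have "\<forall>i<?k. i \<noteq> q \<longrightarrow> f ` ?cl i \<in> F" unfolding F_def by blast
  ultimately show ?thesis using q by blast
qed

lemma class_iff: "G \<in> irregular_S8_graphs \<longleftrightarrow> (\<exists>f F. tri_model G f F \<and> 2 \<le> card F)"
proof
  assume G: "G \<in> irregular_S8_graphs"
  then have "pair_graph G" by (simp add: irregular_S8_graphs_def)
  then obtain c where "proper_coloring G (chromatic_number G) c" using optimal_coloring_exists by blast
  then show "\<exists>f F. tri_model G f F \<and> 2 \<le> card F" using class_model[OF G] by blast
next
  assume "\<exists>f F. tri_model G f F \<and> 2 \<le> card F"
  then show "G \<in> irregular_S8_graphs" using tri_model.model_in_class by blast
qed

section \<open>Reduction to representatives\<close>

lemma aut_image_P: "aut s \<Longrightarrow> s ` {P1, P2, P3} = {P1, P2, P3}"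
proof (rule card_subset_eq)
  assume s: "aut s"
  then show "s ` {P1, P2, P3} \<subseteq> {P1, P2, P3}" unfolding aut_def by (intro image_subsetI) blast
  have "inj s" using s by (simp add: aut_def)
  then show "card (s ` {P1, P2, P3}) = card {P1, P2, P3}"
    by (intro card_image) (rule inj_on_subset, assumption, rule subset_UNIV)
qed simp

lemma aut_quadp: "aut s \<Longrightarrow> s ` quadp = quadp"
proof -
  assume s: "aut s"
  have q: "quadp = insert P0 {P1, P2, P3}" by (simp add: quadp_def)
  have "s P0 = P0" using s by (simp add: aut_def)
  then show ?thesis unfolding q image_insert[of s P0] aut_image_P[OF s] by (simp only:)
qed

lemma aut_inv:
  assumes s: "aut s" shows "aut (inv_into UNIV s)"
proof -
  have inj: "inj s" using s by (simp add: aut_def)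
  have surj: "surj s" by (rule finite_UNIV_inj_surj[OF finite inj])
  have sv: "s (inv_into UNIV s x) = x" for x by (rule surj_f_inv_f[OF surj])
  have "inj (inv_into UNIV s)" by (rule surj_imp_inj_inv[OF surj])
  moreover have "adjp (inv_into UNIV s x) (inv_into UNIV s y) \<longleftrightarrow> adjp x y" for x y
  proof -
    have "adjp (s (inv_into UNIV s x)) (s (inv_into UNIV s y)) \<longleftrightarrow> adjp (inv_into UNIV s x) (inv_into UNIV s y)" using s unfolding aut_def by blast
    then show ?thesis unfolding sv by simp
  qed
  moreover have "inv_into UNIV s P0 = P0" using inv_f_f[OF inj, of P0] s by (simp add: aut_def)
  moreover have "inv_into UNIV s x \<in> {P1, P2, P3}" if "x \<in> {P1, P2, P3}" for x
  proof -
    have "x \<in> s ` {P1, P2, P3}" using that aut_image_P[OF s] by blast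
    then obtain y where "y \<in> {P1, P2, P3}" "x = s y" by blast
    then show ?thesis using inv_f_f[OF inj, of y] by simp
  qed
  ultimately show ?thesis unfolding aut_def by blast
qed

definition rep_fam :: "ri \<Rightarrow> pt set set" where "rep_fam r = set ` set (dec r)"

lemma Union_rep_fam: "\<Union>(rep_fam r) = set (rep r)"
  by (simp add: rep_fam_def rep_def)

lemma fam_rep_fam: "fam (rep_fam r)"
proof -
  have "set t \<in> TRI" if "t \<in> set (dec r)" for t
    using dec_tri_ok[of r] that tri_ok_TRI unfolding list_all_iff by blast
  moreover have "set t \<inter> set t' = {}" if "t \<in> set (dec r)" "t' \<in> set (dec r)" "set t \<noteq> set t'" for t t'
  proof -
    have "t \<noteq> t'" using that(3) by blast
    then show ?thesis using distinct_rep[of r] that(1,2) unfolding rep_def distinct_concat_iff by blast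
  qed
  ultimately show ?thesis unfolding fam_def rep_fam_def disjoint_def by blast
qed

lemma card_Union_fam: "fam F \<Longrightarrow> card (\<Union>F) = 3 * card F"
proof -
  assume F: "fam F"
  have "card (\<Union>F) = sum card F"
    by (rule card_Union_disjoint) (use F in \<open>auto simp: fam_def\<close>)
  also have "\<dots> = (\<Sum>t\<in>F. 3)" by (rule sum.cong[OF refl]) (use TRI_D(2) fam_TRI[OF F] in blast)
  finally show ?thesis by simp
qed

lemma length_rep: "length (rep r) = 3 * card (rep_fam r)"
  using card_Union_fam[OF fam_rep_fam[of r]] distinct_card[OF distinct_rep[of r]] by (simp add: Union_rep_fam)

text \<open>Adds the triples one at a time with \<open>rep_step\<close>. Only unions are tracked:
  the image of the family need not be the decomposition listed in \<open>dec\<close>.\<close>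

lemma fam_rep:
  assumes "fam F"
  shows "\<exists>s j. aut s \<and> s ` \<Union>F = set (rep j)"
  using finite[of F] assms
proof (induction F rule: finite_induct)
  case empty
  have "id ` \<Union>{} = set (rep R0)" by (simp add: rep_def)
  then show ?case using aut_id by blast
next
  case (insert t F)
  have "fam F" using insert.prems by (rule fam_subset) blast
  from insert.IH[OF this] obtain s i where s: "aut s" "s ` \<Union>F = set (rep i)"
    by (elim exE conjE) (rule that)
  have inj: "inj s" using s(1) by (simp add: aut_def)
  have "t \<inter> \<Union>F = {}" using fam_disjoint[OF insert.prems] insert.hyps(2) by blast
  then have dis: "s ` t \<inter> set (rep i) = {}" unfolding s(2)[symmetric] image_Int[OF inj, symmetric] by simp
  have tri: "s ` t \<in> TRI" by (rule TRI_aut[OF s(1)]) (rule fam_TRI[OF insert.prems], simp)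
  obtain r j where r: "aut r" "r ` (set (rep i) \<union> s ` t) = set (rep j)"
    using rep_step[OF tri dis] by (elim exE conjE) (rule that)
  have "(r \<circ> s) ` \<Union>(insert t F) = r ` (s ` t \<union> s ` \<Union>F)" by (simp only: image_comp[symmetric] Union_insert image_Un)
  also have "\<dots> = set (rep j)" unfolding s(2) Un_commute[of "s ` t"] by (rule r(2))
  finally show ?case using aut_comp[OF r(1) s(1)] by blast
qed

lemma Gam_arcs: "x \<in> pverts (Gam U) \<Longrightarrow> y \<in> pverts (Gam U) \<Longrightarrow> (x, y) \<in> parcs (Gam U) \<longleftrightarrow> adjp x y"
  by (simp add: Gam_def)

lemma pverts_Gam: "pverts (Gam U) = quadp \<union> U"
  by (simp add: Gam_def)

lemma tri_model_Gam: "fam F \<Longrightarrow> tri_model (Gam (\<Union>F)) id F"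
  by (rule tri_model.intro) (simp_all add: pair_graph_Gam Gam_arcs pverts_Gam bij_betw_def)

lemma tri_model_iso:
  assumes G: "pair_graph G" and F: "fam F" and iso: "G \<simeq> Gam (\<Union>F)"
  shows "\<exists>f. tri_model G f F"
proof -
  obtain f where f: "bij_betw f (pverts G) (pverts (Gam (\<Union>F)))"
    "\<And>u v. u \<in> pverts G \<Longrightarrow> v \<in> pverts G \<Longrightarrow> (u, v) \<in> parcs G \<longleftrightarrow> (f u, f v) \<in> parcs (Gam (\<Union>F))"
    using isomorphic_iff[OF G pair_graph_arcs[OF pair_graph_Gam]] iso by blast
  have V: "f v \<in> pverts (Gam (\<Union>F))" if "v \<in> pverts G" for v using f(1) that by (auto simp: bij_betw_def)
  have "tri_model G f F"
  proof (rule tri_model.intro)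
    show "bij_betw f (pverts G) (quadp \<union> \<Union>F)" using f(1) by (simp only: pverts_Gam)
    show "(u, v) \<in> parcs G \<longleftrightarrow> adjp (f u) (f v)" if "u \<in> pverts G" "v \<in> pverts G" for u v
      using f(2)[OF that] Gam_arcs[OF V V] that by blast
  qed (rule G F)+
  then show ?thesis by blast
qed

lemma Gam_aut:
  assumes s: "aut s" shows "Gam U \<simeq> Gam (s ` U)"
proof (rule isomorphicI[OF pair_graph_Gam pair_graph_arcs[OF pair_graph_Gam], where f = s])
  have inj: "inj s" using s by (simp add: aut_def)
  show "bij_betw s (pverts (Gam U)) (pverts (Gam (s ` U)))"
    unfolding bij_betw_def pverts_Gam image_Un aut_quadp[OF s]
    using inj_on_subset[OF inj subset_UNIV] by blast
  fix u v assume uv: "u \<in> pverts (Gam U)" "v \<in> pverts (Gam U)"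
  then have "s u \<in> pverts (Gam (s ` U))" "s v \<in> pverts (Gam (s ` U))"
    using aut_quadp[OF s] unfolding pverts_Gam by blast+
  then show "(u, v) \<in> parcs (Gam U) \<longleftrightarrow> (s u, s v) \<in> parcs (Gam (s ` U))"
    using Gam_arcs uv s unfolding aut_def by metis
qed

context tri_model
begin

lemma iso_induced:
  assumes S: "S \<subseteq> pverts G" and im: "f ` S = quadp \<union> U"
  shows "induced G S \<simeq> Gam U"
proof (rule isomorphicI[OF pair_graph_induced[OF G S] pair_graph_arcs[OF pair_graph_Gam], where f = f])
  show "bij_betw f (pverts (induced G S)) (pverts (Gam U))"
    using inj_on_subset[OF inj S] im by (simp add: induced_def pverts_Gam bij_betw_def)
  fix u v assume "u \<in> pverts (induced G S)" "v \<in> pverts (induced G S)"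
  then have uv: "u \<in> S" "v \<in> S" by (simp_all add: induced_def)
  have "f u \<in> pverts (Gam U)" "f v \<in> pverts (Gam U)" using im uv unfolding pverts_Gam by blast+
  then show "(u, v) \<in> parcs (induced G S) \<longleftrightarrow> (f u, f v) \<in> parcs (Gam U)"
    using arc[of u v] S uv by (auto simp: induced_def Gam_arcs)
qed

lemma iso_Gam: "G \<simeq> Gam (\<Union>F)"
proof (rule isomorphicI[OF G pair_graph_arcs[OF pair_graph_Gam] bij[folded pverts_Gam]])
  fix u v assume uv: "u \<in> pverts G" "v \<in> pverts G"
  show "(u, v) \<in> parcs G \<longleftrightarrow> (f u, f v) \<in> parcs (Gam (\<Union>F))"
  proof -
    have "f u \<in> pverts (Gam (\<Union>F))" "f v \<in> pverts (Gam (\<Union>F))"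
      unfolding pverts_Gam by (rule fV[OF uv(1)], rule fV[OF uv(2)])
    then show ?thesis unfolding arc[OF uv] by (rule Gam_arcs[symmetric])
  qed
qed

lemma iso_rep:
  assumes "2 \<le> card F"
  shows "\<exists>s j. aut s \<and> s ` \<Union>F = set (rep j) \<and> 6 \<le> length (rep j) \<and> G \<simeq> Gam (set (rep j))"
proof -
  obtain s j where s: "aut s" "s ` \<Union>F = set (rep j)" using fam_rep[OF fam] by (elim exE conjE) (rule that)
  have "inj s" using s(1) by (simp add: aut_def)
  then have "card (set (rep j)) = card (\<Union>F)"
    unfolding s(2)[symmetric] by (intro card_image) (rule inj_on_subset, assumption, rule subset_UNIV)
  then have "6 \<le> length (rep j)" using assms card_Union_fam[OF fam] distinct_card[OF distinct_rep[of j]] by simp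
  moreover have "G \<simeq> Gam (set (rep j))"
    using isomorphic_trans[OF G pair_graph_Gam pair_graph_arcs[OF pair_graph_Gam] iso_Gam Gam_aut[OF s(1)]]
    unfolding s(2) .
  ultimately show ?thesis using s by blast
qed

end

text \<open>Length at least 6 expresses that the representative consists of at least two triples,
  which excludes \<open>R0\<close> and \<open>R1\<close>.\<close>

lemma class_rep_iff:
  assumes G: "pair_graph G"
  shows "G \<in> irregular_S8_graphs \<longleftrightarrow> (\<exists>j. 6 \<le> length (rep j) \<and> G \<simeq> Gam (set (rep j)))"
proof
  assume "G \<in> irregular_S8_graphs"
  then obtain f F where m: "tri_model G f F" "2 \<le> card F"
    unfolding class_iff by (elim exE conjE) (rule that)
  show "\<exists>j. 6 \<le> length (rep j) \<and> G \<simeq> Gam (set (rep j))"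
    using tri_model.iso_rep[OF m] by (elim exE conjE) (intro exI conjI)
next
  assume "\<exists>j. 6 \<le> length (rep j) \<and> G \<simeq> Gam (set (rep j))"
  then obtain j where j: "6 \<le> length (rep j)" "G \<simeq> Gam (\<Union>(rep_fam j))" unfolding Union_rep_fam by blast
  have "\<exists>f. tri_model G f (rep_fam j)" by (rule tri_model_iso[OF G fam_rep_fam j(2)])
  moreover have "2 \<le> card (rep_fam j)" using j(1) unfolding length_rep by simp
  ultimately show "G \<in> irregular_S8_graphs" unfolding class_iff by blast
qed

lemma iso_degree:
  assumes G: "pair_graph G" and H: "pair_graph H" and f: "bij_betw f (pverts G) (pverts H)"
    and arc: "\<And>u v. u \<in> pverts G \<Longrightarrow> v \<in> pverts G \<Longrightarrow> (u, v) \<in> parcs G \<longleftrightarrow> (f u, f v) \<in> parcs H"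
    and v: "v \<in> pverts G"
  shows "card {u. (u, v) \<in> parcs G} = card {w. (w, f v) \<in> parcs H}"
proof (rule bij_betw_same_card)
  have sub: "{u. (u, v) \<in> parcs G} \<subseteq> pverts G" using pair_graph_wf[OF G] by blast
  have "f ` {u. (u, v) \<in> parcs G} = {w. (w, f v) \<in> parcs H}"
  proof (intro subset_antisym subsetI)
    fix w assume "w \<in> f ` {u. (u, v) \<in> parcs G}"
    then show "w \<in> {w. (w, f v) \<in> parcs H}" using arc v sub by blast
  next
    fix w assume w: "w \<in> {w. (w, f v) \<in> parcs H}"
    then have "w \<in> pverts H" using pair_graph_wf[OF H] by blast
    then obtain u where "u \<in> pverts G" "w = f u" using f by (auto simp: bij_betw_def)
    then show "w \<in> f ` {u. (u, v) \<in> parcs G}" using arc v w by blast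
  qed
  then show "bij_betw f {u. (u, v) \<in> parcs G} {w. (w, f v) \<in> parcs H}"
    using inj_on_subset[OF _ sub] f unfolding bij_betw_def by blast
qed

subsection \<open>Chromatic components\<close>

text \<open>If the class of four were not among the chosen color classes, the component would live
  on triples only, any two of which are joined 2-regularly; it would be regular. So an irregular
  component corresponds to a subfamily.\<close>

lemma component_model:
  assumes H: "pair_graph H" "irregular H" and G': "G' \<in> irregular_S8_graphs" and comp: "chromatic_component H G'"
  shows "\<exists>f F F1. tri_model G' f F \<and> F1 \<subseteq> F \<and> H \<simeq> Gam (\<Union>F1)"
proof -
  obtain m c where m: "m \<le> chromatic_number G'" and c: "proper_coloring G' (chromatic_number G') c"
    and iso: "H \<simeq> induced G' {v \<in> pverts G'. c v < m}"
    using comp unfolding chromatic_component_def m_chromatic_component_def induced_restrict by blast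
  obtain f F q where mod: "tri_model G' f F" and q: "q < chromatic_number G'" "f ` {v \<in> pverts G'. c v = q} = quadp"
    and tri: "\<forall>i<chromatic_number G'. i \<noteq> q \<longrightarrow> f ` {v \<in> pverts G'. c v = i} \<in> F"
    using class_model[OF G' c] by (elim exE conjE) (rule that)
  interpret tri_model G' f F by (rule mod)
  define S where "S = {v \<in> pverts G'. c v < m}"
  define F1 where "F1 = (\<lambda>i. f ` {v \<in> pverts G'. c v = i}) ` ({..<m} - {q})"
  have F1: "F1 \<subseteq> F"
    unfolding F1_def
  proof (rule image_subsetI)
    fix i assume "i \<in> {..<m} - {q}"
    then have "i < chromatic_number G'" "i \<noteq> q" using m by auto
    then show "f ` {v \<in> pverts G'. c v = i} \<in> F" using tri by blast
  qed
  have SV: "S \<subseteq> pverts G'" by (simp add: S_def)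
  have pS: "pair_graph (induced G' S)" by (rule pair_graph_induced[OF G SV])
  have isoS: "H \<simeq> induced G' S" using iso by (simp only: S_def)
  have q_less: "q < m"
  proof (rule ccontr)
    assume "\<not> q < m"
    then have fS: "f ` S = \<Union>F1" unfolding F1_def S_def by auto
    obtain h where h: "bij_betw h (pverts H) (pverts (induced G' S))"
      "\<And>u v. u \<in> pverts H \<Longrightarrow> v \<in> pverts H \<Longrightarrow> (u, v) \<in> parcs H \<longleftrightarrow> (h u, h v) \<in> parcs (induced G' S)"
      using isomorphic_iff[OF H(1) pair_graph_arcs[OF pS]] isoS by blast
    have "card {u. (u, v) \<in> parcs H} = 2 * (card F1 - 1)" if v: "v \<in> pverts H" for v
    proof -
      have hv: "h v \<in> S" using h(1) v by (auto simp: bij_betw_def induced_def)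
      then have hV: "h v \<in> pverts G'" using SV by blast
      obtain t where t: "t \<in> F1" "f (h v) \<in> t" using fS hv by blast
      \<comment> \<open>With weight zero on the class of four and this indicator on the triples, the
        neighbour sum counts the neighbours inside \<open>S\<close>.\<close>
      let ?e = "\<lambda>t. if t \<in> F1 then 1 else 0 :: real"
      have "real (card {w. (w, h v) \<in> parcs (induced G' S)}) = nbsum G' (blk 0 0 ?e \<circ> f) (h v)"
      proof -
        have val: "(blk 0 0 ?e \<circ> f) w = (if w \<in> S then 1 else 0)" if w: "w \<in> pverts G'" for w
        proof -
          have fw: "w \<in> S \<longleftrightarrow> f w \<in> \<Union>F1" unfolding fS[symmetric] by (simp add: inj_on_image_mem_iff[OF inj w SV])
          from w show ?thesis
          proof (cases rule: point_cases)
            case 1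
            moreover have "P0 \<notin> \<Union>F1" using F1 TRI_not_quadp fam_TRI[OF fam] by (auto simp: quadp_def)
            ultimately show ?thesis using fw by (simp add: blk_P0)
          next
            case 2
            moreover have "f w \<notin> \<Union>F1" using F1 TRI_not_quadp fam_TRI[OF fam] 2 by (auto simp: quadp_def)
            ultimately show ?thesis using fw by (simp add: blk_quad)
          next
            case (3 t')
            have "f w \<in> \<Union>F1 \<longleftrightarrow> t' \<in> F1" using 3 F1 fam_disjoint[OF fam] by blast
            then show ?thesis using fw by (simp add: blk_tri[OF 3])
          qed
        qed
        have "{w. (w, h v) \<in> parcs (induced G' S)} = {w \<in> {w. w \<in> pverts G' \<and> (h v, w) \<in> parcs G'}. w \<in> S}"
          using hv pair_graph_sym[OF G] SV by (auto simp: induced_def)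
        moreover have "nbsum G' (blk 0 0 ?e \<circ> f) (h v) = (\<Sum>w | w \<in> pverts G' \<and> (h v, w) \<in> parcs G'. if w \<in> S then 1 else 0)"
          unfolding nbsum_eq[OF pair_graph_finite[OF G]] by (rule sum.cong[OF refl]) (use val in blast)
        ultimately show ?thesis using pair_graph_finite[OF G] by (simp add: sum_if_const)
      qed
      also have "\<dots> = 2 * sum ?e (F - {t})" using nbsum_tri[OF hV _ t(2), of 0 0 ?e] t(1) F1 by auto
      also have "sum ?e (F - {t}) = real (card {t' \<in> F - {t}. t' \<in> F1})" using sum_if_const[of "F - {t}" "\<lambda>t. t \<in> F1" 1] by simp
      also have "{t' \<in> F - {t}. t' \<in> F1} = F1 - {t}" using F1 by blast
      also have "card (F1 - {t}) = card F1 - 1" using t(1) by simp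
      finally have "real (card {w. (w, h v) \<in> parcs (induced G' S)}) = real (2 * (card F1 - 1))" by simp
      then have "card {w. (w, h v) \<in> parcs (induced G' S)} = 2 * (card F1 - 1)" by (simp only: of_nat_eq_iff)
      moreover have "card {u. (u, v) \<in> parcs H} = card {w. (w, h v) \<in> parcs (induced G' S)}"
        by (rule iso_degree[OF H(1) pS h(1) _ v]) (rule h(2))
      ultimately show ?thesis by (rule trans[rotated])
    qed
    then show False using H(2) unfolding irregular_def by blast
  qed
  have "S = (\<Union>i\<in>insert q ({..<m} - {q}). {v \<in> pverts G'. c v = i})" using q_less by (auto simp: S_def)
  then have "f ` S = quadp \<union> \<Union>F1" using q(2) by (simp only: image_UN image_Un UN_insert F1_def)
  then have "induced G' S \<simeq> Gam (\<Union>F1)" by (rule iso_induced[OF SV])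
  then have "H \<simeq> Gam (\<Union>F1)"
    by (rule isomorphic_trans[OF H(1) pS pair_graph_arcs[OF pair_graph_Gam] isoS])
  then show ?thesis using mod F1 by blast
qed

text \<open>The order of the colors is free, so the color classes can be arranged to put the desired
  subfamily first.\<close>

lemma (in tri_model) component_sub:
  assumes F1: "F1 \<subseteq> F" "1 \<le> card F1" and H: "pair_graph H" "H \<simeq> Gam (\<Union>F1)"
  shows "chromatic_component H G"
proof -
  let ?k = "card F1" and ?l = "card (F - F1)"
  have k: "?k \<le> card F" using F1(1) by (intro card_mono) simp_all
  have kl: "?k + ?l = card F" using F1(1) k by (simp add: card_Diff_subset)
  obtain n1 where n1: "bij_betw n1 F1 {0..<?k}" using ex_bij_betw_finite_nat[of F1] by auto
  obtain n2 where n2: "bij_betw n2 (F - F1) {0..<?l}" using ex_bij_betw_finite_nat[of "F - F1"] by auto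
  \<comment> \<open>The triples of \<open>F1\<close> get the colors from 1 to \<open>?k\<close>,
    which together with color 0 make up the first \<open>?k + 1\<close> colors.\<close>
  define n where "n t = (if t \<in> F1 then Suc (n1 t) else Suc (?k + n2 t))" for t
  have n1k: "n1 t < ?k" if "t \<in> F1" for t using n1 that by (auto simp: bij_betw_def)
  have n2l: "n2 t < ?l" if "t \<in> F - F1" for t using n2 that by (auto simp: bij_betw_def)
  have "inj_on n F"
  proof (rule inj_onI)
    fix t t' assume t: "t \<in> F" "t' \<in> F" "n t = n t'"
    show "t = t'"
    proof (cases "t \<in> F1"; cases "t' \<in> F1")
      assume "t \<in> F1" "t' \<in> F1"
      then show ?thesis using t(3) n1 by (auto simp: n_def bij_betw_def dest: inj_onD)
    next
      assume "t \<in> F1" "t' \<notin> F1"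
      then show ?thesis using t(3) n1k[of t] by (simp add: n_def)
    next
      assume "t \<notin> F1" "t' \<in> F1"
      then show ?thesis using t(3) n1k[of t'] by (simp add: n_def)
    next
      assume "t \<notin> F1" "t' \<notin> F1"
      then show ?thesis using t n2 by (auto simp: n_def bij_betw_def dest: inj_onD)
    qed
  qed
  moreover have "n ` F \<subseteq> {1..card F}"
    using n1k n2l kl by (fastforce simp: n_def)
  ultimately have col: "proper_coloring G (card F + 1) (tri_color n)" by (rule tri_color_proper)
  have k1: "1 \<le> card F" using k F1(2) by simp
  let ?S = "{v \<in> pverts G. tri_color n v < ?k + 1}"
  have mem: "tri_color n v < ?k + 1 \<longleftrightarrow> f v \<in> quadp \<union> \<Union>F1" if v: "v \<in> pverts G" for v
  proof (cases "f v \<in> quadp")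
    case True
    then show ?thesis by (simp add: tri_color_quad)
  next
    case False
    then obtain t where t: "t \<in> F" "f v \<in> t" using fV[OF v] by blast
    have "f v \<in> \<Union>F1 \<longleftrightarrow> t \<in> F1" using t F1(1) fam_disjoint[OF fam] by blast
    moreover have "n t < ?k + 1 \<longleftrightarrow> t \<in> F1" using n1k[of t] by (simp add: n_def)
    ultimately show ?thesis using False by (simp add: tri_color_tri[OF t])
  qed
  have "f ` ?S = quadp \<union> \<Union>F1"
  proof (intro subset_antisym subsetI)
    fix y assume y: "y \<in> quadp \<union> \<Union>F1"
    then have "y \<in> quadp \<union> \<Union>F" using F1(1) by blast
    then obtain v where "v \<in> pverts G" "f v = y" using vertex by blast
    then show "y \<in> f ` ?S" using mem y by blast
  qed (use mem in blast)
  then have "induced G ?S \<simeq> Gam (\<Union>F1)" by (intro iso_induced) blast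
  then have "Gam (\<Union>F1) \<simeq> induced G ?S"
    by (rule isomorphic_sym[OF pair_graph_induced[OF G] pair_graph_Gam, rotated]) blast
  then have "H \<simeq> induced G ?S"
    by (rule isomorphic_trans[OF H(1) pair_graph_Gam pair_graph_arcs[OF pair_graph_induced[OF G]] H(2), rotated]) blast
  then have "m_chromatic_component (?k + 1) H G"
    unfolding m_chromatic_component_def induced_restrict chromatic_model[OF k1] using col by blast
  then show ?thesis
    unfolding chromatic_component_def chromatic_model[OF k1] using k F1(2) by (intro exI[of _ "?k + 1"]) simp
qed

text \<open>There are only finitely many families, so each lies in a maximal one; a triple disjoint
  from that one could be added.\<close>

lemma fam_extend: "fam F \<Longrightarrow> \<exists>F'. fam F' \<and> F \<subseteq> F' \<and> (\<forall>t\<in>TRI. t \<inter> \<Union>F' \<noteq> {})"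
proof -
  assume F: "fam F"
  obtain F' where F': "F \<subseteq> F'" "F' \<in> {E. fam E}" "\<And>E. E \<in> {E. fam E} \<Longrightarrow> F' \<subseteq> E \<Longrightarrow> F' = E"
    using finite_has_maximal2[of "{E. fam E}" F] F by auto
  have "t \<inter> \<Union>F' \<noteq> {}" if t: "t \<in> TRI" for t
  proof
    assume dis: "t \<inter> \<Union>F' = {}"
    have "fam (insert t F')"
      using F'(2) t dis unfolding fam_def mem_Collect_eq disjoint_def by blast
    then have "t \<in> F'" using F'(3)[of "insert t F'"] by blast
    then have "t = {}" using dis by blast
    then show False using TRI_D(2)[OF t] by simp
  qed
  then show ?thesis using F' by blast
qed

text \<open>The representatives without any entry in \<open>steps\<close>. In the order listed they
  belong to \<open>M5\<close>, \<open>M23\<close>, \<open>M22\<close> and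
  \<open>M25\<close>.\<close>

definition max_reps :: "ri set" where "max_reps = {R18, R30, R33, R36}"

lemma max_rep_meets: "j \<in> max_reps \<Longrightarrow> t \<in> TRI \<Longrightarrow> t \<inter> set (rep j) \<noteq> {}"
proof -
  assume j: "j \<in> max_reps" and t: "t \<in> TRI"
  obtain a b c where abc: "t = {a, b, c}" "[a, b, c] \<in> set tri_list" using t by (rule TRI_obtain)
  have "steps j = []" using j unfolding max_reps_def by (elim insertE) simp_all
  then have "list_ex (\<lambda>x. x \<in> set (rep j)) [a, b, c]"
    using steps_complete[of j] abc(2) unfolding list_all_iff by auto
  then show ?thesis unfolding abc(1) list_ex_iff by auto
qed

text \<open>Only the first entry is tested: a single disjoint triple shows that a representative can
  be extended.\<close>

lemma steps_disjoint: "list_all (\<lambda>(t, w, i). tri_ok t \<and> list_all (\<lambda>x. x \<notin> set (rep r)) t) (take 1 (steps r))"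
  by (cases r) (simp_all add: tri_ok_def rep_def)

lemma steps_Nil: "steps r = [] \<Longrightarrow> r \<in> max_reps"
  by (cases r) (simp_all add: max_reps_def)

lemma max_rep_iff: "(\<forall>t\<in>TRI. t \<inter> set (rep j) \<noteq> {}) \<longleftrightarrow> j \<in> max_reps"
proof
  assume all: "\<forall>t\<in>TRI. t \<inter> set (rep j) \<noteq> {}"
  show "j \<in> max_reps"
  proof (cases "steps j")
    case Nil
    then show ?thesis by (rule steps_Nil)
  next
    case (Cons p ps)
    obtain t w i where p: "p = (t, w, i)" by (cases p)
    have "tri_ok t" "\<And>x. x \<in> set t \<Longrightarrow> x \<notin> set (rep j)"
      using steps_disjoint[of j] unfolding Cons p list_all_iff by auto
    then show ?thesis using all tri_ok_TRI[of t] by blast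
  qed
qed (use max_rep_meets in blast)

text \<open>A triple avoiding the representative would be carried by the inverse symmetry to a
  triple avoiding the family.\<close>

lemma max_fam_rep:
  assumes F: "fam F" and max: "\<forall>t\<in>TRI. t \<inter> \<Union>F \<noteq> {}" and s: "aut s" "s ` \<Union>F = set (rep j)"
  shows "j \<in> max_reps"
proof -
  have inj: "inj s" using s(1) by (simp add: aut_def)
  have surj: "surj s" by (rule finite_UNIV_inj_surj[OF finite inj])
  have "t \<inter> set (rep j) \<noteq> {}" if t: "t \<in> TRI" for t
  proof -
    have "inv_into UNIV s ` t \<inter> \<Union>F \<noteq> {}" using max TRI_aut[OF aut_inv[OF s(1)] t] by blast
    then obtain x where x: "x \<in> t" "inv_into UNIV s x \<in> \<Union>F" by blast
    then have "s (inv_into UNIV s x) \<in> set (rep j)" unfolding s(2)[symmetric] by blast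
    then show ?thesis using x(1) unfolding surj_f_inv_f[OF surj] by blast
  qed
  then show ?thesis using max_rep_iff by blast
qed

subsection \<open>Pairwise non-isomorphism\<close>

text \<open>Counts every triple inside \<open>U\<close>, not just the members of a chosen family, so
  the number depends on the set alone.\<close>

definition tri_count :: "pt set \<Rightarrow> pt \<Rightarrow> nat" where
  "tri_count U x = card {t \<in> TRI. t \<subseteq> U \<and> x \<in> t}"

text \<open>By \<open>has_partner_iff\<close> the partner is \<open>ap x\<close>; the description by
  adjacency makes invariance under isomorphisms evident.\<close>

definition has_partner :: "pt set \<Rightarrow> pt \<Rightarrow> bool" where
  "has_partner U x \<longleftrightarrow> (\<exists>y\<in>U. y \<noteq> x \<and> \<not> adjp x y \<and> (\<exists>i\<in>{P1, P2, P3}. adjp i x \<and> adjp i y))"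

text \<open>The square and the factor 3 are weights for which the values separate representatives of
  equal size, as \<open>code_distinct\<close> confirms.\<close>

definition invariant :: "pt set \<Rightarrow> nat" where
  "invariant U = (\<Sum>x\<in>U. (tri_count U x)^2 * (if has_partner U x then 3 else 1))"

lemma invariant_cong:
  assumes inj: "inj_on g (quadp \<union> U)" and sub: "U \<subseteq> set (nb P0)" "g ` U \<subseteq> set (nb P0)"
    and arc: "\<And>x y. x \<in> quadp \<union> U \<Longrightarrow> y \<in> quadp \<union> U \<Longrightarrow> adjp (g x) (g y) \<longleftrightarrow> adjp x y"
    and gP: "g ` {P1, P2, P3} = {P1, P2, P3}"
  shows "invariant (g ` U) = invariant U"
proof -
  have PQ: "{P1, P2, P3} \<subseteq> quadp" by (simp add: quadp_def)
  have injU: "inj_on g U" by (rule inj_on_subset[OF inj]) blast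
  have geq: "g x = g y \<longleftrightarrow> x = y" if "x \<in> U" "y \<in> U" for x y using injU that by (auto dest: inj_onD)
  have arcU: "adjp (g x) (g y) \<longleftrightarrow> adjp x y" if "x \<in> U" "y \<in> U" for x y using arc that by blast
  have arcP: "adjp (g i) (g y) \<longleftrightarrow> adjp i y" if "i \<in> {P1, P2, P3}" "y \<in> U" for i y using arc PQ that by blast
  have exP: "(\<exists>i\<in>{P1, P2, P3}. Q i) \<longleftrightarrow> (\<exists>i\<in>{P1, P2, P3}. Q (g i))" for Q
  proof -
    have "(\<exists>i\<in>g ` A. Q i) \<longleftrightarrow> (\<exists>i\<in>A. Q (g i))" for A by blast
    from this[of "{P1, P2, P3}"] show ?thesis unfolding gP .
  qed
  have allP: "(\<forall>i\<in>{P1, P2, P3}. Q i) \<longleftrightarrow> (\<forall>i\<in>{P1, P2, P3}. Q (g i))" for Q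
  proof -
    have "(\<forall>i\<in>g ` A. Q i) \<longleftrightarrow> (\<forall>i\<in>A. Q (g i))" for A by blast
    from this[of "{P1, P2, P3}"] show ?thesis unfolding gP .
  qed
  have tri: "g ` t \<in> TRI \<longleftrightarrow> t \<in> TRI" if t: "t \<subseteq> U" for t
  proof -
    have "card (g ` t) = card t" by (rule card_image) (rule inj_on_subset[OF injU t])
    moreover have "(\<forall>x\<in>g ` t. \<forall>y\<in>g ` t. \<not> adjp x y) \<longleftrightarrow> (\<forall>x\<in>t. \<forall>y\<in>t. \<not> adjp x y)"
      using arcU t by blast
    moreover have "(\<forall>i\<in>{P1, P2, P3}. \<exists>x\<in>g ` t. adjp i x) \<longleftrightarrow> (\<forall>i\<in>{P1, P2, P3}. \<exists>x\<in>t. adjp i x)"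
    proof -
      have "(\<forall>i\<in>{P1, P2, P3}. \<exists>x\<in>g ` t. adjp i x) \<longleftrightarrow> (\<forall>i\<in>{P1, P2, P3}. \<exists>x\<in>t. adjp (g i) (g x))"
        unfolding allP[of "\<lambda>i. \<exists>x\<in>g ` t. adjp i x"] by (simp only: bex_simps)
      also have "\<dots> \<longleftrightarrow> (\<forall>i\<in>{P1, P2, P3}. \<exists>x\<in>t. adjp i x)"
        by (intro ball_cong bex_cong refl) (simp only: arcP subsetD[OF t])
      finally show ?thesis .
    qed
    moreover have "t \<subseteq> set (nb P0)" "g ` t \<subseteq> set (nb P0)" using t sub by blast+
    ultimately show ?thesis unfolding TRI_def mem_Collect_eq by (simp only: simp_thms)
  qed
  have count: "tri_count (g ` U) (g x) = tri_count U x" if x: "x \<in> U" for x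
  proof -
    have "{t \<in> TRI. t \<subseteq> g ` U \<and> g x \<in> t} = (`) g ` {t \<in> TRI. t \<subseteq> U \<and> x \<in> t}"
    proof (intro subset_antisym subsetI)
      fix t assume t: "t \<in> {t \<in> TRI. t \<subseteq> g ` U \<and> g x \<in> t}"
      then obtain s where s: "s \<subseteq> U" "t = g ` s" by (auto simp: subset_image_iff)
      then have "x \<in> s" using t x geq by blast
      then show "t \<in> (`) g ` {t \<in> TRI. t \<subseteq> U \<and> x \<in> t}" using s t tri by blast
    next
      fix t assume "t \<in> (`) g ` {t \<in> TRI. t \<subseteq> U \<and> x \<in> t}"
      then show "t \<in> {t \<in> TRI. t \<subseteq> g ` U \<and> g x \<in> t}" using tri by blast
    qed
    moreover have "inj_on ((`) g) {t \<in> TRI. t \<subseteq> U \<and> x \<in> t}"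
      by (rule inj_on_subset[OF inj_on_image_Pow[OF injU]]) blast
    ultimately show ?thesis unfolding tri_count_def by (simp add: card_image)
  qed
  have partner: "has_partner (g ` U) (g x) \<longleftrightarrow> has_partner U x" if x: "x \<in> U" for x
  proof -
    have e: "(\<exists>i\<in>{P1, P2, P3}. adjp i (g x) \<and> adjp i (g y)) \<longleftrightarrow> (\<exists>i\<in>{P1, P2, P3}. adjp i x \<and> adjp i y)"
      if y: "y \<in> U" for y
      unfolding exP[of "\<lambda>i. adjp i (g x) \<and> adjp i (g y)"]
      by (rule bex_cong[OF refl]) (simp only: arcP[OF _ x] arcP[OF _ y])
    have "has_partner (g ` U) (g x) \<longleftrightarrow> (\<exists>y\<in>U. g y \<noteq> g x \<and> \<not> adjp (g x) (g y) \<and>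
        (\<exists>i\<in>{P1, P2, P3}. adjp i (g x) \<and> adjp i (g y)))"
      unfolding has_partner_def by (simp only: bex_simps)
    also have "\<dots> \<longleftrightarrow> (\<exists>y\<in>U. y \<noteq> x \<and> \<not> adjp x y \<and> (\<exists>i\<in>{P1, P2, P3}. adjp i x \<and> adjp i y))"
      by (rule bex_cong[OF refl]) (simp only: geq arcU e x)
    finally show ?thesis unfolding has_partner_def .
  qed
  show ?thesis unfolding invariant_def sum.reindex[OF injU] o_def
    by (rule sum.cong[OF refl]) (simp add: count partner)
qed

lemma tri_model_degree_cases:
  assumes "tri_model G f F" "v \<in> pverts G" "1 \<le> card F"
  shows "(card {u. (u, v) \<in> parcs G} = 3 * card F \<longleftrightarrow> f v = P0) \<and>
    (card {u. (u, v) \<in> parcs G} = card F \<longleftrightarrow> f v \<in> {P1, P2, P3})"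
proof -
  interpret tri_model G f F by (rule assms(1))
  have ne: "F \<noteq> {}" using assms(3) by auto
  from assms(2) show ?thesis
  proof (cases rule: point_cases)
    case 1
    then show ?thesis using degree_P0[OF assms(2) 1] 1 ne by simp
  next
    case 2
    then show ?thesis using degree_quad[OF assms(2) 2] 2 ne by auto
  next
    case (3 t)
    then have "f v \<notin> quadp" using TRI_not_quadp fam_TRI[OF fam] by blast
    then show ?thesis using degree_tri[OF assms(2) 3] ne by (auto simp: quadp_def)
  qed
qed

text \<open>The degrees \<open>3 * card F\<close>, \<open>card F\<close> and
  \<open>2 * card F\<close> recognize \<open>P0\<close>, the points \<open>P1\<close>,
  \<open>P2\<close>, \<open>P3\<close> and the points of triples. Hence every isomorphism respects
  the standard class, and \<open>invariant_cong\<close> applies.\<close>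

lemma Gam_iso_invariant:
  assumes F: "fam F" "1 \<le> card F" and F': "fam F'" "1 \<le> card F'" and iso: "Gam (\<Union>F) \<simeq> Gam (\<Union>F')"
  shows "card F = card F' \<and> invariant (\<Union>F) = invariant (\<Union>F')"
proof -
  obtain g where g: "bij_betw g (pverts (Gam (\<Union>F))) (pverts (Gam (\<Union>F')))"
    "\<And>u v. u \<in> pverts (Gam (\<Union>F)) \<Longrightarrow> v \<in> pverts (Gam (\<Union>F)) \<Longrightarrow>
       (u, v) \<in> parcs (Gam (\<Union>F)) \<longleftrightarrow> (g u, g v) \<in> parcs (Gam (\<Union>F'))"
    using isomorphic_iff[OF pair_graph_Gam pair_graph_arcs[OF pair_graph_Gam]] iso by blast
  have deg: "card {u. (u, v) \<in> parcs (Gam (\<Union>F))} = card {w. (w, g v) \<in> parcs (Gam (\<Union>F'))}"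
    if "v \<in> pverts (Gam (\<Union>F))" for v
    by (rule iso_degree[OF pair_graph_Gam pair_graph_Gam g(1) _ that]) (rule g(2))
  have gV: "g v \<in> pverts (Gam (\<Union>F'))" if "v \<in> pverts (Gam (\<Union>F))" for v using g(1) that by (auto simp: bij_betw_def)
  have size: "card (pverts (Gam (\<Union>E))) = 4 + 3 * card E" if E: "fam E" for E
  proof -
    have "quadp \<inter> \<Union>E = {}" using TRI_not_quadp fam_TRI[OF E] by blast
    then have "card (quadp \<union> \<Union>E) = card quadp + card (\<Union>E)" by (intro card_Un_disjoint) simp_all
    then show ?thesis unfolding pverts_Gam card_Union_fam[OF E] by (simp add: quadp_def)
  qed
  have k: "card F = card F'" using bij_betw_same_card[OF g(1)] unfolding size[OF F(1)] size[OF F'(1)] by simp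
  have c: "card {u. (u, v) \<in> parcs (Gam (\<Union>F))} = 3 * card F \<longleftrightarrow> v = P0"
    "card {u. (u, v) \<in> parcs (Gam (\<Union>F))} = card F \<longleftrightarrow> v \<in> {P1, P2, P3}" if "v \<in> pverts (Gam (\<Union>F))" for v
    using tri_model_degree_cases[OF tri_model_Gam[OF F(1)] that F(2)] by simp_all
  have c': "card {u. (u, v) \<in> parcs (Gam (\<Union>F'))} = 3 * card F' \<longleftrightarrow> v = P0"
    "card {u. (u, v) \<in> parcs (Gam (\<Union>F'))} = card F' \<longleftrightarrow> v \<in> {P1, P2, P3}" if "v \<in> pverts (Gam (\<Union>F'))" for v
    using tri_model_degree_cases[OF tri_model_Gam[OF F'(1)] that F'(2)] by simp_all
  have g0: "g v = P0 \<longleftrightarrow> v = P0" and g1: "g v \<in> {P1, P2, P3} \<longleftrightarrow> v \<in> {P1, P2, P3}"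
    if v: "v \<in> pverts (Gam (\<Union>F))" for v
    using c[OF v] c'[OF gV[OF v]] deg[OF v] k by metis+
  have inj: "inj_on g (quadp \<union> \<Union>F)" using bij_betw_imp_inj_on[OF g(1)] unfolding pverts_Gam .
  have im: "g ` (quadp \<union> \<Union>F) = quadp \<union> \<Union>F'" using bij_betw_imp_surj_on[OF g(1)] unfolding pverts_Gam .
  have QQ: "quadp \<inter> \<Union>F = {}" "quadp \<inter> \<Union>F' = {}" using TRI_not_quadp fam_TRI[OF F(1)] fam_TRI[OF F'(1)] by blast+
  have gq: "g v \<in> quadp \<longleftrightarrow> v \<in> quadp" if v: "v \<in> quadp \<union> \<Union>F" for v
    using g0[of v] g1[of v] v unfolding pverts_Gam quadp_def by blast
  have gU: "g ` \<Union>F = \<Union>F'"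
  proof (intro subset_antisym image_subsetI subsetI)
    fix x assume x: "x \<in> \<Union>F"
    have xU: "x \<in> quadp \<union> \<Union>F" using x by (rule UnI2)
    have "x \<notin> quadp" using QQ(1) x disjoint_iff[of quadp] by metis
    then have n: "g x \<notin> quadp" using gq[OF xU] by simp
    have "g x \<in> quadp \<union> \<Union>F'" unfolding im[symmetric] using xU by (rule imageI)
    then show "g x \<in> \<Union>F'" using n by (simp only: Un_iff simp_thms)
  next
    fix y assume y: "y \<in> \<Union>F'"
    have "y \<in> g ` (quadp \<union> \<Union>F)" unfolding im using y by (rule UnI2)
    then obtain x where x: "y = g x" "x \<in> quadp \<union> \<Union>F" by (rule imageE)
    have "g x \<notin> quadp" using QQ(2) y x(1) disjoint_iff[of quadp] by metis
    then have n: "x \<notin> quadp" using gq[OF x(2)] by simp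
    have "x \<in> \<Union>F" using x(2) n by (simp only: Un_iff simp_thms)
    then show "y \<in> g ` \<Union>F" unfolding x(1) by (rule imageI)
  qed
  have gP: "g ` {P1, P2, P3} = {P1, P2, P3}"
  proof (rule card_subset_eq)
    have sub: "{P1, P2, P3} \<subseteq> pverts (Gam (\<Union>F))" by (simp add: pverts_Gam quadp_def)
    show "g ` {P1, P2, P3} \<subseteq> {P1, P2, P3}"
    proof (rule image_subsetI)
      fix x assume x: "x \<in> {P1, P2, P3}"
      then show "g x \<in> {P1, P2, P3}" using g1[OF subsetD[OF sub x]] by blast
    qed
    show "card (g ` {P1, P2, P3}) = card {P1, P2, P3}"
      by (rule card_image) (rule inj_on_subset[OF inj], simp add: quadp_def)
  qed simp
  have nbs: "\<Union>E \<subseteq> set (nb P0)" if "fam E" for E using TRI_D(1) fam_TRI[OF that] by blast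
  have arc: "adjp (g x) (g y) \<longleftrightarrow> adjp x y" if "x \<in> quadp \<union> \<Union>F" "y \<in> quadp \<union> \<Union>F" for x y
  proof -
    have V: "x \<in> pverts (Gam (\<Union>F))" "y \<in> pverts (Gam (\<Union>F))" unfolding pverts_Gam by (fact that)+
    show ?thesis
      using g(2)[OF V] unfolding Gam_arcs[OF V] Gam_arcs[OF gV[OF V(1)] gV[OF V(2)]] by (rule sym)
  qed
  have "invariant (g ` \<Union>F) = invariant (\<Union>F)"
    by (rule invariant_cong[OF inj nbs[OF F(1)] _ arc gP]) (simp only: gU nbs[OF F'(1)])
  then show ?thesis using k unfolding gU by simp
qed

definition tri_within :: "ri \<Rightarrow> pt list list" where
  "tri_within r = filter (list_all (\<lambda>y. y \<in> set (rep r))) tri_list"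

text \<open>The invariant in a form that can be evaluated: triples are taken from
  \<open>tri_list\<close>, and partners from the table \<open>ap\<close>.\<close>

definition rep_value :: "ri \<Rightarrow> nat" where
  "rep_value r = sum_list (map (\<lambda>x. (length (filter (\<lambda>t. x \<in> set t) (tri_within r)))^2 *
     (if ap x \<in> set (rep r) then 3 else 1)) (rep r))"

primrec code :: "ri \<Rightarrow> nat" where
    "code R0 = 0"
  | "code R1 = 3"
  | "code R2 = 10"
  | "code R3 = 6"
  | "code R4 = 18"
  | "code R5 = 22"
  | "code R6 = 17"
  | "code R7 = 30"
  | "code R8 = 9"
  | "code R9 = 36"
  | "code R10 = 21"
  | "code R11 = 80"
  | "code R12 = 44"
  | "code R13 = 58"
  | "code R14 = 42"
  | "code R15 = 70"
  | "code R16 = 28"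
  | "code R17 = 69"
  | "code R18 = 144"
  | "code R19 = 39"
  | "code R20 = 24"
  | "code R21 = 36"
  | "code R22 = 131"
  | "code R23 = 93"
  | "code R24 = 109"
  | "code R25 = 123"
  | "code R26 = 140"
  | "code R27 = 125"
  | "code R28 = 102"
  | "code R29 = 54"
  | "code R30 = 324"
  | "code R31 = 234"
  | "code R32 = 243"
  | "code R33 = 306"
  | "code R34 = 216"
  | "code R35 = 534"
  | "code R36 = 1152"

lemma tri_list_ok: "list_all tri_ok tri_list"
  by (simp add: tri_list_def tri_ok_def)

lemma distinct_tri_list_all: "distinct tri_list"
  by (simp add: tri_list_def)

text \<open>A listed triple has its entries in the disjoint neighbourhoods of \<open>P1\<close>,
  \<open>P2\<close> and \<open>P3\<close>, in this order, so the set determines the list.\<close>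

lemma inj_on_tri_list: "inj_on set (set tri_list)"
proof (rule inj_onI)
  fix t t' assume t: "t \<in> set tri_list" "t' \<in> set tri_list" and eq: "set t = set t'"
  have form: "\<exists>a b c. s = [a, b, c] \<and> a \<in> set (nb P1) \<and> b \<in> set (nb P2) \<and> c \<in> set (nb P3)"
    if "s \<in> set tri_list" for s
  proof -
    have ok: "tri_ok s" using tri_list_ok that unfolding list_all_iff by blast
    then obtain a b c where s: "s = [a, b, c]" unfolding tri_ok_def by (simp split: list.split_asm)
    have "a \<in> set (nb P1) \<and> b \<in> set (nb P2) \<and> c \<in> set (nb P3)"
      using ok unfolding tri_ok_def s by (simp only: list.case simp_thms)
    then show ?thesis using s by blast
  qed
  obtain a b c where s: "t = [a, b, c]" "a \<in> set (nb P1)" "b \<in> set (nb P2)" "c \<in> set (nb P3)"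
    using form[OF t(1)] by blast
  obtain a' b' c' where s': "t' = [a', b', c']" "a' \<in> set (nb P1)" "b' \<in> set (nb P2)" "c' \<in> set (nb P3)"
    using form[OF t(2)] by blast
  have d: "set (nb P1) \<inter> set (nb P2) = {}" "set (nb P1) \<inter> set (nb P3) = {}" "set (nb P2) \<inter> set (nb P3) = {}"
    by simp_all
  have mem: "a \<in> {a', b', c'}" "b \<in> {a', b', c'}" "c \<in> {a', b', c'}"
    using eq unfolding s(1) s'(1) by (simp_all only: list.set) blast+
  have "a = a'" using mem(1) s(2) s' d by blast
  moreover have "b = b'" using mem(2) s(3) s' d by blast
  moreover have "c = c'" using mem(3) s(4) s' d by blast
  ultimately show "t = t'" using s(1) s'(1) by simp
qed

lemma tri_count_rep: "tri_count (set (rep r)) x = length (filter (\<lambda>t. x \<in> set t) (tri_within r))"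
proof -
  let ?L = "filter (\<lambda>t. x \<in> set t) (tri_within r)"
  have "{t \<in> TRI. t \<subseteq> set (rep r) \<and> x \<in> t} = set ` set ?L"
  proof (intro subset_antisym subsetI)
    fix t assume t: "t \<in> {t \<in> TRI. t \<subseteq> set (rep r) \<and> x \<in> t}"
    then have "t \<in> TRI" by blast
    then obtain a b c where "t = {a, b, c}" "[a, b, c] \<in> set tri_list" by (rule TRI_obtain)
    then have "t = set [a, b, c]" "[a, b, c] \<in> set tri_list" by simp_all
    then show "t \<in> set ` set ?L" using t unfolding tri_within_def set_filter list_all_iff by blast
  next
    fix t assume "t \<in> set ` set ?L"
    then obtain l where l: "t = set l" "l \<in> set tri_list" "set l \<subseteq> set (rep r)" "x \<in> set l"
      unfolding tri_within_def set_filter list_all_iff by blast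
    then have "t \<in> TRI" using tri_list_ok tri_ok_TRI unfolding list_all_iff by blast
    then show "t \<in> {t \<in> TRI. t \<subseteq> set (rep r) \<and> x \<in> t}" using l by blast
  qed
  moreover have "inj_on set (set ?L)"
    by (rule inj_on_subset[OF inj_on_tri_list]) (auto simp: tri_within_def)
  ultimately have "tri_count (set (rep r)) x = card (set ?L)" unfolding tri_count_def by (simp only: card_image)
  also have "\<dots> = length ?L"
    by (rule distinct_card) (unfold tri_within_def, intro distinct_filter distinct_tri_list_all)
  finally show ?thesis .
qed

lemma partner_table: "list_all (\<lambda>x. filter (\<lambda>y. y \<noteq> x \<and> y \<notin> set (nb x) \<and>
    list_ex (\<lambda>i. x \<in> set (nb i) \<and> y \<in> set (nb i)) [P1, P2, P3]) (nb P0) = [ap x]) (nb P0)"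
  by simp

lemma has_partner_iff:
  assumes U: "U \<subseteq> set (nb P0)" and x: "x \<in> set (nb P0)"
  shows "has_partner U x \<longleftrightarrow> ap x \<in> U"
proof -
  have "filter (\<lambda>y. y \<noteq> x \<and> y \<notin> set (nb x) \<and> list_ex (\<lambda>i. x \<in> set (nb i) \<and> y \<in> set (nb i)) [P1, P2, P3]) (nb P0) = [ap x]"
    using partner_table x unfolding list_all_iff by blast
  then have "set (filter (\<lambda>y. y \<noteq> x \<and> y \<notin> set (nb x) \<and> list_ex (\<lambda>i. x \<in> set (nb i) \<and> y \<in> set (nb i)) [P1, P2, P3]) (nb P0)) = {ap x}"
    by (simp only: list.set)
  then have "{y. y \<in> set (nb P0) \<and> y \<noteq> x \<and> \<not> adjp x y \<and> (\<exists>i\<in>set [P1, P2, P3]. adjp i x \<and> adjp i y)} = {ap x}"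
    unfolding set_filter list_ex_iff adjp_def by blast
  then have iff: "y \<in> set (nb P0) \<and> y \<noteq> x \<and> \<not> adjp x y \<and> (\<exists>i\<in>{P1, P2, P3}. adjp i x \<and> adjp i y) \<longleftrightarrow> y = ap x" for y
    unfolding set_eq_iff list.set mem_Collect_eq singleton_iff by blast
  have "has_partner U x \<longleftrightarrow> (\<exists>y\<in>U. y = ap x)"
    unfolding has_partner_def by (rule bex_cong[OF refl]) (simp only: iff[symmetric] subsetD[OF U] simp_thms)
  also have "\<dots> \<longleftrightarrow> ap x \<in> U" by blast
  finally show ?thesis .
qed

lemma rep_sub: "set (rep r) \<subseteq> set (nb P0)"
proof -
  have "t \<subseteq> set (nb P0)" if "t \<in> rep_fam r" for t by (rule TRI_D(1)[OF fam_TRI[OF fam_rep_fam that]])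
  then show ?thesis unfolding Union_rep_fam[symmetric] by blast
qed

lemma invariant_rep: "invariant (set (rep r)) = rep_value r"
proof -
  have "invariant (set (rep r)) = (\<Sum>x\<in>set (rep r). (length (filter (\<lambda>t. x \<in> set t) (tri_within r)))^2 *
     (if ap x \<in> set (rep r) then 3 else 1))"
    unfolding invariant_def tri_count_rep
    by (rule sum.cong[OF refl]) (simp only: has_partner_iff[OF rep_sub subsetD[OF rep_sub]])
  also have "\<dots> = rep_value r"
    unfolding rep_value_def by (rule sum_list_distinct_conv_sum_set[OF distinct_rep, symmetric])
  finally show ?thesis .
qed

lemma rep_value_code: "rep_value r = code r"
  by (cases r) (simp_all add: rep_value_def tri_within_def tri_list_def rep_def power2_eq_square)

definition all_ri :: "ri list" where
  "all_ri = [R0, R1, R2, R3, R4, R5, R6, R7, R8, R9, R10, R11, R12, R13, R14, R15, R16, R17, R18, R19,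
     R20, R21, R22, R23, R24, R25, R26, R27, R28, R29, R30, R31, R32, R33, R34, R35, R36]"

lemma set_all_ri: "set all_ri = UNIV"
proof -
  have "x \<in> set all_ri" for x by (cases x) (simp_all add: all_ri_def)
  then show ?thesis by blast
qed

text \<open>The number of triples is part of the key because codes can coincide for different sizes,
  as for \<open>R9\<close> and \<open>R21\<close>.\<close>

lemma code_distinct: "distinct (map (\<lambda>r. (length (dec r), code r)) all_ri)"
  by (simp add: all_ri_def)

lemma rep_noniso:
  assumes i: "6 \<le> length (rep i)" and j: "6 \<le> length (rep j)" and iso: "Gam (set (rep i)) \<simeq> Gam (set (rep j))"
  shows "i = j"
proof -
  have k: "1 \<le> card (rep_fam i)" "1 \<le> card (rep_fam j)" using i j unfolding length_rep by simp_all
  have "card (rep_fam i) = card (rep_fam j) \<and> invariant (set (rep i)) = invariant (set (rep j))"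
    using Gam_iso_invariant[OF fam_rep_fam k(1) fam_rep_fam k(2)] iso unfolding Union_rep_fam by blast
  then have "length (rep i) = length (rep j)" "code i = code j"
    unfolding length_rep invariant_rep rep_value_code by simp_all
  moreover have "length (rep r) = 3 * length (dec r)" for r
  proof -
    show ?thesis by (cases r) (simp_all add: rep_def)
  qed
  ultimately have "(length (dec i), code i) = (length (dec j), code j)" by simp
  moreover have "inj_on (\<lambda>r. (length (dec r), code r)) (set all_ri)" using code_distinct unfolding distinct_map by blast
  ultimately show ?thesis unfolding set_all_ri by (auto dest: injD)
qed

subsection \<open>The four maximal graphs\<close>

definition code_vec :: "bool \<times> nat \<times> nat \<Rightarrow> int Matrix.vec" where
  "code_vec p = (if fst p then b_vec (snd p) else a_vec (snd p))"

definition code_ok :: "bool \<times> nat \<times> nat \<Rightarrow> bool" where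
  "code_ok p \<longleftrightarrow> 1 \<le> fst (snd p) \<and> fst (snd p) < snd (snd p) \<and> snd (snd p) \<le> 8"

text \<open>Nested conditionals in place of connectives let the simplifier stop at the first
  decisive comparison.\<close>

fun code_adj :: "bool \<times> nat \<times> nat \<Rightarrow> bool \<times> nat \<times> nat \<Rightarrow> bool" where
  "code_adj (s, i, j) (s', i', j') \<longleftrightarrow>
     (if s = s' then (if i = i' then j \<noteq> j' else if j = j' then True else if i = j' then True else j = i')
      else (if i = i' then False else if j = j' then False else if i = j' then False else j \<noteq> i'))"

text \<open>The subtraction passes from the numbering of pairs, which starts at 1, to that of vector
  entries.\<close>

definition code_set :: "bool \<times> nat \<times> nat \<Rightarrow> nat set" where
  "code_set p = {fst (snd p) - 1, snd (snd p) - 1}"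

lemma code_vec_pair:
  assumes "code_ok p"
  shows "code_vec p = vec_of_list (pair_vec (code_set p) (fst p))"
proof -
  obtain s i j where p: "p = (s, i, j)" by (cases p) auto
  have ij: "1 \<le> i" "i < j" "j \<le> 8" using assms by (simp_all add: code_ok_def p)
  show ?thesis
  proof (rule eq_vecI)
    have d: "dim_vec (vec_of_list (pair_vec (code_set p) (fst p))) = 8"
      unfolding pair_vec_def dim_vec_of_list length_map length_upt by simp
    show "dim_vec (code_vec p) = dim_vec (vec_of_list (pair_vec (code_set p) (fst p)))"
      unfolding d by (simp add: code_vec_def a_vec_def b_vec_def p)
    fix k assume "k < dim_vec (vec_of_list (pair_vec (code_set p) (fst p)))"
    then have k: "k < 8" unfolding d .
    have e: "vec_of_list (pair_vec (code_set p) (fst p)) $ k =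
      (if k \<in> code_set p then (if s then - 1 else 2) else (if s then 1 else 0))"
      using k unfolding vec_of_list_index pair_vec_def by (subst nth_map_upt) (simp_all add: p)
    show "code_vec p $ k = vec_of_list (pair_vec (code_set p) (fst p)) $ k"
      unfolding e using k ij
      by (cases s) (auto simp: code_vec_def a_vec_def b_vec_def p code_set_def)
  qed
qed

lemma code_set_pair: "code_ok p \<Longrightarrow> code_set p \<subseteq> {0..<8} \<and> card (code_set p) = 2"
  by (auto simp: code_ok_def code_set_def)

lemma code_set_eq: "code_ok p \<Longrightarrow> code_ok q \<Longrightarrow> code_set p = code_set q \<longleftrightarrow> snd p = snd q"
  unfolding code_ok_def code_set_def doubleton_eq_iff prod_eq_iff by linarith

lemma code_vec_prod:
  assumes p: "code_ok p" and q: "code_ok q"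
  shows "code_vec p \<bullet> code_vec q = (if p = q then 8 else if code_adj p q then 4
     else if fst p \<noteq> fst q \<and> snd p = snd q then - 4 else 0)"
proof -
  have len: "length (pair_vec (code_set p) (fst p)) = length (pair_vec (code_set q) (fst q))"
    by (simp only: pair_vec_def length_map)
  have cp: "code_set p \<subseteq> {0..<8}" "card (code_set p) = 2" and cq: "code_set q \<subseteq> {0..<8}" "card (code_set q) = 2"
    using code_set_pair[OF p] code_set_pair[OF q] by blast+
  have v: "code_vec p \<bullet> code_vec q = (if fst p = fst q then 4 * int (card (code_set p \<inter> code_set q))
      else 4 - 4 * int (card (code_set p \<inter> code_set q)))"
    unfolding code_vec_pair[OF p] code_vec_pair[OF q] scalar_prod_ipl[OF len] by (rule ipl_pair_vec[OF cp cq])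
  have ci: "card (code_set p \<inter> code_set q) = (if snd p = snd q then 2 else if code_set p \<inter> code_set q \<noteq> {} then 1 else 0)"
    unfolding card_Int_pairs[OF cp(2) cq(2)] code_set_eq[OF p q] ..
  have meet: "code_set p \<inter> code_set q \<noteq> {} \<longleftrightarrow> fst (snd p) = fst (snd q) \<or> fst (snd p) = snd (snd q)
      \<or> snd (snd p) = fst (snd q) \<or> snd (snd p) = snd (snd q)"
    using p q unfolding code_ok_def code_set_def by auto
  obtain s i j s' i' j' where pq: "p = (s, i, j)" "q = (s', i', j')" by (metis prod.collapse)
  have "i < j" "i' < j'" using p q by (simp_all add: code_ok_def pq)
  then show ?thesis unfolding v ci meet unfolding pq by auto
qed

lemma a_vec_carrier: "a_vec p \<in> carrier_vec 8" and b_vec_carrier: "b_vec p \<in> carrier_vec 8"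
  by (cases p, simp add: a_vec_def, cases p, simp add: b_vec_def)

lemma pair_graph_Gamma:
  assumes "finite A" "finite B" shows "pair_graph (Gamma_graph A B)"
proof (rule pair_graphI)
  show "finite (pverts (Gamma_graph A B))" using assms by (simp add: Gamma_graph_def Let_def)
  fix u v assume uv: "(u, v) \<in> parcs (Gamma_graph A B)"
  then have "u \<in> carrier_vec 8" "v \<in> carrier_vec 8"
    using a_vec_carrier b_vec_carrier by (auto simp: Gamma_graph_def Let_def)
  then have "u \<bullet> v = v \<bullet> u" by (rule comm_scalar_prod)
  then show "u \<in> pverts (Gamma_graph A B) \<and> v \<in> pverts (Gamma_graph A B) \<and> u \<noteq> v \<and> (v, u) \<in> parcs (Gamma_graph A B)"
    using uv by (auto simp: Gamma_graph_def Let_def)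
qed

text \<open>\<open>T\<close> tabulates an isomorphism between points and codes of vectors.
  Distinctness and the matching length make it a bijection by counting, and the remaining hypotheses
  are finite checks.\<close>

lemma Gamma_iso_rep:
  assumes V: "a_vec ` A \<union> b_vec ` B = code_vec ` set (map snd T)"
    and ok: "list_all code_ok (map snd T)" and d: "distinct (map fst T)"
    and sub: "list_all (\<lambda>x. x \<in> set (P0 # P1 # P2 # P3 # rep r)) (map fst T)"
    and len: "length T = 4 + length (rep r)"
    and adj: "list_all (\<lambda>(x, p). list_all (\<lambda>(y, q). y \<in> set (nb x) \<longleftrightarrow> code_adj p q) T) T"
    and inj: "distinct (map snd T)"
    and fin: "finite A" "finite B"
  shows "Gamma_graph A B \<simeq> Gam (set (rep r))"
proof (rule isomorphic_sym[OF pair_graph_Gam pair_graph_Gamma[OF fin]])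
  have quad_rep: "quadp \<inter> set (rep r) = {}" using TRI_not_quadp fam_TRI[OF fam_rep_fam[of r]] unfolding Union_rep_fam[symmetric] by blast
  have cQ: "card (quadp \<union> set (rep r)) = 4 + length (rep r)"
    using quad_rep distinct_card[OF distinct_rep[of r]] by (subst card_Un_disjoint) (simp_all add: quadp_def)
  have "set (map fst T) \<subseteq> quadp \<union> set (rep r)" using sub unfolding list_all_iff quadp_def by auto
  then have fT: "set (map fst T) = quadp \<union> set (rep r)"
    by (intro card_subset_eq) (simp_all only: finite cQ distinct_card[OF d] length_map len)
  define m where "m x = the (map_of T x)" for x
  have m: "(x, m x) \<in> set T" if "x \<in> quadp \<union> set (rep r)" for x
  proof -
    have "x \<in> fst ` set T" using that fT by simp
    then obtain p where p: "(x, p) \<in> set T" by force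
    then have "map_of T x = Some p" using d by (intro map_of_is_SomeI)
    then show ?thesis using p by (simp add: m_def)
  qed
  have ok': "code_ok (m x)" if "x \<in> quadp \<union> set (rep r)" for x
    using ok m[OF that] unfolding list_all_iff set_map by (metis imageI snd_conv)
  have inj_m: "x = y" if "x \<in> quadp \<union> set (rep r)" "y \<in> quadp \<union> set (rep r)" "m x = m y" for x y
  proof -
    have inj_snd: "inj_on snd (set T)" using inj unfolding distinct_map by blast
    have "(x, m x) = (y, m y)"
      by (rule inj_onD[OF inj_snd _ m[OF that(1)] m[OF that(2)]]) (simp only: snd_conv that(3))
    then show ?thesis by simp
  qed
  have adj_m: "adjp x y \<longleftrightarrow> code_adj (m x) (m y)" if "x \<in> quadp \<union> set (rep r)" "y \<in> quadp \<union> set (rep r)" for x y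
    using adj m[OF that(1)] m[OF that(2)] unfolding list_all_iff adjp_def by fast
  have not4: "\<not> (fst p \<noteq> fst q \<and> snd p = snd q) \<or> \<not> code_adj p q" for p q
    by (cases p; cases q) simp
  have prod: "code_vec (m x) \<bullet> code_vec (m y) = 4 \<longleftrightarrow> adjp x y"
    and eq: "code_vec (m x) = code_vec (m y) \<longleftrightarrow> x = y"
    if xy: "x \<in> quadp \<union> set (rep r)" "y \<in> quadp \<union> set (rep r)" for x y
  proof -
    have v: "code_vec (m x) \<bullet> code_vec (m y) = (if m x = m y then 8 else if code_adj (m x) (m y) then 4
     else if fst (m x) \<noteq> fst (m y) \<and> snd (m x) = snd (m y) then - 4 else 0)"
      by (rule code_vec_prod[OF ok'[OF xy(1)] ok'[OF xy(2)]])
    have v': "code_vec (m y) \<bullet> code_vec (m y) = 8" using code_vec_prod[OF ok'[OF xy(2)] ok'[OF xy(2)]] by simp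
    show "code_vec (m x) = code_vec (m y) \<longleftrightarrow> x = y"
    proof
      assume "code_vec (m x) = code_vec (m y)"
      then have "code_vec (m x) \<bullet> code_vec (m y) = 8" using v' by simp
      then have "m x = m y" unfolding v by (auto split: if_splits)
      then show "x = y" by (rule inj_m[OF xy])
    qed simp
    have "m x = m y \<Longrightarrow> \<not> adjp x y" using inj_m[OF xy] adjp_irrefl by blast
    then show "code_vec (m x) \<bullet> code_vec (m y) = 4 \<longleftrightarrow> adjp x y"
      unfolding v adj_m[OF xy] by auto
  qed
  have pv: "pverts (Gamma_graph A B) = code_vec ` set (map snd T)" by (simp add: Gamma_graph_def Let_def V)
  show "Gam (set (rep r)) \<simeq> Gamma_graph A B"
  proof (rule isomorphicI[OF pair_graph_Gam pair_graph_arcs[OF pair_graph_Gamma[OF fin]], where f = "code_vec \<circ> m"])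
    have im: "m ` (quadp \<union> set (rep r)) = set (map snd T)"
    proof (intro subset_antisym subsetI)
      fix p assume "p \<in> m ` (quadp \<union> set (rep r))"
      then show "p \<in> set (map snd T)" using m by force
    next
      fix p assume "p \<in> set (map snd T)"
      then obtain x where x: "(x, p) \<in> set T" by auto
      then have "map_of T x = Some p" using d by (intro map_of_is_SomeI)
      moreover have "x \<in> quadp \<union> set (rep r)" using x fT by force
      ultimately show "p \<in> m ` (quadp \<union> set (rep r))" by (intro image_eqI[of _ _ x]) (simp_all add: m_def)
    qed
    show "bij_betw (code_vec \<circ> m) (pverts (Gam (set (rep r)))) (pverts (Gamma_graph A B))"
      unfolding bij_betw_def
    proof
      show "inj_on (code_vec \<circ> m) (pverts (Gam (set (rep r))))"
        unfolding pverts_Gam by (rule inj_onI) (simp only: o_apply eq)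
      show "(code_vec \<circ> m) ` pverts (Gam (set (rep r))) = pverts (Gamma_graph A B)"
        by (simp only: image_comp[symmetric] pverts_Gam im pv)
    qed
    fix x y assume xy: "x \<in> pverts (Gam (set (rep r)))" "y \<in> pverts (Gam (set (rep r)))"
    then have xy': "x \<in> quadp \<union> set (rep r)" "y \<in> quadp \<union> set (rep r)" by (simp_all add: pverts_Gam)
    have "code_vec (m x) \<in> pverts (Gamma_graph A B)" "code_vec (m y) \<in> pverts (Gamma_graph A B)"
      unfolding pv im[symmetric] using xy' by blast+
    then have "((code_vec \<circ> m) x, (code_vec \<circ> m) y) \<in> parcs (Gamma_graph A B) \<longleftrightarrow>
        code_vec (m x) \<noteq> code_vec (m y) \<and> code_vec (m x) \<bullet> code_vec (m y) = 4"
      by (simp add: Gamma_graph_def Let_def)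
    also have "\<dots> \<longleftrightarrow> adjp x y" using prod[OF xy'] eq[OF xy'] adjp_irrefl by blast
    finally show "(x, y) \<in> parcs (Gam (set (rep r))) \<longleftrightarrow> ((code_vec \<circ> m) x, (code_vec \<circ> m) y) \<in> parcs (Gamma_graph A B)"
      using Gam_arcs[OF xy] by simp
  qed
qed

text \<open>In this table and the next three the distinguished vertex \<open>P0\<close> corresponds
  to the vector b_12.\<close>

definition M5_map :: "(pt \<times> bool \<times> nat \<times> nat) list" where
  "M5_map = [
    (P4, False, 3, 5), (P14, False, 3, 6), (P16, False, 3, 7), (P10, False, 3, 8),
    (P5, False, 4, 5), (P15, False, 4, 6), (P17, False, 4, 7), (P11, False, 4, 8),
    (P20, False, 5, 6), (P21, False, 5, 7), (P26, False, 6, 8), (P27, False, 7, 8),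
    (P0, True, 1, 2), (P3, True, 3, 4), (P2, True, 5, 8), (P1, True, 6, 7)]"

definition M22_map :: "(pt \<times> bool \<times> nat \<times> nat) list" where
  "M22_map = [
    (P4, False, 3, 4), (P16, False, 3, 5), (P14, False, 3, 6), (P10, False, 3, 7),
    (P21, False, 4, 5), (P20, False, 4, 6), (P5, False, 4, 8), (P27, False, 5, 7),
    (P17, False, 5, 8), (P26, False, 6, 7), (P15, False, 6, 8), (P11, False, 7, 8),
    (P0, True, 1, 2), (P23, True, 1, 3), (P18, True, 1, 4), (P6, True, 1, 5),
    (P9, True, 2, 6), (P13, True, 2, 7), (P24, True, 2, 8), (P3, True, 3, 8),
    (P2, True, 4, 7), (P1, True, 5, 6)]"

definition M23_map :: "(pt \<times> bool \<times> nat \<times> nat) list" where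
  "M23_map = [
    (P8, False, 3, 5), (P5, False, 3, 6), (P13, False, 3, 7), (P15, False, 3, 8),
    (P10, False, 4, 5), (P7, False, 4, 6), (P16, False, 4, 7), (P18, False, 4, 8),
    (P24, False, 5, 7), (P26, False, 5, 8), (P21, False, 6, 7), (P23, False, 6, 8),
    (P0, True, 1, 2), (P27, True, 1, 3), (P25, True, 1, 4), (P17, True, 1, 5),
    (P14, True, 2, 6), (P6, True, 2, 7), (P4, True, 2, 8), (P3, True, 3, 4), (P2, True, 5, 6),
    (P1, True, 7, 8)]"

definition M25_map :: "(pt \<times> bool \<times> nat \<times> nat) list" where
  "M25_map = [
    (P3, False, 1, 8), (P2, False, 2, 7), (P4, False, 3, 4), (P5, False, 3, 5),
    (P6, False, 3, 6), (P12, False, 3, 7), (P20, False, 3, 8), (P9, False, 4, 5),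
    (P10, False, 4, 6), (P16, False, 4, 7), (P24, False, 4, 8), (P11, False, 5, 6),
    (P17, False, 5, 7), (P25, False, 5, 8), (P18, False, 6, 7), (P26, False, 6, 8),
    (P0, True, 1, 2), (P19, True, 1, 3), (P15, True, 1, 4), (P14, True, 1, 5),
    (P13, True, 1, 6), (P8, True, 1, 7), (P27, True, 2, 3), (P23, True, 2, 4),
    (P22, True, 2, 5), (P21, True, 2, 6), (P7, True, 2, 8), (P1, True, 7, 8)]"

lemma M5_rep: "M5 \<simeq> Gam (set (rep R18))"
  unfolding M5_def
by (rule Gamma_iso_rep[where T = M5_map],
      simp only: M5_map_def list.map list.set snd_conv fst_conv image_insert image_empty code_vec_def
        if_True if_False Un_insert_left Un_empty_left,
      simp_all add: M5_map_def code_ok_def rep_def)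

lemma M22_rep: "M22 \<simeq> Gam (set (rep R33))"
  unfolding M22_def
by (rule Gamma_iso_rep[where T = M22_map],
      simp only: M22_map_def list.map list.set snd_conv fst_conv image_insert image_empty code_vec_def
        if_True if_False Un_insert_left Un_empty_left,
      simp_all add: M22_map_def code_ok_def rep_def)

lemma M23_rep: "M23 \<simeq> Gam (set (rep R30))"
  unfolding M23_def
by (rule Gamma_iso_rep[where T = M23_map],
      simp only: M23_map_def list.map list.set snd_conv fst_conv image_insert image_empty code_vec_def
        if_True if_False Un_insert_left Un_empty_left,
      simp_all add: M23_map_def code_ok_def rep_def)

lemma M25_rep: "M25 \<simeq> Gam (set (rep R36))"
  unfolding M25_def
by (rule Gamma_iso_rep[where T = M25_map],
      simp only: M25_map_def list.map list.set snd_conv fst_conv image_insert image_empty code_vec_def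
        if_True if_False Un_insert_left Un_empty_left,
      simp_all add: M25_map_def code_ok_def rep_def)

lemma pair_graph_Ms: "pair_graph M5" "pair_graph M22" "pair_graph M23" "pair_graph M25"
  unfolding M5_def M22_def M23_def M25_def by (rule pair_graph_Gamma; simp)+

subsection \<open>The classification\<close>

text \<open>The theorem quantifies over graphs with natural numbers as vertices, whereas the
  standard graphs have vertices of type \<open>pt\<close>.\<close>

lemma nat_copy:
  assumes "pair_graph (G :: 'a pair_pre_digraph)"
  shows "\<exists>H :: nat pair_pre_digraph. pair_graph H \<and> H \<simeq> G"
proof -
  obtain n where n: "bij_betw n (pverts G) {0..<card (pverts G)}"
    using ex_bij_betw_finite_nat[OF pair_graph_finite[OF assms]] by blast
  have nV: "n v \<in> {0..<card (pverts G)}" if "v \<in> pverts G" for v using n that by (auto simp: bij_betw_def)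
  have n_eq: "n u = n v \<longleftrightarrow> u = v" if "u \<in> pverts G" "v \<in> pverts G" for u v
    using n that by (auto simp: bij_betw_def dest: inj_onD)
  define H :: "nat pair_pre_digraph" where
    "H = \<lparr> pverts = {0..<card (pverts G)}, parcs = {(n u, n v) | u v. (u, v) \<in> parcs G} \<rparr>"
  have H: "pair_graph H"
  proof (rule pair_graphI)
    fix a b assume "(a, b) \<in> parcs H"
    then obtain u v where uv: "a = n u" "b = n v" "(u, v) \<in> parcs G" by (auto simp: H_def)
    have V: "u \<in> pverts G" "v \<in> pverts G" using pair_graph_wf[OF assms uv(3)] by blast+
    have "u \<noteq> v" using uv(3) pair_graph_irrefl[OF assms] by blast
    then have "a \<noteq> b" using uv(1,2) n_eq[OF V] by simp
    moreover have "(v, u) \<in> parcs G" using uv(3) by (simp only: pair_graph_sym[OF assms, of v u])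
    then have "(b, a) \<in> parcs H" unfolding uv(1,2) by (fastforce simp: H_def)
    moreover have "a \<in> pverts H" "b \<in> pverts H"
      using nV[OF V(1)] nV[OF V(2)] uv(1,2) by (simp_all add: H_def)
    ultimately show "a \<in> pverts H \<and> b \<in> pverts H \<and> a \<noteq> b \<and> (b, a) \<in> parcs H" by blast
  qed (simp add: H_def)
  have "G \<simeq> H"
  proof (rule isomorphicI[OF assms pair_graph_arcs[OF H], where f = n])
    show "bij_betw n (pverts G) (pverts H)" using n by (simp add: H_def)
    fix u v assume uv: "u \<in> pverts G" "v \<in> pverts G"
    show "(u, v) \<in> parcs G \<longleftrightarrow> (n u, n v) \<in> parcs H"
    proof
      assume "(n u, n v) \<in> parcs H"
      then obtain u' v' where e: "n u = n u'" "n v = n v'" "(u', v') \<in> parcs G" by (auto simp: H_def)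
      have V: "u' \<in> pverts G" "v' \<in> pverts G" using pair_graph_wf[OF assms e(3)] by blast+
      have "u = u'" "v = v'" using n_eq[OF uv(1) V(1)] n_eq[OF uv(2) V(2)] e(1,2) by simp_all
      then show "(u, v) \<in> parcs G" using e(3) by simp
    qed (fastforce simp: H_def)
  qed
  then show ?thesis using isomorphic_sym[OF assms H] H by blast
qed

lemma iso_transfer:
  assumes "pair_graph G" "pair_graph H" "pair_graph K" "G \<simeq> K" "H \<simeq> K"
  shows "G \<simeq> H"
  using isomorphic_trans[OF assms(1,3) pair_graph_arcs[OF assms(2)] assms(4) isomorphic_sym[OF assms(2,3,5)]] .

lemma iso_comp:
  assumes "pair_graph G" "pair_graph H" "pair_graph K" "G \<simeq> H" "H \<simeq> K"
  shows "G \<simeq> K"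
  by (rule isomorphic_trans[OF assms(1,2) pair_graph_arcs[OF assms(3)] assms(4,5)])

lemma rep_unique:
  assumes G: "pair_graph G" and i: "6 \<le> length (rep i)" "G \<simeq> Gam (set (rep i))"
    and j: "6 \<le> length (rep j)" "G \<simeq> Gam (set (rep j))"
  shows "i = j"
  by (rule rep_noniso[OF i(1) j(1)])
    (rule iso_comp[OF pair_graph_Gam G pair_graph_Gam isomorphic_sym[OF G pair_graph_Gam i(2)] j(2)])

lemma class_pair_graph: "G \<in> irregular_S8_graphs \<Longrightarrow> pair_graph G"
  by (simp add: irregular_S8_graphs_def)

lemma class_irregular: "G \<in> irregular_S8_graphs \<Longrightarrow> irregular G"
  by (simp add: irregular_S8_graphs_def)

lemma max_reps_length: "j \<in> max_reps \<Longrightarrow> 6 \<le> length (rep j)"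
  unfolding max_reps_def by (elim insertE) (simp_all add: rep_def)

text \<open>A family is enlarged to a maximal one, of which it is a subfamily. All copies
  \<open>K\<close> on an arbitrary type are covered, as both the four graphs on integer vectors and
  graphs on natural numbers are needed.\<close>

lemma class_extends:
  assumes G: "G \<in> irregular_S8_graphs"
  shows "\<exists>j. j \<in> max_reps \<and> (\<forall>K :: 'b pair_pre_digraph. pair_graph K \<longrightarrow> K \<simeq> Gam (set (rep j)) \<longrightarrow>
    K \<in> irregular_S8_graphs \<and> chromatic_component G K)"
proof -
  obtain f F where m: "tri_model G f F" "2 \<le> card F" using G unfolding class_iff by (elim exE conjE) (rule that)
  interpret tri_model G f F by (rule m(1))
  obtain F' where F': "fam F'" "F \<subseteq> F'" "\<forall>t\<in>TRI. t \<inter> \<Union>F' \<noteq> {}" using fam_extend[OF fam] by (elim exE conjE) (rule that)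
  obtain s j where s: "aut s" "s ` \<Union>F' = set (rep j)" using fam_rep[OF F'(1)] by (elim exE conjE) (rule that)
  have j: "j \<in> max_reps" by (rule max_fam_rep[OF F'(1) F'(3) s])
  have iso: "Gam (\<Union>F') \<simeq> Gam (set (rep j))" using Gam_aut[OF s(1), of "\<Union>F'"] unfolding s(2) .
  have k: "card F \<le> card F'" by (rule card_mono[OF finite F'(2)])
  have "K \<in> irregular_S8_graphs \<and> chromatic_component G K"
    if K: "pair_graph K" "K \<simeq> Gam (set (rep j))" for K :: "'b pair_pre_digraph"
  proof -
    have "K \<simeq> Gam (\<Union>F')" by (rule iso_transfer[OF K(1) pair_graph_Gam pair_graph_Gam K(2) iso])
    then obtain h where h: "tri_model K h F'" using tri_model_iso[OF K(1) F'(1)] by blast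
    have "K \<in> irregular_S8_graphs"
      unfolding class_iff by (intro exI[of _ h] exI[of _ F'] conjI) (use h k m(2) in simp_all)
    moreover have "chromatic_component G K"
      by (rule tri_model.component_sub[OF h F'(2) _ tri_model.G[OF m(1)] iso_Gam]) (use m(2) in simp)
    ultimately show ?thesis by blast
  qed
  then show ?thesis using j by blast
qed

text \<open>The component is a subfamily \<open>F1\<close> whose union is moved onto
  \<open>rep j\<close>. Every triple meets \<open>rep j\<close>, so the larger family cannot contain
  a triple disjoint from those of \<open>F1\<close>.\<close>

lemma component_of_maximal:
  assumes G: "G \<in> irregular_S8_graphs" and j: "j \<in> max_reps" "G \<simeq> Gam (set (rep j))"
    and K: "K \<in> irregular_S8_graphs" and comp: "chromatic_component G K"
  shows "G \<simeq> K"
proof -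
  note g = class_pair_graph[OF G]
  obtain f F F1 where m: "tri_model K f F" "F1 \<subseteq> F" "G \<simeq> Gam (\<Union>F1)"
    using component_model[OF g class_irregular[OF G] K comp] by (elim exE conjE) (rule that)
  interpret tri_model K f F by (rule m(1))
  have F1: "fam F1" by (rule fam_subset[OF fam m(2)])
  obtain s i where s: "aut s" "s ` \<Union>F1 = set (rep i)" using fam_rep[OF F1] by (elim exE conjE) (rule that)
  have inj_s: "inj s" using s(1) by (simp add: aut_def)
  have iso: "Gam (\<Union>F1) \<simeq> Gam (set (rep i))" using Gam_aut[OF s(1), of "\<Union>F1"] unfolding s(2) .
  have gi: "G \<simeq> Gam (set (rep i))" by (rule iso_comp[OF g pair_graph_Gam pair_graph_Gam m(3) iso])
  \<comment> \<open>Comparing numbers of vertices transfers the length bound from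
    \<open>rep j\<close> to \<open>rep i\<close>, which \<open>rep_unique\<close> requires.\<close>
  have "card (pverts (Gam (set (rep i)))) = card (pverts (Gam (set (rep j))))"
  proof -
    have "Gam (set (rep i)) \<simeq> Gam (set (rep j))"
      by (rule iso_comp[OF pair_graph_Gam g pair_graph_Gam isomorphic_sym[OF g pair_graph_Gam gi] j(2)])
    then obtain h where "bij_betw h (pverts (Gam (set (rep i)))) (pverts (Gam (set (rep j))))"
      using isomorphic_iff[OF pair_graph_Gam pair_graph_arcs[OF pair_graph_Gam]] by blast
    then show ?thesis by (rule bij_betw_same_card)
  qed
  moreover have "card (pverts (Gam (set (rep r)))) = 4 + length (rep r)" for r
  proof -
    have "quadp \<inter> set (rep r) = {}" using nbP0_not_quadp rep_sub by blast
    then show ?thesis unfolding pverts_Gam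
      by (subst card_Un_disjoint) (simp_all add: quadp_def distinct_card[OF distinct_rep])
  qed
  ultimately have len: "6 \<le> length (rep i)" using max_reps_length[OF j(1)] by simp
  have ij: "i = j" by (rule rep_unique[OF g len gi max_reps_length[OF j(1)] j(2)])
  have "F1 = F"
  proof (rule ccontr)
    assume "F1 \<noteq> F"
    then obtain t where t: "t \<in> F" "t \<notin> F1" using m(2) by blast
    have "t \<inter> \<Union>F1 = {}" using fam_disjoint[OF fam t(1)] m(2) t(2) by blast
    then have "s ` t \<inter> set (rep j) = {}" unfolding ij[symmetric] s(2)[symmetric] image_Int[OF inj_s, symmetric] by simp
    then show False using max_rep_meets[OF j(1) TRI_aut[OF s(1) fam_TRI[OF fam t(1)]]] by blast
  qed
  have "K \<simeq> Gam (\<Union>F1)" unfolding \<open>F1 = F\<close> by (rule iso_Gam)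
  then show ?thesis by (rule iso_transfer[OF g tri_model.G[OF m(1)] pair_graph_Gam m(3)])
qed

definition S8_reps :: "ri set" where "S8_reps = {j. 6 \<le> length (rep j)}"

lemma card_S8_reps: "card S8_reps = 35"
proof -
  have "S8_reps = set (filter (\<lambda>j. 6 \<le> length (rep j)) all_ri)"
    unfolding S8_reps_def set_filter set_all_ri by blast
  moreover have "distinct (filter (\<lambda>j. 6 \<le> length (rep j)) all_ri)"
    by (rule distinct_filter) (simp add: all_ri_def)
  moreover have "length (filter (\<lambda>j. 6 \<le> length (rep j)) all_ri) = 35" by (simp add: all_ri_def rep_def)
  ultimately show ?thesis by (metis distinct_card)
qed

text \<open>Each equivalence class consists of the copies of exactly one representative, so the
  classes are in bijection with \<open>S8_reps\<close>.\<close>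

lemma card_classes: "card ((irregular_S8_graphs :: nat pair_pre_digraph set) // iso_rel irregular_S8_graphs) = 35"
proof -
  let ?C = "irregular_S8_graphs :: nat pair_pre_digraph set"
  define cls where "cls j = {G :: nat pair_pre_digraph. pair_graph G \<and> G \<simeq> Gam (set (rep j))}" for j
  have cls_C: "G \<in> ?C" if "j \<in> S8_reps" "G \<in> cls j" for G j
  proof -
    have "pair_graph G" "G \<simeq> Gam (set (rep j))" "6 \<le> length (rep j)"
      using that by (simp_all add: S8_reps_def cls_def)
    then show ?thesis using class_rep_iff[of G] by blast
  qed
  have ex: "\<exists>G. G \<in> cls j" for j using nat_copy[OF pair_graph_Gam] unfolding cls_def by blast
  have cover: "\<exists>j\<in>S8_reps. G \<in> cls j" if GC: "G \<in> ?C" for G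
  proof -
    obtain j where "6 \<le> length (rep j)" "G \<simeq> Gam (set (rep j))"
      using class_rep_iff[OF class_pair_graph[OF GC], THEN iffD1, OF GC] by (elim exE conjE) (rule that)
    then have "j \<in> S8_reps" "G \<in> cls j" using class_pair_graph[OF GC] by (simp_all add: S8_reps_def cls_def)
    then show ?thesis by (rule rev_bexI)
  qed
  have image: "iso_rel ?C `` {G} = cls j" if j: "j \<in> S8_reps" and G: "G \<in> cls j" for G j
  proof (intro subset_antisym subsetI)
    fix H assume "H \<in> iso_rel ?C `` {G}"
    then have H: "H \<in> ?C" "G \<simeq> H" by (simp_all add: iso_rel_def)
    have g: "pair_graph G" "G \<simeq> Gam (set (rep j))" using G by (simp_all add: cls_def)
    have "H \<simeq> Gam (set (rep j))"
      by (rule iso_comp[OF class_pair_graph[OF H(1)] g(1) pair_graph_Gam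
          isomorphic_sym[OF g(1) class_pair_graph[OF H(1)] H(2)] g(2)])
    then show "H \<in> cls j" using class_pair_graph[OF H(1)] by (simp add: cls_def)
  next
    fix H assume H: "H \<in> cls j"
    have gh: "pair_graph G" "G \<simeq> Gam (set (rep j))" "pair_graph H" "H \<simeq> Gam (set (rep j))"
      using G H by (simp_all add: cls_def)
    have "G \<simeq> H" by (rule iso_transfer[OF gh(1,3) pair_graph_Gam gh(2,4)])
    then show "H \<in> iso_rel ?C `` {G}" using cls_C[OF j G] cls_C[OF j H] by (simp add: iso_rel_def)
  qed
  have "?C // iso_rel ?C = cls ` S8_reps"
  proof (intro subset_antisym subsetI)
    fix c assume "c \<in> ?C // iso_rel ?C"
    then obtain G where G: "G \<in> ?C" "c = iso_rel ?C `` {G}" by (rule quotientE)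
    obtain j where j: "j \<in> S8_reps" "G \<in> cls j" using cover[OF G(1)] by (rule bexE)
    show "c \<in> cls ` S8_reps" unfolding G(2) image[OF j] using j(1) by (rule imageI)
  next
    fix c assume "c \<in> cls ` S8_reps"
    then obtain j where j: "j \<in> S8_reps" "c = cls j" by blast
    obtain G where G: "G \<in> cls j" using ex by blast
    have "iso_rel ?C `` {G} \<in> ?C // iso_rel ?C" by (rule quotientI) (rule cls_C[OF j(1) G])
    then show "c \<in> ?C // iso_rel ?C" unfolding j(2) image[OF j(1) G] .
  qed
  moreover have "inj_on cls S8_reps"
  proof (rule inj_onI)
    fix i j assume ij: "i \<in> S8_reps" "j \<in> S8_reps" "cls i = cls j"
    obtain G where "G \<in> cls i" using ex by blast
    then have "pair_graph G" "G \<simeq> Gam (set (rep i))" "G \<simeq> Gam (set (rep j))" using ij(3) by (auto simp: cls_def)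
    then show "i = j" using rep_unique ij(1,2) unfolding S8_reps_def by blast
  qed
  ultimately show ?thesis by (simp add: card_image card_S8_reps)
qed

theorem mainTheorem7:
  shows "card ((irregular_S8_graphs :: nat pair_pre_digraph set) // iso_rel irregular_S8_graphs) = 35
    \<and> {M5, M22, M23, M25} \<subseteq> irregular_S8_graphs
    \<and> \<not> M5 \<simeq> M22 \<and> \<not> M5 \<simeq> M23 \<and> \<not> M5 \<simeq> M25
    \<and> \<not> M22 \<simeq> M23 \<and> \<not> M22 \<simeq> M25 \<and> \<not> M23 \<simeq> M25
    \<and> (\<forall>G \<in> (irregular_S8_graphs :: nat pair_pre_digraph set).
          maximal_chromatic irregular_S8_graphs G \<longleftrightarrow>
            G \<simeq> M5 \<or> G \<simeq> M22 \<or> G \<simeq> M23 \<or> G \<simeq> M25)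
    \<and> (\<forall>G \<in> (irregular_S8_graphs :: nat pair_pre_digraph set).
          chromatic_component G M5 \<or> chromatic_component G M22 \<or>
          chromatic_component G M23 \<or> chromatic_component G M25)"
proof -
  let ?C = "irregular_S8_graphs :: nat pair_pre_digraph set"
  have len: "6 \<le> length (rep R18)" "6 \<le> length (rep R33)" "6 \<le> length (rep R30)" "6 \<le> length (rep R36)"
    by (rule max_reps_length, simp add: max_reps_def)+
  have mem: "M5 \<in> irregular_S8_graphs" "M22 \<in> irregular_S8_graphs" "M23 \<in> irregular_S8_graphs" "M25 \<in> irregular_S8_graphs"
    by (rule class_rep_iff[OF pair_graph_Ms(1), THEN iffD2], intro exI[of _ R18] conjI len M5_rep)
      (rule class_rep_iff[OF pair_graph_Ms(2), THEN iffD2], intro exI[of _ R33] conjI len M22_rep,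
       rule class_rep_iff[OF pair_graph_Ms(3), THEN iffD2], intro exI[of _ R30] conjI len M23_rep,
       rule class_rep_iff[OF pair_graph_Ms(4), THEN iffD2], intro exI[of _ R36] conjI len M25_rep)
  have non: "\<not> K \<simeq> L" if K: "pair_graph K" "K \<simeq> Gam (set (rep i))" and L: "pair_graph L" "L \<simeq> Gam (set (rep j))"
    and l: "6 \<le> length (rep i)" "6 \<le> length (rep j)" and ne: "i \<noteq> j" for K L :: "int Matrix.vec pair_pre_digraph" and i j
  proof
    assume "K \<simeq> L"
    then have "K \<simeq> Gam (set (rep j))" by (rule iso_comp[OF K(1) L(1) pair_graph_Gam _ L(2)])
    then show False using rep_unique[OF K(1) l(1) K(2) l(2)] ne by blast
  qed
  note p = pair_graph_Ms
  have noniso: "\<not> M5 \<simeq> M22" "\<not> M5 \<simeq> M23" "\<not> M5 \<simeq> M25" "\<not> M22 \<simeq> M23" "\<not> M22 \<simeq> M25" "\<not> M23 \<simeq> M25"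
    by (rule non[OF p(1) M5_rep p(2) M22_rep len(1,2)], simp)
      (rule non[OF p(1) M5_rep p(3) M23_rep len(1,3)], simp,
       rule non[OF p(1) M5_rep p(4) M25_rep len(1,4)], simp,
       rule non[OF p(2) M22_rep p(3) M23_rep len(2,3)], simp,
       rule non[OF p(2) M22_rep p(4) M25_rep len(2,4)], simp,
       rule non[OF p(3) M23_rep p(4) M25_rep len(3,4)], simp)
  have max_iff: "(\<exists>j\<in>max_reps. G \<simeq> Gam (set (rep j))) \<longleftrightarrow> G \<simeq> M5 \<or> G \<simeq> M22 \<or> G \<simeq> M23 \<or> G \<simeq> M25"
    if g: "pair_graph G" for G :: "nat pair_pre_digraph"
  proof -
    have "G \<simeq> M \<longleftrightarrow> G \<simeq> Gam (set (rep j))" if M: "pair_graph M" "M \<simeq> Gam (set (rep j))" for M :: "int Matrix.vec pair_pre_digraph" and j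
      using iso_comp[OF g M(1) pair_graph_Gam _ M(2)] iso_transfer[OF g M(1) pair_graph_Gam _ M(2)] by blast
    note e = this[OF p(1) M5_rep] this[OF p(2) M22_rep] this[OF p(3) M23_rep] this[OF p(4) M25_rep]
    show ?thesis unfolding max_reps_def e by blast
  qed
  have comp: "chromatic_component G M5 \<or> chromatic_component G M22 \<or> chromatic_component G M23 \<or> chromatic_component G M25"
    if G: "G \<in> ?C" for G
  proof -
    obtain j where j: "j \<in> max_reps" "\<forall>K :: int Matrix.vec pair_pre_digraph. pair_graph K \<longrightarrow> K \<simeq> Gam (set (rep j)) \<longrightarrow>
        K \<in> irregular_S8_graphs \<and> chromatic_component G K"
      using class_extends[OF G, where ?'b = "int Matrix.vec"] by (elim exE conjE) (rule that)
    note c = j(2)[rule_format, THEN conjunct2]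
    have "j = R18 \<or> j = R30 \<or> j = R33 \<or> j = R36" using j(1) by (simp add: max_reps_def)
    then show ?thesis
      using c[OF p(1)] c[OF p(2)] c[OF p(3)] c[OF p(4)] M5_rep M22_rep M23_rep M25_rep by blast
  qed
  have max: "maximal_chromatic ?C G \<longleftrightarrow> (\<exists>j\<in>max_reps. G \<simeq> Gam (set (rep j)))" if G: "G \<in> ?C" for G
  proof
    assume "maximal_chromatic ?C G"
    then have nomore: "G \<simeq> K" if "K \<in> ?C" "chromatic_component G K" for K
      using that unfolding maximal_chromatic_def by blast
    obtain j where j: "j \<in> max_reps" "\<forall>K :: nat pair_pre_digraph. pair_graph K \<longrightarrow> K \<simeq> Gam (set (rep j)) \<longrightarrow>
        K \<in> ?C \<and> chromatic_component G K"
      using class_extends[OF G, where ?'b = nat] by (elim exE conjE) (rule that)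
    \<comment> \<open>Maximality refers to graphs on natural numbers, so the extension is realized
      by such a copy.\<close>
    obtain K :: "nat pair_pre_digraph" where K: "pair_graph K" "K \<simeq> Gam (set (rep j))"
      using nat_copy[OF pair_graph_Gam] by blast
    have "G \<simeq> K" using nomore j(2)[rule_format, OF K] by blast
    then have "G \<simeq> Gam (set (rep j))" by (rule iso_comp[OF class_pair_graph[OF G] K(1) pair_graph_Gam _ K(2)])
    then show "\<exists>j\<in>max_reps. G \<simeq> Gam (set (rep j))" using j(1) by blast
  next
    assume "\<exists>j\<in>max_reps. G \<simeq> Gam (set (rep j))"
    then obtain j where j: "j \<in> max_reps" "G \<simeq> Gam (set (rep j))" by (rule bexE)
    have "G \<simeq> K" if "K \<in> ?C" "chromatic_component G K" for K
      by (rule component_of_maximal[OF G j that])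
    then show "maximal_chromatic ?C G"
      unfolding maximal_chromatic_def using G by blast
  qed
  have main: "maximal_chromatic ?C G \<longleftrightarrow> G \<simeq> M5 \<or> G \<simeq> M22 \<or> G \<simeq> M23 \<or> G \<simeq> M25" if G: "G \<in> ?C" for G
    using max[OF G] max_iff[OF class_pair_graph[OF G]] by (rule trans)
  have sub: "{M5, M22, M23, M25} \<subseteq> irregular_S8_graphs" by (simp add: mem)
  show ?thesis by (intro conjI card_classes sub noniso ballI main comp)
qed

end
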